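(* Let $\mathscr E$ and $\mathscr B$ be small categories and $u:\mathscr E\to\mathscr B$ a functor. Let $\mathscr A$ be a cocomplete abelian category with exact coproducts. Given a functor $T:(\Delta/\mathscr E)^{op}\to\mathscr A$, there is a third quadrant homology spectral sequence $$E^2_{p,q}\cong H_p^{Th}(\mathscr B,(L_q\Delta/u^* )(T))\Rightarrow H_{p+q}^{Th}(\mathscr E,T)$$ which is functorial with respect to natural transformations, where $L_q\Delta/u^*=Lan_q^{\Delta/u}$ is the $q$-th left satellite of $Lan^{\Delta/u}$, the left Kan extension along (the opposite of) $\Delta/u:\Delta/\mathscr E\to\Delta/\mathscr B$.
   Context: Simplex category: for a small category $\mathscr C$, $\Delta/\mathscr C$ has as objects the pairs $([n],f)$ with $n\ge 0$, $[n]=\{0<1<\dots<n\}$ regarded as a category, and $f:[n]\to\mathscr C$ a functor; morphisms $([n],f)\to([m],g)$ are the order preserving maps $\sigma:[n]\to[m]$ with $f=g\circ\sigma$. A functor $u:\mathscr E\to\mathscr B$ induces $\Delta/u:\Delta/\mathscr E\to\Delta/\mathscr B$, $([n],f)\mapsto([n],u\circ f)$. Thomason homology: for a functor $T:(\Delta/\mathscr C)^{op}\to\mathscr A$ (a contravariant Thomason natural system), $H_n^{Th}(\mathscr C,T)$ is the $n$-th homology of the complex $\bigoplus_{f:[n]\to\mathscr C}T(f)$, $n\ge 0$, with differential from degree $n+1$ to degree $n$ given on $T(f)$ by $\sum_{i=0}^{n+1}(-1)^i(\delta^i)^*$, where $(\delta^i)^*:T(f)\to T(f\circ\delta^i)$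 is induced by the injection $\delta^i:[n]\to[n+1]$ omitting $i$. $Lan^{\Delta/u}:\mathrm{Fun}((\Delta/\mathscr E)^{op},\mathscr A)\to\mathrm{Fun}((\Delta/\mathscr B)^{op},\mathscr A)$ is the left adjoint of pre-composition with $(\Delta/u)^{op}$; its left satellites are its left derived functors. The spectral sequence is indexed by $p,q\ge 0$ and is of homological type (called "third quadrant" in the paper's convention). *)

theory Defs
  imports Main "HOL-Library.FuncSet" "HOL-Algebra.Group" "HOL-Algebra.FiniteProduct"
begin

section \<open>Categories, functors, natural transformations\<close>

record ('o, 'a) cat =
  Ob   :: "'o set"
  Ar   :: "'a set"
  Dom  :: "'a \<Rightarrow> 'o"
  Cod  :: "'a \<Rightarrow> 'o"
  Id   :: "'o \<Rightarrow> 'a"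
  Comp :: "'a \<Rightarrow> 'a \<Rightarrow> 'a"   (infixl \<open>\<cdot>\<index>\<close> 70)

definition Hom :: "('o, 'a, 'z) cat_scheme \<Rightarrow> 'o \<Rightarrow> 'o \<Rightarrow> 'a set" where
  "Hom C x y = {f \<in> Ar C. Dom C f = x \<and> Cod C f = y}"

locale category =
  fixes C :: "('o, 'a, 'z) cat_scheme" (structure)
  assumes dom_ob: "f \<in> Ar C \<Longrightarrow> Dom C f \<in> Ob C"
    and cod_ob: "f \<in> Ar C \<Longrightarrow> Cod C f \<in> Ob C"
    and id_hom: "x \<in> Ob C \<Longrightarrow> Id C x \<in> Hom C x x"
    and comp_hom: "\<lbrakk>f \<in> Hom C x y; g \<in> Hom C y z\<rbrakk> \<Longrightarrow> g \<cdot> f \<in> Hom C x z"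
    and id_right: "f \<in> Hom C x y \<Longrightarrow> f \<cdot> Id C x = f"
    and id_left: "f \<in> Hom C x y \<Longrightarrow> Id C y \<cdot> f = f"
    and comp_assoc:
      "\<lbrakk>f \<in> Hom C w x; g \<in> Hom C x y; h \<in> Hom C y z\<rbrakk> \<Longrightarrow> (h \<cdot> g) \<cdot> f = h \<cdot> (g \<cdot> f)"

definition op_cat :: "('o, 'a) cat \<Rightarrow> ('o, 'a) cat" where
  "op_cat C = \<lparr>Ob = Ob C, Ar = Ar C, Dom = Cod C, Cod = Dom C, Id = Id C,
               Comp = (\<lambda>f g. g \<cdot>\<^bsub>C\<^esub> f)\<rparr>"

record ('o1, 'a1, 'o2, 'a2) fctr =
  obj_map :: "'o1 \<Rightarrow> 'o2"
  arr_map :: "'a1 \<Rightarrow> 'a2"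

text \<open>Functors (and the components of natural transformations) are extensional, so that
  equality of functors is equality in HOL.\<close>

definition is_functor ::
    "('o1, 'a1, 'z1) cat_scheme \<Rightarrow> ('o2, 'a2, 'z2) cat_scheme \<Rightarrow> ('o1, 'a1, 'o2, 'a2) fctr \<Rightarrow> bool" where
  "is_functor C D F \<longleftrightarrow>
     category C \<and> category D \<and>
     obj_map F \<in> Ob C \<rightarrow>\<^sub>E Ob D \<and> arr_map F \<in> Ar C \<rightarrow>\<^sub>E Ar D \<and>
     (\<forall>f\<in>Ar C. arr_map F f \<in> Hom D (obj_map F (Dom C f)) (obj_map F (Cod C f))) \<and>
     (\<forall>x\<in>Ob C. arr_map F (Id C x) = Id D (obj_map F x)) \<and>
     (\<forall>x y z. \<forall>f\<in>Hom C x y. \<forall>g\<in>Hom C y z.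
        arr_map F (g \<cdot>\<^bsub>C\<^esub> f) = arr_map F g \<cdot>\<^bsub>D\<^esub> arr_map F f)"

definition functor_comp ::
    "('o1, 'a1, 'z1) cat_scheme \<Rightarrow> ('o2, 'a2, 'o3, 'a3) fctr \<Rightarrow> ('o1, 'a1, 'o2, 'a2) fctr
      \<Rightarrow> ('o1, 'a1, 'o3, 'a3) fctr" where
  "functor_comp C G F = \<lparr>obj_map = compose (Ob C) (obj_map G) (obj_map F),
                  arr_map = compose (Ar C) (arr_map G) (arr_map F)\<rparr>"

definition nat_trans ::
    "('o1, 'a1, 'z1) cat_scheme \<Rightarrow> ('o2, 'a2, 'z2) cat_scheme \<Rightarrow> ('o1, 'a1, 'o2, 'a2) fctr
      \<Rightarrow> ('o1, 'a1, 'o2, 'a2) fctr \<Rightarrow> ('o1 \<Rightarrow> 'a2) \<Rightarrow> bool" where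
  "nat_trans C D F G \<eta> \<longleftrightarrow>
     is_functor C D F \<and> is_functor C D G \<and> \<eta> \<in> extensional (Ob C) \<and>
     (\<forall>x\<in>Ob C. \<eta> x \<in> Hom D (obj_map F x) (obj_map G x)) \<and>
     (\<forall>x y. \<forall>f\<in>Hom C x y. \<eta> y \<cdot>\<^bsub>D\<^esub> arr_map F f = arr_map G f \<cdot>\<^bsub>D\<^esub> \<eta> x)"

definition is_left_adjoint ::
    "('o1, 'a1, 'z1) cat_scheme \<Rightarrow> ('o2, 'a2, 'z2) cat_scheme \<Rightarrow> ('o1, 'a1, 'o2, 'a2) fctr
      \<Rightarrow> ('o2, 'a2, 'o1, 'a1) fctr \<Rightarrow> bool" where
  "is_left_adjoint C D L G \<longleftrightarrow>
     is_functor C D L \<and> is_functor D C G \<and>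
     (\<exists>\<phi>. (\<forall>x\<in>Ob C. \<forall>y\<in>Ob D.
              bij_betw (\<phi> x y) (Hom D (obj_map L x) y) (Hom C x (obj_map G y))) \<and>
          (\<forall>x x' y y'. \<forall>f\<in>Hom C x' x. \<forall>g\<in>Hom D y y'. \<forall>h\<in>Hom D (obj_map L x) y.
              \<phi> x' y' (g \<cdot>\<^bsub>D\<^esub> h \<cdot>\<^bsub>D\<^esub> arr_map L f) = arr_map G g \<cdot>\<^bsub>C\<^esub> \<phi> x y h \<cdot>\<^bsub>C\<^esub> f))"

definition is_mono :: "('o, 'a, 'z) cat_scheme \<Rightarrow> 'a \<Rightarrow> bool" where
  "is_mono C m \<longleftrightarrow> m \<in> Ar C \<and>
     (\<forall>x. \<forall>f\<in>Hom C x (Dom C m). \<forall>g\<in>Hom C x (Dom C m). m \<cdot>\<^bsub>C\<^esub> f = m \<cdot>\<^bsub>C\<^esub> g \<longrightarrow> f = g)"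

definition is_epi :: "('o, 'a, 'z) cat_scheme \<Rightarrow> 'a \<Rightarrow> bool" where
  "is_epi C e \<longleftrightarrow> e \<in> Ar C \<and>
     (\<forall>x. \<forall>f\<in>Hom C (Cod C e) x. \<forall>g\<in>Hom C (Cod C e) x. f \<cdot>\<^bsub>C\<^esub> e = g \<cdot>\<^bsub>C\<^esub> e \<longrightarrow> f = g)"

definition is_iso :: "('o, 'a, 'z) cat_scheme \<Rightarrow> 'a \<Rightarrow> bool" where
  "is_iso C f \<longleftrightarrow> f \<in> Ar C \<and>
     (\<exists>g\<in>Hom C (Cod C f) (Dom C f).
        g \<cdot>\<^bsub>C\<^esub> f = Id C (Dom C f) \<and> f \<cdot>\<^bsub>C\<^esub> g = Id C (Cod C f))"

definition is_zero_obj :: "('o, 'a, 'z) cat_scheme \<Rightarrow> 'o \<Rightarrow> bool" where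
  "is_zero_obj C z \<longleftrightarrow> z \<in> Ob C \<and>
     (\<forall>x\<in>Ob C. (\<exists>!f. f \<in> Hom C x z) \<and> (\<exists>!f. f \<in> Hom C z x))"

definition zero_obj :: "('o, 'a, 'z) cat_scheme \<Rightarrow> 'o" where
  "zero_obj C = (SOME z. is_zero_obj C z)"


section \<open>Colimits and coproducts\<close>

definition is_cocone ::
    "('oj, 'aj, 'z1) cat_scheme \<Rightarrow> ('o, 'a, 'z2) cat_scheme \<Rightarrow> ('oj, 'aj, 'o, 'a) fctr
      \<Rightarrow> 'o \<Rightarrow> ('oj \<Rightarrow> 'a) \<Rightarrow> bool" where
  "is_cocone J C F c \<iota> \<longleftrightarrow> c \<in> Ob C \<and>
     (\<forall>j\<in>Ob J. \<iota> j \<in> Hom C (obj_map F j) c) \<and>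
     (\<forall>j k. \<forall>f\<in>Hom J j k. \<iota> k \<cdot>\<^bsub>C\<^esub> arr_map F f = \<iota> j)"

definition is_colimit ::
    "('oj, 'aj, 'z1) cat_scheme \<Rightarrow> ('o, 'a, 'z2) cat_scheme \<Rightarrow> ('oj, 'aj, 'o, 'a) fctr
      \<Rightarrow> 'o \<Rightarrow> ('oj \<Rightarrow> 'a) \<Rightarrow> bool" where
  "is_colimit J C F c \<iota> \<longleftrightarrow> is_cocone J C F c \<iota> \<and>
     (\<forall>d \<kappa>. is_cocone J C F d \<kappa> \<longrightarrow>
        (\<exists>!h. h \<in> Hom C c d \<and> (\<forall>j\<in>Ob J. h \<cdot>\<^bsub>C\<^esub> \<iota> j = \<kappa> j)))"

text \<open>Smallness is relative to a type \<open>'u\<close>, which plays the role of the universe: small sets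
  are sets of elements of \<open>'u\<close>, small categories are those whose objects and arrows
  lie in \<open>'u\<close>. Statements about small categories should assume \<open>'u\<close> to be infinite; then finite
  products and finite lists of small sets are, up to bijection, again small. No smallness is
  required of the category \<open>C\<close> itself.\<close>

definition cocomplete :: "'u itself \<Rightarrow> ('o, 'a, 'z) cat_scheme \<Rightarrow> bool" where
  "cocomplete U C \<longleftrightarrow>
     (\<forall>(J :: ('u, 'u) cat) F. is_functor J C F \<longrightarrow> (\<exists>c \<iota>. is_colimit J C F c \<iota>))"

definition is_coproduct ::
    "('o, 'a, 'z) cat_scheme \<Rightarrow> 'i set \<Rightarrow> ('i \<Rightarrow> 'o) \<Rightarrow> 'o \<Rightarrow> ('i \<Rightarrow> 'a) \<Rightarrow> bool" where
  "is_coproduct C I X c \<iota> \<longleftrightarrow> c \<in> Ob C \<and> (\<forall>i\<in>I. \<iota> i \<in> Hom C (X i) c) \<and>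
     (\<forall>d\<in>Ob C. \<forall>\<kappa>. (\<forall>i\<in>I. \<kappa> i \<in> Hom C (X i) d) \<longrightarrow>
        (\<exists>!h. h \<in> Hom C c d \<and> (\<forall>i\<in>I. h \<cdot>\<^bsub>C\<^esub> \<iota> i = \<kappa> i)))"

definition coprod :: "('o, 'a, 'z) cat_scheme \<Rightarrow> 'i set \<Rightarrow> ('i \<Rightarrow> 'o) \<Rightarrow> 'o \<times> ('i \<Rightarrow> 'a)" where
  "coprod C I X = (SOME p. is_coproduct C I X (fst p) (snd p))"

abbreviation coprod_obj :: "('o, 'a, 'z) cat_scheme \<Rightarrow> 'i set \<Rightarrow> ('i \<Rightarrow> 'o) \<Rightarrow> 'o" where
  "coprod_obj C I X \<equiv> fst (coprod C I X)"

abbreviation coprod_in :: "('o, 'a, 'z) cat_scheme \<Rightarrow> 'i set \<Rightarrow> ('i \<Rightarrow> 'o) \<Rightarrow> 'i \<Rightarrow> 'a" where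
  "coprod_in C I X \<equiv> snd (coprod C I X)"

definition copair ::
    "('o, 'a, 'z) cat_scheme \<Rightarrow> 'i set \<Rightarrow> ('i \<Rightarrow> 'o) \<Rightarrow> 'o \<Rightarrow> ('i \<Rightarrow> 'a) \<Rightarrow> 'a" where
  "copair C I X d \<kappa> =
     (THE h. h \<in> Hom C (coprod_obj C I X) d \<and> (\<forall>i\<in>I. h \<cdot>\<^bsub>C\<^esub> coprod_in C I X i = \<kappa> i))"

definition coprod_map ::
    "('o, 'a, 'z) cat_scheme \<Rightarrow> 'i set \<Rightarrow> ('i \<Rightarrow> 'o) \<Rightarrow> ('i \<Rightarrow> 'o) \<Rightarrow> ('i \<Rightarrow> 'a) \<Rightarrow> 'a" where
  "coprod_map C I X Y f =
     copair C I X (coprod_obj C I Y) (\<lambda>i. coprod_in C I Y i \<cdot>\<^bsub>C\<^esub> f i)"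


section \<open>Abelian categories\<close>

record ('o, 'a) acat = "('o, 'a) cat" +
  Plus :: "'a \<Rightarrow> 'a \<Rightarrow> 'a"
  Zero :: "'o \<Rightarrow> 'o \<Rightarrow> 'a"

definition hom_group :: "('o, 'a, 'z) acat_scheme \<Rightarrow> 'o \<Rightarrow> 'o \<Rightarrow> 'a monoid" where
  "hom_group A x y = \<lparr>carrier = Hom A x y, mult = Plus A, one = Zero A x y\<rparr>"

locale preadditive = category A for A :: "('o, 'a, 'z) acat_scheme" +
  assumes hom_comm_group: "\<lbrakk>x \<in> Ob A; y \<in> Ob A\<rbrakk> \<Longrightarrow> comm_group (hom_group A x y)"
    and comp_plus_left:
      "\<lbrakk>f \<in> Hom A x y; g \<in> Hom A y z; g' \<in> Hom A y z\<rbrakk> \<Longrightarrow>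
        Plus A g g' \<cdot>\<^bsub>A\<^esub> f = Plus A (g \<cdot>\<^bsub>A\<^esub> f) (g' \<cdot>\<^bsub>A\<^esub> f)"
    and comp_plus_right:
      "\<lbrakk>f \<in> Hom A x y; f' \<in> Hom A x y; g \<in> Hom A y z\<rbrakk> \<Longrightarrow>
        g \<cdot>\<^bsub>A\<^esub> Plus A f f' = Plus A (g \<cdot>\<^bsub>A\<^esub> f) (g \<cdot>\<^bsub>A\<^esub> f')"

definition is_kernel :: "('o, 'a, 'z) acat_scheme \<Rightarrow> 'a \<Rightarrow> 'a \<Rightarrow> bool" where
  "is_kernel A k f \<longleftrightarrow> f \<in> Ar A \<and> k \<in> Ar A \<and> Cod A k = Dom A f \<and>
     f \<cdot>\<^bsub>A\<^esub> k = Zero A (Dom A k) (Cod A f) \<and>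
     (\<forall>x. \<forall>g\<in>Hom A x (Dom A f). f \<cdot>\<^bsub>A\<^esub> g = Zero A x (Cod A f) \<longrightarrow>
        (\<exists>!h. h \<in> Hom A x (Dom A k) \<and> k \<cdot>\<^bsub>A\<^esub> h = g))"

definition is_cokernel :: "('o, 'a, 'z) acat_scheme \<Rightarrow> 'a \<Rightarrow> 'a \<Rightarrow> bool" where
  "is_cokernel A c f \<longleftrightarrow> f \<in> Ar A \<and> c \<in> Ar A \<and> Dom A c = Cod A f \<and>
     c \<cdot>\<^bsub>A\<^esub> f = Zero A (Dom A f) (Cod A c) \<and>
     (\<forall>y. \<forall>g\<in>Hom A (Cod A f) y. g \<cdot>\<^bsub>A\<^esub> f = Zero A (Dom A f) y \<longrightarrow>
        (\<exists>!h. h \<in> Hom A (Cod A c) y \<and> h \<cdot>\<^bsub>A\<^esub> c = g))"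

locale abelian_category = preadditive A for A :: "('o, 'a, 'z) acat_scheme" +
  assumes ex_zero_obj: "\<exists>z. is_zero_obj A z"
    and ex_biproduct:
      "\<lbrakk>x \<in> Ob A; y \<in> Ob A\<rbrakk> \<Longrightarrow>
        \<exists>s \<in> Ob A. \<exists>i\<^sub>1\<in>Hom A x s. \<exists>i\<^sub>2\<in>Hom A y s. \<exists>p\<^sub>1\<in>Hom A s x. \<exists>p\<^sub>2\<in>Hom A s y.
          p\<^sub>1 \<cdot>\<^bsub>A\<^esub> i\<^sub>1 = Id A x \<and> p\<^sub>2 \<cdot>\<^bsub>A\<^esub> i\<^sub>2 = Id A y \<and>
          p\<^sub>1 \<cdot>\<^bsub>A\<^esub> i\<^sub>2 = Zero A y x \<and> p\<^sub>2 \<cdot>\<^bsub>A\<^esub> i\<^sub>1 = Zero A x y \<and>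
          Plus A (i\<^sub>1 \<cdot>\<^bsub>A\<^esub> p\<^sub>1) (i\<^sub>2 \<cdot>\<^bsub>A\<^esub> p\<^sub>2) = Id A s"
    and ex_kernel: "f \<in> Ar A \<Longrightarrow> \<exists>k. is_kernel A k f"
    and ex_cokernel: "f \<in> Ar A \<Longrightarrow> \<exists>c. is_cokernel A c f"
    and mono_normal: "is_mono A m \<Longrightarrow> \<exists>f. is_kernel A m f"
    and epi_normal: "is_epi A e \<Longrightarrow> \<exists>f. is_cokernel A e f"

definition short_exact :: "('o, 'a, 'z) acat_scheme \<Rightarrow> 'a \<Rightarrow> 'a \<Rightarrow> bool" where
  "short_exact A f g \<longleftrightarrow> is_kernel A f g \<and> is_cokernel A g f"

text \<open>Exactness of \<open>\<bullet> \<midarrow>f\<rightarrow> \<bullet> \<midarrow>g\<rightarrow> \<bullet>\<close> in the middle: the image of \<open>f\<close>, i.e. the kernel of its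
  cokernel, is the kernel of \<open>g\<close>.\<close>

definition exact_at :: "('o, 'a, 'z) acat_scheme \<Rightarrow> 'a \<Rightarrow> 'a \<Rightarrow> bool" where
  "exact_at A f g \<longleftrightarrow> (\<exists>c k. is_cokernel A c f \<and> is_kernel A k c \<and> is_kernel A k g)"

definition exact_coproducts :: "'u itself \<Rightarrow> ('o, 'a, 'z) acat_scheme \<Rightarrow> bool" where
  "exact_coproducts U A \<longleftrightarrow>
     (\<forall>(I :: 'u set) X Y Z f g.
        (\<forall>i\<in>I. f i \<in> Hom A (X i) (Y i) \<and> g i \<in> Hom A (Y i) (Z i) \<and> short_exact A (f i) (g i)) \<longrightarrow>
        short_exact A (coprod_map A I X Y f) (coprod_map A I Y Z g))"

text \<open>The functor category; its additive structure is pointwise. An arrow is a natural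
  transformation together with its source and target.\<close>

definition fun_cat ::
    "('o1, 'a1, 'z1) cat_scheme \<Rightarrow> ('o2, 'a2, 'z2) acat_scheme
      \<Rightarrow> (('o1, 'a1, 'o2, 'a2) fctr,
          ('o1, 'a1, 'o2, 'a2) fctr \<times> ('o1 \<Rightarrow> 'a2) \<times> ('o1, 'a1, 'o2, 'a2) fctr) acat" where
  "fun_cat C D =
     \<lparr>Ob = {F. is_functor C D F},
      Ar = {(F, \<eta>, G). nat_trans C D F G \<eta>},
      Dom = fst,
      Cod = snd \<circ> snd,
      Id = (\<lambda>F. (F, (\<lambda>x\<in>Ob C. Id D (obj_map F x)), F)),
      Comp = (\<lambda>(G', \<theta>, H) (F, \<eta>, G). (F, (\<lambda>x\<in>Ob C. \<theta> x \<cdot>\<^bsub>D\<^esub> \<eta> x), H)),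
      Plus = (\<lambda>(F, \<eta>, G) (F', \<theta>, G'). (F, (\<lambda>x\<in>Ob C. Plus D (\<eta> x) (\<theta> x)), G)),
      Zero = (\<lambda>F G. (F, (\<lambda>x\<in>Ob C. Zero D (obj_map F x) (obj_map G x)), G))\<rparr>"

definition precomp ::
    "('o1, 'a1, 'z1) cat_scheme \<Rightarrow> ('o2, 'a2, 'z2) cat_scheme \<Rightarrow> ('o3, 'a3, 'z3) acat_scheme
      \<Rightarrow> ('o1, 'a1, 'o2, 'a2) fctr
      \<Rightarrow> (('o2, 'a2, 'o3, 'a3) fctr,
          ('o2, 'a2, 'o3, 'a3) fctr \<times> ('o2 \<Rightarrow> 'a3) \<times> ('o2, 'a2, 'o3, 'a3) fctr,
          ('o1, 'a1, 'o3, 'a3) fctr,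
          ('o1, 'a1, 'o3, 'a3) fctr \<times> ('o1 \<Rightarrow> 'a3) \<times> ('o1, 'a1, 'o3, 'a3) fctr) fctr" where
  "precomp C C' D K =
     \<lparr>obj_map = (\<lambda>F\<in>Ob (fun_cat C' D). functor_comp C F K),
      arr_map = (\<lambda>(F, \<eta>, G)\<in>Ar (fun_cat C' D).
                   (functor_comp C F K, (\<lambda>x\<in>Ob C. \<eta> (obj_map K x)), functor_comp C G K))\<rparr>"


section \<open>Homology\<close>

text \<open>The homology of \<open>\<bullet> \<midarrow>f\<rightarrow> \<bullet> \<midarrow>g\<rightarrow> \<bullet>\<close> (with \<open>g \<cdot> f = 0\<close>) is the cokernel of the map
  \<open>boundary_lift A f g\<close> from the source of \<open>f\<close> to the kernel of \<open>g\<close> induced by \<open>f\<close>.\<close>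

definition ker_arr :: "('o, 'a, 'z) acat_scheme \<Rightarrow> 'a \<Rightarrow> 'a" where
  "ker_arr A f = (SOME k. is_kernel A k f)"

definition coker_arr :: "('o, 'a, 'z) acat_scheme \<Rightarrow> 'a \<Rightarrow> 'a" where
  "coker_arr A f = (SOME c. is_cokernel A c f)"

definition boundary_lift :: "('o, 'a, 'z) acat_scheme \<Rightarrow> 'a \<Rightarrow> 'a \<Rightarrow> 'a" where
  "boundary_lift A f g =
     (THE h. h \<in> Hom A (Dom A f) (Dom A (ker_arr A g)) \<and> ker_arr A g \<cdot>\<^bsub>A\<^esub> h = f)"

definition homology_proj :: "('o, 'a, 'z) acat_scheme \<Rightarrow> 'a \<Rightarrow> 'a \<Rightarrow> 'a" where
  "homology_proj A f g = coker_arr A (boundary_lift A f g)"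

definition homology_obj :: "('o, 'a, 'z) acat_scheme \<Rightarrow> 'a \<Rightarrow> 'a \<Rightarrow> 'o" where
  "homology_obj A f g = Cod A (homology_proj A f g)"

text \<open>Map on homology induced by the middle component \<open>\<phi>\<close> of a map of complexes from
  \<open>(f, g)\<close> to \<open>(f', g')\<close>.\<close>

definition cycles_map :: "('o, 'a, 'z) acat_scheme \<Rightarrow> 'a \<Rightarrow> 'a \<Rightarrow> 'a \<Rightarrow> 'a" where
  "cycles_map A g g' \<phi> =
     (THE h. h \<in> Hom A (Dom A (ker_arr A g)) (Dom A (ker_arr A g')) \<and>
             ker_arr A g' \<cdot>\<^bsub>A\<^esub> h = \<phi> \<cdot>\<^bsub>A\<^esub> ker_arr A g)"

definition homology_map ::
    "('o, 'a, 'z) acat_scheme \<Rightarrow> 'a \<Rightarrow> 'a \<Rightarrow> 'a \<Rightarrow> 'a \<Rightarrow> 'a \<Rightarrow> 'a" where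
  "homology_map A f g f' g' \<phi> =
     (THE h. h \<in> Hom A (homology_obj A f g) (homology_obj A f' g') \<and>
             h \<cdot>\<^bsub>A\<^esub> homology_proj A f g = homology_proj A f' g' \<cdot>\<^bsub>A\<^esub> cycles_map A g g' \<phi>)"


section \<open>Left satellites\<close>

definition additive_functor ::
    "('o1, 'a1, 'z1) acat_scheme \<Rightarrow> ('o2, 'a2, 'z2) acat_scheme \<Rightarrow> ('o1, 'a1, 'o2, 'a2) fctr
      \<Rightarrow> bool" where
  "additive_functor C D F \<longleftrightarrow> is_functor C D F \<and>
     (\<forall>x y. \<forall>f\<in>Hom C x y. \<forall>g\<in>Hom C x y.
        arr_map F (Plus C f g) = Plus D (arr_map F f) (arr_map F g))"

record ('o1, 'a1, 'o2, 'a2) delta_fctr =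
  degree :: "nat \<Rightarrow> ('o1, 'a1, 'o2, 'a2) fctr"
  conn   :: "nat \<Rightarrow> 'a1 \<Rightarrow> 'a1 \<Rightarrow> 'a2"

text \<open>Homological \<open>\<delta>\<close>-functors in nonnegative degrees: \<open>conn S n f g\<close> is the connecting map
  from degree \<open>n + 1\<close> to degree \<open>n\<close> of the short exact sequence \<open>(f, g)\<close>.\<close>

definition delta_functor ::
    "('o1, 'a1, 'z1) acat_scheme \<Rightarrow> ('o2, 'a2, 'z2) acat_scheme \<Rightarrow> ('o1, 'a1, 'o2, 'a2) delta_fctr
      \<Rightarrow> bool" where
  "delta_functor C D S \<longleftrightarrow>
     (\<forall>n. additive_functor C D (degree S n)) \<and>
     (\<forall>f g. short_exact C f g \<longrightarrow>
        is_epi D (arr_map (degree S 0) g) \<and>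
        (\<forall>n. conn S n f g \<in> Hom D (obj_map (degree S (Suc n)) (Cod C g))
                                     (obj_map (degree S n) (Dom C f)) \<and>
             exact_at D (arr_map (degree S n) f) (arr_map (degree S n) g) \<and>
             exact_at D (arr_map (degree S (Suc n)) g) (conn S n f g) \<and>
             exact_at D (conn S n f g) (arr_map (degree S n) f))) \<and>
     (\<forall>f g f' g' a b c.
        short_exact C f g \<and> short_exact C f' g' \<and>
        a \<in> Hom C (Dom C f) (Dom C f') \<and> b \<in> Hom C (Cod C f) (Cod C f') \<and>
        c \<in> Hom C (Cod C g) (Cod C g') \<and>
        b \<cdot>\<^bsub>C\<^esub> f = f' \<cdot>\<^bsub>C\<^esub> a \<and> c \<cdot>\<^bsub>C\<^esub> g = g' \<cdot>\<^bsub>C\<^esub> b \<longrightarrow>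
        (\<forall>n. conn S n f' g' \<cdot>\<^bsub>D\<^esub> arr_map (degree S (Suc n)) c =
             arr_map (degree S n) a \<cdot>\<^bsub>D\<^esub> conn S n f g))"

definition delta_morphism ::
    "('o1, 'a1, 'z1) acat_scheme \<Rightarrow> ('o2, 'a2, 'z2) acat_scheme \<Rightarrow> ('o1, 'a1, 'o2, 'a2) delta_fctr
      \<Rightarrow> ('o1, 'a1, 'o2, 'a2) delta_fctr \<Rightarrow> (nat \<Rightarrow> 'o1 \<Rightarrow> 'a2) \<Rightarrow> bool" where
  "delta_morphism C D S S' t \<longleftrightarrow>
     (\<forall>n. nat_trans C D (degree S n) (degree S' n) (t n)) \<and>
     (\<forall>n f g. short_exact C f g \<longrightarrow>
        t n (Dom C f) \<cdot>\<^bsub>D\<^esub> conn S n f g = conn S' n f g \<cdot>\<^bsub>D\<^esub> t (Suc n) (Cod C g))"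

text \<open>The left satellites of \<open>F\<close>: the universal homological \<open>\<delta>\<close>-functor with \<open>F\<close> in degree \<open>0\<close>.
  This notion of left derived functor does not presuppose enough projectives.\<close>

definition left_satellites ::
    "('o1, 'a1, 'z1) acat_scheme \<Rightarrow> ('o2, 'a2, 'z2) acat_scheme \<Rightarrow> ('o1, 'a1, 'o2, 'a2) fctr
      \<Rightarrow> ('o1, 'a1, 'o2, 'a2) delta_fctr \<Rightarrow> bool" where
  "left_satellites C D F S \<longleftrightarrow> delta_functor C D S \<and> degree S 0 = F \<and>
     (\<forall>S' t\<^sub>0. delta_functor C D S' \<and> nat_trans C D (degree S' 0) (degree S 0) t\<^sub>0 \<longrightarrow>
        (\<exists>!t. delta_morphism C D S' S t \<and> t 0 = t\<^sub>0))"


section \<open>The simplex category of a category\<close>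

text \<open>The poset \<open>[n]\<close> as a category; the pair \<open>(i, j)\<close> is the arrow from \<open>i\<close> to \<open>j\<close>.\<close>

definition ord_cat :: "nat \<Rightarrow> (nat, nat \<times> nat) cat" where
  "ord_cat n = \<lparr>Ob = {..n}, Ar = {(i, j). i \<le> j \<and> j \<le> n}, Dom = fst, Cod = snd,
                Id = (\<lambda>i. (i, i)), Comp = (\<lambda>g f. (fst f, snd g))\<rparr>"

definition ord_maps :: "nat \<Rightarrow> nat \<Rightarrow> (nat \<Rightarrow> nat) set" where
  "ord_maps n m = {\<sigma> \<in> {..n} \<rightarrow>\<^sub>E {..m}. mono_on {..n} \<sigma>}"

definition ord_functor :: "nat \<Rightarrow> (nat \<Rightarrow> nat) \<Rightarrow> (nat, nat \<times> nat, nat, nat \<times> nat) fctr" where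
  "ord_functor n \<sigma> = \<lparr>obj_map = restrict \<sigma> {..n},
                      arr_map = (\<lambda>(i, j)\<in>Ar (ord_cat n). (\<sigma> i, \<sigma> j))\<rparr>"

type_synonym ('o, 'a) simplex = "nat \<times> (nat, nat \<times> nat, 'o, 'a) fctr"

type_synonym ('o, 'a) simplex_arr = "('o, 'a) simplex \<times> (nat \<Rightarrow> nat) \<times> ('o, 'a) simplex"

definition simplices :: "('o, 'a) cat \<Rightarrow> nat \<Rightarrow> (nat, nat \<times> nat, 'o, 'a) fctr set" where
  "simplices C n = {f. is_functor (ord_cat n) C f}"

definition simplex_cat ::
    "('o, 'a) cat \<Rightarrow> (('o, 'a) simplex, ('o, 'a) simplex_arr) cat" where
  "simplex_cat C =
     \<lparr>Ob = {(n, f). f \<in> simplices C n},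
      Ar = {((n, f), \<sigma>, (m, g)). f \<in> simplices C n \<and> g \<in> simplices C m \<and> \<sigma> \<in> ord_maps n m \<and>
                                  f = functor_comp (ord_cat n) g (ord_functor n \<sigma>)},
      Dom = fst,
      Cod = snd \<circ> snd,
      Id = (\<lambda>x. (x, (\<lambda>i\<in>{..fst x}. i), x)),
      Comp = (\<lambda>(y', \<tau>, z) (x, \<sigma>, y). (x, compose {..fst x} \<tau> \<sigma>, z))\<rparr>"

text \<open>The functor \<open>\<Delta>/u\<close>. Since \<open>op_cat\<close> does not change objects and arrows, the same data
  also represent its opposite.\<close>

definition simplex_functor ::
    "('o1, 'a1) cat \<Rightarrow> ('o1, 'a1, 'o2, 'a2) fctr
      \<Rightarrow> (('o1, 'a1) simplex, ('o1, 'a1) simplex_arr, ('o2, 'a2) simplex, ('o2, 'a2) simplex_arr) fctr"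
  where
  "simplex_functor C u =
     (let \<Delta>u = (\<lambda>(n, f). (n, functor_comp (ord_cat n) u f)) in
      \<lparr>obj_map = (\<lambda>x\<in>Ob (simplex_cat C). \<Delta>u x),
       arr_map = (\<lambda>(x, \<sigma>, y)\<in>Ar (simplex_cat C). (\<Delta>u x, \<sigma>, \<Delta>u y))\<rparr>)"


section \<open>Thomason homology\<close>

type_synonym ('o1, 'a1, 'o2, 'a2) natsys =
  "(('o1, 'a1) simplex, ('o1, 'a1) simplex_arr, 'o2, 'a2) fctr"

type_synonym ('o1, 'a1, 'o2, 'a2) natsys_arr =
  "('o1, 'a1, 'o2, 'a2) natsys \<times> (('o1, 'a1) simplex \<Rightarrow> 'a2) \<times> ('o1, 'a1, 'o2, 'a2) natsys"

text \<open>The category of contravariant Thomason natural systems.\<close>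

definition natsys_cat ::
    "('o1, 'a1) cat \<Rightarrow> ('o2, 'a2) acat
      \<Rightarrow> (('o1, 'a1, 'o2, 'a2) natsys, ('o1, 'a1, 'o2, 'a2) natsys_arr) acat" where
  "natsys_cat C A = fun_cat (op_cat (simplex_cat C)) A"

definition coface :: "nat \<Rightarrow> nat \<Rightarrow> nat \<Rightarrow> nat" where
  "coface n i = (\<lambda>j\<in>{..n}. if j < i then j else Suc j)"

definition face ::
    "nat \<Rightarrow> nat \<Rightarrow> (nat, nat \<times> nat, 'o, 'a) fctr \<Rightarrow> (nat, nat \<times> nat, 'o, 'a) fctr" where
  "face n i f = functor_comp (ord_cat n) f (ord_functor n (coface n i))"

definition coface_arr ::
    "nat \<Rightarrow> nat \<Rightarrow> (nat, nat \<times> nat, 'o, 'a) fctr \<Rightarrow> ('o, 'a) simplex_arr" where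
  "coface_arr n i f = ((n, face n i f), coface n i, (Suc n, f))"

definition thom_chains ::
    "('o1, 'a1) cat \<Rightarrow> ('o2, 'a2) acat \<Rightarrow> ('o1, 'a1, 'o2, 'a2) natsys \<Rightarrow> nat \<Rightarrow> 'o2" where
  "thom_chains C A T n = coprod_obj A (simplices C n) (\<lambda>f. obj_map T (n, f))"

definition thom_diff ::
    "('o1, 'a1) cat \<Rightarrow> ('o2, 'a2) acat \<Rightarrow> ('o1, 'a1, 'o2, 'a2) natsys \<Rightarrow> nat \<Rightarrow> 'a2" where
  "thom_diff C A T n =
     copair A (simplices C (Suc n)) (\<lambda>f. obj_map T (Suc n, f)) (thom_chains C A T n)
       (\<lambda>f. let G = hom_group A (obj_map T (Suc n, f)) (thom_chains C A T n);
                bd = (\<lambda>i. coprod_in A (simplices C n) (\<lambda>f. obj_map T (n, f)) (face n i f)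
                          \<cdot>\<^bsub>A\<^esub> arr_map T (coface_arr n i f))
            in finprod G (\<lambda>i. if even i then bd i else inv\<^bsub>G\<^esub> bd i) {..Suc n})"

text \<open>The differential leaving degree \<open>n\<close>; \<open>thom_diff C A T n\<close> is the one entering it.\<close>

definition thom_out ::
    "('o1, 'a1) cat \<Rightarrow> ('o2, 'a2) acat \<Rightarrow> ('o1, 'a1, 'o2, 'a2) natsys \<Rightarrow> nat \<Rightarrow> 'a2" where
  "thom_out C A T n =
     (case n of 0 \<Rightarrow> Zero A (thom_chains C A T 0) (zero_obj A) | Suc m \<Rightarrow> thom_diff C A T m)"

definition thom_homology ::
    "('o1, 'a1) cat \<Rightarrow> ('o2, 'a2) acat \<Rightarrow> nat
      \<Rightarrow> (('o1, 'a1, 'o2, 'a2) natsys, ('o1, 'a1, 'o2, 'a2) natsys_arr, 'o2, 'a2) fctr" where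
  "thom_homology C A n =
     \<lparr>obj_map = (\<lambda>T\<in>Ob (natsys_cat C A).
                   homology_obj A (thom_diff C A T n) (thom_out C A T n)),
      arr_map = (\<lambda>(T, \<eta>, T')\<in>Ar (natsys_cat C A).
                   homology_map A (thom_diff C A T n) (thom_out C A T n)
                                  (thom_diff C A T' n) (thom_out C A T' n)
                     (coprod_map A (simplices C n) (\<lambda>f. obj_map T (n, f)) (\<lambda>f. obj_map T' (n, f))
                        (\<lambda>f. \<eta> (n, f))))\<rparr>"

text \<open>The left Kan extension along the opposite of \<open>\<Delta>/u\<close>, as a left adjoint.\<close>

definition is_Lan ::
    "('o1, 'a1) cat \<Rightarrow> ('o2, 'a2) cat \<Rightarrow> ('o3, 'a3) acat \<Rightarrow> ('o1, 'a1, 'o2, 'a2) fctr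
      \<Rightarrow> (('o1, 'a1, 'o3, 'a3) natsys, ('o1, 'a1, 'o3, 'a3) natsys_arr,
          ('o2, 'a2, 'o3, 'a3) natsys, ('o2, 'a2, 'o3, 'a3) natsys_arr) fctr \<Rightarrow> bool" where
  "is_Lan E B A u L \<longleftrightarrow>
     is_left_adjoint (natsys_cat E A) (natsys_cat B A) L
       (precomp (op_cat (simplex_cat E)) (op_cat (simplex_cat B)) A (simplex_functor E u))"


section \<open>Spectral sequences\<close>

text \<open>Homological spectral sequences from the second page on. The arrow \<open>turn S r p q\<close> is the
  isomorphism from the homology of page \<open>r\<close> at \<open>(p, q)\<close> to the term of page \<open>r + 1\<close>. The
  indices \<open>p, q\<close> are integers; the terms outside the quadrant \<open>p, q \<ge> 0\<close> are zero.\<close>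

record ('o, 'a) specseq =
  page   :: "nat \<Rightarrow> int \<Rightarrow> int \<Rightarrow> 'o"
  diffl  :: "nat \<Rightarrow> int \<Rightarrow> int \<Rightarrow> 'a"
  turn   :: "nat \<Rightarrow> int \<Rightarrow> int \<Rightarrow> 'a"

definition diff_in :: "('o, 'a) specseq \<Rightarrow> nat \<Rightarrow> int \<Rightarrow> int \<Rightarrow> 'a" where
  "diff_in S r p q = diffl S r (p + int r) (q - int r + 1)"

definition spectral_sequence :: "('o, 'a, 'z) acat_scheme \<Rightarrow> ('o, 'a) specseq \<Rightarrow> bool" where
  "spectral_sequence A S \<longleftrightarrow>
     (\<forall>r\<ge>2. \<forall>p q.
        page S r p q \<in> Ob A \<and>
        (p < 0 \<or> q < 0 \<longrightarrow> is_zero_obj A (page S r p q)) \<and>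
        diffl S r p q \<in> Hom A (page S r p q) (page S r (p - int r) (q + int r - 1)) \<and>
        diffl S r p q \<cdot>\<^bsub>A\<^esub> diff_in S r p q =
          Zero A (page S r (p + int r) (q - int r + 1)) (page S r (p - int r) (q + int r - 1)) \<and>
        turn S r p q \<in> Hom A (homology_obj A (diff_in S r p q) (diffl S r p q)) (page S (Suc r) p q) \<and>
        is_iso A (turn S r p q))"

definition specseq_morphism ::
    "('o, 'a, 'z) acat_scheme \<Rightarrow> ('o, 'a) specseq \<Rightarrow> ('o, 'a) specseq \<Rightarrow> (nat \<Rightarrow> int \<Rightarrow> int \<Rightarrow> 'a)
      \<Rightarrow> bool" where
  "specseq_morphism A S S' \<phi> \<longleftrightarrow>
     (\<forall>r\<ge>2. \<forall>p q.
        \<phi> r p q \<in> Hom A (page S r p q) (page S' r p q) \<and>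
        \<phi> r (p - int r) (q + int r - 1) \<cdot>\<^bsub>A\<^esub> diffl S r p q = diffl S' r p q \<cdot>\<^bsub>A\<^esub> \<phi> r p q \<and>
        \<phi> (Suc r) p q \<cdot>\<^bsub>A\<^esub> turn S r p q =
          turn S' r p q \<cdot>\<^bsub>A\<^esub>
            homology_map A (diff_in S r p q) (diffl S r p q)
                           (diff_in S' r p q) (diffl S' r p q) (\<phi> r p q))"

text \<open>From page \<open>p + q + 2\<close> on, the differentials into and out of position \<open>(p, q)\<close> (where
  \<open>p, q \<ge> 0\<close>) have source and target outside the quadrant, so the limit term is the term of
  this page.\<close>

definition limit_page :: "nat \<Rightarrow> nat \<Rightarrow> nat" where
  "limit_page p q = p + q + 2"

text \<open>Convergence to graded objects \<open>H\<close>: \<open>incl X n p\<close> is the inclusion of the \<open>p\<close>-th filtration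
  step into \<open>H n\<close> (\<open>-1 \<le> p \<le> n\<close>), and \<open>quot X n p\<close> maps the \<open>p\<close>-th step onto the limit term at
  \<open>(p, n - p)\<close>, with the previous step as kernel.\<close>

record 'a filt =
  incl :: "nat \<Rightarrow> int \<Rightarrow> 'a"
  quot :: "nat \<Rightarrow> nat \<Rightarrow> 'a"

definition converges ::
    "('o, 'a, 'z) acat_scheme \<Rightarrow> ('o, 'a) specseq \<Rightarrow> (nat \<Rightarrow> 'o) \<Rightarrow> 'a filt \<Rightarrow> bool" where
  "converges A S H X \<longleftrightarrow>
     (\<forall>n. (\<forall>p. -1 \<le> p \<and> p \<le> int n \<longrightarrow> is_mono A (incl X n p) \<and> Cod A (incl X n p) = H n) \<and>
          is_zero_obj A (Dom A (incl X n (-1))) \<and>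
          is_iso A (incl X n (int n)) \<and>
          (\<forall>p\<le>n. Cod A (quot X n p) = page S (limit_page p (n - p)) (int p) (int (n - p)) \<and>
             (\<exists>j. j \<in> Hom A (Dom A (incl X n (int p - 1))) (Dom A (incl X n (int p))) \<and>
                  incl X n (int p) \<cdot>\<^bsub>A\<^esub> j = incl X n (int p - 1) \<and>
                  short_exact A j (quot X n p))))"

text \<open>Compatibility of a morphism \<open>\<phi>\<close> of spectral sequences with maps \<open>h n\<close> of the abutments:
  \<open>h n\<close> respects the filtrations and induces \<open>\<phi>\<close> on the limit terms.\<close>

definition converges_morphism ::
    "('o, 'a, 'z) acat_scheme \<Rightarrow> 'a filt \<Rightarrow> 'a filt \<Rightarrow> (nat \<Rightarrow> int \<Rightarrow> int \<Rightarrow> 'a) \<Rightarrow> (nat \<Rightarrow> 'a)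
      \<Rightarrow> bool" where
  "converges_morphism A X X' \<phi> h \<longleftrightarrow>
     (\<forall>n. \<forall>p\<le>n. \<exists>t\<in>Hom A (Dom A (incl X n (int p))) (Dom A (incl X' n (int p))).
        incl X' n (int p) \<cdot>\<^bsub>A\<^esub> t = h n \<cdot>\<^bsub>A\<^esub> incl X n (int p) \<and>
        quot X' n p \<cdot>\<^bsub>A\<^esub> t =
          \<phi> (limit_page p (n - p)) (int p) (int (n - p)) \<cdot>\<^bsub>A\<^esub> quot X n p)"

text \<open>A spectral sequence functorial in \<open>N\<close>, converging naturally to the functors \<open>H n\<close>, and with
  second page naturally isomorphic to given functors \<open>E2 p q\<close>.\<close>

definition functorial_specseq ::
    "('on, 'an, 'z1) cat_scheme \<Rightarrow> ('o, 'a, 'z2) acat_scheme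
      \<Rightarrow> (nat \<Rightarrow> nat \<Rightarrow> ('on, 'an, 'o, 'a) fctr) \<Rightarrow> (nat \<Rightarrow> ('on, 'an, 'o, 'a) fctr)
      \<Rightarrow> ('on \<Rightarrow> ('o, 'a) specseq) \<Rightarrow> ('an \<Rightarrow> nat \<Rightarrow> int \<Rightarrow> int \<Rightarrow> 'a)
      \<Rightarrow> ('on \<Rightarrow> 'a filt) \<Rightarrow> (nat \<Rightarrow> nat \<Rightarrow> 'on \<Rightarrow> 'a) \<Rightarrow> bool" where
  "functorial_specseq N A E2 H S \<Phi> X \<theta> \<longleftrightarrow>
     (\<forall>T\<in>Ob N. spectral_sequence A (S T) \<and> converges A (S T) (\<lambda>n. obj_map (H n) T) (X T)) \<and>
     (\<forall>T\<in>Ob N. \<forall>p q. is_iso A (\<theta> p q T) \<and>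
        \<theta> p q T \<in> Hom A (page (S T) 2 (int p) (int q)) (obj_map (E2 p q) T)) \<and>
     (\<forall>T T'. \<forall>t\<in>Hom N T T'.
        specseq_morphism A (S T) (S T') (\<Phi> t) \<and>
        converges_morphism A (X T) (X T') (\<Phi> t) (\<lambda>n. arr_map (H n) t) \<and>
        (\<forall>p q. arr_map (E2 p q) t \<cdot>\<^bsub>A\<^esub> \<theta> p q T = \<theta> p q T' \<cdot>\<^bsub>A\<^esub> \<Phi> t 2 (int p) (int q))) \<and>
     (\<forall>T\<in>Ob N. \<forall>r\<ge>2. \<forall>p q. \<Phi> (Id N T) r p q = Id A (page (S T) r p q)) \<and>
     (\<forall>T T' T''. \<forall>t\<in>Hom N T T'. \<forall>t'\<in>Hom N T' T''. \<forall>r\<ge>2. \<forall>p q.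
        \<Phi> (t' \<cdot>\<^bsub>N\<^esub> t) r p q = \<Phi> t' r p q \<cdot>\<^bsub>A\<^esub> \<Phi> t r p q)"

end

theory Submission
  imports Defs
begin

text \<open>The functor \<open>\<Delta>/u\<close> is a discrete fibration: a simplex obtained from
  \<open>u \<circ> f\<close> by an order preserving map lifts uniquely to one obtained from
  \<open>f\<close> by the same map. Hence the left Kan extension of \<open>T\<close> takes \<open>([n],
  g)\<close> to the coproduct of the \<open>T([n], f)\<close> with \<open>u \<circ> f = g\<close>, and it
  is exact because coproducts are. So its satellites vanish in positive degrees, and the spectral sequence
  is concentrated in the row \<open>q = 0\<close>. What remains is an isomorphism between the Thomason
  complexes of \<open>T\<close> over \<open>E\<close> and of its Kan extension over \<open>B\<close>: in
  each degree both are the coproduct of the \<open>T([n], f)\<close> over all \<open>f\<close>, in the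
  second case taken fibre by fibre.\<close>

section \<open>Categories and preadditive categories\<close>

text \<open>Satellites are specified by a universal property alone, without projective resolutions,
  so their vanishing cannot be read off a construction. For an exact functor, the system that is
  zero in positive degrees is shown to be universal, which gives existence; for an arbitrary
  universal system, vanishing comes from the uniqueness of its endomorphisms. The Kan extension,
  too, is an arbitrary left adjoint: the coproduct formula is proved for one explicit model and
  carried over by the uniqueness of universal arrows.

  A second obstacle is that kernels, cokernels and coproducts are arbitrary choices. Exactness of
  coproducts is assumed for the chosen coproducts over subsets of \<open>'u\<close>, whereas fibres
  are sets of simplices; an infinite universe provides injections of such sets into
  \<open>'u\<close>, and exactness is transported along comparison isomorphisms. For the same reason
  the homology of zero differentials is only isomorphic to the term itself, so the maps turning the
  pages of the degenerate spectral sequence are canonical isomorphisms whose naturality has to be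
  shown.\<close>

lemma Hom_iff: "f \<in> Hom C x y \<longleftrightarrow> f \<in> Ar C \<and> Dom C f = x \<and> Cod C f = y"
  by (simp add: Hom_def)

lemma Hom_D:
  assumes "f \<in> Hom C x y" shows "f \<in> Ar C" "Dom C f = x" "Cod C f = y"
  using assms by (simp_all add: Hom_def)

context category begin

lemma Hom_Ob: assumes "f \<in> Hom C x y" shows "x \<in> Ob C" "y \<in> Ob C"
  using assms dom_ob cod_ob by (auto simp: Hom_def)

lemma comp_ar [simp]:
  assumes "f \<in> Ar C" "g \<in> Ar C" "Dom C g = Cod C f"
  shows "g \<cdot> f \<in> Ar C" "Dom C (g \<cdot> f) = Dom C f" "Cod C (g \<cdot> f) = Cod C g"
  using comp_hom[of f "Dom C f" "Cod C f" g "Cod C g"] assms by (auto simp: Hom_def)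

lemma assoc_ar [simp]:
  assumes "f \<in> Ar C" "g \<in> Ar C" "h \<in> Ar C" "Dom C g = Cod C f" "Dom C h = Cod C g"
  shows "(h \<cdot> g) \<cdot> f = h \<cdot> (g \<cdot> f)"
  using comp_assoc[of f "Dom C f" "Cod C f" g "Cod C g" h "Cod C h"] assms by (auto simp: Hom_def)

lemma id_ar [simp]:
  assumes "x \<in> Ob C" shows "Id C x \<in> Ar C" "Dom C (Id C x) = x" "Cod C (Id C x) = x"
  using id_hom[OF assms] by (auto simp: Hom_def)

lemma id_comp [simp]:
  assumes "f \<in> Ar C"
  shows "Dom C f = x \<Longrightarrow> f \<cdot> Id C x = f" "Cod C f = y \<Longrightarrow> Id C y \<cdot> f = f"
  using id_right[of f "Dom C f" "Cod C f"] id_left[of f "Dom C f" "Cod C f"] assms by (auto simp: Hom_def)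

lemma Dom_Cod_ob [simp]: "f \<in> Ar C \<Longrightarrow> Dom C f \<in> Ob C" "f \<in> Ar C \<Longrightarrow> Cod C f \<in> Ob C"
  using dom_ob cod_ob by auto

lemma comp_eq_reduce:
  assumes "a \<cdot> b = c" "b \<in> Hom C y z" "a \<in> Hom C z w" "t \<in> Hom C x y"
  shows "a \<cdot> (b \<cdot> t) = c \<cdot> t"
  using assms by (auto simp: Hom_iff simp flip: assms(1))

lemma is_isoI:
  assumes "f \<in> Hom C x y" "g \<in> Hom C y x" "g \<cdot> f = Id C x" "f \<cdot> g = Id C y"
  shows "is_iso C f"
  unfolding is_iso_def using assms by (auto simp: Hom_iff)

lemma is_isoE:
  assumes "is_iso C f" "f \<in> Hom C x y"
  obtains g where "g \<in> Hom C y x" "g \<cdot> f = Id C x" "f \<cdot> g = Id C y"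
  using assms unfolding is_iso_def by (auto simp: Hom_iff)

lemma iso_id: "x \<in> Ob C \<Longrightarrow> is_iso C (Id C x)"
  by (rule is_isoI[of _ x x "Id C x"]) (auto simp: Hom_iff)

lemma mono_cancel:
  assumes "is_mono C m" "m \<in> Hom C y z" "f \<in> Hom C x y" "g \<in> Hom C x y" "m \<cdot> f = m \<cdot> g"
  shows "f = g"
  using assms unfolding is_mono_def by (auto simp: Hom_iff)

lemma epi_cancel:
  assumes "is_epi C e" "e \<in> Hom C x y" "f \<in> Hom C y z" "g \<in> Hom C y z" "f \<cdot> e = g \<cdot> e"
  shows "f = g"
  using assms unfolding is_epi_def by (auto simp: Hom_iff)

lemma iso_mono: assumes "is_iso C f" shows "is_mono C f"
proof -
  have f: "f \<in> Hom C (Dom C f) (Cod C f)" using assms by (simp add: is_iso_def Hom_iff)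
  obtain g where g: "g \<in> Hom C (Cod C f) (Dom C f)" "g \<cdot> f = Id C (Dom C f)"
    using is_isoE[OF assms f] by metis
  show ?thesis unfolding is_mono_def
  proof (intro conjI allI ballI impI)
    fix x a b assume a: "a \<in> Hom C x (Dom C f)" and b: "b \<in> Hom C x (Dom C f)" and e: "f \<cdot> a = f \<cdot> b"
    have "a = g \<cdot> (f \<cdot> a)" using comp_eq_reduce[OF g(2) f g(1) a] a by (simp add: Hom_iff)
    also have "\<dots> = b" unfolding e using comp_eq_reduce[OF g(2) f g(1) b] b by (simp add: Hom_iff)
    finally show "a = b" .
  qed (use f in \<open>simp add: Hom_iff\<close>)
qed

lemma iso_epi: assumes "is_iso C f" shows "is_epi C f"
proof -
  have f: "f \<in> Hom C (Dom C f) (Cod C f)" using assms by (simp add: is_iso_def Hom_iff)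
  obtain g where g: "g \<in> Hom C (Cod C f) (Dom C f)" "f \<cdot> g = Id C (Cod C f)"
    using is_isoE[OF assms f] by metis
  show ?thesis unfolding is_epi_def
  proof (intro conjI allI ballI impI)
    fix x a b assume a: "a \<in> Hom C (Cod C f) x" and b: "b \<in> Hom C (Cod C f) x" and e: "a \<cdot> f = b \<cdot> f"
    have "a = (a \<cdot> f) \<cdot> g" using a f g by (simp add: Hom_iff)
    also have "\<dots> = b" unfolding e using b f g by (simp add: Hom_iff)
    finally show "a = b" .
  qed (use f in \<open>simp add: Hom_iff\<close>)
qed

lemma zero_obj_unique:
  assumes "is_zero_obj C z"
  shows "f \<in> Hom C x z \<Longrightarrow> g \<in> Hom C x z \<Longrightarrow> f = g" "f \<in> Hom C z x \<Longrightarrow> g \<in> Hom C z x \<Longrightarrow> f = g"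
proof -
  show "f = g" if "f \<in> Hom C x z" "g \<in> Hom C x z"
  proof -
    have "\<exists>!h. h \<in> Hom C x z" using assms Hom_Ob(1)[OF that(1)] by (simp add: is_zero_obj_def)
    then show ?thesis using that by (auto elim!: ex1E)
  qed
  show "f = g" if "f \<in> Hom C z x" "g \<in> Hom C z x"
  proof -
    have "\<exists>!h. h \<in> Hom C z x" using assms Hom_Ob(2)[OF that(1)] by (simp add: is_zero_obj_def)
    then show ?thesis using that by (auto elim!: ex1E)
  qed
qed

lemma zero_obj_ex:
  assumes "is_zero_obj C z" "x \<in> Ob C"
  shows "\<exists>f. f \<in> Hom C x z" "\<exists>f. f \<in> Hom C z x"
  using assms by (auto simp: is_zero_obj_def)

lemma zero_obj_iso:
  assumes "is_zero_obj C z" "is_zero_obj C w" "f \<in> Hom C z w" shows "is_iso C f"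
proof -
  have ob: "z \<in> Ob C" "w \<in> Ob C" using assms by (auto simp: is_zero_obj_def)
  obtain g where g: "g \<in> Hom C w z" using zero_obj_ex(1)[OF assms(1) ob(2)] by blast
  show ?thesis
    by (rule is_isoI[OF assms(3) g zero_obj_unique(1)[OF assms(1) _ id_hom]
        zero_obj_unique(1)[OF assms(2) _ id_hom]]) (use comp_hom g assms(3) ob in blast)+
qed

end

section \<open>Zero maps, negatives, kernels and cokernels in preadditive categories\<close>

context preadditive begin

lemma hom_group_simps [simp]:
  "carrier (hom_group A x y) = Hom A x y" "mult (hom_group A x y) = Plus A"
  "one (hom_group A x y) = Zero A x y"
  by (simp_all add: hom_group_def)

lemma zero_hom: assumes "x \<in> Ob A" "y \<in> Ob A" shows "Zero A x y \<in> Hom A x y"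
proof -
  interpret comm_group "hom_group A x y" using hom_comm_group assms by blast
  show ?thesis using one_closed by auto
qed

lemma zero_ar [simp]:
  assumes "x \<in> Ob A" "y \<in> Ob A" shows "Zero A x y \<in> Ar A" "Dom A (Zero A x y) = x" "Cod A (Zero A x y) = y"
  using zero_hom[OF assms] by (auto simp: Hom_iff)

lemma plus_hom: assumes "f \<in> Hom A x y" "g \<in> Hom A x y" shows "Plus A f g \<in> Hom A x y"
proof -
  interpret comm_group "hom_group A x y" using hom_comm_group Hom_Ob[OF assms(1)] by blast
  show ?thesis using m_closed[of f g] assms by auto
qed

text \<open>An idempotent of a group is its unit. Composites with zero maps are additive idempotents
  by bilinearity, which is how they are seen to vanish.\<close>

lemma plus_idem:
  assumes "f \<in> Hom A x y" "Plus A f f = f" shows "f = Zero A x y"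
proof -
  interpret comm_group "hom_group A x y" using hom_comm_group Hom_Ob[OF assms(1)] by blast
  show ?thesis using assms l_cancel_one[of f f] by auto
qed

lemma plus_zero:
  assumes "f \<in> Hom A x y" shows "Plus A f (Zero A x y) = f" "Plus A (Zero A x y) f = f"
proof -
  interpret comm_group "hom_group A x y" using hom_comm_group Hom_Ob[OF assms(1)] by blast
  show "Plus A f (Zero A x y) = f" "Plus A (Zero A x y) f = f" using assms r_one[of f] l_one[of f] by auto
qed

lemma comp_zero_right:
  assumes "f \<in> Hom A y z" "x \<in> Ob A" shows "f \<cdot>\<^bsub>A\<^esub> Zero A x y = Zero A x z"
proof (rule plus_idem)
  have z: "Zero A x y \<in> Hom A x y" using assms Hom_Ob zero_hom by auto
  show "f \<cdot>\<^bsub>A\<^esub> Zero A x y \<in> Hom A x z" using comp_hom[OF z assms(1)] .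
  show "Plus A (f \<cdot>\<^bsub>A\<^esub> Zero A x y) (f \<cdot>\<^bsub>A\<^esub> Zero A x y) = f \<cdot>\<^bsub>A\<^esub> Zero A x y"
    using comp_plus_right[OF z z assms(1)] plus_zero[OF z] by simp
qed

lemma comp_zero_left:
  assumes "f \<in> Hom A x y" "z \<in> Ob A" shows "Zero A y z \<cdot>\<^bsub>A\<^esub> f = Zero A x z"
proof (rule plus_idem)
  have z: "Zero A y z \<in> Hom A y z" using assms Hom_Ob zero_hom by auto
  show "Zero A y z \<cdot>\<^bsub>A\<^esub> f \<in> Hom A x z" using comp_hom[OF assms(1) z] .
  show "Plus A (Zero A y z \<cdot>\<^bsub>A\<^esub> f) (Zero A y z \<cdot>\<^bsub>A\<^esub> f) = Zero A y z \<cdot>\<^bsub>A\<^esub> f"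
    using comp_plus_left[OF assms(1) z z] plus_zero[OF z] by simp
qed

lemma comp_zero [simp]:
  "f \<in> Ar A \<Longrightarrow> x \<in> Ob A \<Longrightarrow> y = Dom A f \<Longrightarrow> f \<cdot>\<^bsub>A\<^esub> Zero A x y = Zero A x (Cod A f)"
  "f \<in> Ar A \<Longrightarrow> z \<in> Ob A \<Longrightarrow> y = Cod A f \<Longrightarrow> Zero A y z \<cdot>\<^bsub>A\<^esub> f = Zero A (Dom A f) z"
  using comp_zero_right[of f "Dom A f" "Cod A f"] comp_zero_left[of f "Dom A f" "Cod A f"] by (auto simp:
      Hom_iff)

abbreviation neg where "neg x y f \<equiv> inv\<^bsub>hom_group A x y\<^esub> f"

lemma neg_hom: assumes "f \<in> Hom A x y" shows "neg x y f \<in> Hom A x y"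
proof -
  interpret comm_group "hom_group A x y" using hom_comm_group Hom_Ob[OF assms(1)] by blast
  show ?thesis using assms inv_closed[of f] by auto
qed

lemma neg_unique:
  assumes "f \<in> Hom A x y" "g \<in> Hom A x y" "Plus A g f = Zero A x y" shows "neg x y f = g"
proof -
  interpret comm_group "hom_group A x y" using hom_comm_group Hom_Ob[OF assms(1)] by blast
  show ?thesis using assms inv_equality[of g f] by auto
qed

lemma plus_neg:
  assumes "f \<in> Hom A x y" shows "Plus A (neg x y f) f = Zero A x y"
proof -
  interpret comm_group "hom_group A x y" using hom_comm_group Hom_Ob[OF assms(1)] by blast
  show ?thesis using assms l_inv[of f] by auto
qed

lemma comp_neg_right:
  assumes "f \<in> Hom A x y" "g \<in> Hom A y z" shows "g \<cdot>\<^bsub>A\<^esub> neg x y f = neg x z (g \<cdot>\<^bsub>A\<^esub> f)"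
proof (rule neg_unique[symmetric])
  show "Plus A (g \<cdot>\<^bsub>A\<^esub> neg x y f) (g \<cdot>\<^bsub>A\<^esub> f) = Zero A x z"
    using comp_plus_right[OF neg_hom[OF assms(1)] assms] plus_neg[OF assms(1)]
      comp_zero_right[OF assms(2)] Hom_Ob[OF assms(1)] by simp
qed (use assms neg_hom comp_hom in blast)+

lemma comp_neg_left:
  assumes "f \<in> Hom A x y" "g \<in> Hom A y z" shows "neg y z g \<cdot>\<^bsub>A\<^esub> f = neg x z (g \<cdot>\<^bsub>A\<^esub> f)"
proof (rule neg_unique[symmetric])
  show "Plus A (neg y z g \<cdot>\<^bsub>A\<^esub> f) (g \<cdot>\<^bsub>A\<^esub> f) = Zero A x z"
    using comp_plus_left[OF assms(1) neg_hom[OF assms(2)] assms(2)] plus_neg[OF assms(2)]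
      comp_zero_left[OF assms(1)] Hom_Ob[OF assms(2)] by simp
qed (use assms neg_hom comp_hom in blast)+

lemma comp_finprod_right:
  assumes "finite I" "\<And>i. i \<in> I \<Longrightarrow> f i \<in> Hom A x y" "g \<in> Hom A y z" "x \<in> Ob A"
  shows "g \<cdot>\<^bsub>A\<^esub> finprod (hom_group A x y) f I = finprod (hom_group A x z) (\<lambda>i. g \<cdot>\<^bsub>A\<^esub> f i) I"
proof -
  interpret G: comm_group "hom_group A x y" using hom_comm_group Hom_Ob assms by blast
  interpret H: comm_group "hom_group A x z" using hom_comm_group Hom_Ob assms by blast
  show ?thesis using assms(1,2)
  proof (induction I rule: finite_induct)
    case empty then show ?case using comp_zero_right assms by simp
  next
    case (insert i I)
    have "finprod (hom_group A x y) f I \<in> Hom A x y" using insert G.finprod_closed[of f I] by auto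
    moreover have "g \<cdot>\<^bsub>A\<^esub> f j \<in> Hom A x z" if "j \<in> insert i I" for j
      using comp_hom[OF insert.prems[OF that] assms(3)] .
    ultimately show ?case using insert assms comp_plus_right[of "f i" x y _ g z]
      by (simp add: Pi_def)
  qed
qed

lemma comp_finprod_left:
  assumes "finite I" "\<And>i. i \<in> I \<Longrightarrow> f i \<in> Hom A y z" "g \<in> Hom A x y" "z \<in> Ob A"
  shows "finprod (hom_group A y z) f I \<cdot>\<^bsub>A\<^esub> g = finprod (hom_group A x z) (\<lambda>i. f i \<cdot>\<^bsub>A\<^esub> g) I"
proof -
  interpret G: comm_group "hom_group A y z" using hom_comm_group Hom_Ob assms by blast
  interpret H: comm_group "hom_group A x z" using hom_comm_group Hom_Ob assms by blast
  show ?thesis using assms(1,2)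
  proof (induction I rule: finite_induct)
    case empty then show ?case using comp_zero_left assms by simp
  next
    case (insert i I)
    have "finprod (hom_group A y z) f I \<in> Hom A y z" using insert G.finprod_closed[of f I] by auto
    moreover have "f j \<cdot>\<^bsub>A\<^esub> g \<in> Hom A x z" if "j \<in> insert i I" for j
      using comp_hom[OF assms(3) insert.prems[OF that]] .
    ultimately show ?case using insert assms comp_plus_left[of g x y "f i" z]
      by (simp add: Pi_def)
  qed
qed

text \<open>If the identity is zero, every map into or out of \<open>x\<close> equals its composite
  with it and so vanishes. The criterion is an equation of arrows, hence can be tested on coproduct
  injections or componentwise.\<close>

lemma zero_obj_iff:
  assumes "x \<in> Ob A" shows "is_zero_obj A x \<longleftrightarrow> Id A x = Zero A x x"
proof
  assume "is_zero_obj A x" then show "Id A x = Zero A x x"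
    using zero_obj_unique(1)[OF _ id_hom zero_hom] assms by blast
next
  assume e: "Id A x = Zero A x x"
  have "f = Zero A y x" if "f \<in> Hom A y x" for f y
    using id_left[OF that] comp_zero_left[OF that assms] by (simp add: e)
  moreover have "f = Zero A x y" if "f \<in> Hom A x y" for f y
    using id_right[OF that] comp_zero_right[OF that assms] by (simp add: e)
  ultimately show "is_zero_obj A x"
    unfolding is_zero_obj_def using assms zero_hom[of _ x] zero_hom[of x] by (intro conjI ballI ex1I) blast+
qed

lemma zero_obj_hom:
  assumes "is_zero_obj A z"
  shows "f \<in> Hom A x z \<Longrightarrow> f = Zero A x z" "f \<in> Hom A z x \<Longrightarrow> f = Zero A z x"
proof -
  have z: "z \<in> Ob A" using assms by (simp add: is_zero_obj_def)
  show "f = Zero A x z" if "f \<in> Hom A x z"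
    using zero_obj_unique(1)[OF assms that zero_hom] Hom_Ob[OF that] z by blast
  show "f = Zero A z x" if "f \<in> Hom A z x"
    using zero_obj_unique(2)[OF assms that zero_hom] Hom_Ob[OF that] z by blast
qed

lemma kernel_hom:
  assumes "is_kernel A k f" "f \<in> Hom A x y" shows "k \<in> Hom A (Dom A k) x" "f \<cdot>\<^bsub>A\<^esub> k = Zero A (Dom A k) y"
  using assms unfolding is_kernel_def by (auto simp: Hom_iff)

lemma cokernel_hom:
  assumes "is_cokernel A c f" "f \<in> Hom A x y" shows "c \<in> Hom A y (Cod A c)" "c \<cdot>\<^bsub>A\<^esub> f = Zero A x (Cod A c)"
  using assms unfolding is_cokernel_def by (auto simp: Hom_iff)

lemma kernel_lift:
  assumes "is_kernel A k f" "f \<in> Hom A x y" "g \<in> Hom A w x" "f \<cdot>\<^bsub>A\<^esub> g = Zero A w y"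
  shows "\<exists>!h. h \<in> Hom A w (Dom A k) \<and> k \<cdot>\<^bsub>A\<^esub> h = g"
  using assms unfolding is_kernel_def by (auto simp: Hom_iff)

lemma cokernel_lift:
  assumes "is_cokernel A c f" "f \<in> Hom A x y" "g \<in> Hom A y w" "g \<cdot>\<^bsub>A\<^esub> f = Zero A x w"
  shows "\<exists>!h. h \<in> Hom A (Cod A c) w \<and> h \<cdot>\<^bsub>A\<^esub> c = g"
  using assms unfolding is_cokernel_def by (auto simp: Hom_iff)

lemma kernel_mono: assumes "is_kernel A k f" shows "is_mono A k"
  unfolding is_mono_def
proof (intro conjI allI ballI impI)
  show "k \<in> Ar A" using assms by (simp add: is_kernel_def)
  have f: "f \<in> Hom A (Dom A f) (Cod A f)" using assms by (simp add: is_kernel_def Hom_iff)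
  note k = kernel_hom[OF assms f]
  fix x a b assume a: "a \<in> Hom A x (Dom A k)" and b: "b \<in> Hom A x (Dom A k)" and e: "k \<cdot>\<^bsub>A\<^esub> a = k \<cdot>\<^bsub>A\<^esub> b"
  have "f \<cdot>\<^bsub>A\<^esub> (k \<cdot>\<^bsub>A\<^esub> a) = Zero A x (Cod A f)"
    using comp_eq_reduce[OF k(2) k(1) f a] a f comp_zero_left[OF a] Hom_Ob[OF f] by simp
  then show "a = b" using kernel_lift[OF assms f, of "k \<cdot>\<^bsub>A\<^esub> a" x] comp_hom[OF a k(1)] a b e by metis
qed

lemma cokernel_epi: assumes "is_cokernel A c f" shows "is_epi A c"
  unfolding is_epi_def
proof (intro conjI allI ballI impI)
  show "c \<in> Ar A" using assms by (simp add: is_cokernel_def)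
  have f: "f \<in> Hom A (Dom A f) (Cod A f)" using assms by (simp add: is_cokernel_def Hom_iff)
  note k = cokernel_hom[OF assms f]
  fix x a b assume a: "a \<in> Hom A (Cod A c) x" and b: "b \<in> Hom A (Cod A c) x" and e: "a \<cdot>\<^bsub>A\<^esub> c = b \<cdot>\<^bsub>A\<^esub> c"
  have "(a \<cdot>\<^bsub>A\<^esub> c) \<cdot>\<^bsub>A\<^esub> f = Zero A (Dom A f) x"
    using k a f Hom_Ob[OF f] by (simp add: Hom_iff)
  then show "a = b" using cokernel_lift[OF assms f, of "a \<cdot>\<^bsub>A\<^esub> c" x] comp_hom[OF k(1) a] a b e by metis
qed

text \<open>Uniqueness of lifts is cancellation of a monomorphism, so only their existence remains
  to be supplied.\<close>

lemma kernelI: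
  assumes "f \<in> Hom A x y" "k \<in> Hom A w x" "f \<cdot>\<^bsub>A\<^esub> k = Zero A w y" "is_mono A k"
    "\<And>v g. g \<in> Hom A v x \<Longrightarrow> f \<cdot>\<^bsub>A\<^esub> g = Zero A v y \<Longrightarrow> \<exists>h \<in> Hom A v w. k \<cdot>\<^bsub>A\<^esub> h = g"
  shows "is_kernel A k f"
  unfolding is_kernel_def
proof (intro conjI allI ballI impI)
  fix v g assume "g \<in> Hom A v (Dom A f)" "f \<cdot>\<^bsub>A\<^esub> g = Zero A v (Cod A f)"
  then have "g \<in> Hom A v x" "f \<cdot>\<^bsub>A\<^esub> g = Zero A v y" using assms(1) by (auto simp: Hom_iff)
  from assms(5)[OF this] obtain h where h: "h \<in> Hom A v w" "k \<cdot>\<^bsub>A\<^esub> h = g" by blast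
  then show "\<exists>!h. h \<in> Hom A v (Dom A k) \<and> k \<cdot>\<^bsub>A\<^esub> h = g"
    using mono_cancel[OF assms(4,2)] assms(2) by (metis Hom_D(2))
qed (use assms in \<open>auto simp: Hom_iff\<close>)

lemma cokernelI:
  assumes "f \<in> Hom A x y" "c \<in> Hom A y w" "c \<cdot>\<^bsub>A\<^esub> f = Zero A x w" "is_epi A c"
    "\<And>v g. g \<in> Hom A y v \<Longrightarrow> g \<cdot>\<^bsub>A\<^esub> f = Zero A x v \<Longrightarrow> \<exists>h \<in> Hom A w v. h \<cdot>\<^bsub>A\<^esub> c = g"
  shows "is_cokernel A c f"
  unfolding is_cokernel_def
proof (intro conjI allI ballI impI)
  fix v g assume "g \<in> Hom A (Cod A f) v" "g \<cdot>\<^bsub>A\<^esub> f = Zero A (Dom A f) v"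
  then have "g \<in> Hom A y v" "g \<cdot>\<^bsub>A\<^esub> f = Zero A x v" using assms(1) by (auto simp: Hom_iff)
  from assms(5)[OF this] obtain h where h: "h \<in> Hom A w v" "h \<cdot>\<^bsub>A\<^esub> c = g" by blast
  then show "\<exists>!h. h \<in> Hom A (Cod A c) v \<and> h \<cdot>\<^bsub>A\<^esub> c = g"
    using epi_cancel[OF assms(4,2)] assms(2) by (metis Hom_D(3))
qed (use assms in \<open>auto simp: Hom_iff\<close>)

end

section \<open>Coproducts\<close>

context category begin

lemma coproduct_ob: "is_coproduct C I X c \<iota> \<Longrightarrow> c \<in> Ob C"
  by (simp add: is_coproduct_def)

lemma coproduct_in: "is_coproduct C I X c \<iota> \<Longrightarrow> i \<in> I \<Longrightarrow> \<iota> i \<in> Hom C (X i) c"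
  by (simp add: is_coproduct_def)

lemma coproduct_ex1:
  assumes "is_coproduct C I X c \<iota>" "d \<in> Ob C" "\<And>i. i \<in> I \<Longrightarrow> \<kappa> i \<in> Hom C (X i) d"
  shows "\<exists>!h. h \<in> Hom C c d \<and> (\<forall>i\<in>I. h \<cdot> \<iota> i = \<kappa> i)"
  using assms unfolding is_coproduct_def by simp

lemma coproduct_ex:
  assumes "is_coproduct C I X c \<iota>" "d \<in> Ob C" "\<And>i. i \<in> I \<Longrightarrow> \<kappa> i \<in> Hom C (X i) d"
  obtains h where "h \<in> Hom C c d" "\<And>i. i \<in> I \<Longrightarrow> h \<cdot> \<iota> i = \<kappa> i"
  using coproduct_ex1[OF assms] by blast

lemma coproduct_eq:
  assumes "is_coproduct C I X c \<iota>" "f \<in> Hom C c d" "g \<in> Hom C c d" "\<And>i. i \<in> I \<Longrightarrow> f \<cdot> \<iota> i = g \<cdot> \<iota> i"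
  shows "f = g"
proof -
  have "\<exists>!h. h \<in> Hom C c d \<and> (\<forall>i\<in>I. h \<cdot> \<iota> i = g \<cdot> \<iota> i)"
    by (rule coproduct_ex1[OF assms(1)])
      (use Hom_Ob[OF assms(2)] comp_hom[OF coproduct_in[OF assms(1)] assms(3)] in auto)
  moreover have "f \<in> Hom C c d \<and> (\<forall>i\<in>I. f \<cdot> \<iota> i = g \<cdot> \<iota> i)" "g \<in> Hom C c d \<and> (\<forall>i\<in>I. g \<cdot> \<iota> i = g \<cdot> \<iota> i)"
    using assms by auto
  ultimately show ?thesis by (elim ex1E) metis
qed

lemma is_coproductI:
  assumes "c \<in> Ob C" "\<And>i. i \<in> I \<Longrightarrow> \<iota> i \<in> Hom C (X i) c"
    and "\<And>d \<kappa>. d \<in> Ob C \<Longrightarrow> (\<And>i. i \<in> I \<Longrightarrow> \<kappa> i \<in> Hom C (X i) d) \<Longrightarrow> \<exists>h. h \<in> Hom C c d \<and> (\<forall>i\<in>I. h \<cdot> \<iota> i = \<kappa> i)"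
    and "\<And>d f g. f \<in> Hom C c d \<Longrightarrow> g \<in> Hom C c d \<Longrightarrow> (\<And>i. i \<in> I \<Longrightarrow> f \<cdot> \<iota> i = g \<cdot> \<iota> i) \<Longrightarrow> f = g"
  shows "is_coproduct C I X c \<iota>"
  unfolding is_coproduct_def
proof (intro conjI ballI allI impI)
  fix d \<kappa> assume "d \<in> Ob C" "\<forall>i\<in>I. \<kappa> i \<in> Hom C (X i) d"
  then obtain h where h: "h \<in> Hom C c d" "\<forall>i\<in>I. h \<cdot> \<iota> i = \<kappa> i" using assms(3) by blast
  show "\<exists>!h. h \<in> Hom C c d \<and> (\<forall>i\<in>I. h \<cdot> \<iota> i = \<kappa> i)"
    by (rule ex1I[of _ h]) (use h assms(4) in auto)
qed (use assms in auto)

lemma coproduct_comparison_iso: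
  assumes c: "is_coproduct C I X c \<iota>" and d: "is_coproduct C I X d \<kappa>"
    and h: "h \<in> Hom C c d" "\<And>i. i \<in> I \<Longrightarrow> h \<cdot> \<iota> i = \<kappa> i"
  shows "is_iso C h"
proof -
  obtain k where k: "k \<in> Hom C d c" "\<And>i. i \<in> I \<Longrightarrow> k \<cdot> \<kappa> i = \<iota> i"
    using coproduct_ex[OF d coproduct_ob[OF c] coproduct_in[OF c]] by metis
  note ci = coproduct_in[OF c] and di = coproduct_in[OF d]
  show ?thesis
  proof (rule is_isoI[OF h(1) k(1)])
    show "k \<cdot> h = Id C c"
    proof (rule coproduct_eq[OF c comp_hom[OF h(1) k(1)] id_hom])
      fix i assume i: "i \<in> I"
      show "k \<cdot> h \<cdot> \<iota> i = Id C c \<cdot> \<iota> i"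
        using comp_assoc[OF ci[OF i] h(1) k(1)] h(2)[OF i] k(2)[OF i] id_left[OF ci[OF i]] by simp
    qed (rule coproduct_ob[OF c])
    show "h \<cdot> k = Id C d"
    proof (rule coproduct_eq[OF d comp_hom[OF k(1) h(1)] id_hom])
      fix i assume i: "i \<in> I"
      show "h \<cdot> k \<cdot> \<kappa> i = Id C d \<cdot> \<kappa> i"
        using comp_assoc[OF di[OF i] k(1) h(1)] h(2)[OF i] k(2)[OF i] id_left[OF di[OF i]] by simp
    qed (rule coproduct_ob[OF d])
  qed
qed

lemma coproduct_transport:
  assumes c: "is_coproduct C I X c \<iota>" and h: "is_iso C h" "h \<in> Hom C c d" "\<And>i. i \<in> I \<Longrightarrow> h \<cdot> \<iota> i = \<kappa> i"
  shows "is_coproduct C I X d \<kappa>"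
proof -
  obtain k where k: "k \<in> Hom C d c" "k \<cdot> h = Id C c" "h \<cdot> k = Id C d" using is_isoE[OF h(1,2)] .
  note ci = coproduct_in[OF c]
  have ki: "k \<cdot> \<kappa> i = \<iota> i" if "i \<in> I" for i
    using h(3)[OF that] comp_assoc[OF ci[OF that] h(2) k(1)] k(2) id_left[OF ci[OF that]] by simp
  have di: "\<kappa> i \<in> Hom C (X i) d" if "i \<in> I" for i using h(3)[OF that] comp_hom[OF ci[OF that] h(2)] by simp
  show ?thesis
  proof (rule is_coproductI)
    show "d \<in> Ob C" using Hom_Ob h by blast
    fix e and \<mu> assume e: "e \<in> Ob C" "\<And>i. i \<in> I \<Longrightarrow> \<mu> i \<in> Hom C (X i) e"
    obtain m where m: "m \<in> Hom C c e" "\<And>i. i \<in> I \<Longrightarrow> m \<cdot> \<iota> i = \<mu> i" using coproduct_ex[OF c e] by metis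
    have "m \<cdot> k \<cdot> \<kappa> i = \<mu> i" if "i \<in> I" for i
      using comp_assoc[OF di[OF that] k(1) m(1)] ki[OF that] m(2)[OF that] by simp
    then show "\<exists>h. h \<in> Hom C d e \<and> (\<forall>i\<in>I. h \<cdot> \<kappa> i = \<mu> i)" using comp_hom[OF k(1) m(1)] by blast
  next
    fix e f g assume fg: "f \<in> Hom C d e" "g \<in> Hom C d e" "\<And>i. i \<in> I \<Longrightarrow> f \<cdot> \<kappa> i = g \<cdot> \<kappa> i"
    have "f \<cdot> h = g \<cdot> h"
    proof (rule coproduct_eq[OF c comp_hom[OF h(2) fg(1)] comp_hom[OF h(2) fg(2)]])
      fix i assume i: "i \<in> I"
      show "f \<cdot> h \<cdot> \<iota> i = g \<cdot> h \<cdot> \<iota> i"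
        using comp_assoc[OF ci[OF i] h(2) fg(1)] comp_assoc[OF ci[OF i] h(2) fg(2)] h(3)[OF i] fg(3)[OF i]
            by simp
    qed
    then show "f = g" using epi_cancel[OF iso_epi[OF h(1)] h(2) fg(1,2)] by simp
  qed (rule di)
qed

text \<open>Associativity of coproducts: a map out of \<open>c\<close> is a family of maps out of
  the \<open>Y j\<close>, and each of these is a family over one fibre of \<open>v\<close>. As every
  \<open>i\<close> lies in exactly one fibre, a single family \<open>\<kappa>\<close> serves all
  fibres.\<close>

lemma coproduct_fibrewise:
  assumes c: "is_coproduct C J Y c \<iota>" and v: "v \<in> I \<rightarrow> J"
    and f: "\<And>j. j \<in> J \<Longrightarrow> is_coproduct C {i \<in> I. v i = j} X (Y j) \<kappa>"
  shows "is_coproduct C I X c (\<lambda>i. \<iota> (v i) \<cdot> \<kappa> i)"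
proof (rule is_coproductI)
  note ci = coproduct_in[OF c]
  show "c \<in> Ob C" using coproduct_ob[OF c] .
  have vi: "v i \<in> J" if "i \<in> I" for i using v that by auto
  have ki: "\<kappa> i \<in> Hom C (X i) (Y (v i))" if "i \<in> I" for i
    using coproduct_in[OF f[OF vi[OF that]], of i] that by simp
  show "\<iota> (v i) \<cdot> \<kappa> i \<in> Hom C (X i) c" if "i \<in> I" for i
    using comp_hom[OF ki[OF that] ci[OF vi[OF that]]] .
  fix d
  {
    fix \<mu> assume d: "d \<in> Ob C" and m: "\<And>i. i \<in> I \<Longrightarrow> \<mu> i \<in> Hom C (X i) d"
    have "\<exists>h. h \<in> Hom C (Y j) d \<and> (\<forall>i\<in>{i \<in> I. v i = j}. h \<cdot> \<kappa> i = \<mu> i)" if "j \<in> J" for j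
      using coproduct_ex[OF f[OF that] d, of \<mu>] m by (metis (no_types, lifting) mem_Collect_eq)
    then obtain H where H: "\<And>j. j \<in> J \<Longrightarrow> H j \<in> Hom C (Y j) d"
      "\<And>j i. j \<in> J \<Longrightarrow> i \<in> I \<Longrightarrow> v i = j \<Longrightarrow> H j \<cdot> \<kappa> i = \<mu> i" by (metis (mono_tags, lifting) mem_Collect_eq)
    obtain h where h: "h \<in> Hom C c d" "\<And>j. j \<in> J \<Longrightarrow> h \<cdot> \<iota> j = H j" using coproduct_ex[OF c d H(1)] by metis
    have "h \<cdot> (\<iota> (v i) \<cdot> \<kappa> i) = \<mu> i" if "i \<in> I" for i
      using comp_eq_reduce[OF h(2)[OF vi[OF that]] ci[OF vi[OF that]] h(1) ki[OF that]] H(2)[OF vi[OF that]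
          that refl]
      by simp
    then show "\<exists>h. h \<in> Hom C c d \<and> (\<forall>i\<in>I. h \<cdot> (\<iota> (v i) \<cdot> \<kappa> i) = \<mu> i)" using h by blast
  }
  {
    fix p q assume p: "p \<in> Hom C c d" and q: "q \<in> Hom C c d"
      and e: "\<And>i. i \<in> I \<Longrightarrow> p \<cdot> (\<iota> (v i) \<cdot> \<kappa> i) = q \<cdot> (\<iota> (v i) \<cdot> \<kappa> i)"
    show "p = q"
    proof (rule coproduct_eq[OF c p q])
      fix j assume j: "j \<in> J"
      show "p \<cdot> \<iota> j = q \<cdot> \<iota> j"
      proof (rule coproduct_eq[OF f[OF j] comp_hom[OF ci[OF j] p] comp_hom[OF ci[OF j] q]])
        fix i assume "i \<in> {i \<in> I. v i = j}"
        then have i: "i \<in> I" "v i = j" by auto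
        show "p \<cdot> \<iota> j \<cdot> \<kappa> i = q \<cdot> \<iota> j \<cdot> \<kappa> i"
          using e[OF i(1)] comp_assoc[OF ki[OF i(1)] ci p] comp_assoc[OF ki[OF i(1)] ci q] i(2) j by simp
      qed
    qed
  }
qed

text \<open>Used in both directions between a set of simplices and its image in the
  universe.\<close>

lemma coproduct_reindex:
  assumes c: "is_coproduct C J Y c \<iota>" and e: "bij_betw e I J"
  shows "is_coproduct C I (\<lambda>i. Y (e i)) c (\<lambda>i. \<iota> (e i))"
proof (rule is_coproductI)
  note ci = coproduct_in[OF c]
  show "c \<in> Ob C" using coproduct_ob[OF c] .
  have ei: "e i \<in> J" if "i \<in> I" for i using that e by (auto simp: bij_betw_def)
  have inv: "inv_into I e j \<in> I" "e (inv_into I e j) = j" if "j \<in> J" for j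
    using that e by (auto simp: bij_betw_def inv_into_into f_inv_into_f)
  have inv': "inv_into I e (e i) = i" if "i \<in> I" for i using that e by (simp add: bij_betw_def)
  show "\<iota> (e i) \<in> Hom C (Y (e i)) c" if "i \<in> I" for i using ci ei that by blast
  fix d
  {
    fix \<mu> assume d: "d \<in> Ob C" and m: "\<And>i. i \<in> I \<Longrightarrow> \<mu> i \<in> Hom C (Y (e i)) d"
    have "\<mu> (inv_into I e j) \<in> Hom C (Y j) d" if "j \<in> J" for j
      using m[OF inv(1)[OF that]] inv(2)[OF that] by simp
    from coproduct_ex[OF c d this] obtain h where
      "h \<in> Hom C c d" "\<And>j. j \<in> J \<Longrightarrow> h \<cdot> \<iota> j = \<mu> (inv_into I e j)" by blast
    then show "\<exists>h. h \<in> Hom C c d \<and> (\<forall>i\<in>I. h \<cdot> \<iota> (e i) = \<mu> i)" using ei inv' by auto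
  }
  {
    fix p q assume p: "p \<in> Hom C c d" and q: "q \<in> Hom C c d"
      and eq: "\<And>i. i \<in> I \<Longrightarrow> p \<cdot> \<iota> (e i) = q \<cdot> \<iota> (e i)"
    show "p = q"
    proof (rule coproduct_eq[OF c p q])
      fix j assume "j \<in> J"
      then show "p \<cdot> \<iota> j = q \<cdot> \<iota> j" using eq[OF inv(1)] inv(2) by simp
    qed
  }
qed

lemma coprod_is_coproduct:
  assumes "is_coproduct C I X c \<iota>" shows "is_coproduct C I X (coprod_obj C I X) (coprod_in C I X)"
  unfolding coprod_def by (rule someI[of "\<lambda>p. is_coproduct C I X (fst p) (snd p)" "(c, \<iota>)"]) (use assms in
      simp)

lemma copair:
  assumes "is_coproduct C I X c \<iota>" "d \<in> Ob C" "\<And>i. i \<in> I \<Longrightarrow> \<kappa> i \<in> Hom C (X i) d"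
  shows "copair C I X d \<kappa> \<in> Hom C (coprod_obj C I X) d"
    "\<And>i. i \<in> I \<Longrightarrow> copair C I X d \<kappa> \<cdot> coprod_in C I X i = \<kappa> i"
  using theI'[OF coproduct_ex1[OF coprod_is_coproduct[OF assms(1)] assms(2,3)]] unfolding copair_def by auto

lemma ex_small_coproduct:
  fixes e :: "'i \<Rightarrow> 'u"
  assumes "cocomplete TYPE('u) C" "inj_on e I" "X \<in> I \<rightarrow> Ob C"
  shows "\<exists>c \<iota>. is_coproduct C I X c \<iota>"
proof -
  define r where "r = inv_into I e"
  have r: "r j \<in> I" "e (r j) = j" if "j \<in> e ` I" for j
    using that unfolding r_def by (auto simp: inv_into_into f_inv_into_f)
  have re: "r (e i) = i" if "i \<in> I" for i using that assms(2) unfolding r_def by simp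
  \<comment> \<open>The discrete category on the image of \<open>I\<close>, each object serving as
    its own identity. The injection \<open>e\<close> moves the index set into the universe over
    which \<open>cocomplete\<close> quantifies.\<close>
  define J :: "('u, 'u) cat" where
    "J = \<lparr>Ob = e ` I, Ar = e ` I, Dom = id, Cod = id, Id = id, Comp = (\<lambda>f g. f)\<rparr>"
  define F where "F = \<lparr>obj_map = (\<lambda>j\<in>e ` I. X (r j)), arr_map = (\<lambda>j\<in>e ` I. Id C (X (r j)))\<rparr>"
  have Xr: "X (r j) \<in> Ob C" if "j \<in> e ` I" for j using r[OF that] assms(3) by auto
  have "category J" by unfold_locales (auto simp: J_def Hom_def)
  then have F: "is_functor J C F" unfolding is_functor_def
  proof (intro conjI)
    show "\<forall>x y z. \<forall>f\<in>Hom J x y. \<forall>g\<in>Hom J y z. arr_map F (g \<cdot>\<^bsub>J\<^esub> f) = arr_map F g \<cdot> arr_map F f"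
      using Xr by (auto simp: J_def F_def Hom_def)
  qed (use Xr category_axioms in \<open>auto simp: J_def F_def Hom_def\<close>)
  from F assms(1) obtain c \<iota> where c: "is_colimit J C F c \<iota>" unfolding cocomplete_def by blast
  \<comment> \<open>All arrows of \<open>J\<close> are identities, so commutation of a cocone is
    automatic and a colimit of \<open>F\<close> is a coproduct.\<close>
  have iff: "is_cocone J C F d \<kappa> \<longleftrightarrow> d \<in> Ob C \<and> (\<forall>j\<in>e ` I. \<kappa> j \<in> Hom C (X (r j)) d)" for d \<kappa>
    unfolding is_cocone_def using Xr id_right by (auto simp: J_def F_def Hom_def)
  have "is_coproduct C (e ` I) (\<lambda>j. X (r j)) c \<iota>"
    using c unfolding is_colimit_def is_coproduct_def iff by (auto simp: J_def)
  from coproduct_reindex[OF this, of e I] have "is_coproduct C I (\<lambda>i. X (r (e i))) c (\<lambda>i. \<iota> (e i))"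
    using assms(2) by (simp add: bij_betw_def)
  moreover have "is_coproduct C I (\<lambda>i. X (r (e i))) c (\<lambda>i. \<iota> (e i)) = is_coproduct C I X c (\<lambda>i. \<iota> (e i))"
    unfolding is_coproduct_def using re by (simp cong: ball_cong)
  ultimately show ?thesis by blast
qed

end

section \<open>Transport of kernels, cokernels and exactness of coproducts along
  isomorphisms\<close>

context preadditive begin

text \<open>Kernels in functor categories and coproducts are known only up to isomorphism.
  Invariance under an isomorphism of diagrams is how an exactness statement about one model reaches
  another.\<close>

lemma kernel_transport:
  assumes k: "is_kernel A k' f'" and h: "f' \<in> Hom A x' y'" "f \<in> Hom A x y" "k' \<in> Hom A w' x'" "k \<in> Hom A w
      x"
    and a: "a \<in> Hom A w' w" "is_iso A a" and b: "b \<in> Hom A x' x" "is_iso A b" and z: "z \<in> Hom A y' y"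
        "is_iso A z"
    and e: "b \<cdot>\<^bsub>A\<^esub> k' = k \<cdot>\<^bsub>A\<^esub> a" "z \<cdot>\<^bsub>A\<^esub> f' = f \<cdot>\<^bsub>A\<^esub> b"
  shows "is_kernel A k f"
proof -
  obtain a' where a': "a' \<in> Hom A w w'" "a' \<cdot>\<^bsub>A\<^esub> a = Id A w'" "a \<cdot>\<^bsub>A\<^esub> a' = Id A w" using is_isoE[OF a(2,1)]
      .
  obtain b' where b': "b' \<in> Hom A x x'" "b' \<cdot>\<^bsub>A\<^esub> b = Id A x'" "b \<cdot>\<^bsub>A\<^esub> b' = Id A x" using is_isoE[OF b(2,1)]
      .
  note H = h a b a' b' z
  note ob = Hom_Ob[OF h(1)] Hom_Ob[OF h(2)] Hom_Ob[OF h(3)] Hom_Ob[OF h(4)]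
  have k0: "f' \<cdot>\<^bsub>A\<^esub> k' = Zero A w' y'" using kernel_hom(2)[OF k h(1)] h by (simp add: Hom_iff)
  \<comment> \<open>Solves the first square for \<open>k\<close> by precomposing
    \<open>b \<cdot> k' = k \<cdot> a\<close> with the inverse of \<open>a\<close>.\<close>
  have ka: "k = b \<cdot>\<^bsub>A\<^esub> (k' \<cdot>\<^bsub>A\<^esub> a')"
  proof -
    have "k = k \<cdot>\<^bsub>A\<^esub> (a \<cdot>\<^bsub>A\<^esub> a')" using H by (simp add: Hom_iff)
    also have "\<dots> = b \<cdot>\<^bsub>A\<^esub> (k' \<cdot>\<^bsub>A\<^esub> a')" using e(1) H assoc_ar[of a' a k] assoc_ar[of a' k' b] by (simp add:
        Hom_iff)
    finally show ?thesis .
  qed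
  have fb: "f \<cdot>\<^bsub>A\<^esub> (b \<cdot>\<^bsub>A\<^esub> t) = z \<cdot>\<^bsub>A\<^esub> (f' \<cdot>\<^bsub>A\<^esub> t)" if "t \<in> Hom A v x'" for t v
    using e(2) H that assoc_ar[of t b f] assoc_ar[of t f' z] by (simp add: Hom_iff)
  show ?thesis
  proof (rule kernelI[OF h(2,4)])
    have "f \<cdot>\<^bsub>A\<^esub> k = z \<cdot>\<^bsub>A\<^esub> (f' \<cdot>\<^bsub>A\<^esub> (k' \<cdot>\<^bsub>A\<^esub> a'))" unfolding ka using fb comp_hom[OF a'(1) h(3)] by simp
    also have "\<dots> = Zero A w y" using comp_eq_reduce[OF k0 h(3,1) a'(1)] H ob by (simp add: Hom_iff)
    finally show "f \<cdot>\<^bsub>A\<^esub> k = Zero A w y" .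
    show "is_mono A k" unfolding is_mono_def
    proof (intro conjI allI ballI impI)
      fix v p q assume "p \<in> Hom A v (Dom A k)" "q \<in> Hom A v (Dom A k)" and kk: "k \<cdot>\<^bsub>A\<^esub> p = k \<cdot>\<^bsub>A\<^esub> q"
      then have pq: "p \<in> Hom A v w" "q \<in> Hom A v w" using h by (auto simp: Hom_iff)
      have kt: "b' \<cdot>\<^bsub>A\<^esub> (k \<cdot>\<^bsub>A\<^esub> t) = k' \<cdot>\<^bsub>A\<^esub> (a' \<cdot>\<^bsub>A\<^esub> t)" if "t \<in> Hom A v w" for t
      proof -
        have "b' \<cdot>\<^bsub>A\<^esub> (k \<cdot>\<^bsub>A\<^esub> t) = b' \<cdot>\<^bsub>A\<^esub> (b \<cdot>\<^bsub>A\<^esub> (k' \<cdot>\<^bsub>A\<^esub> (a' \<cdot>\<^bsub>A\<^esub> t)))" unfolding ka using H that by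
            (simp add: Hom_iff)
        also have "\<dots> = k' \<cdot>\<^bsub>A\<^esub> (a' \<cdot>\<^bsub>A\<^esub> t)"
          using comp_eq_reduce[OF b'(2) b(1) b'(1), of "k' \<cdot>\<^bsub>A\<^esub> (a' \<cdot>\<^bsub>A\<^esub> t)" v] H that by (simp add:
              Hom_iff)
        finally show ?thesis .
      qed
      have "k' \<cdot>\<^bsub>A\<^esub> (a' \<cdot>\<^bsub>A\<^esub> p) = k' \<cdot>\<^bsub>A\<^esub> (a' \<cdot>\<^bsub>A\<^esub> q)" using kt[OF pq(1)] kt[OF pq(2)] kk by simp
      then have "a' \<cdot>\<^bsub>A\<^esub> p = a' \<cdot>\<^bsub>A\<^esub> q"
        using mono_cancel[OF kernel_mono[OF k] h(3) comp_hom[OF pq(1) a'(1)] comp_hom[OF pq(2) a'(1)]] by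
            simp
      then have "a \<cdot>\<^bsub>A\<^esub> (a' \<cdot>\<^bsub>A\<^esub> p) = a \<cdot>\<^bsub>A\<^esub> (a' \<cdot>\<^bsub>A\<^esub> q)" by simp
      then show "p = q"
        using comp_eq_reduce[OF a'(3,1) a(1) pq(1)] comp_eq_reduce[OF a'(3,1) a(1) pq(2)] pq by (simp add:
            Hom_iff)
    qed (use h in \<open>simp add: Hom_iff\<close>)
    fix v g assume g: "g \<in> Hom A v x" "f \<cdot>\<^bsub>A\<^esub> g = Zero A v y"
    have vv: "v \<in> Ob A" using Hom_Ob[OF g(1)] by simp
    have bb: "b \<cdot>\<^bsub>A\<^esub> (b' \<cdot>\<^bsub>A\<^esub> g) = g" using comp_eq_reduce[OF b'(3,1) b(1) g(1)] g by (simp add: Hom_iff)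
    have "z \<cdot>\<^bsub>A\<^esub> (f' \<cdot>\<^bsub>A\<^esub> (b' \<cdot>\<^bsub>A\<^esub> g)) = z \<cdot>\<^bsub>A\<^esub> Zero A v y'"
      using fb[OF comp_hom[OF g(1) b'(1)]] g(2) bb comp_zero_right[OF z(1) vv] by simp
    then have "f' \<cdot>\<^bsub>A\<^esub> (b' \<cdot>\<^bsub>A\<^esub> g) = Zero A v y'"
      using mono_cancel[OF iso_mono[OF z(2)] z(1) comp_hom[OF comp_hom[OF g(1) b'(1)] h(1)] zero_hom] vv ob
          by simp
    then obtain s where s: "s \<in> Hom A v w'" "k' \<cdot>\<^bsub>A\<^esub> s = b' \<cdot>\<^bsub>A\<^esub> g"
      using kernel_lift[OF k h(1) comp_hom[OF g(1) b'(1)]] h by (auto simp: Hom_iff)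
    have "k \<cdot>\<^bsub>A\<^esub> (a \<cdot>\<^bsub>A\<^esub> s) = b \<cdot>\<^bsub>A\<^esub> (k' \<cdot>\<^bsub>A\<^esub> s)"
      using e(1) H s(1) assoc_ar[of s a k] assoc_ar[of s k' b] by (simp add: Hom_iff)
    then show "\<exists>h\<in>Hom A v w. k \<cdot>\<^bsub>A\<^esub> h = g" using bb s comp_hom[OF s(1) a(1)] by auto
  qed
qed

text \<open>Dual to the preceding argument, with epimorphisms cancelled on the right: a
  factorization through \<open>k\<close> is one through \<open>k'\<close> precomposed with the
  inverse of \<open>z\<close>.\<close>

lemma cokernel_transport:
  assumes k: "is_cokernel A k' f'" and h: "f' \<in> Hom A x' y'" "f \<in> Hom A x y" "k' \<in> Hom A y' w'" "k \<in> Hom A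
      y w"
    and a: "a \<in> Hom A x' x" "is_iso A a" and b: "b \<in> Hom A y' y" "is_iso A b" and z: "z \<in> Hom A w' w"
        "is_iso A z"
    and e: "b \<cdot>\<^bsub>A\<^esub> f' = f \<cdot>\<^bsub>A\<^esub> a" "z \<cdot>\<^bsub>A\<^esub> k' = k \<cdot>\<^bsub>A\<^esub> b"
  shows "is_cokernel A k f"
proof -
  obtain z' where z': "z' \<in> Hom A w w'" "z' \<cdot>\<^bsub>A\<^esub> z = Id A w'" "z \<cdot>\<^bsub>A\<^esub> z' = Id A w" using is_isoE[OF z(2,1)]
      .
  obtain b' where b': "b' \<in> Hom A y y'" "b' \<cdot>\<^bsub>A\<^esub> b = Id A y'" "b \<cdot>\<^bsub>A\<^esub> b' = Id A y" using is_isoE[OF b(2,1)]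
      .
  note H = h a b z' b' z
  note ob = Hom_Ob[OF h(1)] Hom_Ob[OF h(2)] Hom_Ob[OF h(3)] Hom_Ob[OF h(4)]
  have k0: "k' \<cdot>\<^bsub>A\<^esub> f' = Zero A x' w'" using cokernel_hom(2)[OF k h(1)] h by (simp add: Hom_iff)
  have kb: "k \<cdot>\<^bsub>A\<^esub> (b \<cdot>\<^bsub>A\<^esub> t) = z \<cdot>\<^bsub>A\<^esub> (k' \<cdot>\<^bsub>A\<^esub> t)" if "t \<in> Hom A v y'" for t v
    using e(2) H that assoc_ar[of t b k] assoc_ar[of t k' z] by (simp add: Hom_iff)
  have sb: "(t \<cdot>\<^bsub>A\<^esub> b) \<cdot>\<^bsub>A\<^esub> f' = (t \<cdot>\<^bsub>A\<^esub> f) \<cdot>\<^bsub>A\<^esub> a" if "t \<in> Hom A y v" for t v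
    using e(1) H that by (simp add: Hom_iff)
  show ?thesis
  proof (rule cokernelI[OF h(2,4)])
    have "(k \<cdot>\<^bsub>A\<^esub> f) \<cdot>\<^bsub>A\<^esub> a = Zero A x w \<cdot>\<^bsub>A\<^esub> a"
      using sb[OF h(4)] e(2)[symmetric] k0 H ob by (simp add: Hom_iff)
    then show "k \<cdot>\<^bsub>A\<^esub> f = Zero A x w"
      using epi_cancel[OF iso_epi[OF a(2)] a(1) comp_hom[OF h(2,4)] zero_hom] ob by simp
    show "is_epi A k" unfolding is_epi_def
    proof (intro conjI allI ballI impI)
      fix v p q assume "p \<in> Hom A (Cod A k) v" "q \<in> Hom A (Cod A k) v" and kk: "p \<cdot>\<^bsub>A\<^esub> k = q \<cdot>\<^bsub>A\<^esub> k"
      then have pq: "p \<in> Hom A w v" "q \<in> Hom A w v" using h by (auto simp: Hom_iff)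
      have kt: "(t \<cdot>\<^bsub>A\<^esub> z) \<cdot>\<^bsub>A\<^esub> k' = (t \<cdot>\<^bsub>A\<^esub> k) \<cdot>\<^bsub>A\<^esub> b" if "t \<in> Hom A w v" for t
        using e(2) H that by (simp add: Hom_iff)
      have "(p \<cdot>\<^bsub>A\<^esub> z) \<cdot>\<^bsub>A\<^esub> k' = (q \<cdot>\<^bsub>A\<^esub> z) \<cdot>\<^bsub>A\<^esub> k'" using kt[OF pq(1)] kt[OF pq(2)] kk by simp
      then have "p \<cdot>\<^bsub>A\<^esub> z = q \<cdot>\<^bsub>A\<^esub> z"
        using epi_cancel[OF cokernel_epi[OF k] h(3) comp_hom[OF z(1) pq(1)] comp_hom[OF z(1) pq(2)]] by simp
      then show "p = q" using epi_cancel[OF iso_epi[OF z(2)] z(1) pq] by simp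
    qed (use h in \<open>simp add: Hom_iff\<close>)
    fix v g assume g: "g \<in> Hom A y v" "g \<cdot>\<^bsub>A\<^esub> f = Zero A x v"
    have vv: "v \<in> Ob A" using Hom_Ob[OF g(1)] by simp
    have "(g \<cdot>\<^bsub>A\<^esub> b) \<cdot>\<^bsub>A\<^esub> f' = Zero A x' v" using sb[OF g(1)] g(2) H ob vv by (simp add: Hom_iff)
    then obtain s where s: "s \<in> Hom A w' v" "s \<cdot>\<^bsub>A\<^esub> k' = g \<cdot>\<^bsub>A\<^esub> b"
      using cokernel_lift[OF k h(1) comp_hom[OF b(1) g(1)]] h by (auto simp: Hom_iff)
    have "((s \<cdot>\<^bsub>A\<^esub> z') \<cdot>\<^bsub>A\<^esub> k) \<cdot>\<^bsub>A\<^esub> b = s \<cdot>\<^bsub>A\<^esub> (z' \<cdot>\<^bsub>A\<^esub> (z \<cdot>\<^bsub>A\<^esub> k'))"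
      using e(2) H s(1) by (simp add: Hom_iff)
    also have "\<dots> = g \<cdot>\<^bsub>A\<^esub> b"
      using comp_eq_reduce[OF z'(2) z(1) z'(1) h(3)] H s by (simp add: Hom_iff)
    finally have "(s \<cdot>\<^bsub>A\<^esub> z') \<cdot>\<^bsub>A\<^esub> k = g"
      using epi_cancel[OF iso_epi[OF b(2)] b(1) comp_hom[OF h(4) comp_hom[OF z'(1) s(1)]] g(1)] by simp
    then show "\<exists>h\<in>Hom A w v. h \<cdot>\<^bsub>A\<^esub> k = g" using comp_hom[OF z'(1) s(1)] by auto
  qed
qed

text \<open>\<open>exact_coproducts\<close> speaks of the coproducts selected by
  \<open>coprod\<close> over subsets of the universe. Reindexing along \<open>e\<close>, together
  with the comparison isomorphisms between two coproducts of one family, carries its conclusion to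
  arbitrary coproducts over any small index set.\<close>

lemma coproduct_short_exact:
  fixes e :: "'i \<Rightarrow> 'u"
  assumes cc: "cocomplete TYPE('u) A" and ex: "exact_coproducts TYPE('u) A" and e: "inj_on e I"
    and c: "is_coproduct A I X c \<iota>" "is_coproduct A I Y d \<kappa>" "is_coproduct A I Z w \<mu>"
    and F: "F \<in> Hom A c d" "\<And>i. i \<in> I \<Longrightarrow> F \<cdot>\<^bsub>A\<^esub> \<iota> i = \<kappa> i \<cdot>\<^bsub>A\<^esub> f i"
    and G: "G \<in> Hom A d w" "\<And>i. i \<in> I \<Longrightarrow> G \<cdot>\<^bsub>A\<^esub> \<kappa> i = \<mu> i \<cdot>\<^bsub>A\<^esub> g i"
    and fg: "\<And>i. i \<in> I \<Longrightarrow> f i \<in> Hom A (X i) (Y i)" "\<And>i. i \<in> I \<Longrightarrow> g i \<in> Hom A (Y i) (Z i)"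
      "\<And>i. i \<in> I \<Longrightarrow> short_exact A (f i) (g i)"
  shows "short_exact A F G"
proof -
  define r where "r = inv_into I e"
  have r: "bij_betw r (e ` I) I" unfolding r_def using e by (simp add: bij_betw_inv_into
      inj_on_imp_bij_betw)
  then have rI: "r j \<in> I" if "j \<in> e ` I" for j using that by (auto simp: bij_betw_def)
  let ?J = "e ` I"
  note c' = c[THEN coproduct_reindex, OF r]
  note cs = c'[THEN coprod_is_coproduct]
  let ?F = "coprod_map A ?J (\<lambda>j. X (r j)) (\<lambda>j. Y (r j)) (\<lambda>j. f (r j))"
  let ?G = "coprod_map A ?J (\<lambda>j. Y (r j)) (\<lambda>j. Z (r j)) (\<lambda>j. g (r j))"
  have se: "short_exact A ?F ?G"
  proof -
    have "\<forall>j\<in>?J. f (r j) \<in> Hom A (X (r j)) (Y (r j)) \<and> g (r j) \<in> Hom A (Y (r j)) (Z (r j))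
        \<and> short_exact A (f (r j)) (g (r j))"
      using fg rI by simp
    then show ?thesis using ex unfolding exact_coproducts_def by (elim allE) (erule mp)
  qed
  have F': "?F \<in> Hom A (coprod_obj A ?J (\<lambda>j. X (r j))) (coprod_obj A ?J (\<lambda>j. Y (r j)))"
    "\<And>j. j \<in> ?J \<Longrightarrow> ?F \<cdot>\<^bsub>A\<^esub> coprod_in A ?J (\<lambda>j. X (r j)) j = coprod_in A ?J (\<lambda>j. Y (r j)) j \<cdot>\<^bsub>A\<^esub> f (r j)"
    unfolding coprod_map_def
    using copair[OF c'(1) coproduct_ob[OF cs(2)], of "\<lambda>j. coprod_in A ?J (\<lambda>j. Y (r j)) j \<cdot>\<^bsub>A\<^esub> f (r j)"]
      comp_hom[OF fg(1)[OF rI] coproduct_in[OF cs(2)]] by auto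
  have G': "?G \<in> Hom A (coprod_obj A ?J (\<lambda>j. Y (r j))) (coprod_obj A ?J (\<lambda>j. Z (r j)))"
    "\<And>j. j \<in> ?J \<Longrightarrow> ?G \<cdot>\<^bsub>A\<^esub> coprod_in A ?J (\<lambda>j. Y (r j)) j = coprod_in A ?J (\<lambda>j. Z (r j)) j \<cdot>\<^bsub>A\<^esub> g (r j)"
    unfolding coprod_map_def
    using copair[OF c'(2) coproduct_ob[OF cs(3)], of "\<lambda>j. coprod_in A ?J (\<lambda>j. Z (r j)) j \<cdot>\<^bsub>A\<^esub> g (r j)"]
      comp_hom[OF fg(2)[OF rI] coproduct_in[OF cs(3)]] by auto
  \<comment> \<open>\<open>p\<close>, \<open>q\<close> and \<open>s\<close> compare the selected
    coproducts, indexed by the image of \<open>e\<close>, with the given ones. The equations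
    \<open>e1\<close> and \<open>e2\<close> make them a morphism from the selected sequence to the
    given one.\<close>
  obtain p where p: "p \<in> Hom A (coprod_obj A ?J (\<lambda>j. X (r j))) c" "\<And>j. j \<in> ?J \<Longrightarrow> p \<cdot>\<^bsub>A\<^esub> coprod_in A ?J (\<lambda>j.
      X (r j)) j = \<iota> (r j)"
    using coproduct_ex[OF cs(1) coproduct_ob[OF c'(1)] coproduct_in[OF c'(1)]] by metis
  obtain q where q: "q \<in> Hom A (coprod_obj A ?J (\<lambda>j. Y (r j))) d" "\<And>j. j \<in> ?J \<Longrightarrow> q \<cdot>\<^bsub>A\<^esub> coprod_in A ?J (\<lambda>j.
      Y (r j)) j = \<kappa> (r j)"
    using coproduct_ex[OF cs(2) coproduct_ob[OF c'(2)] coproduct_in[OF c'(2)]] by metis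
  obtain s where s: "s \<in> Hom A (coprod_obj A ?J (\<lambda>j. Z (r j))) w" "\<And>j. j \<in> ?J \<Longrightarrow> s \<cdot>\<^bsub>A\<^esub> coprod_in A ?J (\<lambda>j.
      Z (r j)) j = \<mu> (r j)"
    using coproduct_ex[OF cs(3) coproduct_ob[OF c'(3)] coproduct_in[OF c'(3)]] by metis
  have pi: "is_iso A p" by (rule coproduct_comparison_iso[OF cs(1) c'(1) p])
  have qi: "is_iso A q" by (rule coproduct_comparison_iso[OF cs(2) c'(2) q])
  have si: "is_iso A s" by (rule coproduct_comparison_iso[OF cs(3) c'(3) s])
  have e1: "q \<cdot>\<^bsub>A\<^esub> ?F = F \<cdot>\<^bsub>A\<^esub> p"
  proof (rule coproduct_eq[OF cs(1) comp_hom[OF F'(1) q(1)] comp_hom[OF p(1) F(1)]])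
    fix j assume j: "j \<in> ?J"
    note h = coproduct_in[OF cs(1) j] coproduct_in[OF cs(2) j]
    have "q \<cdot>\<^bsub>A\<^esub> ?F \<cdot>\<^bsub>A\<^esub> coprod_in A ?J (\<lambda>j. X (r j)) j = q \<cdot>\<^bsub>A\<^esub> (coprod_in A ?J (\<lambda>j. Y (r j)) j \<cdot>\<^bsub>A\<^esub> f (r
        j))"
      using comp_assoc[OF h(1) F'(1) q(1)] F'(2)[OF j] by simp
    also have "\<dots> = \<kappa> (r j) \<cdot>\<^bsub>A\<^esub> f (r j)"
      by (rule comp_eq_reduce[OF q(2)[OF j] h(2) q(1) fg(1)[OF rI[OF j]]])
    also have "\<dots> = F \<cdot>\<^bsub>A\<^esub> p \<cdot>\<^bsub>A\<^esub> coprod_in A ?J (\<lambda>j. X (r j)) j"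
      using comp_assoc[OF h(1) p(1) F(1)] p(2)[OF j] F(2)[OF rI[OF j]] by simp
    finally show "q \<cdot>\<^bsub>A\<^esub> ?F \<cdot>\<^bsub>A\<^esub> coprod_in A ?J (\<lambda>j. X (r j)) j = F \<cdot>\<^bsub>A\<^esub> p \<cdot>\<^bsub>A\<^esub> coprod_in A ?J (\<lambda>j. X (r
        j)) j" .
  qed
  have e2: "s \<cdot>\<^bsub>A\<^esub> ?G = G \<cdot>\<^bsub>A\<^esub> q"
  proof (rule coproduct_eq[OF cs(2) comp_hom[OF G'(1) s(1)] comp_hom[OF q(1) G(1)]])
    fix j assume j: "j \<in> ?J"
    note h = coproduct_in[OF cs(2) j] coproduct_in[OF cs(3) j]
    have "s \<cdot>\<^bsub>A\<^esub> ?G \<cdot>\<^bsub>A\<^esub> coprod_in A ?J (\<lambda>j. Y (r j)) j = s \<cdot>\<^bsub>A\<^esub> (coprod_in A ?J (\<lambda>j. Z (r j)) j \<cdot>\<^bsub>A\<^esub> g (r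
        j))"
      using comp_assoc[OF h(1) G'(1) s(1)] G'(2)[OF j] by simp
    also have "\<dots> = \<mu> (r j) \<cdot>\<^bsub>A\<^esub> g (r j)"
      by (rule comp_eq_reduce[OF s(2)[OF j] h(2) s(1) fg(2)[OF rI[OF j]]])
    also have "\<dots> = G \<cdot>\<^bsub>A\<^esub> q \<cdot>\<^bsub>A\<^esub> coprod_in A ?J (\<lambda>j. Y (r j)) j"
      using comp_assoc[OF h(1) q(1) G(1)] q(2)[OF j] G(2)[OF rI[OF j]] by simp
    finally show "s \<cdot>\<^bsub>A\<^esub> ?G \<cdot>\<^bsub>A\<^esub> coprod_in A ?J (\<lambda>j. Y (r j)) j = G \<cdot>\<^bsub>A\<^esub> q \<cdot>\<^bsub>A\<^esub> coprod_in A ?J (\<lambda>j. Y (r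
        j)) j" .
  qed
  have "is_kernel A ?F ?G" "is_cokernel A ?G ?F" using se by (auto simp: short_exact_def)
  then show ?thesis unfolding short_exact_def
    using kernel_transport[OF _ G'(1) G(1) F'(1) F(1) p(1) pi q(1) qi s(1) si e1 e2]
      cokernel_transport[OF _ F'(1) F(1) G'(1) G(1) p(1) pi q(1) qi s(1) si e1 e2] by blast
qed

end

section \<open>Homology in an abelian category\<close>

definition composable_zero :: "('o, 'a, 'z) acat_scheme \<Rightarrow> 'a \<Rightarrow> 'a \<Rightarrow> bool" where
  "composable_zero A f g \<longleftrightarrow> f \<in> Ar A \<and> g \<in> Ar A \<and> Dom A g = Cod A f \<and>
     g \<cdot>\<^bsub>A\<^esub> f = Zero A (Dom A f) (Cod A g)"

text \<open>\<open>homology_map\<close> receives only the middle component of a map of complexes.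
  The neighbouring components are existentially quantified because the induced map does not depend
  on which ones are used.\<close>

definition chain_map_at :: "('o, 'a, 'z) acat_scheme \<Rightarrow> 'a \<Rightarrow> 'a \<Rightarrow> 'a \<Rightarrow> 'a \<Rightarrow> 'a \<Rightarrow> bool" where
  "chain_map_at A f g f' g' \<phi> \<longleftrightarrow> \<phi> \<in> Hom A (Cod A f) (Cod A f') \<and>
     (\<exists>\<chi>\<in>Hom A (Dom A f) (Dom A f'). f' \<cdot>\<^bsub>A\<^esub> \<chi> = \<phi> \<cdot>\<^bsub>A\<^esub> f) \<and>
     (\<exists>\<psi>\<in>Hom A (Cod A g) (Cod A g'). g' \<cdot>\<^bsub>A\<^esub> \<phi> = \<psi> \<cdot>\<^bsub>A\<^esub> g)"

context abelian_category begin

lemma ker_arr: "f \<in> Ar A \<Longrightarrow> is_kernel A (ker_arr A f) f"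
  unfolding ker_arr_def using ex_kernel by (rule someI_ex)

lemma coker_arr: "f \<in> Ar A \<Longrightarrow> is_cokernel A (coker_arr A f) f"
  unfolding coker_arr_def using ex_cokernel by (rule someI_ex)

abbreviation "cyc g \<equiv> Dom A (ker_arr A g)"

lemma ker_hom: "g \<in> Hom A x y \<Longrightarrow> ker_arr A g \<in> Hom A (cyc g) x"
  "g \<in> Hom A x y \<Longrightarrow> g \<cdot>\<^bsub>A\<^esub> ker_arr A g = Zero A (cyc g) y"
  using kernel_hom[OF ker_arr] by (auto simp: Hom_iff)

lemma ker_mono: "g \<in> Ar A \<Longrightarrow> is_mono A (ker_arr A g)"
  using kernel_mono ker_arr by blast

lemma composable_zeroD:
  assumes "composable_zero A f g"
  shows "f \<in> Hom A (Dom A f) (Cod A f)" "g \<in> Hom A (Cod A f) (Cod A g)"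
    "g \<cdot>\<^bsub>A\<^esub> f = Zero A (Dom A f) (Cod A g)"
  using assms by (auto simp: composable_zero_def Hom_iff)

lemma boundary_lift:
  assumes "composable_zero A f g"
  shows "boundary_lift A f g \<in> Hom A (Dom A f) (cyc g)" "ker_arr A g \<cdot>\<^bsub>A\<^esub> boundary_lift A f g = f"
proof -
  note d = composable_zeroD[OF assms]
  have "\<exists>!h. h \<in> Hom A (Dom A f) (cyc g) \<and> ker_arr A g \<cdot>\<^bsub>A\<^esub> h = f"
    by (rule kernel_lift[OF ker_arr d(2,1,3)]) (use d in \<open>simp add: Hom_iff\<close>)
  from theI'[OF this] show "boundary_lift A f g \<in> Hom A (Dom A f) (cyc g)"
    "ker_arr A g \<cdot>\<^bsub>A\<^esub> boundary_lift A f g = f" unfolding boundary_lift_def by auto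
qed

lemma homology_proj:
  assumes "composable_zero A f g"
  shows "is_cokernel A (homology_proj A f g) (boundary_lift A f g)"
    "homology_proj A f g \<in> Hom A (cyc g) (homology_obj A f g)"
    "homology_proj A f g \<cdot>\<^bsub>A\<^esub> boundary_lift A f g = Zero A (Dom A f) (homology_obj A f g)"
    "is_epi A (homology_proj A f g)"
proof -
  note b = boundary_lift[OF assms]
  show c: "is_cokernel A (homology_proj A f g) (boundary_lift A f g)"
    unfolding homology_proj_def using coker_arr b(1) by (auto simp: Hom_iff)
  show "homology_proj A f g \<in> Hom A (cyc g) (homology_obj A f g)"
    "homology_proj A f g \<cdot>\<^bsub>A\<^esub> boundary_lift A f g = Zero A (Dom A f) (homology_obj A f g)"
    "is_epi A (homology_proj A f g)"
    using cokernel_hom[OF c b(1)] cokernel_epi[OF c] unfolding homology_obj_def by auto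
qed

lemma homology_obj_ob: "composable_zero A f g \<Longrightarrow> homology_obj A f g \<in> Ob A"
  using homology_proj(2) Hom_Ob(2) by blast

lemma cycles_map:
  assumes "g \<in> Hom A x b" "g' \<in> Hom A x' b'" "\<phi> \<in> Hom A x x'" "\<psi> \<in> Hom A b b'" "g' \<cdot>\<^bsub>A\<^esub> \<phi> = \<psi> \<cdot>\<^bsub>A\<^esub> g"
  shows "cycles_map A g g' \<phi> \<in> Hom A (cyc g) (cyc g')"
    "ker_arr A g' \<cdot>\<^bsub>A\<^esub> cycles_map A g g' \<phi> = \<phi> \<cdot>\<^bsub>A\<^esub> ker_arr A g"
proof -
  note k = ker_hom[OF assms(1)]
  have "g' \<cdot>\<^bsub>A\<^esub> (\<phi> \<cdot>\<^bsub>A\<^esub> ker_arr A g) = \<psi> \<cdot>\<^bsub>A\<^esub> (g \<cdot>\<^bsub>A\<^esub> ker_arr A g)"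
    using comp_eq_reduce[OF assms(5,3,2) k(1)] comp_assoc[OF k(1) assms(1,4)] by simp
  also have "\<dots> = Zero A (cyc g) b'"
    using k(2) comp_zero_right[OF assms(4)] Hom_Ob[OF k(1)] by simp
  finally have "\<exists>!h. h \<in> Hom A (cyc g) (cyc g') \<and> ker_arr A g' \<cdot>\<^bsub>A\<^esub> h = \<phi> \<cdot>\<^bsub>A\<^esub> ker_arr A g"
    by (intro kernel_lift[OF ker_arr assms(2) comp_hom[OF k(1) assms(3)]]) (use assms in \<open>simp add:
        Hom_iff\<close>)
  from theI'[OF this] show "cycles_map A g g' \<phi> \<in> Hom A (cyc g) (cyc g')"
    "ker_arr A g' \<cdot>\<^bsub>A\<^esub> cycles_map A g g' \<phi> = \<phi> \<cdot>\<^bsub>A\<^esub> ker_arr A g" unfolding cycles_map_def by auto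
qed

lemma chain_map_cycles:
  assumes "composable_zero A f g" "composable_zero A f' g'" "chain_map_at A f g f' g' \<phi>"
  shows "cycles_map A g g' \<phi> \<in> Hom A (cyc g) (cyc g')"
    "ker_arr A g' \<cdot>\<^bsub>A\<^esub> cycles_map A g g' \<phi> = \<phi> \<cdot>\<^bsub>A\<^esub> ker_arr A g"
  using cycles_map[OF composable_zeroD(2)[OF assms(1)] composable_zeroD(2)[OF assms(2)]] assms(3)
  unfolding chain_map_at_def by blast+

text \<open>The map on cycles carries boundaries to boundaries: after the monic kernel inclusion
  this is the square with \<open>\<chi>\<close>. It therefore descends to the cokernels.\<close>

lemma homology_map:
  assumes "composable_zero A f g" "composable_zero A f' g'" "chain_map_at A f g f' g' \<phi>"
  shows "homology_map A f g f' g' \<phi> \<in> Hom A (homology_obj A f g) (homology_obj A f' g')"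
    "homology_map A f g f' g' \<phi> \<cdot>\<^bsub>A\<^esub> homology_proj A f g = homology_proj A f' g' \<cdot>\<^bsub>A\<^esub> cycles_map A g g' \<phi>"
proof -
  note d = composable_zeroD[OF assms(1)] and d' = composable_zeroD[OF assms(2)]
  note b = boundary_lift[OF assms(1)] and b' = boundary_lift[OF assms(2)]
  note p = homology_proj[OF assms(1)] and p' = homology_proj[OF assms(2)]
  note c = chain_map_cycles[OF assms]
  note k = ker_hom[OF d(2)] and k' = ker_hom[OF d'(2)]
  obtain \<chi> where x: "\<chi> \<in> Hom A (Dom A f) (Dom A f')" "f' \<cdot>\<^bsub>A\<^esub> \<chi> = \<phi> \<cdot>\<^bsub>A\<^esub> f"
    using assms(3) unfolding chain_map_at_def by blast
  have \<phi>: "\<phi> \<in> Hom A (Cod A f) (Cod A f')" using assms(3) by (simp add: chain_map_at_def)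
  have "ker_arr A g' \<cdot>\<^bsub>A\<^esub> (cycles_map A g g' \<phi> \<cdot>\<^bsub>A\<^esub> boundary_lift A f g) = \<phi> \<cdot>\<^bsub>A\<^esub> (ker_arr A g \<cdot>\<^bsub>A\<^esub>
      boundary_lift A f g)"
    using comp_eq_reduce[OF c(2,1) k'(1) b(1)] comp_assoc[OF b(1) k(1) \<phi>] by simp
  also have "\<dots> = (ker_arr A g' \<cdot>\<^bsub>A\<^esub> boundary_lift A f' g') \<cdot>\<^bsub>A\<^esub> \<chi>" unfolding b(2) b'(2) x(2) ..
  also have "\<dots> = ker_arr A g' \<cdot>\<^bsub>A\<^esub> (boundary_lift A f' g' \<cdot>\<^bsub>A\<^esub> \<chi>)" by (rule comp_assoc[OF x(1) b'(1) k'(1)])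
  finally have e: "cycles_map A g g' \<phi> \<cdot>\<^bsub>A\<^esub> boundary_lift A f g = boundary_lift A f' g' \<cdot>\<^bsub>A\<^esub> \<chi>"
    by (rule mono_cancel[OF ker_mono[OF Hom_D(1)[OF d'(2)]] k'(1) comp_hom[OF b(1) c(1)] comp_hom[OF x(1)
        b'(1)]])
  have "(homology_proj A f' g' \<cdot>\<^bsub>A\<^esub> cycles_map A g g' \<phi>) \<cdot>\<^bsub>A\<^esub> boundary_lift A f g
      = homology_proj A f' g' \<cdot>\<^bsub>A\<^esub> (boundary_lift A f' g' \<cdot>\<^bsub>A\<^esub> \<chi>)"
    using comp_assoc[OF b(1) c(1) p'(2)] e by simp
  also have "\<dots> = Zero A (Dom A f) (homology_obj A f' g')"
    using comp_eq_reduce[OF p'(3) b'(1) p'(2) x(1)] comp_zero_left[OF x(1)] homology_obj_ob[OF assms(2)] by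
        simp
  finally have "\<exists>!h. h \<in> Hom A (homology_obj A f g) (homology_obj A f' g') \<and>
      h \<cdot>\<^bsub>A\<^esub> homology_proj A f g = homology_proj A f' g' \<cdot>\<^bsub>A\<^esub> cycles_map A g g' \<phi>"
    unfolding homology_obj_def[of _ f g]
    by (intro cokernel_lift[OF p(1) b(1) comp_hom[OF c(1) p'(2)]])
  from theI'[OF this] show "homology_map A f g f' g' \<phi> \<in> Hom A (homology_obj A f g) (homology_obj A f' g')"
    "homology_map A f g f' g' \<phi> \<cdot>\<^bsub>A\<^esub> homology_proj A f g = homology_proj A f' g' \<cdot>\<^bsub>A\<^esub> cycles_map A g g' \<phi>"
    unfolding homology_map_def by auto
qed

text \<open>The kernel inclusion is monic and the homology projection is epic, so any compatible
  pair of maps on cycles and on homology is the pair singled out by the two nested definite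
  descriptions. Identities and composites follow without unfolding them.\<close>

lemma homology_map_eqI:
  assumes "composable_zero A f g" "composable_zero A f' g'" "chain_map_at A f g f' g' \<phi>"
    and c: "c \<in> Hom A (cyc g) (cyc g')" "ker_arr A g' \<cdot>\<^bsub>A\<^esub> c = \<phi> \<cdot>\<^bsub>A\<^esub> ker_arr A g"
    and h: "h \<in> Hom A (homology_obj A f g) (homology_obj A f' g')"
      "h \<cdot>\<^bsub>A\<^esub> homology_proj A f g = homology_proj A f' g' \<cdot>\<^bsub>A\<^esub> c"
  shows "homology_map A f g f' g' \<phi> = h"
proof -
  note C = chain_map_cycles[OF assms(1-3)] and H = homology_map[OF assms(1-3)]
  note k' = ker_hom[OF composable_zeroD(2)[OF assms(2)]]
  have "cycles_map A g g' \<phi> = c"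
    by (rule mono_cancel[OF ker_mono k'(1) C(1) c(1)])
      (use C c assms(2) in \<open>simp_all add: composable_zero_def\<close>)
  then show ?thesis
    using epi_cancel[OF homology_proj(4,2)[OF assms(1)] H(1) h(1)] H(2) h(2) by simp
qed

lemma chain_map_comp:
  assumes z: "composable_zero A f g" "composable_zero A f' g'" "composable_zero A f'' g''"
    and m: "chain_map_at A f g f' g' \<phi>" "chain_map_at A f' g' f'' g'' \<phi>'"
  shows "chain_map_at A f g f'' g'' (\<phi>' \<cdot>\<^bsub>A\<^esub> \<phi>)"
proof -
  note d = composable_zeroD[OF z(1)] composable_zeroD[OF z(2)] composable_zeroD[OF z(3)]
  obtain \<chi> \<psi> where a: "\<phi> \<in> Hom A (Cod A f) (Cod A f')"
    "\<chi> \<in> Hom A (Dom A f) (Dom A f')" "f' \<cdot>\<^bsub>A\<^esub> \<chi> = \<phi> \<cdot>\<^bsub>A\<^esub> f"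
    "\<psi> \<in> Hom A (Cod A g) (Cod A g')" "g' \<cdot>\<^bsub>A\<^esub> \<phi> = \<psi> \<cdot>\<^bsub>A\<^esub> g"
    using m(1) unfolding chain_map_at_def by blast
  obtain \<chi>' \<psi>' where b: "\<phi>' \<in> Hom A (Cod A f') (Cod A f'')"
    "\<chi>' \<in> Hom A (Dom A f') (Dom A f'')" "f'' \<cdot>\<^bsub>A\<^esub> \<chi>' = \<phi>' \<cdot>\<^bsub>A\<^esub> f'"
    "\<psi>' \<in> Hom A (Cod A g') (Cod A g'')" "g'' \<cdot>\<^bsub>A\<^esub> \<phi>' = \<psi>' \<cdot>\<^bsub>A\<^esub> g'"
    using m(2) unfolding chain_map_at_def by blast
  have "f'' \<cdot>\<^bsub>A\<^esub> (\<chi>' \<cdot>\<^bsub>A\<^esub> \<chi>) = (\<phi>' \<cdot>\<^bsub>A\<^esub> \<phi>) \<cdot>\<^bsub>A\<^esub> f"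
    using comp_eq_reduce[OF b(3,2) _ a(2)] a b d by (simp add: Hom_iff)
  moreover have "g'' \<cdot>\<^bsub>A\<^esub> (\<phi>' \<cdot>\<^bsub>A\<^esub> \<phi>) = (\<psi>' \<cdot>\<^bsub>A\<^esub> \<psi>) \<cdot>\<^bsub>A\<^esub> g"
    using comp_eq_reduce[OF b(5,1) _ a(1)] a b d by (simp add: Hom_iff)
  ultimately show ?thesis unfolding chain_map_at_def
    using comp_hom[OF a(2) b(2)] comp_hom[OF a(1) b(1)] comp_hom[OF a(4) b(4)] by blast
qed

lemma homology_map_comp:
  assumes z: "composable_zero A f g" "composable_zero A f' g'" "composable_zero A f'' g''"
    and m: "chain_map_at A f g f' g' \<phi>" "chain_map_at A f' g' f'' g'' \<phi>'"
  shows "homology_map A f g f'' g'' (\<phi>' \<cdot>\<^bsub>A\<^esub> \<phi>) = homology_map A f' g' f'' g'' \<phi>' \<cdot>\<^bsub>A\<^esub> homology_map A f g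
      f' g' \<phi>"
proof (rule homology_map_eqI[OF z(1,3) chain_map_comp[OF z m]])
  note c = chain_map_cycles[OF z(1,2) m(1)] and c' = chain_map_cycles[OF z(2,3) m(2)]
  note H = homology_map[OF z(1,2) m(1)] and H' = homology_map[OF z(2,3) m(2)]
  note d = composable_zeroD[OF z(1)] composable_zeroD[OF z(2)] composable_zeroD[OF z(3)]
  note k = ker_hom[OF d(2)] ker_hom[OF d(5)] ker_hom[OF d(8)]
  note p = homology_proj(2)[OF z(1)] homology_proj(2)[OF z(2)] homology_proj(2)[OF z(3)]
  have \<phi>: "\<phi> \<in> Hom A (Cod A f) (Cod A f')" "\<phi>' \<in> Hom A (Cod A f') (Cod A f'')"
    using m by (simp_all add: chain_map_at_def)
  show "cycles_map A g' g'' \<phi>' \<cdot>\<^bsub>A\<^esub> cycles_map A g g' \<phi> \<in> Hom A (cyc g) (cyc g'')"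
    using comp_hom[OF c(1) c'(1)] .
  show "ker_arr A g'' \<cdot>\<^bsub>A\<^esub> (cycles_map A g' g'' \<phi>' \<cdot>\<^bsub>A\<^esub> cycles_map A g g' \<phi>) = \<phi>' \<cdot>\<^bsub>A\<^esub> \<phi> \<cdot>\<^bsub>A\<^esub> ker_arr A g"
    using comp_eq_reduce[OF c'(2,1) k(5) c(1)] comp_assoc[OF c(1) k(3) \<phi>(2)] c(2) comp_assoc[OF k(1) \<phi>] by
        simp
  show "homology_map A f' g' f'' g'' \<phi>' \<cdot>\<^bsub>A\<^esub> homology_map A f g f' g' \<phi> \<in> Hom A (homology_obj A f g)
      (homology_obj A f'' g'')"
    using comp_hom[OF H(1) H'(1)] .
  show "homology_map A f' g' f'' g'' \<phi>' \<cdot>\<^bsub>A\<^esub> homology_map A f g f' g' \<phi> \<cdot>\<^bsub>A\<^esub> homology_proj A f g =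
    homology_proj A f'' g'' \<cdot>\<^bsub>A\<^esub> (cycles_map A g' g'' \<phi>' \<cdot>\<^bsub>A\<^esub> cycles_map A g g' \<phi>)"
    using comp_assoc[OF p(1) H(1) H'(1)] H(2) comp_eq_reduce[OF H'(2) p(2) H'(1) c(1)]
      comp_assoc[OF c(1) c'(1) p(3)] by simp
qed

lemma chain_map_id:
  assumes "composable_zero A f g" shows "chain_map_at A f g f g (Id A (Cod A f))"
  unfolding chain_map_at_def
proof (intro conjI)
  note d = composable_zeroD[OF assms]
  show "\<exists>\<chi>\<in>Hom A (Dom A f) (Dom A f). f \<cdot>\<^bsub>A\<^esub> \<chi> = Id A (Cod A f) \<cdot>\<^bsub>A\<^esub> f"
    by (rule bexI[of _ "Id A (Dom A f)"]) (use d in \<open>auto simp: Hom_iff\<close>)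
  show "\<exists>\<psi>\<in>Hom A (Cod A g) (Cod A g). g \<cdot>\<^bsub>A\<^esub> Id A (Cod A f) = \<psi> \<cdot>\<^bsub>A\<^esub> g"
    by (rule bexI[of _ "Id A (Cod A g)"]) (use d in \<open>auto simp: Hom_iff\<close>)
qed (use assms in \<open>auto simp: composable_zero_def Hom_iff\<close>)

lemma homology_map_id:
  assumes "composable_zero A f g"
  shows "homology_map A f g f g (Id A (Cod A f)) = Id A (homology_obj A f g)"
proof (rule homology_map_eqI[OF assms assms chain_map_id[OF assms]])
  note k = ker_hom(1)[OF composable_zeroD(2)[OF assms]] and p = homology_proj(2)[OF assms]
  show "ker_arr A g \<cdot>\<^bsub>A\<^esub> Id A (cyc g) = Id A (Cod A f) \<cdot>\<^bsub>A\<^esub> ker_arr A g" using id_left[OF k] id_right[OF k]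
      by simp
  show "Id A (homology_obj A f g) \<cdot>\<^bsub>A\<^esub> homology_proj A f g = homology_proj A f g \<cdot>\<^bsub>A\<^esub> Id A (cyc g)"
    using id_left[OF p] id_right[OF p] by simp
  show "Id A (cyc g) \<in> Hom A (cyc g) (cyc g)" using id_hom[OF Hom_Ob(1)[OF k]] .
  show "Id A (homology_obj A f g) \<in> Hom A (homology_obj A f g) (homology_obj A f g)"
    using id_hom[OF Hom_Ob(2)[OF p]] .
qed

lemma homology_map_iso:
  assumes z: "composable_zero A f g" "composable_zero A f' g'"
    and \<phi>: "\<phi> \<in> Hom A (Cod A f) (Cod A f')" "is_iso A \<phi>"
    and x: "\<chi> \<in> Hom A (Dom A f) (Dom A f')" "is_iso A \<chi>" "f' \<cdot>\<^bsub>A\<^esub> \<chi> = \<phi> \<cdot>\<^bsub>A\<^esub> f"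
    and y: "\<psi> \<in> Hom A (Cod A g) (Cod A g')" "is_iso A \<psi>" "g' \<cdot>\<^bsub>A\<^esub> \<phi> = \<psi> \<cdot>\<^bsub>A\<^esub> g"
  shows "is_iso A (homology_map A f g f' g' \<phi>)"
proof -
  note d = composable_zeroD[OF z(1)] composable_zeroD[OF z(2)]
  \<comment> \<open>Inverting the vertical isomorphisms of a commuting square gives a commuting
    square in the other direction. Applied to both squares, this makes \<open>i\<close> a map of
    complexes.\<close>
  have inv: "s \<cdot>\<^bsub>A\<^esub> b = a \<cdot>\<^bsub>A\<^esub> r"
    if h: "a \<in> Hom A u v" "b \<in> Hom A u' v'" "p \<in> Hom A u u'" "q \<in> Hom A v v'" "b \<cdot>\<^bsub>A\<^esub> p = q \<cdot>\<^bsub>A\<^esub> a"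
      "r \<in> Hom A u' u" "p \<cdot>\<^bsub>A\<^esub> r = Id A u'" "s \<in> Hom A v' v" "s \<cdot>\<^bsub>A\<^esub> q = Id A v" for a b p q r s u v u' v'
  proof -
    have "s \<cdot>\<^bsub>A\<^esub> b = s \<cdot>\<^bsub>A\<^esub> (b \<cdot>\<^bsub>A\<^esub> (p \<cdot>\<^bsub>A\<^esub> r))" using h by (simp add: Hom_iff)
    also have "\<dots> = s \<cdot>\<^bsub>A\<^esub> (q \<cdot>\<^bsub>A\<^esub> (a \<cdot>\<^bsub>A\<^esub> r))" using h comp_eq_reduce[OF h(5,3,2,6)] by (simp add: Hom_iff)
    also have "\<dots> = a \<cdot>\<^bsub>A\<^esub> r" using comp_eq_reduce[OF h(9,4,8) comp_hom[OF h(6,1)]] h by (simp add: Hom_iff)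
    finally show ?thesis .
  qed
  obtain i where i: "i \<in> Hom A (Cod A f') (Cod A f)" "i \<cdot>\<^bsub>A\<^esub> \<phi> = Id A (Cod A f)" "\<phi> \<cdot>\<^bsub>A\<^esub> i = Id A (Cod A
      f')"
    using is_isoE[OF \<phi>(2,1)] .
  obtain j where j: "j \<in> Hom A (Dom A f') (Dom A f)" "j \<cdot>\<^bsub>A\<^esub> \<chi> = Id A (Dom A f)" "\<chi> \<cdot>\<^bsub>A\<^esub> j = Id A (Dom A
      f')"
    using is_isoE[OF x(2,1)] .
  obtain k where k: "k \<in> Hom A (Cod A g') (Cod A g)" "k \<cdot>\<^bsub>A\<^esub> \<psi> = Id A (Cod A g)" "\<psi> \<cdot>\<^bsub>A\<^esub> k = Id A (Cod A
      g')"
    using is_isoE[OF y(2,1)] .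
  have m: "chain_map_at A f g f' g' \<phi>" unfolding chain_map_at_def using \<phi> x y by blast
  have "i \<cdot>\<^bsub>A\<^esub> f' = f \<cdot>\<^bsub>A\<^esub> j" by (rule inv[OF d(1) d(4) x(1) \<phi>(1) x(3) j(1,3) i(1,2)])
  moreover have "k \<cdot>\<^bsub>A\<^esub> g' = g \<cdot>\<^bsub>A\<^esub> i" by (rule inv[OF d(2) d(5) \<phi>(1) y(1,3) i(1,3) k(1,2)])
  ultimately have m': "chain_map_at A f' g' f g i" unfolding chain_map_at_def using i j k by metis
  show ?thesis
    by (rule is_isoI[OF homology_map(1)[OF z m] homology_map(1)[OF z(2,1) m']])
      (use homology_map_comp[OF z z(1) m m'] homology_map_comp[OF z(2,1,2) m' m] i
        homology_map_id[OF z(1)] homology_map_id[OF z(2)] in auto)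
qed

text \<open>The cycles embed in a zero object and the homology is a quotient of the cycles;
  cancelling the mono and then the epi shows that both identities vanish.\<close>

lemma homology_zero:
  assumes z: "composable_zero A f g" and "is_zero_obj A (Cod A f)"
  shows "is_zero_obj A (homology_obj A f g)"
proof -
  note k = ker_hom(1)[OF composable_zeroD(2)[OF z]] and p = homology_proj[OF z]
  note ob = Hom_Ob[OF k] and hob = homology_obj_ob[OF z]
  have "ker_arr A g = Zero A (cyc g) (Cod A f)" by (rule zero_obj_hom(1)[OF assms(2) k])
  then have "ker_arr A g \<cdot>\<^bsub>A\<^esub> Id A (cyc g) = ker_arr A g \<cdot>\<^bsub>A\<^esub> Zero A (cyc g) (cyc g)"
    using comp_zero_right[OF k ob(1)] id_right[OF k] by simp
  then have e: "Id A (cyc g) = Zero A (cyc g) (cyc g)"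
    using mono_cancel[OF ker_mono k id_hom[OF ob(1)] zero_hom[OF ob(1) ob(1)]] z by (simp add:
        composable_zero_def)
  have "homology_proj A f g = Zero A (cyc g) (homology_obj A f g)"
    using id_right[OF p(2)] e comp_zero_right[OF p(2) ob(1)] by simp
  then have "Id A (homology_obj A f g) \<cdot>\<^bsub>A\<^esub> homology_proj A f g
      = Zero A (homology_obj A f g) (homology_obj A f g) \<cdot>\<^bsub>A\<^esub> homology_proj A f g"
    using comp_zero_left[OF p(2) hob] id_left[OF p(2)] by simp
  from epi_cancel[OF p(4,2) id_hom[OF hob] zero_hom[OF hob hob] this]
  show ?thesis using zero_obj_iff[OF hob] by simp
qed

text \<open>With zero differentials the homology at \<open>x\<close> is \<open>x\<close> only up to
  isomorphism, as kernels and cokernels are arbitrary choices. The last condition pins the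
  isomorphism down, the projection being epic, and is what makes it natural.\<close>

definition homology_of_zero :: "'o \<Rightarrow> 'o \<Rightarrow> 'o \<Rightarrow> 'a" where
  "homology_of_zero a x b = (SOME h.
     h \<in> Hom A (homology_obj A (Zero A a x) (Zero A x b)) x \<and> is_iso A h \<and>
     h \<cdot>\<^bsub>A\<^esub> homology_proj A (Zero A a x) (Zero A x b) = ker_arr A (Zero A x b))"

lemma composable_zero_zero:
  assumes "a \<in> Ob A" "x \<in> Ob A" "b \<in> Ob A" shows "composable_zero A (Zero A a x) (Zero A x b)"
  using assms comp_zero_left[OF zero_hom] by (simp add: composable_zero_def)

lemma homology_of_zero:
  assumes ob: "a \<in> Ob A" "x \<in> Ob A" "b \<in> Ob A"
  defines "f \<equiv> Zero A a x" and "g \<equiv> Zero A x b"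
  shows "homology_of_zero a x b \<in> Hom A (homology_obj A f g) x"
    "is_iso A (homology_of_zero a x b)"
    "homology_of_zero a x b \<cdot>\<^bsub>A\<^esub> homology_proj A f g = ker_arr A g"
proof -
  have z: "composable_zero A f g" unfolding f_def g_def by (rule composable_zero_zero[OF ob])
  have g: "g \<in> Hom A x b" and f: "f \<in> Hom A a x" unfolding g_def f_def using zero_hom ob by auto
  note k = ker_hom[OF g] and p = homology_proj[OF z] and b = boundary_lift[OF z]
  have fx: "Dom A f = a" "Cod A f = x" using f by (auto simp: Hom_iff)
  note kob = Hom_Ob[OF k(1)]
  have m: "is_mono A (ker_arr A g)" using ker_mono g by (simp add: Hom_iff)
  \<comment> \<open>The identity lifts through the kernel of a zero map, so the kernel inclusion is
    invertible, with inverse \<open>s\<close>.\<close>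
  have "\<exists>!h. h \<in> Hom A x (cyc g) \<and> ker_arr A g \<cdot>\<^bsub>A\<^esub> h = Id A x"
    by (rule kernel_lift[OF ker_arr g id_hom[OF ob(2)]])
      (use g ob id_right[OF g] in \<open>simp_all add: Hom_iff g_def\<close>)
  then obtain s where s: "s \<in> Hom A x (cyc g)" "ker_arr A g \<cdot>\<^bsub>A\<^esub> s = Id A x" by blast
  have "ker_arr A g \<cdot>\<^bsub>A\<^esub> (s \<cdot>\<^bsub>A\<^esub> ker_arr A g) = ker_arr A g \<cdot>\<^bsub>A\<^esub> Id A (cyc g)"
    using comp_eq_reduce[OF s(2,1) k(1) k(1)] id_left[OF k(1)] id_right[OF k(1)] by simp
  then have s': "s \<cdot>\<^bsub>A\<^esub> ker_arr A g = Id A (cyc g)"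
    by (rule mono_cancel[OF m k(1) comp_hom[OF k(1) s(1)] id_hom[OF kob(1)]])
  have bl: "boundary_lift A f g = Zero A a (cyc g)"
  proof (rule mono_cancel[OF m k(1) _ zero_hom[OF ob(1) kob(1)]])
    show "boundary_lift A f g \<in> Hom A a (cyc g)" using b fx by simp
    show "ker_arr A g \<cdot>\<^bsub>A\<^esub> boundary_lift A f g = ker_arr A g \<cdot>\<^bsub>A\<^esub> Zero A a (cyc g)"
      using b(2) comp_zero_right[OF k(1) ob(1)] by (simp add: f_def)
  qed
  \<comment> \<open>The boundary lift is zero, so the identity of the cycles factors through its
    cokernel; the factor \<open>r\<close> inverts the projection.\<close>
  have "\<exists>!h. h \<in> Hom A (Cod A (homology_proj A f g)) (cyc g) \<and> h \<cdot>\<^bsub>A\<^esub> homology_proj A f g = Id A (cyc g)"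
    by (rule cokernel_lift[OF p(1) b(1) id_hom[OF kob(1)]])
      (use b bl fx id_left[OF zero_hom[OF ob(1) kob(1)]] in simp)
  then obtain r where r: "r \<in> Hom A (homology_obj A f g) (cyc g)" "r \<cdot>\<^bsub>A\<^esub> homology_proj A f g = Id A (cyc
      g)"
    unfolding homology_obj_def by blast
  have "(homology_proj A f g \<cdot>\<^bsub>A\<^esub> r) \<cdot>\<^bsub>A\<^esub> homology_proj A f g = Id A (homology_obj A f g) \<cdot>\<^bsub>A\<^esub>
      homology_proj A f g"
    using comp_assoc[OF p(2) r(1) p(2)] r(2) id_left[OF p(2)] id_right[OF p(2)] by simp
  then have r': "homology_proj A f g \<cdot>\<^bsub>A\<^esub> r = Id A (homology_obj A f g)"
    by (rule epi_cancel[OF p(4,2) comp_hom[OF r(1) p(2)] id_hom[OF homology_obj_ob[OF z]]])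
  have "is_iso A (ker_arr A g \<cdot>\<^bsub>A\<^esub> r)"
  proof (rule is_isoI[OF comp_hom[OF r(1) k(1)] comp_hom[OF s(1) p(2)]])
    show "homology_proj A f g \<cdot>\<^bsub>A\<^esub> s \<cdot>\<^bsub>A\<^esub> (ker_arr A g \<cdot>\<^bsub>A\<^esub> r) = Id A (homology_obj A f g)"
      using comp_assoc[OF comp_hom[OF r(1) k(1)] s(1) p(2)] comp_eq_reduce[OF s' k(1) s(1) r(1)] id_left[OF
          r(1)] r'
      by simp
    show "ker_arr A g \<cdot>\<^bsub>A\<^esub> r \<cdot>\<^bsub>A\<^esub> (homology_proj A f g \<cdot>\<^bsub>A\<^esub> s) = Id A x"
      using comp_assoc[OF comp_hom[OF s(1) p(2)] r(1) k(1)] comp_eq_reduce[OF r(2) p(2) r(1) s(1)]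
          id_left[OF s(1)] s(2)
      by simp
  qed
  moreover have "ker_arr A g \<cdot>\<^bsub>A\<^esub> r \<cdot>\<^bsub>A\<^esub> homology_proj A f g = ker_arr A g"
    using comp_assoc[OF p(2) r(1) k(1)] r(2) id_right[OF k(1)] by simp
  ultimately have "\<exists>h. h \<in> Hom A (homology_obj A f g) x \<and> is_iso A h \<and> h \<cdot>\<^bsub>A\<^esub> homology_proj A f g = ker_arr
      A g"
    using comp_hom[OF r(1) k(1)] by blast
  from someI_ex[OF this] show "homology_of_zero a x b \<in> Hom A (homology_obj A f g) x"
    "is_iso A (homology_of_zero a x b)"
    "homology_of_zero a x b \<cdot>\<^bsub>A\<^esub> homology_proj A f g = ker_arr A g"
    unfolding homology_of_zero_def f_def g_def by auto
qed

text \<open>Cancelling the epic projection reduces naturality to the defining square of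
  \<open>cycles_map\<close>.\<close>

lemma homology_of_zero_natural:
  assumes ob: "a \<in> Ob A" "x \<in> Ob A" "b \<in> Ob A" "a' \<in> Ob A" "x' \<in> Ob A" "b' \<in> Ob A" and \<phi>: "\<phi> \<in> Hom A x x'"
  shows "\<phi> \<cdot>\<^bsub>A\<^esub> homology_of_zero a x b =
     homology_of_zero a' x' b' \<cdot>\<^bsub>A\<^esub>
       homology_map A (Zero A a x) (Zero A x b) (Zero A a' x') (Zero A x' b') \<phi>"
proof -
  let ?f = "Zero A a x" and ?g = "Zero A x b" and ?f' = "Zero A a' x'" and ?g' = "Zero A x' b'"
  have z: "composable_zero A ?f ?g" "composable_zero A ?f' ?g'" using composable_zero_zero ob by auto
  have m: "chain_map_at A ?f ?g ?f' ?g' \<phi>"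
    unfolding chain_map_at_def
  proof (intro conjI)
    show "\<exists>\<chi>\<in>Hom A (Dom A ?f) (Dom A ?f'). ?f' \<cdot>\<^bsub>A\<^esub> \<chi> = \<phi> \<cdot>\<^bsub>A\<^esub> ?f"
      by (rule bexI[of _ "Zero A a a'"]) (use ob \<phi> in \<open>auto simp: Hom_iff\<close>)
    show "\<exists>\<psi>\<in>Hom A (Cod A ?g) (Cod A ?g'). ?g' \<cdot>\<^bsub>A\<^esub> \<phi> = \<psi> \<cdot>\<^bsub>A\<^esub> ?g"
      by (rule bexI[of _ "Zero A b b'"]) (use ob \<phi> in \<open>auto simp: Hom_iff\<close>)
  qed (use ob \<phi> in \<open>auto simp: Hom_iff\<close>)
  note h = homology_of_zero[OF ob(1-3)] and h' = homology_of_zero[OF ob(4-6)]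
  note c = chain_map_cycles[OF z m] and H = homology_map[OF z m]
  note p = homology_proj[OF z(1)] and p' = homology_proj[OF z(2)]
  show ?thesis
  proof (rule epi_cancel[OF p(4,2) comp_hom[OF h(1) \<phi>] comp_hom[OF H(1) h'(1)]])
    show "\<phi> \<cdot>\<^bsub>A\<^esub> homology_of_zero a x b \<cdot>\<^bsub>A\<^esub> homology_proj A ?f ?g = homology_of_zero a' x' b' \<cdot>\<^bsub>A\<^esub>
      homology_map A ?f ?g ?f' ?g' \<phi> \<cdot>\<^bsub>A\<^esub> homology_proj A ?f ?g"
      using comp_assoc[OF p(2) h(1) \<phi>] h(3) comp_assoc[OF p(2) H(1) h'(1)] H(2)
        comp_eq_reduce[OF h'(3) p'(2) h'(1) c(1)] c(2) by simp
  qed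
qed

end

section \<open>Functors, functor categories and adjunctions\<close>

lemma functorD:
  assumes "is_functor C D F"
  shows "category C" "category D"
    "\<And>x. x \<in> Ob C \<Longrightarrow> obj_map F x \<in> Ob D"
    "\<And>f x y. f \<in> Hom C x y \<Longrightarrow> arr_map F f \<in> Hom D (obj_map F x) (obj_map F y)"
    "\<And>x. x \<in> Ob C \<Longrightarrow> arr_map F (Id C x) = Id D (obj_map F x)"
    "\<And>x y z f g. f \<in> Hom C x y \<Longrightarrow> g \<in> Hom C y z \<Longrightarrow> arr_map F (g \<cdot>\<^bsub>C\<^esub> f) = arr_map F g \<cdot>\<^bsub>D\<^esub> arr_map F f"
    "obj_map F \<in> extensional (Ob C)" "arr_map F \<in> extensional (Ar C)"
  using assms unfolding is_functor_def by (auto simp: Hom_iff PiE_def)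

lemma functorI:
  assumes "category C" "category D"
    "\<And>x. x \<in> Ob C \<Longrightarrow> obj_map F x \<in> Ob D"
    "\<And>f. f \<in> Ar C \<Longrightarrow> arr_map F f \<in> Hom D (obj_map F (Dom C f)) (obj_map F (Cod C f))"
    "\<And>x. x \<in> Ob C \<Longrightarrow> arr_map F (Id C x) = Id D (obj_map F x)"
    "\<And>x y z f g. f \<in> Hom C x y \<Longrightarrow> g \<in> Hom C y z \<Longrightarrow> arr_map F (g \<cdot>\<^bsub>C\<^esub> f) = arr_map F g \<cdot>\<^bsub>D\<^esub> arr_map F f"
    "obj_map F \<in> extensional (Ob C)" "arr_map F \<in> extensional (Ar C)"
  shows "is_functor C D F"
  using assms unfolding is_functor_def by (auto simp: Hom_iff PiE_def)

lemma functor_comp: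
  assumes F: "is_functor C D F" and G: "is_functor D E G"
  shows "is_functor C E (functor_comp C G F)"
proof -
  note f = functorD[OF F] and g = functorD[OF G]
  interpret C: category C by (rule f)
  interpret D: category D by (rule f)
  have "arr_map F h \<in> Ar D" if "h \<in> Ar C" for h using f(4)[of h "Dom C h" "Cod C h"] that by (simp add:
      Hom_iff)
  note ar = this
  show ?thesis
  proof (rule functorI)
    show "arr_map (functor_comp C G F) h
         \<in> Hom E (obj_map (functor_comp C G F) (Dom C h)) (obj_map (functor_comp C G F) (Cod C h))"
      if "h \<in> Ar C" for h
      using g(4)[OF f(4)[of h "Dom C h" "Cod C h"]] that by (simp add: functor_comp_def compose_def Hom_iff)
    show "arr_map (functor_comp C G F) (h' \<cdot>\<^bsub>C\<^esub> h)
         = arr_map (functor_comp C G F) h' \<cdot>\<^bsub>E\<^esub> arr_map (functor_comp C G F) h"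
      if "h \<in> Hom C x y" "h' \<in> Hom C y z" for x y z h h'
      using g(6)[OF f(4)[OF that(1)] f(4)[OF that(2)]] f(6)[OF that] that C.comp_hom[OF that]
      by (simp add: functor_comp_def compose_def Hom_iff)
  qed (use f g in \<open>auto simp: functor_comp_def compose_def\<close>)
qed

lemma functor_comp_apply:
  "x \<in> Ob C \<Longrightarrow> obj_map (functor_comp C G F) x = obj_map G (obj_map F x)"
  "f \<in> Ar C \<Longrightarrow> arr_map (functor_comp C G F) f = arr_map G (arr_map F f)"
  by (simp_all add: functor_comp_def compose_def)

lemma functor_comp_assoc:
  assumes "is_functor B C F"
  shows "functor_comp B H (functor_comp B G F) = functor_comp B (functor_comp C H G) F"
  using functorD(3,4)[OF assms]
  by (auto simp: functor_comp_def compose_def fun_eq_iff restrict_def Hom_iff)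

abbreviation component :: "'f \<times> ('x \<Rightarrow> 'a) \<times> 'f \<Rightarrow> 'x \<Rightarrow> 'a" where
  "component t \<equiv> fst (snd t)"

lemma nat_transI:
  assumes "is_functor C D F" "is_functor C D G" "\<eta> \<in> extensional (Ob C)"
    "\<And>x. x \<in> Ob C \<Longrightarrow> \<eta> x \<in> Hom D (obj_map F x) (obj_map G x)"
    "\<And>x y f. f \<in> Hom C x y \<Longrightarrow> \<eta> y \<cdot>\<^bsub>D\<^esub> arr_map F f = arr_map G f \<cdot>\<^bsub>D\<^esub> \<eta> x"
  shows "nat_trans C D F G \<eta>"
  using assms unfolding nat_trans_def by auto

lemma nat_transD:
  assumes "nat_trans C D F G \<eta>"
  shows "is_functor C D F" "is_functor C D G" "\<eta> \<in> extensional (Ob C)"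
    "\<And>x. x \<in> Ob C \<Longrightarrow> \<eta> x \<in> Hom D (obj_map F x) (obj_map G x)"
    "\<And>x y f. f \<in> Hom C x y \<Longrightarrow> \<eta> y \<cdot>\<^bsub>D\<^esub> arr_map F f = arr_map G f \<cdot>\<^bsub>D\<^esub> \<eta> x"
  using assms unfolding nat_trans_def by auto

lemma Ob_fun_cat: "F \<in> Ob (fun_cat C D) \<longleftrightarrow> is_functor C D F"
  by (simp add: fun_cat_def)

lemma Hom_fun_cat:
  "t \<in> Hom (fun_cat C D) F G \<longleftrightarrow> (\<exists>\<eta>. t = (F, \<eta>, G) \<and> nat_trans C D F G \<eta>)"
  by (auto simp: Hom_iff fun_cat_def)

lemma fun_cat_HomI: "nat_trans C D F G \<eta> \<Longrightarrow> (F, \<eta>, G) \<in> Hom (fun_cat C D) F G"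
  by (simp add: Hom_fun_cat)

lemma fun_cat_HomD:
  assumes "t \<in> Hom (fun_cat C D) F G"
  shows "is_functor C D F" "is_functor C D G"
    "\<And>x. x \<in> Ob C \<Longrightarrow> component t x \<in> Hom D (obj_map F x) (obj_map G x)"
    "\<And>x y f. f \<in> Hom C x y \<Longrightarrow> component t y \<cdot>\<^bsub>D\<^esub> arr_map F f = arr_map G f \<cdot>\<^bsub>D\<^esub> component t x"
    "t = (F, component t, G)" "nat_trans C D F G (component t)"
  using assms nat_transD unfolding Hom_fun_cat by fastforce+

lemma fun_cat_eqI:
  assumes "t \<in> Hom (fun_cat C D) F G" "s \<in> Hom (fun_cat C D) F G"
    "\<And>x. x \<in> Ob C \<Longrightarrow> component t x = component s x"
  shows "t = s"
proof -
  have "component t = component s"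
    using assms(3) nat_transD(3)[OF fun_cat_HomD(6)] assms(1,2) by (meson extensionalityI)
  then show ?thesis using fun_cat_HomD(5)[OF assms(1)] fun_cat_HomD(5)[OF assms(2)] by simp
qed

lemma component_comp:
  "x \<in> Ob C \<Longrightarrow> component (s \<cdot>\<^bsub>fun_cat C D\<^esub> t) x = component s x \<cdot>\<^bsub>D\<^esub> component t x"
  by (auto simp: fun_cat_def split: prod.splits)

lemma component_id: "x \<in> Ob C \<Longrightarrow> component (Id (fun_cat C D) F) x = Id D (obj_map F x)"
  by (simp add: fun_cat_def)

lemma component_plus:
  "x \<in> Ob C \<Longrightarrow> component (Plus (fun_cat C D) s t) x = Plus D (component s x) (component t x)"
  by (auto simp: fun_cat_def split: prod.splits)

lemma component_zero:
  "x \<in> Ob C \<Longrightarrow> component (Zero (fun_cat C D) F G) x = Zero D (obj_map F x) (obj_map G x)"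
  by (simp add: fun_cat_def)

lemma fun_cat_category:
  assumes "category C" "category D" shows "category (fun_cat C D)"
proof -
  interpret C: category C by fact
  interpret D: category D by fact
  let ?N = "fun_cat C D"
  have id: "Id ?N F \<in> Hom ?N F F" if "is_functor C D F" for F
  proof -
    note f = functorD[OF that]
    have "nat_trans C D F F (\<lambda>x\<in>Ob C. Id D (obj_map F x))"
      by (rule nat_transI[OF that that])
        (use f D.id_hom D.id_left[OF f(4)] D.id_right[OF f(4)] C.Hom_Ob in auto)
    then show ?thesis using fun_cat_HomI by (force simp: fun_cat_def)
  qed
  have comp: "s \<cdot>\<^bsub>?N\<^esub> t \<in> Hom ?N F H" if t: "t \<in> Hom ?N F G" and s: "s \<in> Hom ?N G H" for F G H s t
  proof -
    note t' = fun_cat_HomD[OF t] and s' = fun_cat_HomD[OF s]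
    have "nat_trans C D F H (\<lambda>x\<in>Ob C. component s x \<cdot>\<^bsub>D\<^esub> component t x)"
    proof (rule nat_transI[OF t'(1) s'(2)])
      fix x y f assume f: "f \<in> Hom C x y"
      note xy = C.Hom_Ob[OF f]
      note h = functorD(4)[OF t'(1) f] functorD(4)[OF t'(2) f] functorD(4)[OF s'(2) f]
        t'(3)[OF xy(1)] t'(3)[OF xy(2)] s'(3)[OF xy(1)] s'(3)[OF xy(2)]
      have "component s y \<cdot>\<^bsub>D\<^esub> component t y \<cdot>\<^bsub>D\<^esub> arr_map F f = component s y \<cdot>\<^bsub>D\<^esub> (arr_map G f \<cdot>\<^bsub>D\<^esub>
          component t x)"
        using D.comp_assoc[OF h(1,5,7)] t'(4)[OF f] by simp
      also have "\<dots> = arr_map H f \<cdot>\<^bsub>D\<^esub> (component s x \<cdot>\<^bsub>D\<^esub> component t x)"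
        using D.comp_eq_reduce[OF s'(4)[OF f] h(2,7,4)] D.comp_assoc[OF h(4,6,3)] by simp
      finally show "(\<lambda>x\<in>Ob C. component s x \<cdot>\<^bsub>D\<^esub> component t x) y \<cdot>\<^bsub>D\<^esub> arr_map F f =
        arr_map H f \<cdot>\<^bsub>D\<^esub> (\<lambda>x\<in>Ob C. component s x \<cdot>\<^bsub>D\<^esub> component t x) x" using xy by simp
    qed (use D.comp_hom[OF t'(3) s'(3)] in auto)
    moreover obtain \<eta> \<theta> where "t = (F, \<eta>, G)" "s = (G, \<theta>, H)" using t s by (auto simp: Hom_fun_cat)
    then have "s \<cdot>\<^bsub>?N\<^esub> t = (F, (\<lambda>x\<in>Ob C. component s x \<cdot>\<^bsub>D\<^esub> component t x), H)"
      by (simp add: fun_cat_def)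
    ultimately show ?thesis using fun_cat_HomI by simp
  qed
  show ?thesis
  proof
    fix f assume "f \<in> Ar ?N"
    then have "f \<in> Hom ?N (Dom ?N f) (Cod ?N f)" by (simp add: Hom_iff)
    from fun_cat_HomD[OF this] show "Dom ?N f \<in> Ob ?N" "Cod ?N f \<in> Ob ?N" by (simp_all add: Ob_fun_cat)
  next
    fix F assume "F \<in> Ob ?N" then show "Id ?N F \<in> Hom ?N F F" using id by (simp add: Ob_fun_cat)
  next
    fix f F G assume f: "f \<in> Hom ?N F G"
    note f' = fun_cat_HomD[OF f]
    show "f \<cdot>\<^bsub>?N\<^esub> Id ?N F = f"
      by (rule fun_cat_eqI[OF comp[OF id f] f])
        (use f' D.id_right[OF f'(3)] in \<open>auto simp: component_comp component_id\<close>)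
    show "Id ?N G \<cdot>\<^bsub>?N\<^esub> f = f"
      by (rule fun_cat_eqI[OF comp[OF f id] f])
        (use f' D.id_left[OF f'(3)] in \<open>auto simp: component_comp component_id\<close>)
  next
    fix f g h F G H K assume f: "f \<in> Hom ?N F G" and g: "g \<in> Hom ?N G H" and h: "h \<in> Hom ?N H K"
    show "h \<cdot>\<^bsub>?N\<^esub> g \<cdot>\<^bsub>?N\<^esub> f = h \<cdot>\<^bsub>?N\<^esub> (g \<cdot>\<^bsub>?N\<^esub> f)"
      by (rule fun_cat_eqI[OF comp[OF f comp[OF g h]] comp[OF comp[OF f g] h]])
        (use D.comp_assoc[OF fun_cat_HomD(3)[OF f] fun_cat_HomD(3)[OF g] fun_cat_HomD(3)[OF h]]
          in \<open>auto simp: component_comp\<close>)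
  qed (rule comp)
qed

text \<open>The group axioms are inherited componentwise. The negative is natural because
  composition commutes with negation on either side.\<close>

lemma fun_cat_preadditive:
  assumes "category C" "preadditive D" shows "preadditive (fun_cat C D)"
proof -
  interpret C: category C by fact
  interpret D: preadditive D by fact
  let ?N = "fun_cat C D"
  interpret N: category ?N by (rule fun_cat_category) unfold_locales
  have zero: "Zero ?N F G \<in> Hom ?N F G" if F: "is_functor C D F" and G: "is_functor C D G" for F G
  proof -
    note f = functorD[OF F] and g = functorD[OF G]
    have "nat_trans C D F G (\<lambda>x\<in>Ob C. Zero D (obj_map F x) (obj_map G x))"
      by (rule nat_transI[OF F G])
        (use f(3) g(3) D.zero_hom D.comp_zero_right[OF g(4)] D.comp_zero_left[OF f(4)] C.Hom_Ob in auto)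
    then show ?thesis using fun_cat_HomI by (force simp: fun_cat_def)
  qed
  have plus: "Plus ?N s t \<in> Hom ?N F G" if t: "t \<in> Hom ?N F G" and s: "s \<in> Hom ?N F G" for F G s t
  proof -
    note t' = fun_cat_HomD[OF t] and s' = fun_cat_HomD[OF s]
    have "nat_trans C D F G (\<lambda>x\<in>Ob C. Plus D (component s x) (component t x))"
    proof (rule nat_transI[OF t'(1,2)])
      fix x y f assume f: "f \<in> Hom C x y"
      note xy = C.Hom_Ob[OF f]
      show "(\<lambda>x\<in>Ob C. Plus D (component s x) (component t x)) y \<cdot>\<^bsub>D\<^esub> arr_map F f =
        arr_map G f \<cdot>\<^bsub>D\<^esub> (\<lambda>x\<in>Ob C. Plus D (component s x) (component t x)) x"
        using xy D.comp_plus_left[OF functorD(4)[OF t'(1) f] s'(3) t'(3)]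
          D.comp_plus_right[OF s'(3) t'(3) functorD(4)[OF t'(2) f]] t'(4)[OF f] s'(4)[OF f] by simp
    qed (use D.plus_hom[OF s'(3) t'(3)] in auto)
    moreover obtain \<eta> \<theta> where "t = (F, \<eta>, G)" "s = (F, \<theta>, G)" using t s by (auto simp: Hom_fun_cat)
    then have "Plus ?N s t = (F, (\<lambda>x\<in>Ob C. Plus D (component s x) (component t x)), G)"
      by (simp add: fun_cat_def)
    ultimately show ?thesis using fun_cat_HomI by simp
  qed
  show ?thesis
  proof (intro preadditive.intro preadditive_axioms.intro)
    fix F G assume FG: "F \<in> Ob ?N" "G \<in> Ob ?N"
    then have FG': "is_functor C D F" "is_functor C D G" by (auto simp: Ob_fun_cat)
    have cg: "comm_group (hom_group D (obj_map F x) (obj_map G x))" if "x \<in> Ob C" for x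
      by (rule D.hom_comm_group) (use functorD(3)[OF FG'(1) that] functorD(3)[OF FG'(2) that] in auto)
    have ac: "Plus D (Plus D a b) c = Plus D a (Plus D b c)" "Plus D a b = Plus D b a"
      if "x \<in> Ob C" "a \<in> Hom D (obj_map F x) (obj_map G x)" "b \<in> Hom D (obj_map F x) (obj_map G x)"
        "c \<in> Hom D (obj_map F x) (obj_map G x)" for x a b c
    proof -
      interpret comm_group "hom_group D (obj_map F x) (obj_map G x)" by (rule cg[OF that(1)])
      show "Plus D (Plus D a b) c = Plus D a (Plus D b c)" "Plus D a b = Plus D b a"
        using m_assoc[of a b c] m_comm[of a b] that by auto
    qed
    show "comm_group (hom_group ?N F G)"
    proof (rule comm_groupI, goal_cases)
      case (1 s t) then show ?case using plus by (auto simp: hom_group_def)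
    next
      case 2 then show ?case using zero FG' by (auto simp: hom_group_def)
    next
      case (3 a b c)
      then have h: "a \<in> Hom ?N F G" "b \<in> Hom ?N F G" "c \<in> Hom ?N F G" by (auto simp: hom_group_def)
      have "Plus ?N (Plus ?N a b) c = Plus ?N a (Plus ?N b c)"
        by (rule fun_cat_eqI[OF plus[OF h(3) plus[OF h(2,1)]] plus[OF plus[OF h(3,2)] h(1)]])
          (use ac(1) fun_cat_HomD(3)[OF h(1)] fun_cat_HomD(3)[OF h(2)] fun_cat_HomD(3)[OF h(3)]
            in \<open>auto simp: component_plus\<close>)
      then show ?case by (simp add: hom_group_def)
    next
      case (4 a b)
      then have h: "a \<in> Hom ?N F G" "b \<in> Hom ?N F G" by (auto simp: hom_group_def)
      have "Plus ?N a b = Plus ?N b a"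
        by (rule fun_cat_eqI[OF plus[OF h(2,1)] plus[OF h(1,2)]])
          (use ac(2)[OF _ fun_cat_HomD(3)[OF h(1)] fun_cat_HomD(3)[OF h(2)] fun_cat_HomD(3)[OF h(1)]]
            in \<open>auto simp: component_plus\<close>)
      then show ?case by (simp add: hom_group_def)
    next
      case (5 a)
      then have h: "a \<in> Hom ?N F G" by (auto simp: hom_group_def)
      have "Plus ?N (Zero ?N F G) a = a"
        by (rule fun_cat_eqI[OF plus[OF h zero[OF FG']] h])
          (use D.plus_zero[OF fun_cat_HomD(3)[OF h]] in \<open>auto simp: component_plus component_zero\<close>)
      then show ?case by (simp add: hom_group_def)
    next
      case (6 a)
      then have h: "a \<in> Hom ?N F G" by (auto simp: hom_group_def)
      note h' = fun_cat_HomD[OF h]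
      let ?n = "\<lambda>x\<in>Ob C. D.neg (obj_map F x) (obj_map G x) (component a x)"
      have "nat_trans C D F G ?n"
      proof (rule nat_transI[OF FG'])
        fix x y f assume f: "f \<in> Hom C x y"
        note xy = C.Hom_Ob[OF f]
        show "?n y \<cdot>\<^bsub>D\<^esub> arr_map F f = arr_map G f \<cdot>\<^bsub>D\<^esub> ?n x"
          using xy D.comp_neg_left[OF functorD(4)[OF FG'(1) f] h'(3)]
            D.comp_neg_right[OF h'(3) functorD(4)[OF FG'(2) f]] h'(4)[OF f] by simp
      qed (use D.neg_hom[OF h'(3)] in auto)
      then have n: "(F, ?n, G) \<in> Hom ?N F G" by (rule fun_cat_HomI)
      have "Plus ?N (F, ?n, G) a = Zero ?N F G"
        by (rule fun_cat_eqI[OF plus[OF h n] zero[OF FG']])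
          (use D.plus_neg[OF h'(3)] in \<open>auto simp: component_plus component_zero\<close>)
      then show ?case using n by (auto simp: hom_group_def)
    qed
  next
    fix f F G g g' H assume f: "f \<in> Hom ?N F G" and g: "g \<in> Hom ?N G H" "g' \<in> Hom ?N G H"
    show "Plus ?N g g' \<cdot>\<^bsub>?N\<^esub> f = Plus ?N (g \<cdot>\<^bsub>?N\<^esub> f) (g' \<cdot>\<^bsub>?N\<^esub> f)"
      by (rule fun_cat_eqI[OF N.comp_hom[OF f plus[OF g(2,1)]] plus[OF N.comp_hom[OF f g(2)] N.comp_hom[OF
          f g(1)]]])
        (use D.comp_plus_left[OF fun_cat_HomD(3)[OF f] fun_cat_HomD(3)[OF g(1)] fun_cat_HomD(3)[OF g(2)]]
          in \<open>auto simp: component_plus component_comp\<close>)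
  next
    fix f F G f' g H assume f: "f \<in> Hom ?N F G" "f' \<in> Hom ?N F G" and g: "g \<in> Hom ?N G H"
    show "g \<cdot>\<^bsub>?N\<^esub> Plus ?N f f' = Plus ?N (g \<cdot>\<^bsub>?N\<^esub> f) (g \<cdot>\<^bsub>?N\<^esub> f')"
      by (rule fun_cat_eqI[OF N.comp_hom[OF plus[OF f(2,1)] g] plus[OF N.comp_hom[OF f(2) g] N.comp_hom[OF
          f(1) g]]])
        (use D.comp_plus_right[OF fun_cat_HomD(3)[OF f(1)] fun_cat_HomD(3)[OF f(2)] fun_cat_HomD(3)[OF g]]
          in \<open>auto simp: component_plus component_comp\<close>)
  qed unfold_locales
qed

lemma fun_cat_iso_component:
  assumes "is_iso (fun_cat C D) t" "t \<in> Hom (fun_cat C D) F G" "x \<in> Ob C"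
  shows "is_iso D (component t x)"
proof -
  have c: "category C" "category D" using fun_cat_HomD(1)[OF assms(2)] functorD by auto
  interpret N: category "fun_cat C D" by (rule fun_cat_category[OF c])
  interpret D: category D by fact
  obtain s where s: "s \<in> Hom (fun_cat C D) G F" "s \<cdot>\<^bsub>fun_cat C D\<^esub> t = Id (fun_cat C D) F"
    "t \<cdot>\<^bsub>fun_cat C D\<^esub> s = Id (fun_cat C D) G" using N.is_isoE[OF assms(1,2)] .
  show ?thesis
    by (rule D.is_isoI[OF fun_cat_HomD(3)[OF assms(2,3)] fun_cat_HomD(3)[OF s(1) assms(3)]])
      (use s(2,3) assms(3) in \<open>simp_all flip: component_comp add: component_id\<close>)
qed

definition zero_functor :: "('o1, 'a1, 'z1) cat_scheme \<Rightarrow> ('o2, 'a2, 'z2) cat_scheme \<Rightarrow> ('o1, 'a1, 'o2, 'a2)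
    fctr" where
  "zero_functor C D = \<lparr>obj_map = (\<lambda>x\<in>Ob C. zero_obj D), arr_map = (\<lambda>f\<in>Ar C. Id D (zero_obj D))\<rparr>"

lemma (in category) zero_obj:
  assumes "\<exists>z. is_zero_obj C z" shows "is_zero_obj C (zero_obj C)" "zero_obj C \<in> Ob C"
proof -
  show "is_zero_obj C (zero_obj C)" unfolding zero_obj_def by (rule someI_ex[OF assms])
  then show "zero_obj C \<in> Ob C" by (simp add: is_zero_obj_def)
qed

lemma zero_functor:
  assumes "category C" "category D" "\<exists>z. is_zero_obj D z" shows "is_functor C D (zero_functor C D)"
proof -
  interpret C: category C by fact
  interpret D: category D by fact
  note z = D.zero_obj[OF assms(3)]
  show ?thesis
  proof (rule functorI[OF assms(1,2)])
    show "arr_map (zero_functor C D) (g \<cdot>\<^bsub>C\<^esub> f) = arr_map (zero_functor C D) g \<cdot>\<^bsub>D\<^esub> arr_map (zero_functor C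
        D) f"
      if "f \<in> Hom C x y" "g \<in> Hom C y w" for x y w f g
      using that z by (simp add: zero_functor_def Hom_iff)
  qed (use z D.id_hom in \<open>auto simp: zero_functor_def\<close>)
qed

lemma fun_cat_zero_objI:
  assumes "category C" "preadditive D" "is_functor C D F" "\<And>x. x \<in> Ob C \<Longrightarrow> is_zero_obj D (obj_map F x)"
  shows "is_zero_obj (fun_cat C D) F"
proof -
  interpret N: preadditive "fun_cat C D" by (rule fun_cat_preadditive[OF assms(1,2)])
  interpret D: preadditive D by fact
  have F: "F \<in> Ob (fun_cat C D)" using assms(3) by (simp add: Ob_fun_cat)
  have "Id (fun_cat C D) F = Zero (fun_cat C D) F F"
    by (rule fun_cat_eqI[OF N.id_hom[OF F] N.zero_hom[OF F F]])
      (use assms(4) functorD(3)[OF assms(3)] D.zero_obj_iff in \<open>simp add: component_id component_zero\<close>)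
  then show ?thesis using N.zero_obj_iff[OF F] by simp
qed

lemma fun_cat_zero_objD:
  assumes "category C" "preadditive D" "is_zero_obj (fun_cat C D) F" "x \<in> Ob C"
  shows "is_zero_obj D (obj_map F x)"
proof -
  interpret N: preadditive "fun_cat C D" by (rule fun_cat_preadditive[OF assms(1,2)])
  interpret D: preadditive D by fact
  have F: "F \<in> Ob (fun_cat C D)" using assms(3) by (simp add: is_zero_obj_def)
  then have "obj_map F x \<in> Ob D" using functorD(3) assms(4) by (metis Ob_fun_cat)
  moreover have "Id (fun_cat C D) F = Zero (fun_cat C D) F F" using N.zero_obj_iff[OF F] assms(3) by simp
  then have "Id D (obj_map F x) = Zero D (obj_map F x) (obj_map F x)"
    using component_id[OF assms(4), of D F] component_zero[OF assms(4), of D F F] by simp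
  ultimately show ?thesis using D.zero_obj_iff by simp
qed

lemma fun_cat_zero_obj:
  assumes "category C" "preadditive D" "\<exists>z. is_zero_obj D z"
  shows "is_zero_obj (fun_cat C D) (zero_functor C D)"
proof -
  interpret D: preadditive D by fact
  show ?thesis
    by (rule fun_cat_zero_objI[OF assms(1,2) zero_functor[OF assms(1) D.category_axioms assms(3)]])
      (use D.zero_obj[OF assms(3)] in \<open>simp add: zero_functor_def\<close>)
qed

subsection \<open>Units of adjunctions\<close>

text \<open>An adjunction presented by universal arrows. In this form, without the hom-set
  bijection, the fibrewise coproduct can be recognised as a value of the Kan extension.\<close>

definition is_unit :: "('o1, 'a1, 'z1) cat_scheme \<Rightarrow> ('o2, 'a2, 'z2) cat_scheme \<Rightarrow> ('o1, 'a1, 'o2, 'a2) fctr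
      \<Rightarrow> ('o2, 'a2, 'o1, 'a1) fctr \<Rightarrow> ('o1 \<Rightarrow> 'a1) \<Rightarrow> bool" where
  "is_unit C D L G \<eta> \<longleftrightarrow>
    (\<forall>x\<in>Ob C. \<eta> x \<in> Hom C x (obj_map G (obj_map L x))) \<and>
    (\<forall>x\<in>Ob C. \<forall>y\<in>Ob D. \<forall>f\<in>Hom C x (obj_map G y). \<exists>!h. h \<in> Hom D (obj_map L x) y \<and> arr_map G h \<cdot>\<^bsub>C\<^esub> \<eta> x = f)
        \<and>
    (\<forall>x x'. \<forall>f\<in>Hom C x x'. arr_map G (arr_map L f) \<cdot>\<^bsub>C\<^esub> \<eta> x = \<eta> x' \<cdot>\<^bsub>C\<^esub> f)"

text \<open>The Yoneda argument: with \<open>\<eta> x\<close> the image of the identity of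
  \<open>L x\<close>, naturality forces \<open>\<phi> x y h\<close> to be \<open>arr_map G h\<close>
  composed with \<open>\<eta> x\<close>.\<close>

lemma left_adjoint_unit:
  assumes "is_left_adjoint C D L G" shows "\<exists>\<eta>. is_unit C D L G \<eta>"
proof -
  have L: "is_functor C D L" and G: "is_functor D C G" using assms by (auto simp: is_left_adjoint_def)
  note l = functorD[OF L] and g = functorD[OF G]
  interpret C: category C by (rule l)
  interpret D: category D by (rule l)
  obtain \<phi> where bij: "\<And>x y. x \<in> Ob C \<Longrightarrow> y \<in> Ob D \<Longrightarrow> bij_betw (\<phi> x y) (Hom D (obj_map L x) y) (Hom C x
      (obj_map G y))"
    and nat: "\<And>x x' y y' f g h. f \<in> Hom C x' x \<Longrightarrow> g \<in> Hom D y y' \<Longrightarrow> h \<in> Hom D (obj_map L x) y \<Longrightarrow>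
              \<phi> x' y' (g \<cdot>\<^bsub>D\<^esub> h \<cdot>\<^bsub>D\<^esub> arr_map L f) = arr_map G g \<cdot>\<^bsub>C\<^esub> \<phi> x y h \<cdot>\<^bsub>C\<^esub> f"
    using assms unfolding is_left_adjoint_def by blast
  define \<eta> where "\<eta> = (\<lambda>x. \<phi> x (obj_map L x) (Id D (obj_map L x)))"
  have hom: "\<phi> x y h \<in> Hom C x (obj_map G y)" if "x \<in> Ob C" "h \<in> Hom D (obj_map L x) y" for x y h
    using bij[OF that(1) D.Hom_Ob(2)[OF that(2)]] that(2) by (auto simp: bij_betw_def)
  have \<eta>: "\<eta> x \<in> Hom C x (obj_map G (obj_map L x))" if "x \<in> Ob C" for x
    unfolding \<eta>_def by (rule hom[OF that D.id_hom[OF l(3)[OF that]]])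
  have e: "\<phi> x y h = arr_map G h \<cdot>\<^bsub>C\<^esub> \<eta> x" if x: "x \<in> Ob C" and h: "h \<in> Hom D (obj_map L x) y" for x y h
  proof -
    have "\<phi> x y (h \<cdot>\<^bsub>D\<^esub> Id D (obj_map L x) \<cdot>\<^bsub>D\<^esub> arr_map L (Id C x)) = arr_map G h \<cdot>\<^bsub>C\<^esub> \<eta> x \<cdot>\<^bsub>C\<^esub> Id C x"
      unfolding \<eta>_def by (rule nat[OF C.id_hom[OF x] h D.id_hom[OF l(3)[OF x]]])
    then show ?thesis using l(5)[OF x] D.id_right[OF h] C.id_right[OF C.comp_hom[OF \<eta>[OF x] g(4)[OF h]]] by
        simp
  qed
  have "\<exists>!h. h \<in> Hom D (obj_map L x) y \<and> arr_map G h \<cdot>\<^bsub>C\<^esub> \<eta> x = f"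
    if x: "x \<in> Ob C" "y \<in> Ob D" "f \<in> Hom C x (obj_map G y)" for x y f
  proof -
    have "\<exists>!h. h \<in> Hom D (obj_map L x) y \<and> \<phi> x y h = f"
    proof -
      obtain h where h: "h \<in> Hom D (obj_map L x) y" "\<phi> x y h = f"
        using bij_betw_imp_surj_on[OF bij[OF x(1,2)]] x(3) by (metis imageE)
      show ?thesis
        by (rule ex1I[of _ h]) (use h bij_betw_imp_inj_on[OF bij[OF x(1,2)]] in \<open>auto dest: inj_onD\<close>)
    qed
    then show ?thesis by (simp add: e[OF x(1)] cong: conj_cong)
  qed
  moreover have "arr_map G (arr_map L f) \<cdot>\<^bsub>C\<^esub> \<eta> x = \<eta> x' \<cdot>\<^bsub>C\<^esub> f" if f: "f \<in> Hom C x x'" for x x' f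
  proof -
    note x = C.Hom_Ob[OF f]
    have "\<phi> x (obj_map L x') (Id D (obj_map L x') \<cdot>\<^bsub>D\<^esub> Id D (obj_map L x') \<cdot>\<^bsub>D\<^esub> arr_map L f)
        = arr_map G (Id D (obj_map L x')) \<cdot>\<^bsub>C\<^esub> \<eta> x' \<cdot>\<^bsub>C\<^esub> f"
      unfolding \<eta>_def by (rule nat[OF f D.id_hom[OF l(3)[OF x(2)]] D.id_hom[OF l(3)[OF x(2)]]])
    then show ?thesis using e[OF x(1) l(4)[OF f]] D.id_left[OF D.id_hom[OF l(3)[OF x(2)]]] D.id_left[OF
        l(4)[OF f]]
        g(5)[OF l(3)[OF x(2)]] C.id_left[OF \<eta>[OF x(2)]] by simp
  qed
  ultimately show ?thesis unfolding is_unit_def using \<eta> by blast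
qed

text \<open>Universal arrows chosen object by object assemble to an adjoint: the value on an arrow
  is forced by naturality of the unit, and functoriality follows from uniqueness.\<close>

lemma left_adjointI:
  assumes G: "is_functor D C G"
    and ex: "\<And>x. x \<in> Ob C \<Longrightarrow> \<exists>l \<eta>. l \<in> Ob D \<and> \<eta> \<in> Hom C x (obj_map G l) \<and>
      (\<forall>y\<in>Ob D. \<forall>f\<in>Hom C x (obj_map G y). \<exists>!h. h \<in> Hom D l y \<and> arr_map G h \<cdot>\<^bsub>C\<^esub> \<eta> = f)"
  shows "\<exists>L. is_left_adjoint C D L G"
proof -
  note g = functorD[OF G]
  interpret C: category C by (rule g)
  interpret D: category D by (rule g)
  have "\<exists>p. fst p \<in> Ob D \<and> snd p \<in> Hom C x (obj_map G (fst p)) \<and>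
      (\<forall>y\<in>Ob D. \<forall>f\<in>Hom C x (obj_map G y). \<exists>!h. h \<in> Hom D (fst p) y \<and> arr_map G h \<cdot>\<^bsub>C\<^esub> snd p = f)"
    if "x \<in> Ob C" for x using ex[OF that] by auto
  then obtain P where P: "\<And>x. x \<in> Ob C \<Longrightarrow> fst (P x) \<in> Ob D \<and> snd (P x) \<in> Hom C x (obj_map G (fst (P x))) \<and>
      (\<forall>y\<in>Ob D. \<forall>f\<in>Hom C x (obj_map G y). \<exists>!h. h \<in> Hom D (fst (P x)) y \<and> arr_map G h \<cdot>\<^bsub>C\<^esub> snd (P x) = f)"
    by metis
  define l \<eta> where "l = (\<lambda>x. fst (P x))" and "\<eta> = (\<lambda>x. snd (P x))"
  have l: "l x \<in> Ob D" and \<eta>: "\<eta> x \<in> Hom C x (obj_map G (l x))" if "x \<in> Ob C" for x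
    using P[OF that] by (auto simp: l_def \<eta>_def)
  have u: "\<exists>!h. h \<in> Hom D (l x) y \<and> arr_map G h \<cdot>\<^bsub>C\<^esub> \<eta> x = f"
    if "x \<in> Ob C" "y \<in> Ob D" "f \<in> Hom C x (obj_map G y)" for x y f
    using P[OF that(1)] that(2,3) by (auto simp: l_def \<eta>_def)
  have ueq: "h = h'" if "x \<in> Ob C" "h \<in> Hom D (l x) y" "h' \<in> Hom D (l x) y"
    "arr_map G h \<cdot>\<^bsub>C\<^esub> \<eta> x = arr_map G h' \<cdot>\<^bsub>C\<^esub> \<eta> x" for x y h h'
    using u[OF that(1) D.Hom_Ob(2)[OF that(2)] C.comp_hom[OF \<eta>[OF that(1)] g(4)[OF that(2)]]] that(2-) by
        (elim ex1E) metis
  define L where "L = \<lparr>obj_map = (\<lambda>x\<in>Ob C. l x),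
     arr_map = (\<lambda>f\<in>Ar C. THE h. h \<in> Hom D (l (Dom C f)) (l (Cod C f)) \<and>
                  arr_map G h \<cdot>\<^bsub>C\<^esub> \<eta> (Dom C f) = \<eta> (Cod C f) \<cdot>\<^bsub>C\<^esub> f)\<rparr>"
  have Lo: "obj_map L x = l x" if "x \<in> Ob C" for x using that by (simp add: L_def)
  have La: "arr_map L f \<in> Hom D (l x) (l x')" "arr_map G (arr_map L f) \<cdot>\<^bsub>C\<^esub> \<eta> x = \<eta> x' \<cdot>\<^bsub>C\<^esub> f"
    if f: "f \<in> Hom C x x'" for f x x'
    using theI'[OF u[OF C.Hom_Ob(1)[OF f] l C.comp_hom[OF f \<eta>]]] C.Hom_Ob[OF f] f by (auto simp: L_def
        Hom_iff)
  have L: "is_functor C D L"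
  proof (rule functorI)
    fix f assume "f \<in> Ar C" then show "arr_map L f \<in> Hom D (obj_map L (Dom C f)) (obj_map L (Cod C f))"
      using La(1)[of f "Dom C f" "Cod C f"] Lo by (simp add: Hom_iff)
  next
    fix x assume x: "x \<in> Ob C"
    show "arr_map L (Id C x) = Id D (obj_map L x)" unfolding Lo[OF x]
      by (rule ueq[OF x La(1)[OF C.id_hom[OF x]] D.id_hom[OF l[OF x]]])
        (use La(2)[OF C.id_hom[OF x]] g(5)[OF l[OF x]] C.id_left[OF \<eta>[OF x]] C.id_right[OF \<eta>[OF x]] in simp)
  next
    fix x y z f h assume f: "f \<in> Hom C x y" and h: "h \<in> Hom C y z"
    note x = C.Hom_Ob[OF f] C.Hom_Ob[OF h]
    show "arr_map L (h \<cdot>\<^bsub>C\<^esub> f) = arr_map L h \<cdot>\<^bsub>D\<^esub> arr_map L f"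
    proof (rule ueq[OF x(1) La(1)[OF C.comp_hom[OF f h]] D.comp_hom[OF La(1)[OF f] La(1)[OF h]]])
      note a = g(4)[OF La(1)[OF f]] g(4)[OF La(1)[OF h]]
      have "arr_map G (arr_map L h \<cdot>\<^bsub>D\<^esub> arr_map L f) \<cdot>\<^bsub>C\<^esub> \<eta> x = arr_map G (arr_map L h) \<cdot>\<^bsub>C\<^esub> (\<eta> y \<cdot>\<^bsub>C\<^esub> f)"
        using g(6)[OF La(1)[OF f] La(1)[OF h]] C.comp_assoc[OF \<eta>[OF x(1)] a] La(2)[OF f] by simp
      also have "\<dots> = \<eta> z \<cdot>\<^bsub>C\<^esub> (h \<cdot>\<^bsub>C\<^esub> f)"
        using C.comp_eq_reduce[OF La(2)[OF h] \<eta>[OF x(2)] a(2) f] C.comp_assoc[OF f h \<eta>[OF x(4)]] by simp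
      finally show "arr_map G (arr_map L (h \<cdot>\<^bsub>C\<^esub> f)) \<cdot>\<^bsub>C\<^esub> \<eta> x = arr_map G (arr_map L h \<cdot>\<^bsub>D\<^esub> arr_map L f)
          \<cdot>\<^bsub>C\<^esub> \<eta> x"
        using La(2)[OF C.comp_hom[OF f h]] by simp
    qed
  qed (use g l in \<open>auto simp: L_def\<close>)
  let ?\<phi> = "\<lambda>x y h. arr_map G h \<cdot>\<^bsub>C\<^esub> \<eta> x"
  have "bij_betw (?\<phi> x y) (Hom D (obj_map L x) y) (Hom C x (obj_map G y))" if x: "x \<in> Ob C" "y \<in> Ob D" for
      x y
    unfolding bij_betw_def
  proof (intro conjI equalityI subsetI)
    show "inj_on (?\<phi> x y) (Hom D (obj_map L x) y)"
      using ueq[OF x(1)] unfolding Lo[OF x(1)] inj_on_def by blast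
    show "f \<in> Hom C x (obj_map G y)" if "f \<in> ?\<phi> x y ` Hom D (obj_map L x) y" for f
      using that C.comp_hom[OF \<eta>[OF x(1)] g(4)] Lo[OF x(1)] by auto
    show "f \<in> ?\<phi> x y ` Hom D (obj_map L x) y" if "f \<in> Hom C x (obj_map G y)" for f
      using u[OF x that] Lo[OF x(1)] by auto
  qed
  moreover have "?\<phi> x' y' (k \<cdot>\<^bsub>D\<^esub> h \<cdot>\<^bsub>D\<^esub> arr_map L f) = arr_map G k \<cdot>\<^bsub>C\<^esub> ?\<phi> x y h \<cdot>\<^bsub>C\<^esub> f"
    if f: "f \<in> Hom C x' x" and k: "k \<in> Hom D y y'" and h: "h \<in> Hom D (obj_map L x) y" for x x' y y' f k h
  proof -
    note x = C.Hom_Ob[OF f]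
    have h: "h \<in> Hom D (l x) y" using h Lo[OF x(2)] by simp
    note a = g(4)[OF La(1)[OF f]] g(4)[OF h] g(4)[OF k]
    have "arr_map G (k \<cdot>\<^bsub>D\<^esub> h \<cdot>\<^bsub>D\<^esub> arr_map L f) \<cdot>\<^bsub>C\<^esub> \<eta> x'
        = (arr_map G k \<cdot>\<^bsub>C\<^esub> arr_map G h \<cdot>\<^bsub>C\<^esub> arr_map G (arr_map L f)) \<cdot>\<^bsub>C\<^esub> \<eta> x'"
      using g(6)[OF La(1)[OF f] D.comp_hom[OF h k]] g(6)[OF h k] by simp
    also have "\<dots> = arr_map G k \<cdot>\<^bsub>C\<^esub> arr_map G h \<cdot>\<^bsub>C\<^esub> (\<eta> x \<cdot>\<^bsub>C\<^esub> f)"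
      using C.comp_assoc[OF \<eta>[OF x(1)] a(1) C.comp_hom[OF a(2,3)]] La(2)[OF f] by simp
    also have "\<dots> = arr_map G k \<cdot>\<^bsub>C\<^esub> (arr_map G h \<cdot>\<^bsub>C\<^esub> \<eta> x) \<cdot>\<^bsub>C\<^esub> f"
      using C.comp_assoc[OF f \<eta>[OF x(2)] C.comp_hom[OF a(2,3)]] C.comp_assoc[OF \<eta>[OF x(2)] a(2,3)] by simp
    finally show ?thesis .
  qed
  ultimately have "is_left_adjoint C D L G"
    unfolding is_left_adjoint_def using L G by (intro conjI exI[of _ ?\<phi>] ballI allI) auto
  then show ?thesis ..
qed

lemma unit_eq:
  assumes "is_functor C D L" "is_functor D C G" "is_unit C D L G \<eta>"
    "x \<in> Ob C" "h \<in> Hom D (obj_map L x) y" "h' \<in> Hom D (obj_map L x) y"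
    "arr_map G h \<cdot>\<^bsub>C\<^esub> \<eta> x = arr_map G h' \<cdot>\<^bsub>C\<^esub> \<eta> x"
  shows "h = h'"
proof -
  interpret C: category C by (rule functorD(1)[OF assms(1)])
  interpret D: category D by (rule functorD(2)[OF assms(1)])
  have "arr_map G h \<cdot>\<^bsub>C\<^esub> \<eta> x \<in> Hom C x (obj_map G y)"
    using C.comp_hom[OF _ functorD(4)[OF assms(2,5)]] assms(3,4) unfolding is_unit_def by blast
  then have "\<exists>!k. k \<in> Hom D (obj_map L x) y \<and> arr_map G k \<cdot>\<^bsub>C\<^esub> \<eta> x = arr_map G h \<cdot>\<^bsub>C\<^esub> \<eta> x"
    using assms(3,4) D.Hom_Ob(2)[OF assms(5)] unfolding is_unit_def by simp
  then show ?thesis using assms(5-) by (elim ex1E) metis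
qed

text \<open>A map out of \<open>L x\<close> is determined by its image under \<open>G\<close>
  composed with the unit, and there the two candidates agree because \<open>G\<close> is
  additive.\<close>

lemma left_adjoint_additive:
  assumes "is_left_adjoint C D L G" "preadditive C" "preadditive D" "additive_functor D C G"
  shows "additive_functor C D L"
proof -
  interpret C: preadditive C by fact
  interpret D: preadditive D by fact
  obtain \<eta> where u: "is_unit C D L G \<eta>" using left_adjoint_unit[OF assms(1)] ..
  have L: "is_functor C D L" and G: "is_functor D C G" using assms by (auto simp: is_left_adjoint_def)
  have Gadd: "arr_map G (Plus D a b) = Plus C (arr_map G a) (arr_map G b)" if "a \<in> Hom D x y" "b \<in> Hom D x
      y" for a b x y
    using assms(4) that unfolding additive_functor_def by blast
  have "arr_map L (Plus C f g) = Plus D (arr_map L f) (arr_map L g)" if f: "f \<in> Hom C x y" and g: "g \<in> Hom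
      C x y" for f g x y
  proof (rule unit_eq[OF L G u C.Hom_Ob(1)[OF f] functorD(4)[OF L C.plus_hom[OF f g]]
        D.plus_hom[OF functorD(4)[OF L f] functorD(4)[OF L g]]])
    have n: "arr_map G (arr_map L f) \<cdot>\<^bsub>C\<^esub> \<eta> x = \<eta> y \<cdot>\<^bsub>C\<^esub> f" if "f \<in> Hom C x y" for f
      using u that unfolding is_unit_def by blast
    have e: "\<eta> z \<in> Hom C z (obj_map G (obj_map L z))" if "z \<in> Ob C" for z using u that unfolding
        is_unit_def by blast
    note fL = functorD(4)[OF L f] functorD(4)[OF L g]
    show "arr_map G (arr_map L (Plus C f g)) \<cdot>\<^bsub>C\<^esub> \<eta> x = arr_map G (Plus D (arr_map L f) (arr_map L g)) \<cdot>\<^bsub>C\<^esub>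
        \<eta> x"
      using n[OF f] n[OF g] n[OF C.plus_hom[OF f g]] C.comp_plus_right[OF f g e[OF C.Hom_Ob(2)[OF f]]]
        Gadd[OF fL] C.comp_plus_left[OF e[OF C.Hom_Ob(1)[OF f]] functorD(4)[OF G fL(1)] functorD(4)[OF G
            fL(2)]] by simp
  qed
  then show ?thesis unfolding additive_functor_def using L by blast
qed

section \<open>Exactness in functor categories is pointwise\<close>

context preadditive begin

lemma kernel_unique:
  assumes "is_kernel A k f" "is_kernel A k' f" "f \<in> Hom A x y"
  obtains i where "i \<in> Hom A (Dom A k') (Dom A k)" "is_iso A i" "k \<cdot>\<^bsub>A\<^esub> i = k'"
proof -
  note a = kernel_hom[OF assms(1,3)] and b = kernel_hom[OF assms(2,3)]
  obtain i where i: "i \<in> Hom A (Dom A k') (Dom A k)" "k \<cdot>\<^bsub>A\<^esub> i = k'"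
    using kernel_lift[OF assms(1,3) b] by blast
  obtain j where j: "j \<in> Hom A (Dom A k) (Dom A k')" "k' \<cdot>\<^bsub>A\<^esub> j = k"
    using kernel_lift[OF assms(2,3) a] by blast
  note ob = Hom_Ob(1)[OF a(1)] Hom_Ob(1)[OF b(1)]
  have "is_iso A i"
  proof (rule is_isoI[OF i(1) j(1)])
    show "j \<cdot>\<^bsub>A\<^esub> i = Id A (Dom A k')"
      by (rule mono_cancel[OF kernel_mono[OF assms(2)] b(1) comp_hom[OF i(1) j(1)] id_hom[OF ob(2)]])
        (use comp_assoc[OF i(1) j(1) b(1)] i j id_right[OF b(1)] in simp)
    show "i \<cdot>\<^bsub>A\<^esub> j = Id A (Dom A k)"
      by (rule mono_cancel[OF kernel_mono[OF assms(1)] a(1) comp_hom[OF j(1) i(1)] id_hom[OF ob(1)]])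
        (use comp_assoc[OF j(1) i(1) a(1)] i j id_right[OF a(1)] in simp)
  qed
  then show ?thesis using that i by blast
qed

lemma cokernel_unique:
  assumes "is_cokernel A k f" "is_cokernel A k' f" "f \<in> Hom A x y"
  obtains i where "i \<in> Hom A (Cod A k') (Cod A k)" "is_iso A i" "i \<cdot>\<^bsub>A\<^esub> k' = k"
proof -
  note a = cokernel_hom[OF assms(1,3)] and b = cokernel_hom[OF assms(2,3)]
  obtain i where i: "i \<in> Hom A (Cod A k') (Cod A k)" "i \<cdot>\<^bsub>A\<^esub> k' = k"
    using cokernel_lift[OF assms(2,3) a] by blast
  obtain j where j: "j \<in> Hom A (Cod A k) (Cod A k')" "j \<cdot>\<^bsub>A\<^esub> k = k'"
    using cokernel_lift[OF assms(1,3) b] by blast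
  note ob = Hom_Ob(2)[OF a(1)] Hom_Ob(2)[OF b(1)]
  have "is_iso A i"
  proof (rule is_isoI[OF i(1) j(1)])
    show "j \<cdot>\<^bsub>A\<^esub> i = Id A (Cod A k')"
      by (rule epi_cancel[OF cokernel_epi[OF assms(2)] b(1) comp_hom[OF i(1) j(1)] id_hom[OF ob(2)]])
        (use comp_assoc[OF b(1) i(1) j(1)] i j id_left[OF b(1)] in simp)
    show "i \<cdot>\<^bsub>A\<^esub> j = Id A (Cod A k)"
      by (rule epi_cancel[OF cokernel_epi[OF assms(1)] a(1) comp_hom[OF j(1) i(1)] id_hom[OF ob(1)]])
        (use comp_assoc[OF a(1) j(1) i(1)] i j id_left[OF a(1)] in simp)
  qed
  then show ?thesis using that i by blast
qed

end

lemma (in abelian_category) fun_cat_preadditive': "category C \<Longrightarrow> preadditive (fun_cat C A)"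
  by (rule fun_cat_preadditive, assumption, unfold_locales)

text \<open>Lifts exist at every object, and the monic components of \<open>k\<close> force them to
  be natural.\<close>

lemma (in abelian_category) kernel_if_pointwise:
  assumes C: "category C" and k: "k \<in> Hom (fun_cat C A) K G" and t: "t \<in> Hom (fun_cat C A) G H"
    and ker: "\<And>x. x \<in> Ob C \<Longrightarrow> is_kernel A (component k x) (component t x)"
  shows "is_kernel (fun_cat C A) k t"
proof -
  interpret C: category C by (rule C)
  interpret N: preadditive "fun_cat C A" by (rule fun_cat_preadditive'[OF C])
  let ?N = "fun_cat C A"
  note k' = fun_cat_HomD[OF k] and t' = fun_cat_HomD[OF t]
  note cancel = mono_cancel[OF kernel_mono[OF ker] k'(3)]
  show ?thesis
  proof (rule N.kernelI[OF t k])
    show "t \<cdot>\<^bsub>?N\<^esub> k = Zero ?N K H"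
      by (rule fun_cat_eqI[OF N.comp_hom[OF k t] N.zero_hom])
        (use k' t' kernel_hom(2)[OF ker t'(3)] in \<open>auto simp: Ob_fun_cat component_comp component_zero
            Hom_iff\<close>)
    show "is_mono ?N k" unfolding is_mono_def
    proof (intro conjI allI ballI impI)
      fix V a b assume ab: "a \<in> Hom ?N V (Dom ?N k)" "b \<in> Hom ?N V (Dom ?N k)" and e: "k \<cdot>\<^bsub>?N\<^esub> a = k \<cdot>\<^bsub>?N\<^esub>
          b"
      have ab: "a \<in> Hom ?N V K" "b \<in> Hom ?N V K" using ab k by (auto simp: Hom_iff)
      have e': "component k x \<cdot>\<^bsub>A\<^esub> component a x = component k x \<cdot>\<^bsub>A\<^esub> component b x" if "x \<in> Ob C" for x
        using arg_cong[OF e, of "\<lambda>s. component s x"] that by (simp add: component_comp)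
      show "a = b"
        by (rule fun_cat_eqI[OF ab], rule cancel)
          (use fun_cat_HomD(3)[OF ab(1)] fun_cat_HomD(3)[OF ab(2)] e' in simp_all)
    qed (use k in \<open>simp add: Hom_iff\<close>)
    fix V g assume g: "g \<in> Hom ?N V G" and tg: "t \<cdot>\<^bsub>?N\<^esub> g = Zero ?N V H"
    note g' = fun_cat_HomD[OF g]
    have "\<exists>h. h \<in> Hom A (obj_map V x) (obj_map K x) \<and> component k x \<cdot>\<^bsub>A\<^esub> h = component g x" if x: "x \<in> Ob
        C" for x
    proof -
      have "component t x \<cdot>\<^bsub>A\<^esub> component g x = Zero A (obj_map V x) (obj_map H x)"
        using component_comp[OF x, of A t g] tg component_zero[OF x, of A V H] by simp
      from kernel_lift[OF ker[OF x] t'(3)[OF x] g'(3)[OF x] this] k'(3)[OF x] show ?thesis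
        by (auto simp: Hom_iff)
    qed
    then obtain h where h: "\<And>x. x \<in> Ob C \<Longrightarrow> h x \<in> Hom A (obj_map V x) (obj_map K x)"
      "\<And>x. x \<in> Ob C \<Longrightarrow> component k x \<cdot>\<^bsub>A\<^esub> h x = component g x" by metis
    have "nat_trans C A V K (\<lambda>x\<in>Ob C. h x)"
    proof (rule nat_transI[OF g'(1) k'(1)])
      fix x y f assume f: "f \<in> Hom C x y"
      note xy = C.Hom_Ob[OF f]
      note V = functorD(4)[OF g'(1) f] and K = functorD(4)[OF k'(1) f] and G = functorD(4)[OF t'(1) f]
      have "component k y \<cdot>\<^bsub>A\<^esub> (h y \<cdot>\<^bsub>A\<^esub> arr_map V f) = component k y \<cdot>\<^bsub>A\<^esub> (arr_map K f \<cdot>\<^bsub>A\<^esub> h x)"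
        using comp_eq_reduce[OF h(2)[OF xy(2)] h(1)[OF xy(2)] k'(3)[OF xy(2)] V] g'(4)[OF f] h(2)[OF xy(1)]
          comp_eq_reduce[OF k'(4)[OF f] K k'(3)[OF xy(2)] h(1)[OF xy(1)]]
          comp_assoc[OF h(1)[OF xy(1)] k'(3)[OF xy(1)] G] by simp
      then show "(\<lambda>x\<in>Ob C. h x) y \<cdot>\<^bsub>A\<^esub> arr_map V f = arr_map K f \<cdot>\<^bsub>A\<^esub> (\<lambda>x\<in>Ob C. h x) x"
        using cancel[OF xy(2) xy(2) comp_hom[OF V h(1)[OF xy(2)]] comp_hom[OF h(1)[OF xy(1)] K]] xy by simp
    qed (use h in auto)
    then have hh: "(V, (\<lambda>x\<in>Ob C. h x), K) \<in> Hom ?N V K" by (rule fun_cat_HomI)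
    have "k \<cdot>\<^bsub>?N\<^esub> (V, (\<lambda>x\<in>Ob C. h x), K) = g"
      by (rule fun_cat_eqI[OF N.comp_hom[OF hh k] g]) (use h in \<open>simp add: component_comp\<close>)
    then show "\<exists>h\<in>Hom ?N V K. k \<cdot>\<^bsub>?N\<^esub> h = g" using hh by blast
  qed
qed

text \<open>Here the epic components of \<open>k\<close> force the factorizations at the single
  objects to be natural.\<close>

lemma (in abelian_category) cokernel_if_pointwise:
  assumes C: "category C" and t: "t \<in> Hom (fun_cat C A) G H" and k: "k \<in> Hom (fun_cat C A) H K"
    and ker: "\<And>x. x \<in> Ob C \<Longrightarrow> is_cokernel A (component k x) (component t x)"
  shows "is_cokernel (fun_cat C A) k t"
proof -
  interpret C: category C by (rule C)
  interpret N: preadditive "fun_cat C A" by (rule fun_cat_preadditive'[OF C])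
  let ?N = "fun_cat C A"
  note k' = fun_cat_HomD[OF k] and t' = fun_cat_HomD[OF t]
  note cancel = epi_cancel[OF cokernel_epi[OF ker] k'(3)]
  show ?thesis
  proof (rule N.cokernelI[OF t k])
    show "k \<cdot>\<^bsub>?N\<^esub> t = Zero ?N G K"
      by (rule fun_cat_eqI[OF N.comp_hom[OF t k] N.zero_hom])
        (use k' t' cokernel_hom(2)[OF ker t'(3)] in \<open>auto simp: Ob_fun_cat component_comp component_zero
            Hom_iff\<close>)
    show "is_epi ?N k" unfolding is_epi_def
    proof (intro conjI allI ballI impI)
      fix V a b assume ab: "a \<in> Hom ?N (Cod ?N k) V" "b \<in> Hom ?N (Cod ?N k) V" and e: "a \<cdot>\<^bsub>?N\<^esub> k = b \<cdot>\<^bsub>?N\<^esub>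
          k"
      have ab: "a \<in> Hom ?N K V" "b \<in> Hom ?N K V" using ab k by (auto simp: Hom_iff)
      have e': "component a x \<cdot>\<^bsub>A\<^esub> component k x = component b x \<cdot>\<^bsub>A\<^esub> component k x" if "x \<in> Ob C" for x
        using arg_cong[OF e, of "\<lambda>s. component s x"] that by (simp add: component_comp)
      show "a = b"
        by (rule fun_cat_eqI[OF ab], rule cancel)
          (use fun_cat_HomD(3)[OF ab(1)] fun_cat_HomD(3)[OF ab(2)] e' in simp_all)
    qed (use k in \<open>simp add: Hom_iff\<close>)
    fix V g assume g: "g \<in> Hom ?N H V" and tg: "g \<cdot>\<^bsub>?N\<^esub> t = Zero ?N G V"
    note g' = fun_cat_HomD[OF g]
    have "\<exists>h. h \<in> Hom A (obj_map K x) (obj_map V x) \<and> h \<cdot>\<^bsub>A\<^esub> component k x = component g x" if x: "x \<in> Ob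
        C" for x
    proof -
      have "component g x \<cdot>\<^bsub>A\<^esub> component t x = Zero A (obj_map G x) (obj_map V x)"
        using component_comp[OF x, of A g t] tg component_zero[OF x, of A G V] by simp
      from cokernel_lift[OF ker[OF x] t'(3)[OF x] g'(3)[OF x] this] k'(3)[OF x] show ?thesis
        by (auto simp: Hom_iff)
    qed
    then obtain h where h: "\<And>x. x \<in> Ob C \<Longrightarrow> h x \<in> Hom A (obj_map K x) (obj_map V x)"
      "\<And>x. x \<in> Ob C \<Longrightarrow> h x \<cdot>\<^bsub>A\<^esub> component k x = component g x" by metis
    have "nat_trans C A K V (\<lambda>x\<in>Ob C. h x)"
    proof (rule nat_transI[OF k'(2) g'(2)])
      fix x y f assume f: "f \<in> Hom C x y"
      note xy = C.Hom_Ob[OF f]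
      note V = functorD(4)[OF g'(2) f] and K = functorD(4)[OF k'(2) f] and H = functorD(4)[OF t'(2) f]
      have "(h y \<cdot>\<^bsub>A\<^esub> arr_map K f) \<cdot>\<^bsub>A\<^esub> component k x = (arr_map V f \<cdot>\<^bsub>A\<^esub> h x) \<cdot>\<^bsub>A\<^esub> component k x"
        using comp_assoc[OF k'(3)[OF xy(1)] K h(1)[OF xy(2)]] k'(4)[OF f, symmetric]
          comp_eq_reduce[OF h(2)[OF xy(2)] k'(3)[OF xy(2)] h(1)[OF xy(2)] H] g'(4)[OF f] h(2)[OF xy(1)]
          comp_assoc[OF k'(3)[OF xy(1)] h(1)[OF xy(1)] V] by simp
      then show "(\<lambda>x\<in>Ob C. h x) y \<cdot>\<^bsub>A\<^esub> arr_map K f = arr_map V f \<cdot>\<^bsub>A\<^esub> (\<lambda>x\<in>Ob C. h x) x"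
        using cancel[OF xy(1) xy(1) comp_hom[OF K h(1)[OF xy(2)]] comp_hom[OF h(1)[OF xy(1)] V]] xy by simp
    qed (use h in auto)
    then have hh: "(K, (\<lambda>x\<in>Ob C. h x), V) \<in> Hom ?N K V" by (rule fun_cat_HomI)
    have "(K, (\<lambda>x\<in>Ob C. h x), V) \<cdot>\<^bsub>?N\<^esub> k = g"
      by (rule fun_cat_eqI[OF N.comp_hom[OF k hh] g]) (use h in \<open>simp add: component_comp\<close>)
    then show "\<exists>h\<in>Hom ?N K V. h \<cdot>\<^bsub>?N\<^esub> k = g" using hh by blast
  qed
qed

text \<open>The unique maps between chosen kernels turn them into a functor, the functor laws
  following from monic inclusions. This provides something with which an abstract kernel in the
  functor category can be compared.\<close>

lemma (in abelian_category) ex_pointwise_kernel: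
  assumes C: "category C" and t: "t \<in> Hom (fun_cat C A) G H"
  obtains K k where "k \<in> Hom (fun_cat C A) K G" "\<And>x. x \<in> Ob C \<Longrightarrow> is_kernel A (component k x) (component t x)"
proof -
  interpret C: category C by (rule C)
  note t' = fun_cat_HomD[OF t]
  define \<kappa> where "\<kappa> = (\<lambda>x. ker_arr A (component t x))"
  have ker: "is_kernel A (\<kappa> x) (component t x)" if "x \<in> Ob C" for x
    unfolding \<kappa>_def by (rule ker_arr) (use t'(3)[OF that] in \<open>simp add: Hom_iff\<close>)
  note kh = kernel_hom[OF ker t'(3)]
  note cancel = mono_cancel[OF kernel_mono[OF ker] kh(1)]
  \<comment> \<open>\<open>cycles_map\<close> is the map induced on kernels by a commuting square,
    here the naturality square of \<open>t\<close>.\<close>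
  define m where "m = (\<lambda>f. cycles_map A (component t (Dom C f)) (component t (Cod C f)) (arr_map G f))"
  have m: "m f \<in> Hom A (Dom A (\<kappa> x)) (Dom A (\<kappa> y))" "\<kappa> y \<cdot>\<^bsub>A\<^esub> m f = arr_map G f \<cdot>\<^bsub>A\<^esub> \<kappa> x"
    if f: "f \<in> Hom C x y" for f x y
    using cycles_map[OF t'(3)[OF C.Hom_Ob(1)[OF f]] t'(3)[OF C.Hom_Ob(2)[OF f]] functorD(4)[OF t'(1) f]
      functorD(4)[OF t'(2) f] t'(4)[OF f]] f by (simp_all add: \<kappa>_def m_def Hom_iff)
  note G = functorD[OF t'(1)]
  define K where "K = \<lparr>obj_map = (\<lambda>x\<in>Ob C. Dom A (\<kappa> x)), arr_map = (\<lambda>f\<in>Ar C. m f)\<rparr>"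
  have Ko: "obj_map K x = Dom A (\<kappa> x)" if "x \<in> Ob C" for x using that by (simp add: K_def)
  have Ka: "arr_map K f = m f" if "f \<in> Hom C x y" for f x y using that by (simp add: K_def Hom_iff)
  have K: "is_functor C A K"
  proof (rule functorI)
    fix x assume x: "x \<in> Ob C"
    show "obj_map K x \<in> Ob A" using Hom_Ob[OF kh(1)[OF x x]] Ko[OF x] by simp
    have "m (Id C x) = Id A (Dom A (\<kappa> x))"
      by (rule cancel[OF x x x m(1)[OF C.id_hom[OF x]] id_hom])
        (use Hom_Ob[OF kh(1)[OF x x]] m(2)[OF C.id_hom[OF x]] G(5)[OF x] id_left[OF kh(1)[OF x x]]
          id_right[OF kh(1)[OF x x]] in simp_all)
    then show "arr_map K (Id C x) = Id A (obj_map K x)" using Ka[OF C.id_hom[OF x]] Ko[OF x] by simp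
  next
    fix f assume "f \<in> Ar C"
    then have "f \<in> Hom C (Dom C f) (Cod C f)" by (simp add: Hom_iff)
    from m(1)[OF this] Ka[OF this] Ko C.Hom_Ob[OF this]
    show "arr_map K f \<in> Hom A (obj_map K (Dom C f)) (obj_map K (Cod C f))" by simp
  next
    fix x y z f g assume f: "f \<in> Hom C x y" and g: "g \<in> Hom C y z"
    note x = C.Hom_Ob[OF f] C.Hom_Ob[OF g]
    have "m (g \<cdot>\<^bsub>C\<^esub> f) = m g \<cdot>\<^bsub>A\<^esub> m f"
    proof (rule cancel[OF x(4) x(4) x(4) m(1)[OF C.comp_hom[OF f g]] comp_hom[OF m(1)[OF f] m(1)[OF g]]])
      show "\<kappa> z \<cdot>\<^bsub>A\<^esub> m (g \<cdot>\<^bsub>C\<^esub> f) = \<kappa> z \<cdot>\<^bsub>A\<^esub> (m g \<cdot>\<^bsub>A\<^esub> m f)"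
        using m(2)[OF C.comp_hom[OF f g]] G(6)[OF f g] comp_eq_reduce[OF m(2)[OF g] m(1)[OF g] kh(1)[OF
            x(4) x(4)] m(1)[OF f]]
          comp_assoc[OF m(1)[OF f] kh(1)[OF x(2) x(2)] G(4)[OF g]] m(2)[OF f]
          comp_assoc[OF kh(1)[OF x(1) x(1)] G(4)[OF f] G(4)[OF g]] by simp
    qed
    then show "arr_map K (g \<cdot>\<^bsub>C\<^esub> f) = arr_map K g \<cdot>\<^bsub>A\<^esub> arr_map K f"
      using Ka[OF f] Ka[OF g] Ka[OF C.comp_hom[OF f g]] by simp
  qed (use G category_axioms in \<open>auto simp: K_def\<close>)
  have "nat_trans C A K G (\<lambda>x\<in>Ob C. \<kappa> x)"
  proof (rule nat_transI[OF K t'(1)])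
    fix x y f assume f: "f \<in> Hom C x y"
    show "(\<lambda>x\<in>Ob C. \<kappa> x) y \<cdot>\<^bsub>A\<^esub> arr_map K f = arr_map G f \<cdot>\<^bsub>A\<^esub> (\<lambda>x\<in>Ob C. \<kappa> x) x"
      using m(2)[OF f] Ka[OF f] C.Hom_Ob[OF f] by simp
  qed (use kh(1) Ko in auto)
  from that[OF fun_cat_HomI[OF this]] ker show ?thesis by simp
qed

lemma (in abelian_category) ex_pointwise_cokernel:
  assumes C: "category C" and t: "t \<in> Hom (fun_cat C A) G H"
  obtains K k where "k \<in> Hom (fun_cat C A) H K" "\<And>x. x \<in> Ob C \<Longrightarrow> is_cokernel A (component k x) (component t
      x)"
proof -
  interpret C: category C by (rule C)
  note t' = fun_cat_HomD[OF t]
  define \<kappa> where "\<kappa> = (\<lambda>x. coker_arr A (component t x))"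
  have ker: "is_cokernel A (\<kappa> x) (component t x)" if "x \<in> Ob C" for x
    unfolding \<kappa>_def by (rule coker_arr) (use t'(3)[OF that] in \<open>simp add: Hom_iff\<close>)
  note kh = cokernel_hom[OF ker t'(3)]
  note cancel = epi_cancel[OF cokernel_epi[OF ker] kh(1)]
  note G = functorD[OF t'(2)]
  have "\<exists>m. m \<in> Hom A (Cod A (\<kappa> x)) (Cod A (\<kappa> y)) \<and> m \<cdot>\<^bsub>A\<^esub> \<kappa> x = \<kappa> y \<cdot>\<^bsub>A\<^esub> arr_map H f"
    if f: "f \<in> Hom C x y" for f x y
  proof -
    note x = C.Hom_Ob[OF f]
    note T = functorD(4)[OF t'(1) f]
    have "(\<kappa> y \<cdot>\<^bsub>A\<^esub> arr_map H f) \<cdot>\<^bsub>A\<^esub> component t x = \<kappa> y \<cdot>\<^bsub>A\<^esub> (component t y \<cdot>\<^bsub>A\<^esub> arr_map G f)"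
      using comp_assoc[OF t'(3)[OF x(1)] G(4)[OF f] kh(1)[OF x(2) x(2)]] t'(4)[OF f] by simp
    also have "\<dots> = Zero A (obj_map G x) (Cod A (\<kappa> y))"
      using comp_eq_reduce[OF kh(2)[OF x(2) x(2)] t'(3)[OF x(2)] kh(1)[OF x(2) x(2)] T]
        comp_zero_left[OF T] Hom_Ob(2)[OF kh(1)[OF x(2) x(2)]] by simp
    finally show ?thesis
      using cokernel_lift[OF ker[OF x(1)] t'(3)[OF x(1)] comp_hom[OF G(4)[OF f] kh(1)[OF x(2) x(2)]]] by
          blast
  qed
  \<comment> \<open>Choice is made over all triples \<open>f x y\<close> at once; \<open>m\<close>
    then takes the actual source and target of \<open>f\<close>.\<close>
  then have "\<exists>M. \<forall>f x y. f \<in> Hom C x y \<longrightarrow> M f x y \<in> Hom A (Cod A (\<kappa> x)) (Cod A (\<kappa> y)) \<and> M f x y \<cdot>\<^bsub>A\<^esub> \<kappa> x = \<kappa>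
      y \<cdot>\<^bsub>A\<^esub> arr_map H f"
    by (intro choice allI) blast
  then obtain M where M: "\<And>f x y. f \<in> Hom C x y \<Longrightarrow> M f x y \<in> Hom A (Cod A (\<kappa> x)) (Cod A (\<kappa> y))"
    "\<And>f x y. f \<in> Hom C x y \<Longrightarrow> M f x y \<cdot>\<^bsub>A\<^esub> \<kappa> x = \<kappa> y \<cdot>\<^bsub>A\<^esub> arr_map H f" by blast
  define m where "m = (\<lambda>f. M f (Dom C f) (Cod C f))"
  have m: "m f \<in> Hom A (Cod A (\<kappa> x)) (Cod A (\<kappa> y))" "m f \<cdot>\<^bsub>A\<^esub> \<kappa> x = \<kappa> y \<cdot>\<^bsub>A\<^esub> arr_map H f"
    if f: "f \<in> Hom C x y" for f x y
    using M[OF f] f by (auto simp: m_def Hom_iff)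
  define K where "K = \<lparr>obj_map = (\<lambda>x\<in>Ob C. Cod A (\<kappa> x)), arr_map = (\<lambda>f\<in>Ar C. m f)\<rparr>"
  have Ko: "obj_map K x = Cod A (\<kappa> x)" if "x \<in> Ob C" for x using that by (simp add: K_def)
  have Ka: "arr_map K f = m f" if "f \<in> Hom C x y" for f x y using that by (simp add: K_def Hom_iff)
  have K: "is_functor C A K"
  proof (rule functorI)
    fix x assume x: "x \<in> Ob C"
    show "obj_map K x \<in> Ob A" using Hom_Ob[OF kh(1)[OF x x]] Ko[OF x] by simp
    have "m (Id C x) = Id A (Cod A (\<kappa> x))"
      by (rule cancel[OF x x x m(1)[OF C.id_hom[OF x]] id_hom])
        (use Hom_Ob[OF kh(1)[OF x x]] m(2)[OF C.id_hom[OF x]] G(5)[OF x] id_left[OF kh(1)[OF x x]]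
          id_right[OF kh(1)[OF x x]] in simp_all)
    then show "arr_map K (Id C x) = Id A (obj_map K x)" using Ka[OF C.id_hom[OF x]] Ko[OF x] by simp
  next
    fix f assume "f \<in> Ar C"
    then have "f \<in> Hom C (Dom C f) (Cod C f)" by (simp add: Hom_iff)
    from m(1)[OF this] Ka[OF this] Ko C.Hom_Ob[OF this]
    show "arr_map K f \<in> Hom A (obj_map K (Dom C f)) (obj_map K (Cod C f))" by simp
  next
    fix x y z f g assume f: "f \<in> Hom C x y" and g: "g \<in> Hom C y z"
    note x = C.Hom_Ob[OF f] C.Hom_Ob[OF g]
    have "m (g \<cdot>\<^bsub>C\<^esub> f) = m g \<cdot>\<^bsub>A\<^esub> m f"
    proof (rule cancel[OF x(1) x(1) x(1) m(1)[OF C.comp_hom[OF f g]] comp_hom[OF m(1)[OF f] m(1)[OF g]]])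
      show "m (g \<cdot>\<^bsub>C\<^esub> f) \<cdot>\<^bsub>A\<^esub> \<kappa> x = m g \<cdot>\<^bsub>A\<^esub> m f \<cdot>\<^bsub>A\<^esub> \<kappa> x"
        using m(2)[OF C.comp_hom[OF f g]] G(6)[OF f g] comp_assoc[OF kh(1)[OF x(1) x(1)] m(1)[OF f] m(1)[OF
            g]] m(2)[OF f]
          comp_eq_reduce[OF m(2)[OF g] kh(1)[OF x(2) x(2)] m(1)[OF g] G(4)[OF f]]
          comp_assoc[OF G(4)[OF f] G(4)[OF g] kh(1)[OF x(4) x(4)]] by simp
    qed
    then show "arr_map K (g \<cdot>\<^bsub>C\<^esub> f) = arr_map K g \<cdot>\<^bsub>A\<^esub> arr_map K f"
      using Ka[OF f] Ka[OF g] Ka[OF C.comp_hom[OF f g]] by simp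
  qed (use G category_axioms in \<open>auto simp: K_def\<close>)
  have "nat_trans C A H K (\<lambda>x\<in>Ob C. \<kappa> x)"
  proof (rule nat_transI[OF t'(2) K])
    fix x y f assume f: "f \<in> Hom C x y"
    show "(\<lambda>x\<in>Ob C. \<kappa> x) y \<cdot>\<^bsub>A\<^esub> arr_map H f = arr_map K f \<cdot>\<^bsub>A\<^esub> (\<lambda>x\<in>Ob C. \<kappa> x) x"
      using m(2)[OF f] Ka[OF f] C.Hom_Ob[OF f] by simp
  qed (use kh(1) Ko in auto)
  from that[OF fun_cat_HomI[OF this]] ker show ?thesis by simp
qed

text \<open>A kernel formed componentwise is a kernel in the functor category, hence isomorphic to
  \<open>k\<close>. Components of isomorphisms are isomorphisms, so the property passes to the
  components of \<open>k\<close>.\<close>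

lemma (in abelian_category) kernel_component:
  assumes C: "category C" and k: "is_kernel (fun_cat C A) k t" and x: "x \<in> Ob C"
  shows "is_kernel A (component k x) (component t x)"
proof -
  interpret N: preadditive "fun_cat C A" by (rule fun_cat_preadditive'[OF C])
  obtain G H where t: "t \<in> Hom (fun_cat C A) G H" using k by (auto simp: is_kernel_def Hom_iff)
  obtain K' k' where k': "k' \<in> Hom (fun_cat C A) K' G" "\<And>x. x \<in> Ob C \<Longrightarrow> is_kernel A (component k' x)
      (component t x)"
    using ex_pointwise_kernel[OF C t] by blast
  have kk: "k \<in> Hom (fun_cat C A) (Dom (fun_cat C A) k) G" using N.kernel_hom[OF k t] by simp
  obtain i where i: "i \<in> Hom (fun_cat C A) K' (Dom (fun_cat C A) k)" "is_iso (fun_cat C A) i" "k \<cdot>\<^bsub>fun_cat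
      C A\<^esub> i = k'"
    using N.kernel_unique[OF k kernel_if_pointwise[OF C k'(1) t k'(2)] t] k'(1) by (auto simp: Hom_iff)
  note h = fun_cat_HomD(3)[OF t x] fun_cat_HomD(3)[OF k'(1) x] fun_cat_HomD(3)[OF kk x] fun_cat_HomD(3)[OF
      i(1) x]
  note o = Hom_Ob[OF h(1)]
  show ?thesis
    by (rule kernel_transport[OF k'(2)[OF x] h(1,1,2,3,4) fun_cat_iso_component[OF i(2,1) x]
        id_hom[OF o(1)] iso_id[OF o(1)] id_hom[OF o(2)] iso_id[OF o(2)]])
      (use component_comp[OF x, of A k i] i(3) id_left[OF h(2)] id_left[OF h(1)] id_right[OF h(1)] in
          simp_all)
qed

lemma (in abelian_category) cokernel_component:
  assumes C: "category C" and k: "is_cokernel (fun_cat C A) k t" and x: "x \<in> Ob C"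
  shows "is_cokernel A (component k x) (component t x)"
proof -
  interpret N: preadditive "fun_cat C A" by (rule fun_cat_preadditive'[OF C])
  obtain G H where t: "t \<in> Hom (fun_cat C A) G H" using k by (auto simp: is_cokernel_def Hom_iff)
  obtain K' k' where k': "k' \<in> Hom (fun_cat C A) H K'" "\<And>x. x \<in> Ob C \<Longrightarrow> is_cokernel A (component k' x)
      (component t x)"
    using ex_pointwise_cokernel[OF C t] by blast
  have kk: "k \<in> Hom (fun_cat C A) H (Cod (fun_cat C A) k)" using N.cokernel_hom[OF k t] by simp
  obtain i where i: "i \<in> Hom (fun_cat C A) K' (Cod (fun_cat C A) k)" "is_iso (fun_cat C A) i" "i \<cdot>\<^bsub>fun_cat
      C A\<^esub> k' = k"
    using N.cokernel_unique[OF k cokernel_if_pointwise[OF C t k'(1) k'(2)] t] k'(1) by (auto simp: Hom_iff)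
  note h = fun_cat_HomD(3)[OF t x] fun_cat_HomD(3)[OF k'(1) x] fun_cat_HomD(3)[OF kk x] fun_cat_HomD(3)[OF
      i(1) x]
  note o = Hom_Ob[OF h(1)]
  show ?thesis
    by (rule cokernel_transport[OF k'(2)[OF x] h(1,1,2,3) id_hom[OF o(1)] iso_id[OF o(1)]
        id_hom[OF o(2)] iso_id[OF o(2)] h(4) fun_cat_iso_component[OF i(2,1) x]])
      (use component_comp[OF x, of A i k'] i(3) id_right[OF h(3)] id_left[OF h(1)] id_right[OF h(1)] in
          simp_all)
qed

section \<open>The simplex category\<close>

lemma op_cat_simps [simp]:
  "Ob (op_cat C) = Ob C" "Ar (op_cat C) = Ar C" "Dom (op_cat C) = Cod C" "Cod (op_cat C) = Dom C"
  "Id (op_cat C) = Id C" "g \<cdot>\<^bsub>op_cat C\<^esub> f = f \<cdot>\<^bsub>C\<^esub> g"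
  by (simp_all add: op_cat_def)

lemma Hom_op [simp]: "Hom (op_cat C) x y = Hom C y x"
  by (auto simp: Hom_def)

lemma op_category:
  assumes "category C" shows "category (op_cat C)"
proof -
  interpret category C by fact
  show ?thesis
    by unfold_locales (use id_hom comp_hom id_left id_right comp_assoc[symmetric] in simp_all)
qed

lemma functor_op:
  assumes "is_functor C D F" shows "is_functor (op_cat C) (op_cat D) F"
  using functorD[OF assms] op_category[OF functorD(1)[OF assms]] op_category[OF functorD(2)[OF assms]]
  by (intro functorI) (auto simp: Hom_iff)

lemma fctr_eqI:
  assumes "is_functor C D F" "is_functor C D G"
    "\<And>x. x \<in> Ob C \<Longrightarrow> obj_map F x = obj_map G x" "\<And>x. x \<in> Ar C \<Longrightarrow> arr_map F x = arr_map G x"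
  shows "F = G"
proof -
  have "obj_map F = obj_map G" "arr_map F = arr_map G"
    using assms functorD(7,8)[OF assms(1)] functorD(7,8)[OF assms(2)] by (meson extensionalityI)+
  then show ?thesis by simp
qed

lemma ord_cat_simps [simp]:
  "Ob (ord_cat n) = {..n}" "Ar (ord_cat n) = {(i, j). i \<le> j \<and> j \<le> n}" "Dom (ord_cat n) = fst"
  "Cod (ord_cat n) = snd" "Id (ord_cat n) = (\<lambda>i. (i, i))" "g \<cdot>\<^bsub>ord_cat n\<^esub> f = (fst f, snd g)"
  by (simp_all add: ord_cat_def)

lemma ord_category: "category (ord_cat n)"
  by unfold_locales (auto simp: Hom_iff)

lemma ord_mapsD:
  assumes "\<sigma> \<in> ord_maps n m"
  shows "i \<le> n \<Longrightarrow> \<sigma> i \<le> m" "i \<le> j \<Longrightarrow> j \<le> n \<Longrightarrow> \<sigma> i \<le> \<sigma> j" "\<sigma> \<in> extensional {..n}"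
  using assms by (auto simp: ord_maps_def mono_on_def PiE_def)

lemma ord_functor:
  assumes "\<sigma> \<in> ord_maps n m" shows "is_functor (ord_cat n) (ord_cat m) (ord_functor n \<sigma>)"
  using ord_mapsD[OF assms] ord_category
  by (intro functorI) (auto simp: Hom_iff ord_functor_def)

lemma ord_maps_compose:
  "\<sigma> \<in> ord_maps n m \<Longrightarrow> \<tau> \<in> ord_maps m k \<Longrightarrow> compose {..n} \<tau> \<sigma> \<in> ord_maps n k"
  by (auto simp: ord_maps_def mono_on_def compose_def PiE_def Pi_def)

lemma ord_maps_id: "(\<lambda>i\<in>{..n}. i) \<in> ord_maps n n"
  by (auto simp: ord_maps_def mono_on_def)

abbreviation pull :: "nat \<Rightarrow> (nat, nat \<times> nat, 'o, 'a) fctr \<Rightarrow> (nat \<Rightarrow> nat) \<Rightarrow> (nat, nat \<times> nat, 'o, 'a) fctr"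
    where
  "pull n f \<sigma> \<equiv> functor_comp (ord_cat n) f (ord_functor n \<sigma>)"

lemma ord_functor_compose:
  assumes "\<sigma> \<in> ord_maps n m" "\<tau> \<in> ord_maps m k"
  shows "functor_comp (ord_cat n) (ord_functor m \<tau>) (ord_functor n \<sigma>) = ord_functor n (compose {..n} \<tau> \<sigma>)"
  by (rule fctr_eqI[OF functor_comp[OF ord_functor[OF assms(1)] ord_functor[OF assms(2)]]
        ord_functor[OF ord_maps_compose[OF assms]]])
    (use ord_mapsD[OF assms(1)] in \<open>auto simp: functor_comp_def ord_functor_def compose_def\<close>)

lemma pull_simplices: "f \<in> simplices C m \<Longrightarrow> \<sigma> \<in> ord_maps n m \<Longrightarrow> pull n f \<sigma> \<in> simplices C n"
  unfolding simplices_def using functor_comp[OF ord_functor] by blast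

lemma pull_pull:
  assumes "\<sigma> \<in> ord_maps n m" "\<tau> \<in> ord_maps m k"
  shows "pull n (pull m f \<tau>) \<sigma> = pull n f (compose {..n} \<tau> \<sigma>)"
  using functor_comp_assoc[OF ord_functor[OF assms(1)], of f "ord_functor m \<tau>"] ord_functor_compose[OF
      assms] by simp

lemma pull_id:
  assumes "f \<in> simplices C n" shows "pull n f (\<lambda>i\<in>{..n}. i) = f"
proof -
  have f: "is_functor (ord_cat n) C f" using assms by (simp add: simplices_def)
  show ?thesis
    by (rule fctr_eqI[OF functor_comp[OF ord_functor[OF ord_maps_id] f] f])
      (auto simp: functor_comp_def ord_functor_def compose_def)
qed

lemma Ob_simplex_cat: "(n, f) \<in> Ob (simplex_cat C) \<longleftrightarrow> f \<in> simplices C n"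
  by (simp add: simplex_cat_def)

text \<open>An arrow into \<open>(m, g)\<close> amounts to an order preserving map into
  \<open>{..m}\<close>, its source being forced. This is why lifts along a functor of simplex
  categories exist and are unique.\<close>

lemma Hom_simplex_cat:
  "a \<in> Hom (simplex_cat C) (n, f) (m, g) \<longleftrightarrow>
     (\<exists>\<sigma>. a = ((n, f), \<sigma>, (m, g)) \<and> g \<in> simplices C m \<and> \<sigma> \<in> ord_maps n m \<and> f = pull n g \<sigma>)"
  using pull_simplices by (fastforce simp: Hom_iff simplex_cat_def)

lemma simplex_cat_Comp:
  "((m', g'), \<tau>, z) \<cdot>\<^bsub>simplex_cat C\<^esub> ((n, f), \<sigma>, y) = ((n, f), compose {..n} \<tau> \<sigma>, z)"
  by (simp add: simplex_cat_def)

lemma simplex_cat_Id: "Id (simplex_cat C) (n, f) = ((n, f), (\<lambda>i\<in>{..n}. i), (n, f))"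
  by (simp add: simplex_cat_def)

lemma simplex_category: "category (simplex_cat C)"
proof
  fix a assume "a \<in> Ar (simplex_cat C)"
  then show "Dom (simplex_cat C) a \<in> Ob (simplex_cat C)" "Cod (simplex_cat C) a \<in> Ob (simplex_cat C)"
    by (auto simp: simplex_cat_def)
next
  fix x assume "x \<in> Ob (simplex_cat C)"
  then show "Id (simplex_cat C) x \<in> Hom (simplex_cat C) x x"
    by (cases x) (simp add: Hom_simplex_cat Ob_simplex_cat simplex_cat_Id ord_maps_id pull_id)
next
  fix a b x y z assume "a \<in> Hom (simplex_cat C) x y" "b \<in> Hom (simplex_cat C) y z"
  then show "b \<cdot>\<^bsub>simplex_cat C\<^esub> a \<in> Hom (simplex_cat C) x z"
    by (cases x; cases y; cases z) (auto simp: Hom_simplex_cat simplex_cat_Comp ord_maps_compose pull_pull)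
next
  fix a x y assume a: "a \<in> Hom (simplex_cat C) x y"
  have "compose {..n} \<sigma> (\<lambda>i\<in>{..n}. i) = \<sigma>" "compose {..n} (\<lambda>i\<in>{..m}. i) \<sigma> = \<sigma>" if "\<sigma> \<in> ord_maps n m" for n
      m \<sigma>
    using ord_mapsD[OF that] by (auto simp: compose_def fun_eq_iff extensional_def)
  then show "a \<cdot>\<^bsub>simplex_cat C\<^esub> Id (simplex_cat C) x = a" "Id (simplex_cat C) y \<cdot>\<^bsub>simplex_cat C\<^esub> a = a"
    using a by (cases x; cases y; auto simp: Hom_simplex_cat simplex_cat_Comp simplex_cat_Id)+
next
  fix a b c w x y z assume "a \<in> Hom (simplex_cat C) w x" "b \<in> Hom (simplex_cat C) x y" "c \<in> Hom
      (simplex_cat C) y z"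
  moreover have "compose {..n} (compose {..m} \<rho> \<tau>) \<sigma> = compose {..n} \<rho> (compose {..n} \<tau> \<sigma>)" if "\<sigma> \<in>
      ord_maps n m" for n m \<rho> \<tau> \<sigma>
    using ord_mapsD[OF that] by (auto simp: compose_def fun_eq_iff)
  ultimately show "c \<cdot>\<^bsub>simplex_cat C\<^esub> b \<cdot>\<^bsub>simplex_cat C\<^esub> a = c \<cdot>\<^bsub>simplex_cat C\<^esub> (b \<cdot>\<^bsub>simplex_cat C\<^esub> a)"
    by (cases w; cases x; cases y; cases z) (auto simp: Hom_simplex_cat simplex_cat_Comp)
qed

section \<open>The functor induced on simplex categories, and restriction along it\<close>

abbreviation "after u n f \<equiv> functor_comp (ord_cat n) u f"

lemma after_simplices: "is_functor E B u \<Longrightarrow> f \<in> simplices E n \<Longrightarrow> after u n f \<in> simplices B n"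
  unfolding simplices_def using functor_comp by blast

text \<open>Associativity of composition: \<open>u\<close> acts after a simplex and
  \<open>\<sigma>\<close> before it. This makes \<open>simplex_functor\<close> well defined on
  arrows and lets pullback act between fibres.\<close>

lemma after_pull:
  "\<sigma> \<in> ord_maps n m \<Longrightarrow> after u n (pull n f \<sigma>) = pull n (after u m f) \<sigma>"
  using functor_comp_assoc[OF ord_functor] by blast

lemma simplex_functor_apply:
  "f \<in> simplices E n \<Longrightarrow> obj_map (simplex_functor E u) (n, f) = (n, after u n f)"
  "a \<in> Hom (simplex_cat E) (n, f) (m, g) \<Longrightarrow> a = ((n, f), \<sigma>, (m, g)) \<Longrightarrow>
     arr_map (simplex_functor E u) a = ((n, after u n f), \<sigma>, (m, after u m g))"
  by (auto simp: simplex_functor_def Let_def Ob_simplex_cat Hom_iff)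

lemma simplex_functor:
  assumes "is_functor E B u"
  shows "is_functor (simplex_cat E) (simplex_cat B) (simplex_functor E u)"
proof (rule functorI[OF simplex_category simplex_category])
  note s = after_simplices[OF assms]
  interpret E: category "simplex_cat E" by (rule simplex_category)
  fix x assume x: "x \<in> Ob (simplex_cat E)"
  show "obj_map (simplex_functor E u) x \<in> Ob (simplex_cat B)"
    using x s by (cases x) (simp add: Ob_simplex_cat simplex_functor_apply)
  show "arr_map (simplex_functor E u) (Id (simplex_cat E) x) = Id (simplex_cat B) (obj_map (simplex_functor
      E u) x)"
    using x E.id_hom[OF x] by (cases x) (simp add: Ob_simplex_cat simplex_functor_apply simplex_cat_Id)
next
  note s = after_simplices[OF assms]
  interpret E: category "simplex_cat E" by (rule simplex_category)
  have hom: "arr_map (simplex_functor E u) a \<in> Hom (simplex_cat B)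
      (obj_map (simplex_functor E u) x) (obj_map (simplex_functor E u) y)"
    if a: "a \<in> Hom (simplex_cat E) x y" for a x y
  proof -
    obtain n f m g where xy: "x = (n, f)" "y = (m, g)" by (cases x; cases y) auto
    then obtain \<sigma> where "a = ((n, f), \<sigma>, (m, g))" "g \<in> simplices E m" "\<sigma> \<in> ord_maps n m" "f = pull n g \<sigma>"
      using a by (auto simp: Hom_simplex_cat)
    then show ?thesis using a xy
      by (simp add: simplex_functor_apply Hom_simplex_cat s pull_simplices after_pull)
  qed
  show "arr_map (simplex_functor E u) a \<in> Hom (simplex_cat B) (obj_map (simplex_functor E u) (Dom
      (simplex_cat E) a))
         (obj_map (simplex_functor E u) (Cod (simplex_cat E) a))" if "a \<in> Ar (simplex_cat E)" for a
    by (rule hom) (use that in \<open>simp add: Hom_iff\<close>)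
  show "arr_map (simplex_functor E u) (b \<cdot>\<^bsub>simplex_cat E\<^esub> a) =
       arr_map (simplex_functor E u) b \<cdot>\<^bsub>simplex_cat B\<^esub> arr_map (simplex_functor E u) a"
    if ab: "a \<in> Hom (simplex_cat E) x y" "b \<in> Hom (simplex_cat E) y z" for a b x y z
  proof -
    obtain n f m g k h where xy: "x = (n, f)" "y = (m, g)" "z = (k, h)" by (cases x; cases y; cases z) auto
    then obtain \<sigma> \<tau> where e: "a = ((n, f), \<sigma>, (m, g))" "b = ((m, g), \<tau>, (k, h))"
      using ab by (auto simp: Hom_simplex_cat)
    show ?thesis using E.comp_hom[OF ab] ab unfolding xy e simplex_cat_Comp
      by (simp add: simplex_functor_apply(2)[OF _ refl] simplex_cat_Comp)
  qed
qed (auto simp: simplex_functor_def Let_def)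

lemma precomp_apply:
  "is_functor C' D F \<Longrightarrow> obj_map (precomp C C' D K) F = functor_comp C F K"
  "t \<in> Hom (fun_cat C' D) F G \<Longrightarrow> arr_map (precomp C C' D K) t =
     (functor_comp C F K, (\<lambda>x\<in>Ob C. component t (obj_map K x)), functor_comp C G K)"
proof -
  show "is_functor C' D F \<Longrightarrow> obj_map (precomp C C' D K) F = functor_comp C F K"
    by (simp add: precomp_def Ob_fun_cat)
  assume t: "t \<in> Hom (fun_cat C' D) F G"
  then obtain \<eta> where "t = (F, \<eta>, G)" by (auto simp: Hom_fun_cat)
  then show "arr_map (precomp C C' D K) t =
     (functor_comp C F K, (\<lambda>x\<in>Ob C. component t (obj_map K x)), functor_comp C G K)"
    using Hom_D(1)[OF t] by (simp add: precomp_def)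
qed

lemma component_precomp:
  "t \<in> Hom (fun_cat C' D) F G \<Longrightarrow> x \<in> Ob C \<Longrightarrow> component (arr_map (precomp C C' D K) t) x = component t
      (obj_map K x)"
  by (simp add: precomp_apply)

lemma precomp_functor:
  assumes K: "is_functor C C' K" and D: "category D"
  shows "is_functor (fun_cat C' D) (fun_cat C D) (precomp C C' D K)"
proof -
  note k = functorD[OF K]
  interpret C: category C by (rule k)
  interpret C': category C' by (rule k)
  interpret D: category D by (rule D)
  interpret N: category "fun_cat C D" by (rule fun_cat_category[OF k(1) D])
  interpret N': category "fun_cat C' D" by (rule fun_cat_category[OF k(2) D])
  have hom: "arr_map (precomp C C' D K) t \<in> Hom (fun_cat C D) (functor_comp C F K) (functor_comp C G K)"
    if t: "t \<in> Hom (fun_cat C' D) F G" for t F G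
    unfolding precomp_apply(2)[OF t]
  proof (rule fun_cat_HomI, rule nat_transI)
    note t' = fun_cat_HomD[OF t]
    show "is_functor C D (functor_comp C F K)" "is_functor C D (functor_comp C G K)"
      using functor_comp K t' by blast+
    fix x y f assume f: "f \<in> Hom C x y"
    show "(\<lambda>x\<in>Ob C. component t (obj_map K x)) y \<cdot>\<^bsub>D\<^esub> arr_map (functor_comp C F K) f =
       arr_map (functor_comp C G K) f \<cdot>\<^bsub>D\<^esub> (\<lambda>x\<in>Ob C. component t (obj_map K x)) x"
      using t'(4)[OF k(4)[OF f]] C.Hom_Ob[OF f] f by (simp add: functor_comp_apply Hom_iff)
  qed (use fun_cat_HomD(3)[OF t] k(3) in \<open>auto simp: functor_comp_apply\<close>)
  show ?thesis
  proof (rule functorI)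
    fix F assume "F \<in> Ob (fun_cat C' D)"
    then have F: "is_functor C' D F" by (simp add: Ob_fun_cat)
    show "obj_map (precomp C C' D K) F \<in> Ob (fun_cat C D)"
      using F functor_comp[OF K F] by (simp add: precomp_apply Ob_fun_cat)
    have i: "Id (fun_cat C' D) F \<in> Hom (fun_cat C' D) F F" using F by (intro N'.id_hom) (simp add:
        Ob_fun_cat)
    show "arr_map (precomp C C' D K) (Id (fun_cat C' D) F) = Id (fun_cat C D) (obj_map (precomp C C' D K)
        F)"
      unfolding precomp_apply(1)[OF F]
      by (rule fun_cat_eqI[OF hom[OF i] N.id_hom])
        (use functor_comp[OF K F] k(3) in \<open>auto simp: Ob_fun_cat component_precomp[OF i] component_id
            functor_comp_apply\<close>)
  next
    fix t assume t: "t \<in> Ar (fun_cat C' D)"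
    have tt: "t \<in> Hom (fun_cat C' D) (Dom (fun_cat C' D) t) (Cod (fun_cat C' D) t)" using t by (simp add:
        Hom_iff)
    show "arr_map (precomp C C' D K) t \<in> Hom (fun_cat C D) (obj_map (precomp C C' D K) (Dom (fun_cat C' D)
        t))
             (obj_map (precomp C C' D K) (Cod (fun_cat C' D) t))"
      unfolding precomp_apply(1)[OF fun_cat_HomD(1)[OF tt]] precomp_apply(1)[OF fun_cat_HomD(2)[OF tt]]
      by (rule hom[OF tt])
  next
    fix F G H s t assume t: "t \<in> Hom (fun_cat C' D) F G" and s: "s \<in> Hom (fun_cat C' D) G H"
    note st = N'.comp_hom[OF t s]
    show "arr_map (precomp C C' D K) (s \<cdot>\<^bsub>fun_cat C' D\<^esub> t)
        = arr_map (precomp C C' D K) s \<cdot>\<^bsub>fun_cat C D\<^esub> arr_map (precomp C C' D K) t"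
      by (rule fun_cat_eqI[OF hom[OF st] N.comp_hom[OF hom[OF t] hom[OF s]]])
        (use k(3) in \<open>simp add: component_precomp[OF st] component_precomp[OF t] component_precomp[OF s]
            component_comp\<close>)
  qed (use N.category_axioms N'.category_axioms in \<open>auto simp: precomp_def\<close>)
qed

lemma precomp_additive:
  assumes K: "is_functor C C' K" and D: "preadditive D"
  shows "additive_functor (fun_cat C' D) (fun_cat C D) (precomp C C' D K)"
proof -
  note k = functorD[OF K]
  interpret D: preadditive D by (rule D)
  interpret N: preadditive "fun_cat C D" by (rule fun_cat_preadditive[OF k(1) D])
  interpret N': preadditive "fun_cat C' D" by (rule fun_cat_preadditive[OF k(2) D])
  note P = precomp_functor[OF K D.category_axioms]
  have "arr_map (precomp C C' D K) (Plus (fun_cat C' D) s t)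
      = Plus (fun_cat C D) (arr_map (precomp C C' D K) s) (arr_map (precomp C C' D K) t)"
    if s: "s \<in> Hom (fun_cat C' D) F G" and t: "t \<in> Hom (fun_cat C' D) F G" for s t F G
  proof -
    note st = N'.plus_hom[OF s t]
    show ?thesis
      by (rule fun_cat_eqI[OF functorD(4)[OF P st] N.plus_hom[OF functorD(4)[OF P s] functorD(4)[OF P t]]])
        (use k(3) in \<open>simp add: component_precomp[OF st] component_precomp[OF t] component_precomp[OF s]
            component_plus\<close>)
  qed
  then show ?thesis unfolding additive_functor_def using P by blast
qed

text \<open>An infinite set has as many pairs as elements; iterating the resulting injection encodes
  lists of a fixed length by single elements.\<close>

lemma ex_inj_lists:
  assumes "infinite (UNIV :: 'u set)"
  shows "\<exists>e :: 'u list \<Rightarrow> 'u. inj_on e {xs. length xs = k}"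
proof (induction k)
  case 0 show ?case by (rule exI[of _ "\<lambda>_. undefined"]) (simp add: inj_on_def)
next
  case (Suc k)
  then obtain e :: "'u list \<Rightarrow> 'u" where e: "inj_on e {xs. length xs = k}" by blast
  obtain p :: "'u \<times> 'u \<Rightarrow> 'u" where p: "inj p"
    using card_of_ordLeq[THEN iffD2, OF ordIso_imp_ordLeq[OF card_of_Times_same_infinite[OF assms]]] by auto
  have "inj_on (\<lambda>xs. p (hd xs, e (tl xs))) {xs. length xs = Suc k}"
  proof (rule inj_onI)
    fix xs ys :: "'u list" assume l: "xs \<in> {xs. length xs = Suc k}" "ys \<in> {xs. length xs = Suc k}"
      and eq: "p (hd xs, e (tl xs)) = p (hd ys, e (tl ys))"
    have h: "hd xs = hd ys" and t: "e (tl xs) = e (tl ys)" using injD[OF p eq] by auto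
    have "tl xs = tl ys" by (rule inj_onD[OF e t]) (use l in auto)
    moreover have "xs \<noteq> []" "ys \<noteq> []" using l by auto
    ultimately show "xs = ys" using h list.expand by blast
  qed
  then show ?case by blast
qed

text \<open>A simplex is an extensional functor on a finite category, hence determined by a list of
  values in the universe whose length depends on \<open>n\<close> alone.\<close>

lemma simplices_small:
  fixes C :: "('u, 'u) cat"
  assumes "infinite (UNIV :: 'u set)"
  shows "\<exists>e :: (nat, nat \<times> nat, 'u, 'u) fctr \<Rightarrow> 'u. inj_on e (simplices C n)"
proof -
  let ?I = "[0..<Suc n]"
  \<comment> \<open>All pairs of numbers up to \<open>n\<close> are listed, which covers the arrows
    of \<open>ord_cat n\<close>; the surplus pairs only contribute the default value of an
    extensional function.\<close>
  define c :: "(nat, nat \<times> nat, 'u, 'u) fctr \<Rightarrow> 'u list"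
    where "c = (\<lambda>f. map (obj_map f) ?I @ map (arr_map f) (List.product ?I ?I))"
  define k where "k = length ?I + length (List.product ?I ?I)"
  have inj: "inj_on c (simplices C n)"
  proof (rule inj_onI)
    fix f g assume fg: "f \<in> simplices C n" "g \<in> simplices C n" and "c f = c g"
    then have "map (obj_map f) ?I = map (obj_map g) ?I"
      "map (arr_map f) (List.product ?I ?I) = map (arr_map g) (List.product ?I ?I)" by (auto simp: c_def
          simp del: upt_Suc)
    then have "\<forall>x\<in>set ?I. obj_map f x = obj_map g x" "\<forall>x\<in>set (List.product ?I ?I). arr_map f x = arr_map g
        x"
      unfolding map_eq_conv by blast+
    then show "f = g" using fg unfolding simplices_def
      by (intro fctr_eqI[of "ord_cat n" C f g]) (auto simp del: upt_Suc)
  qed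
  obtain e :: "'u list \<Rightarrow> 'u" where e: "inj_on e {xs. length xs = k}" using ex_inj_lists[OF assms] by blast
  have "length (c f) = k" for f by (simp add: c_def k_def del: upt_Suc)
  then have "inj_on (e \<circ> c) (simplices C n)"
    by (intro comp_inj_on[OF inj]) (rule inj_on_subset[OF e], auto)
  then show ?thesis by blast
qed

section \<open>Natural systems and their left Kan extension\<close>

lemma natsys_category: "category A \<Longrightarrow> category (natsys_cat C A)"
  unfolding natsys_cat_def by (rule fun_cat_category[OF op_category[OF simplex_category]])

lemma Ob_natsys: "T \<in> Ob (natsys_cat C A) \<longleftrightarrow> is_functor (op_cat (simplex_cat C)) A T"
  by (simp add: natsys_cat_def Ob_fun_cat)

lemmas natsys_HomD = fun_cat_HomD[of _ "op_cat (simplex_cat C)" "A :: ('o, 'a) acat" for C A, folded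
    natsys_cat_def]

abbreviation simplex_arrow :: "nat \<Rightarrow> (nat \<Rightarrow> nat) \<Rightarrow> nat \<Rightarrow> (nat, nat \<times> nat, 'o, 'a) fctr \<Rightarrow> ('o, 'a)
    simplex_arr" where
  "simplex_arrow n \<sigma> m f \<equiv> ((n, pull n f \<sigma>), \<sigma>, (m, f))"

lemma simplex_arrow_hom:
  "f \<in> simplices C m \<Longrightarrow> \<sigma> \<in> ord_maps n m \<Longrightarrow>
     simplex_arrow n \<sigma> m f \<in> Hom (op_cat (simplex_cat C)) (m, f) (n, pull n f \<sigma>)"
  by (simp add: Hom_simplex_cat)

lemma natsys_ob:
  "is_functor (op_cat (simplex_cat C)) A T \<Longrightarrow> f \<in> simplices C n \<Longrightarrow> obj_map T (n, f) \<in> Ob A"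
  using functorD(3) by (fastforce simp: Ob_simplex_cat)

lemma natsys_hom:
  "is_functor (op_cat (simplex_cat C)) A T \<Longrightarrow> f \<in> simplices C m \<Longrightarrow> \<sigma> \<in> ord_maps n m \<Longrightarrow>
     arr_map T (simplex_arrow n \<sigma> m f) \<in> Hom A (obj_map T (m, f)) (obj_map T (n, pull n f \<sigma>))"
  using functorD(4)[OF _ simplex_arrow_hom] by blast

lemma natsys_id:
  "is_functor (op_cat (simplex_cat C)) A T \<Longrightarrow> f \<in> simplices C n \<Longrightarrow>
     arr_map T ((n, f), (\<lambda>i\<in>{..n}. i), (n, f)) = Id A (obj_map T (n, f))"
  using functorD(5)[of "op_cat (simplex_cat C)" A T "(n, f)"] by (simp add: Ob_simplex_cat simplex_cat_Id)

lemma natsys_comp: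
  assumes "is_functor (op_cat (simplex_cat C)) A T" "f \<in> simplices C k" "\<sigma> \<in> ord_maps n m" "\<tau> \<in> ord_maps m
      k"
  shows "arr_map T (simplex_arrow n (compose {..n} \<tau> \<sigma>) k f) =
    arr_map T (simplex_arrow n \<sigma> m (pull m f \<tau>)) \<cdot>\<^bsub>A\<^esub> arr_map T (simplex_arrow m \<tau> k f)"
  using functorD(6)[OF assms(1) simplex_arrow_hom[OF assms(2,4)] simplex_arrow_hom[OF pull_simplices[OF
      assms(2,4)] assms(3)]]
  by (simp add: simplex_cat_Comp pull_pull[OF assms(3,4)])

text \<open>Since the source of an arrow of the simplex category is forced, arrows can be indexed by
  a target simplex and an order preserving map. Functoriality then becomes a unit law and a
  composition law for the action \<open>Y\<close>.\<close>

lemma natsysI: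
  assumes A: "category A" and X: "\<And>n f. f \<in> simplices C n \<Longrightarrow> X n f \<in> Ob A"
    and Y: "\<And>n m \<sigma> f. f \<in> simplices C m \<Longrightarrow> \<sigma> \<in> ord_maps n m \<Longrightarrow> Y n \<sigma> m f \<in> Hom A (X m f) (X n (pull n f \<sigma>))"
    and id: "\<And>n f. f \<in> simplices C n \<Longrightarrow> Y n (\<lambda>i\<in>{..n}. i) n f = Id A (X n f)"
    and comp: "\<And>n m k \<sigma> \<tau> f. f \<in> simplices C k \<Longrightarrow> \<sigma> \<in> ord_maps n m \<Longrightarrow> \<tau> \<in> ord_maps m k \<Longrightarrow>
      Y n (compose {..n} \<tau> \<sigma>) k f = Y n \<sigma> m (pull m f \<tau>) \<cdot>\<^bsub>A\<^esub> Y m \<tau> k f"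
  shows "is_functor (op_cat (simplex_cat C)) A
     \<lparr>obj_map = (\<lambda>(n, f)\<in>Ob (simplex_cat C). X n f),
      arr_map = (\<lambda>((n, _), \<sigma>, (m, f))\<in>Ar (simplex_cat C). Y n \<sigma> m f)\<rparr>" (is "is_functor _ _ ?F")
proof (rule functorI[OF op_category[OF simplex_category] A])
  have o: "obj_map ?F (n, f) = X n f" if "f \<in> simplices C n" for n f
    using that by (simp add: Ob_simplex_cat)
  have a: "arr_map ?F (simplex_arrow n \<sigma> m f) = Y n \<sigma> m f" if "f \<in> simplices C m" "\<sigma> \<in> ord_maps n m" for n
      m \<sigma> f
    using simplex_arrow_hom[OF that] by (simp add: Hom_iff)
  fix x assume "x \<in> Ob (op_cat (simplex_cat C))"
  then obtain n f where x: "x = (n, f)" "f \<in> simplices C n" by (cases x) (simp add: Ob_simplex_cat)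
  show "obj_map ?F x \<in> Ob A" using X[OF x(2)] o[OF x(2)] x by simp
  show "arr_map ?F (Id (op_cat (simplex_cat C)) x) = Id A (obj_map ?F x)"
    using a[OF x(2) ord_maps_id] id[OF x(2)] o[OF x(2)] by (simp add: x(1) simplex_cat_Id pull_id[OF x(2)])
next
  have o: "obj_map ?F (n, f) = X n f" if "f \<in> simplices C n" for n f
    using that by (simp add: Ob_simplex_cat)
  have a: "arr_map ?F (simplex_arrow n \<sigma> m f) = Y n \<sigma> m f" if "f \<in> simplices C m" "\<sigma> \<in> ord_maps n m" for n
      m \<sigma> f
    using simplex_arrow_hom[OF that] by (simp add: Hom_iff)
  {
    fix a assume "a \<in> Ar (op_cat (simplex_cat C))"
    then have "a \<in> Hom (simplex_cat C) (Dom (simplex_cat C) a) (Cod (simplex_cat C) a)" by (simp add: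
        Hom_iff)
    then obtain n m \<sigma> f where f: "a = simplex_arrow n \<sigma> m f" "f \<in> simplices C m" "\<sigma> \<in> ord_maps n m"
      by (cases "Dom (simplex_cat C) a"; cases "Cod (simplex_cat C) a") (auto simp: Hom_simplex_cat)
    then have d: "Dom (simplex_cat C) a = (n, pull n f \<sigma>)" "Cod (simplex_cat C) a = (m, f)"
      by (simp_all add: simplex_cat_def)
    show "arr_map ?F a \<in> Hom A (obj_map ?F (Dom (op_cat (simplex_cat C)) a)) (obj_map ?F (Cod (op_cat
        (simplex_cat C)) a))"
      using Y[OF f(2,3)] o[OF f(2)] o[OF pull_simplices[OF f(2,3)]] a[OF f(2,3)]
      unfolding op_cat_simps d unfolding f(1) by simp
  }
  {
    fix x y z a b assume "a \<in> Hom (op_cat (simplex_cat C)) x y" "b \<in> Hom (op_cat (simplex_cat C)) y z"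
    then obtain k m n f \<sigma> \<tau> where f: "a = simplex_arrow m \<tau> k f" "f \<in> simplices C k" "\<tau> \<in> ord_maps m k"
      "\<sigma> \<in> ord_maps n m" "b = simplex_arrow n \<sigma> m (pull m f \<tau>)"
      by (cases x; cases y; cases z) (auto simp: Hom_simplex_cat)
    have "b \<cdot>\<^bsub>op_cat (simplex_cat C)\<^esub> a = simplex_arrow n (compose {..n} \<tau> \<sigma>) k f"
      using pull_pull[OF f(4,3)] by (simp add: f(1,5) simplex_cat_Comp)
    then show "arr_map ?F (b \<cdot>\<^bsub>op_cat (simplex_cat C)\<^esub> a) = arr_map ?F b \<cdot>\<^bsub>A\<^esub> arr_map ?F a"
      using comp[OF f(2,4,3)] a[OF f(2,3)] a[OF pull_simplices[OF f(2,3)] f(4)] a[OF f(2)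
          ord_maps_compose[OF f(4,3)]]
      unfolding f(1,5) by simp
  }
qed auto

lemma natsys_nat_transI:
  assumes "is_functor (op_cat (simplex_cat C)) A T" "is_functor (op_cat (simplex_cat C)) A T'"
    and h: "\<And>n f. f \<in> simplices C n \<Longrightarrow> h (n, f) \<in> Hom A (obj_map T (n, f)) (obj_map T' (n, f))"
    and nat: "\<And>n m \<sigma> f. f \<in> simplices C m \<Longrightarrow> \<sigma> \<in> ord_maps n m \<Longrightarrow> h (n, pull n f \<sigma>) \<cdot>\<^bsub>A\<^esub> arr_map T
        (simplex_arrow n \<sigma> m f) =
       arr_map T' (simplex_arrow n \<sigma> m f) \<cdot>\<^bsub>A\<^esub> h (m, f)"
  shows "(T, (\<lambda>x\<in>Ob (simplex_cat C). h x), T') \<in> Hom (natsys_cat C A) T T'"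
  unfolding natsys_cat_def
proof (rule fun_cat_HomI, rule nat_transI[OF assms(1,2)])
  fix x y a assume "a \<in> Hom (op_cat (simplex_cat C)) x y"
  then obtain m n f \<sigma> where f: "a = simplex_arrow n \<sigma> m f" "f \<in> simplices C m" "\<sigma> \<in> ord_maps n m"
    "x = (m, f)" "y = (n, pull n f \<sigma>)"
    by (cases x; cases y) (auto simp: Hom_simplex_cat)
  show "(\<lambda>x\<in>Ob (simplex_cat C). h x) y \<cdot>\<^bsub>A\<^esub> arr_map T a = arr_map T' a \<cdot>\<^bsub>A\<^esub> (\<lambda>x\<in>Ob (simplex_cat C). h x) x"
    using nat[OF f(2,3)] f pull_simplices[OF f(2,3)] by (simp add: Ob_simplex_cat)
qed (use h in \<open>auto simp: Ob_simplex_cat\<close>)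

lemma natsys_naturality:
  assumes "t \<in> Hom (natsys_cat C A) T T'" "f \<in> simplices C m" "\<sigma> \<in> ord_maps n m"
  shows "component t (n, pull n f \<sigma>) \<cdot>\<^bsub>A\<^esub> arr_map T (simplex_arrow n \<sigma> m f) =
       arr_map T' (simplex_arrow n \<sigma> m f) \<cdot>\<^bsub>A\<^esub> component t (m, f)"
  using natsys_HomD(4)[OF assms(1) simplex_arrow_hom[OF assms(2,3)]] .

lemma natsys_component:
  assumes "t \<in> Hom (natsys_cat C A) T T'" "f \<in> simplices C n"
  shows "component t (n, f) \<in> Hom A (obj_map T (n, f)) (obj_map T' (n, f))"
  using natsys_HomD(3)[OF assms(1), of "(n, f)"] assms(2) by (simp add: Ob_simplex_cat)

lemma natsys_eqI:
  assumes "t \<in> Hom (natsys_cat C A) F G" "s \<in> Hom (natsys_cat C A) F G"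
    "\<And>n f. f \<in> simplices C n \<Longrightarrow> component t (n, f) = component s (n, f)"
  shows "t = s"
  using assms unfolding natsys_cat_def by (elim fun_cat_eqI) (auto simp: Ob_simplex_cat)

abbreviation restriction where
  "restriction E B A u \<equiv> precomp (op_cat (simplex_cat E)) (op_cat (simplex_cat B)) A (simplex_functor E u)"

locale cocomplete_abelian = abelian_category A for A :: "('o, 'a) acat" +
  fixes U :: "'u itself"
  assumes infinite_universe: "infinite (UNIV :: 'u set)"
    and cocomplete: "cocomplete U A"
begin

lemma small_index: "I \<subseteq> simplices C n \<Longrightarrow> \<exists>e :: _ \<Rightarrow> 'u. inj_on e I" for C :: "('u, 'u) cat"
  using simplices_small[OF infinite_universe, of C n] inj_on_subset by blast

text \<open>Sets of simplices inject into the universe, so cocompleteness gives coproducts over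
  them, and the arbitrary choice made by \<open>coprod\<close> is then one of these.\<close>

lemma coprod_simplices:
  fixes C :: "('u, 'u) cat"
  assumes "I \<subseteq> simplices C n" "X \<in> I \<rightarrow> Ob A"
  shows "is_coproduct A I X (coprod_obj A I X) (coprod_in A I X)"
proof -
  obtain e :: "_ \<Rightarrow> 'u" where e: "inj_on e I" using small_index[OF assms(1)] by blast
  \<comment> \<open>\<open>cocomplete\<close> depends on its first argument only through the type,
    so \<open>U\<close> may be exchanged for \<open>TYPE('u)\<close>.\<close>
  have "cocomplete TYPE('u) A" using cocomplete by (simp add: cocomplete_def)
  from ex_small_coproduct[OF this e assms(2)] coprod_is_coproduct show ?thesis by blast
qed

end

locale natsys_functor = cocomplete_abelian A "TYPE('u)"
  for A :: "('o, 'a) acat" and E B :: "('u, 'u) cat" and u :: "('u, 'u, 'u, 'u) fctr" +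
  assumes u: "is_functor E B u"
begin

abbreviation "NE \<equiv> natsys_cat E A"
abbreviation "NB \<equiv> natsys_cat B A"
abbreviation "K \<equiv> restriction E B A u"

lemma simplex_functor_u: "is_functor (op_cat (simplex_cat E)) (op_cat (simplex_cat B)) (simplex_functor E
    u)"
  by (rule functor_op[OF simplex_functor[OF u]])

lemma NE_preadditive: "preadditive NE" and NB_preadditive: "preadditive NB"
  unfolding natsys_cat_def by (rule fun_cat_preadditive'[OF op_category[OF simplex_category]])+

lemma K_functor: "is_functor NB NE K"
  unfolding natsys_cat_def by (rule precomp_functor[OF simplex_functor_u category_axioms])

lemma K_additive: "additive_functor NB NE K"
  unfolding natsys_cat_def by (rule precomp_additive[OF simplex_functor_u preadditive_axioms])

lemma K_apply:
  assumes "is_functor (op_cat (simplex_cat B)) A G"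
  shows "is_functor (op_cat (simplex_cat E)) A (obj_map K G)"
    "f \<in> simplices E n \<Longrightarrow> obj_map (obj_map K G) (n, f) = obj_map G (n, after u n f)"
    "f \<in> simplices E m \<Longrightarrow> \<sigma> \<in> ord_maps n m \<Longrightarrow>
       arr_map (obj_map K G) (simplex_arrow n \<sigma> m f) = arr_map G (simplex_arrow n \<sigma> m (after u m f))"
proof -
  show "is_functor (op_cat (simplex_cat E)) A (obj_map K G)"
    using functor_comp[OF simplex_functor_u assms] by (simp add: precomp_apply(1)[OF assms])
  show "f \<in> simplices E n \<Longrightarrow> obj_map (obj_map K G) (n, f) = obj_map G (n, after u n f)"
    by (simp add: precomp_apply(1)[OF assms] functor_comp_apply Ob_simplex_cat simplex_functor_apply)
  assume a: "f \<in> simplices E m" "\<sigma> \<in> ord_maps n m"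
  have "simplex_arrow n \<sigma> m f \<in> Hom (simplex_cat E) (n, pull n f \<sigma>) (m, f)" using a by (simp add:
      Hom_simplex_cat)
  then show "arr_map (obj_map K G) (simplex_arrow n \<sigma> m f) = arr_map G (simplex_arrow n \<sigma> m (after u m f))"
    using simplex_functor_apply(2)[OF _ refl, of n "pull n f \<sigma>" \<sigma> m f E u] after_pull[OF a(2), of u f]
    by (simp add: precomp_apply(1)[OF assms] functor_comp_apply Hom_iff)
qed

lemma K_component:
  "t \<in> Hom NB G H \<Longrightarrow> f \<in> simplices E n \<Longrightarrow> component (arr_map K t) (n, f) = component t (n, after u n f)"
  unfolding natsys_cat_def
  by (subst component_precomp) (auto simp: Ob_simplex_cat simplex_functor_apply)

definition fibre :: "nat \<Rightarrow> (nat, nat \<times> nat, 'u, 'u) fctr \<Rightarrow> (nat, nat \<times> nat, 'u, 'u) fctr set" where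
  "fibre n g = {f \<in> simplices E n. after u n f = g}"

text \<open>The summand indexed by \<open>f\<close> thereby has a place in the coproduct over the
  fibre of the pulled back simplex, which yields the transition maps of the Kan extension.\<close>

lemma fibre_pull:
  "f \<in> fibre m g \<Longrightarrow> \<sigma> \<in> ord_maps n m \<Longrightarrow> pull n f \<sigma> \<in> fibre n (pull n g \<sigma>)"
  by (auto simp: fibre_def pull_simplices after_pull)

text \<open>Restriction evaluates \<open>G\<close> at the image of a simplex under \<open>u\<close>,
  so the components of a map \<open>t\<close> from \<open>T\<close> to \<open>K G\<close> at the
  simplices of one fibre share a target. Thus \<open>t\<close> restricts to a cocone on each fibre,
  that is, to a map out of each coproduct; naturality of \<open>t\<close> matches naturality of
  these maps.\<close>

lemma ex_fibrewise_universal_arrow: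
  assumes T: "is_functor (op_cat (simplex_cat E)) A T"
  shows "\<exists>M e. M \<in> Ob NB \<and> e \<in> Hom NE T (obj_map K M) \<and>
    (\<forall>n. \<forall>g\<in>simplices B n. is_coproduct A (fibre n g) (\<lambda>f. obj_map T (n, f)) (obj_map M (n, g)) (\<lambda>f.
        component e (n, f))) \<and>
    (\<forall>G\<in>Ob NB. \<forall>t\<in>Hom NE T (obj_map K G). \<exists>!h. h \<in> Hom NB M G \<and> arr_map K h \<cdot>\<^bsub>NE\<^esub> e = t)"
proof -
  interpret NE: preadditive NE by (rule NE_preadditive)
  interpret NB: preadditive NB by (rule NB_preadditive)
  define X where "X = (\<lambda>n g. coprod_obj A (fibre n g) (\<lambda>f. obj_map T (n, f)))"
  define \<iota> where "\<iota> = (\<lambda>n g. coprod_in A (fibre n g) (\<lambda>f. obj_map T (n, f)))"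
  have fib: "fibre n g \<subseteq> simplices E n" for n g by (auto simp: fibre_def)
  have cop: "is_coproduct A (fibre n g) (\<lambda>f. obj_map T (n, f)) (X n g) (\<iota> n g)" for n g
    unfolding X_def \<iota>_def by (rule coprod_simplices[OF fib]) (use natsys_ob[OF T] fib in blast)
  note in_hom = coproduct_in[OF cop]
  \<comment> \<open>The transition map sends the summand of \<open>f\<close> to the summand of
    \<open>pull n f \<sigma>\<close> by the action of \<open>T\<close>.\<close>
  define Y where "Y = (\<lambda>n \<sigma> m g. copair A (fibre m g) (\<lambda>f. obj_map T (m, f)) (X n (pull n g \<sigma>))
      (\<lambda>f. \<iota> n (pull n g \<sigma>) (pull n f \<sigma>) \<cdot>\<^bsub>A\<^esub> arr_map T (simplex_arrow n \<sigma> m f)))"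
  have T_hom: "arr_map T (simplex_arrow n \<sigma> m f) \<in> Hom A (obj_map T (m, f)) (obj_map T (n, pull n f \<sigma>))"
    if "\<sigma> \<in> ord_maps n m" "f \<in> fibre m g" for n m g \<sigma> f
    by (rule natsys_hom[OF T]) (use that fib in auto)
  have Y: "Y n \<sigma> m g \<in> Hom A (X m g) (X n (pull n g \<sigma>))"
    "\<And>f. f \<in> fibre m g \<Longrightarrow> Y n \<sigma> m g \<cdot>\<^bsub>A\<^esub> \<iota> m g f = \<iota> n (pull n g \<sigma>) (pull n f \<sigma>) \<cdot>\<^bsub>A\<^esub> arr_map T
        (simplex_arrow n \<sigma> m f)"
    if s: "\<sigma> \<in> ord_maps n m" for n m \<sigma> g
    using copair[OF cop[of m g] coproduct_ob[OF cop], of "\<lambda>f. \<iota> n (pull n g \<sigma>) (pull n f \<sigma>) \<cdot>\<^bsub>A\<^esub> arr_map T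
        (simplex_arrow n \<sigma> m f)"]
      comp_hom[OF T_hom[OF s] in_hom[OF fibre_pull[OF _ s]]] unfolding Y_def X_def \<iota>_def by blast+
  define M where "M = \<lparr>obj_map = (\<lambda>(n, f)\<in>Ob (simplex_cat B). X n f),
      arr_map = (\<lambda>((n, _), \<sigma>, (m, f))\<in>Ar (simplex_cat B). Y n \<sigma> m f)\<rparr>"
  have M: "is_functor (op_cat (simplex_cat B)) A M" unfolding M_def
  proof (rule natsysI[OF category_axioms])
    show "X n g \<in> Ob A" for n g using coproduct_ob[OF cop] .
    show "Y n \<sigma> m g \<in> Hom A (X m g) (X n (pull n g \<sigma>))" if "\<sigma> \<in> ord_maps n m" for n m \<sigma> g by (rule Y(1)[OF
        that])
    fix n :: nat and g assume g: "g \<in> simplices B n"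
    \<comment> \<open>The target of this map is the coproduct over the fibre of
      \<open>pull n g\<close> along the identity; \<open>pull_id\<close> identifies it with
      \<open>X n g\<close>.\<close>
    have Yi: "Y n (\<lambda>i\<in>{..n}. i) n g \<in> Hom A (X n g) (X n g)" using Y(1)[OF ord_maps_id] pull_id[OF g] by
        metis
    show "Y n (\<lambda>i\<in>{..n}. i) n g = Id A (X n g)"
    proof (rule coproduct_eq[OF cop Yi id_hom[OF coproduct_ob[OF cop]]])
      fix f assume f: "f \<in> fibre n g"
      then have "f \<in> simplices E n" using fib by auto
      then show "Y n (\<lambda>i\<in>{..n}. i) n g \<cdot>\<^bsub>A\<^esub> \<iota> n g f = Id A (X n g) \<cdot>\<^bsub>A\<^esub> \<iota> n g f"
        using Y(2)[OF ord_maps_id f] natsys_id[OF T] id_left[OF in_hom[OF f]] id_right[OF in_hom[OF f]]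
        by (simp add: pull_id[OF g] pull_id[OF \<open>f \<in> simplices E n\<close>])
    qed
  next
    fix n m k :: nat and \<sigma> \<tau> g assume g: "g \<in> simplices B k" and s: "\<sigma> \<in> ord_maps n m" and t: "\<tau> \<in> ord_maps
        m k"
    note st = ord_maps_compose[OF s t]
    have pp: "pull n (pull m f \<tau>) \<sigma> = pull n f (compose {..n} \<tau> \<sigma>)" for f :: "(nat, nat \<times> nat, 'u, 'u) fctr"
      by (rule pull_pull[OF s t])
    note Ys = Y(1)[OF s, of "pull m g \<tau>"]
    show "Y n (compose {..n} \<tau> \<sigma>) k g = Y n \<sigma> m (pull m g \<tau>) \<cdot>\<^bsub>A\<^esub> Y m \<tau> k g"
    proof (rule coproduct_eq[OF cop Y(1)[OF st]])
      show "Y n \<sigma> m (pull m g \<tau>) \<cdot>\<^bsub>A\<^esub> Y m \<tau> k g \<in> Hom A (X k g) (X n (pull n g (compose {..n} \<tau> \<sigma>)))"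
        using comp_hom[OF Y(1)[OF t] Ys] pp by simp
      fix f assume f: "f \<in> fibre k g"
      note f' = fibre_pull[OF f t]
      note h = in_hom[OF f] in_hom[OF f'] T_hom[OF t f] T_hom[OF s f'] in_hom[OF fibre_pull[OF f' s]]
      have "Y n \<sigma> m (pull m g \<tau>) \<cdot>\<^bsub>A\<^esub> Y m \<tau> k g \<cdot>\<^bsub>A\<^esub> \<iota> k g f
          = Y n \<sigma> m (pull m g \<tau>) \<cdot>\<^bsub>A\<^esub> (\<iota> m (pull m g \<tau>) (pull m f \<tau>) \<cdot>\<^bsub>A\<^esub> arr_map T (simplex_arrow m \<tau> k
              f))"
        using comp_assoc[OF h(1) Y(1)[OF t] Ys] Y(2)[OF t f] by simp
      also have "\<dots> = \<iota> n (pull n (pull m g \<tau>) \<sigma>) (pull n (pull m f \<tau>) \<sigma>) \<cdot>\<^bsub>A\<^esub>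
          (arr_map T (simplex_arrow n \<sigma> m (pull m f \<tau>)) \<cdot>\<^bsub>A\<^esub> arr_map T (simplex_arrow m \<tau> k f))"
        using comp_eq_reduce[OF Y(2)[OF s f'] h(2) Ys h(3)] comp_assoc[OF h(3,4,5)] by simp
      also have "\<dots> = Y n (compose {..n} \<tau> \<sigma>) k g \<cdot>\<^bsub>A\<^esub> \<iota> k g f"
        using Y(2)[OF st f] natsys_comp[OF T _ s t, of f] f fib pp by (auto simp: fibre_def)
      finally show "Y n (compose {..n} \<tau> \<sigma>) k g \<cdot>\<^bsub>A\<^esub> \<iota> k g f = Y n \<sigma> m (pull m g \<tau>) \<cdot>\<^bsub>A\<^esub> Y m \<tau> k g \<cdot>\<^bsub>A\<^esub> \<iota> k
          g f" ..
    qed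
  qed
  have Mo: "obj_map M (n, g) = X n g" if "g \<in> simplices B n" for n g
    using that by (simp add: M_def Ob_simplex_cat)
  have Ma: "arr_map M (simplex_arrow n \<sigma> m g) = Y n \<sigma> m g" if "g \<in> simplices B m" "\<sigma> \<in> ord_maps n m" for n
      m \<sigma> g
    using simplex_arrow_hom[OF that] by (simp add: M_def Hom_iff)
  note KM = K_apply[OF M]
  note us = after_simplices[OF u]
  have fu: "f \<in> fibre n (after u n f)" if "f \<in> simplices E n" for n f using that by (simp add: fibre_def)
  \<comment> \<open>At \<open>f\<close> the universal arrow is the injection of the summand
    \<open>f\<close> into the coproduct over the fibre through \<open>f\<close>.\<close>
  define e where "e = (T, (\<lambda>(n, f)\<in>Ob (simplex_cat E). \<iota> n (after u n f) f), obj_map K M)"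
  have e: "e \<in> Hom NE T (obj_map K M)" unfolding e_def
  proof (rule natsys_nat_transI[OF T KM(1)])
    fix n f assume f: "f \<in> simplices E n"
    show "(case (n, f) of (n, f) \<Rightarrow> \<iota> n (after u n f) f) \<in> Hom A (obj_map T (n, f)) (obj_map (obj_map K M)
        (n, f))"
      using in_hom[OF fu[OF f]] KM(2)[OF f] Mo[OF us[OF f]] by simp
  next
    fix n m \<sigma> f assume f: "f \<in> simplices E m" and s: "\<sigma> \<in> ord_maps n m"
    show "(case (n, pull n f \<sigma>) of (n, f) \<Rightarrow> \<iota> n (after u n f) f) \<cdot>\<^bsub>A\<^esub> arr_map T (simplex_arrow n \<sigma> m f) =
       arr_map (obj_map K M) (simplex_arrow n \<sigma> m f) \<cdot>\<^bsub>A\<^esub> (case (m, f) of (n, f) \<Rightarrow> \<iota> n (after u n f) f)"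
      using KM(3)[OF f s] Ma[OF us[OF f] s] Y(2)[OF s fu[OF f]] after_pull[OF s, of u f] by simp
  qed
  have ec: "component e (n, f) = \<iota> n (after u n f) f" if "f \<in> simplices E n" for n f
    using that by (simp add: e_def Ob_simplex_cat)
  have cop': "is_coproduct A (fibre n g) (\<lambda>f. obj_map T (n, f)) (obj_map M (n, g)) (\<lambda>f. component e (n, f))"
    if g: "g \<in> simplices B n" for n g
  proof -
    have "component e (n, f) = \<iota> n g f" if "f \<in> fibre n g" for f
      using that ec by (auto simp: fibre_def)
    then show ?thesis unfolding Mo[OF g]
      by (intro coproduct_transport[OF cop iso_id id_hom])
        (use coproduct_ob[OF cop] id_left[OF in_hom] in auto)
  qed
  have "\<exists>!h. h \<in> Hom NB M G \<and> arr_map K h \<cdot>\<^bsub>NE\<^esub> e = t" if G: "G \<in> Ob NB" and t: "t \<in> Hom NE T (obj_map K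
      G)" for G t
  proof -
    have G: "is_functor (op_cat (simplex_cat B)) A G" using G by (simp add: Ob_natsys)
    note KG = K_apply[OF G]
    define H where "H = (\<lambda>n g. copair A (fibre n g) (\<lambda>f. obj_map T (n, f)) (obj_map G (n, g)) (\<lambda>f.
        component t (n, f)))"
    have t_hom: "component t (n, f) \<in> Hom A (obj_map T (n, f)) (obj_map G (n, g))" if "f \<in> fibre n g" for n
        f g
      using natsys_component[OF t, of f n] that KG(2)[of f n] by (auto simp: fibre_def)
    have H: "H n g \<in> Hom A (X n g) (obj_map G (n, g))"
      "\<And>f. f \<in> fibre n g \<Longrightarrow> H n g \<cdot>\<^bsub>A\<^esub> \<iota> n g f = component t (n, f)" if g: "g \<in> simplices B n" for n g
      using copair[OF cop[of n g] natsys_ob[OF G g], of "\<lambda>f. component t (n, f)"] t_hom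
      unfolding H_def X_def \<iota>_def by blast+
    define h where "h = (M, (\<lambda>(n, g)\<in>Ob (simplex_cat B). H n g), G)"
    have h: "h \<in> Hom NB M G" unfolding h_def
    proof (rule natsys_nat_transI[OF M G])
      show "(case (n, g) of (n, g) \<Rightarrow> H n g) \<in> Hom A (obj_map M (n, g)) (obj_map G (n, g))"
        if g: "g \<in> simplices B n" for n g
        using H(1)[OF g] Mo[OF g] by simp
      fix n m \<sigma> g assume g: "g \<in> simplices B m" and s: "\<sigma> \<in> ord_maps n m"
      note g' = pull_simplices[OF g s]
      note Gs = natsys_hom[OF G g s]
      have "H n (pull n g \<sigma>) \<cdot>\<^bsub>A\<^esub> Y n \<sigma> m g = arr_map G (simplex_arrow n \<sigma> m g) \<cdot>\<^bsub>A\<^esub> H m g"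
      proof (rule coproduct_eq[OF cop comp_hom[OF Y(1)[OF s] H(1)[OF g']] comp_hom[OF H(1)[OF g] Gs]])
        fix f assume f: "f \<in> fibre m g"
        then have ff: "f \<in> simplices E m" "after u m f = g" by (auto simp: fibre_def)
        note f' = fibre_pull[OF f s]
        have "H n (pull n g \<sigma>) \<cdot>\<^bsub>A\<^esub> Y n \<sigma> m g \<cdot>\<^bsub>A\<^esub> \<iota> m g f
            = H n (pull n g \<sigma>) \<cdot>\<^bsub>A\<^esub> (\<iota> n (pull n g \<sigma>) (pull n f \<sigma>) \<cdot>\<^bsub>A\<^esub> arr_map T (simplex_arrow n \<sigma> m f))"
          using comp_assoc[OF in_hom[OF f] Y(1)[OF s] H(1)[OF g']] Y(2)[OF s f] by simp
        also have "\<dots> = component t (n, pull n f \<sigma>) \<cdot>\<^bsub>A\<^esub> arr_map T (simplex_arrow n \<sigma> m f)"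
          by (rule comp_eq_reduce[OF H(2)[OF g' f'] in_hom[OF f'] H(1)[OF g'] T_hom[OF s f]])
        also have "\<dots> = arr_map G (simplex_arrow n \<sigma> m g) \<cdot>\<^bsub>A\<^esub> component t (m, f)"
          using natsys_naturality[OF t ff(1) s] KG(3)[OF ff(1) s] ff(2) by simp
        also have "\<dots> = arr_map G (simplex_arrow n \<sigma> m g) \<cdot>\<^bsub>A\<^esub> H m g \<cdot>\<^bsub>A\<^esub> \<iota> m g f"
          using comp_assoc[OF in_hom[OF f] H(1)[OF g] Gs] H(2)[OF g f] by simp
        finally show "H n (pull n g \<sigma>) \<cdot>\<^bsub>A\<^esub> Y n \<sigma> m g \<cdot>\<^bsub>A\<^esub> \<iota> m g f = arr_map G (simplex_arrow n \<sigma> m g) \<cdot>\<^bsub>A\<^esub>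
            H m g \<cdot>\<^bsub>A\<^esub> \<iota> m g f" .
      qed
      then show "(case (n, pull n g \<sigma>) of (n, g) \<Rightarrow> H n g) \<cdot>\<^bsub>A\<^esub> arr_map M (simplex_arrow n \<sigma> m g) =
          arr_map G (simplex_arrow n \<sigma> m g) \<cdot>\<^bsub>A\<^esub> (case (m, g) of (n, g) \<Rightarrow> H n g)"
        using Ma[OF g s] by simp
    qed
    \<comment> \<open>A component of \<open>arr_map K h'\<close> at \<open>f\<close> is that of
      \<open>h'\<close> at the image of \<open>f\<close>. So composing with \<open>e\<close> shows
      \<open>h'\<close> on all fibre injections, which are jointly epic; this gives
      uniqueness.\<close>
    have comp_c: "component (arr_map K h' \<cdot>\<^bsub>NE\<^esub> e) (n, f) = component h' (n, after u n f) \<cdot>\<^bsub>A\<^esub> \<iota> n (after u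
        n f) f"
      if h': "h' \<in> Hom NB M G" and f: "f \<in> simplices E n" for h' n f
      using K_component[OF h' f] ec[OF f] f unfolding natsys_cat_def
      by (subst component_comp) (auto simp: Ob_simplex_cat)
    have hc: "component h (n, g) = H n g" if "g \<in> simplices B n" for n g
      using that by (simp add: h_def Ob_simplex_cat)
    have "arr_map K h \<cdot>\<^bsub>NE\<^esub> e = t"
      by (rule natsys_eqI[OF NE.comp_hom[OF e functorD(4)[OF K_functor h]] t])
        (use comp_c[OF h] hc[OF us] H(2)[OF us fu] in simp)
    moreover have "h' = h" if h': "h' \<in> Hom NB M G" "arr_map K h' \<cdot>\<^bsub>NE\<^esub> e = t" for h'
    proof (rule natsys_eqI[OF h'(1) h])
      fix n g assume g: "g \<in> simplices B n"
      have "component h' (n, g) \<in> Hom A (X n g) (obj_map G (n, g))"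
        using natsys_component[OF h'(1) g] Mo[OF g] by simp
      moreover have "component h' (n, g) \<cdot>\<^bsub>A\<^esub> \<iota> n g f = H n g \<cdot>\<^bsub>A\<^esub> \<iota> n g f" if f: "f \<in> fibre n g" for f
        using comp_c[OF h'(1), of f n] h'(2) H(2)[OF g f] f by (auto simp: fibre_def)
      ultimately show "component h' (n, g) = component h (n, g)"
        unfolding hc[OF g] using coproduct_eq[OF cop _ H(1)[OF g]] by blast
    qed
    ultimately show ?thesis using h by blast
  qed
  then show ?thesis using M e cop' by (intro exI[of _ M] exI[of _ e]) (simp add: Ob_natsys)
qed

lemma ex_Lan: "\<exists>L. is_Lan E B A u L"
  unfolding is_Lan_def
proof (rule left_adjointI[OF K_functor])
  fix T assume "T \<in> Ob NE"
  then have "is_functor (op_cat (simplex_cat E)) A T" by (simp add: Ob_natsys)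
  from ex_fibrewise_universal_arrow[OF this]
  show "\<exists>l \<eta>. l \<in> Ob NB \<and> \<eta> \<in> Hom NE T (obj_map K l) \<and>
      (\<forall>y\<in>Ob NB. \<forall>f\<in>Hom NE T (obj_map K y). \<exists>!h. h \<in> Hom NB l y \<and> arr_map K h \<cdot>\<^bsub>NE\<^esub> \<eta> = f)"
    by blast
qed

text \<open>Universal arrows are unique up to isomorphism, so the coproduct formula for the explicit
  model \<open>M\<close> holds for every left adjoint \<open>L\<close>, with the components of its
  unit as injections.\<close>

lemma unit_coproduct:
  assumes L: "is_functor NE NB L" and \<eta>: "is_unit NE NB L K \<eta>" and T: "T \<in> Ob NE" and g: "g \<in> simplices B n"
  shows "is_coproduct A (fibre n g) (\<lambda>f. obj_map T (n, f)) (obj_map (obj_map L T) (n, g)) (\<lambda>f. component (\<eta>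
      T) (n, f))"
proof -
  interpret NE: preadditive NE by (rule NE_preadditive)
  interpret NB: preadditive NB by (rule NB_preadditive)
  have T': "is_functor (op_cat (simplex_cat E)) A T" using T by (simp add: Ob_natsys)
  obtain M e where M: "M \<in> Ob NB" and e: "e \<in> Hom NE T (obj_map K M)"
    and cop: "\<And>n g. g \<in> simplices B n \<Longrightarrow>
      is_coproduct A (fibre n g) (\<lambda>f. obj_map T (n, f)) (obj_map M (n, g)) (\<lambda>f. component e (n, f))"
    and univ: "\<And>G t. G \<in> Ob NB \<Longrightarrow> t \<in> Hom NE T (obj_map K G) \<Longrightarrow> \<exists>!h. h \<in> Hom NB M G \<and> arr_map K h \<cdot>\<^bsub>NE\<^esub> e = t"
    using ex_fibrewise_universal_arrow[OF T'] by blast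
  have LT: "obj_map L T \<in> Ob NB" using functorD(3)[OF L T] .
  have eta: "\<eta> T \<in> Hom NE T (obj_map K (obj_map L T))" using \<eta> T by (simp add: is_unit_def)
  note Kc = functorD(6)[OF K_functor] and Ki = functorD(5)[OF K_functor] and Kh = functorD(4)[OF K_functor]
  obtain h where h: "h \<in> Hom NB M (obj_map L T)" "arr_map K h \<cdot>\<^bsub>NE\<^esub> e = \<eta> T" using univ[OF LT eta] by blast
  have "\<exists>!k. k \<in> Hom NB (obj_map L T) M \<and> arr_map K k \<cdot>\<^bsub>NE\<^esub> \<eta> T = e"
    using \<eta> T M e unfolding is_unit_def by simp
  then obtain k where k: "k \<in> Hom NB (obj_map L T) M" "arr_map K k \<cdot>\<^bsub>NE\<^esub> \<eta> T = e" by blast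
  \<comment> \<open>Each of the two composites of \<open>h\<close> and \<open>k\<close> leaves a
    universal arrow fixed, so it is an identity.\<close>
  have "is_iso NB h"
  proof (rule NB.is_isoI[OF h(1) k(1)])
    have "arr_map K (k \<cdot>\<^bsub>NB\<^esub> h) \<cdot>\<^bsub>NE\<^esub> e = e"
      using Kc[OF h(1) k(1)] NE.comp_assoc[OF e Kh[OF h(1)] Kh[OF k(1)]] h(2) k(2) by simp
    moreover have "arr_map K (Id NB M) \<cdot>\<^bsub>NE\<^esub> e = e" using Ki[OF M] NE.id_left[OF e] by simp
    moreover note univ[OF M e] NB.comp_hom[OF h(1) k(1)] NB.id_hom[OF M]
    ultimately show "k \<cdot>\<^bsub>NB\<^esub> h = Id NB M" by (elim ex1E) metis
    have "arr_map K (h \<cdot>\<^bsub>NB\<^esub> k) \<cdot>\<^bsub>NE\<^esub> \<eta> T = \<eta> T"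
      using Kc[OF k(1) h(1)] NE.comp_assoc[OF eta Kh[OF k(1)] Kh[OF h(1)]] h(2) k(2) by simp
    moreover have "arr_map K (Id NB (obj_map L T)) \<cdot>\<^bsub>NE\<^esub> \<eta> T = \<eta> T" using Ki[OF LT] NE.id_left[OF eta] by
        simp
    ultimately show "h \<cdot>\<^bsub>NB\<^esub> k = Id NB (obj_map L T)"
      by (intro unit_eq[OF L K_functor \<eta> T NB.comp_hom[OF k(1) h(1)] NB.id_hom[OF LT]]) simp
  qed
  then have iso: "is_iso A (component h (n, g))"
    using h(1) g unfolding natsys_cat_def by (intro fun_cat_iso_component) (auto simp: Ob_simplex_cat)
  show ?thesis
  proof (rule coproduct_transport[OF cop[OF g] iso natsys_component[OF h(1) g]])
    fix f assume "f \<in> fibre n g"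
    then have f: "f \<in> simplices E n" "after u n f = g" by (auto simp: fibre_def)
    have "component (arr_map K h \<cdot>\<^bsub>NE\<^esub> e) (n, f) = component (arr_map K h) (n, f) \<cdot>\<^bsub>A\<^esub> component e (n, f)"
      using f(1) unfolding natsys_cat_def by (subst component_comp) (auto simp: Ob_simplex_cat)
    then show "component h (n, g) \<cdot>\<^bsub>A\<^esub> component e (n, f) = component (\<eta> T) (n, f)"
      using h(2) K_component[OF h(1) f(1)] f(2) by simp
  qed
qed

end

section \<open>Thomason homology\<close>

context comm_group begin

text \<open>An alternating sum in multiplicative notation, spelled as in the body of
  \<open>thom_diff\<close> so that the two agree by unfolding.\<close>

definition alt_sum :: "(nat \<Rightarrow> 'a) \<Rightarrow> nat \<Rightarrow> 'a" where
  "alt_sum b N = finprod G (\<lambda>i. if even i then b i else inv (b i)) {..N}"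

lemma alt_sum_0: "b 0 \<in> carrier G \<Longrightarrow> alt_sum b 0 = b 0"
  by (simp add: alt_sum_def)

lemma alt_sum_Suc:
  assumes "\<And>i. i \<le> Suc N \<Longrightarrow> b i \<in> carrier G"
  shows "alt_sum b (Suc N) = (if even N then inv (b (Suc N)) else b (Suc N)) \<otimes> alt_sum b N"
  unfolding alt_sum_def by (subst finprod_Suc) (use assms in auto)

lemma alt_sum_closed: "(\<And>i. i \<le> N \<Longrightarrow> b i \<in> carrier G) \<Longrightarrow> alt_sum b N \<in> carrier G"
  unfolding alt_sum_def by (intro finprod_closed) auto

lemma alt_sum_cong: "(\<And>i. i \<le> N \<Longrightarrow> b i = c i) \<Longrightarrow> (\<And>i. i \<le> N \<Longrightarrow> c i \<in> carrier G) \<Longrightarrow> alt_sum b N = alt_sum c N"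
  unfolding alt_sum_def by (intro finprod_cong') auto

lemma alt_sum_mult:
  assumes "\<And>i. i \<le> N \<Longrightarrow> b i \<in> carrier G" "\<And>i. i \<le> N \<Longrightarrow> c i \<in> carrier G"
  shows "alt_sum (\<lambda>i. b i \<otimes> c i) N = alt_sum b N \<otimes> alt_sum c N"
  using assms
proof (induction N)
  case 0 then show ?case by (simp add: alt_sum_0)
next
  case (Suc N)
  have "alt_sum b N \<in> carrier G" "alt_sum c N \<in> carrier G" using Suc.prems by (auto intro: alt_sum_closed)
  then show ?case using Suc by (simp add: alt_sum_Suc inv_mult m_ac)
qed

lemma alt_sum_inv:
  assumes "\<And>i. i \<le> N \<Longrightarrow> b i \<in> carrier G"
  shows "alt_sum (\<lambda>i. inv (b i)) N = inv (alt_sum b N)"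
  using assms
proof (induction N)
  case 0 then show ?case by (simp add: alt_sum_0)
next
  case (Suc N)
  have "alt_sum b N \<in> carrier G" using Suc.prems by (auto intro: alt_sum_closed)
  then show ?case using Suc by (simp add: alt_sum_Suc inv_mult)
qed

text \<open>The cancellation behind the vanishing of the squared differential: the entry at
  \<open>(i, j)\<close> with \<open>j < i\<close> recurs at \<open>(j, i - 1)\<close> with opposite
  sign. In the induction, enlarging the array adds column \<open>Suc N\<close> and row
  \<open>Suc (Suc N)\<close>, and these two cancel.\<close>

lemma alt_sum_alt_sum_simplicial:
  assumes a: "\<And>i j. i \<le> Suc N \<Longrightarrow> j \<le> N \<Longrightarrow> a i j \<in> carrier G"
    and e: "\<And>i j. j < i \<Longrightarrow> i \<le> Suc N \<Longrightarrow> a i j = a j (i - 1)"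
  shows "alt_sum (\<lambda>i. alt_sum (a i) N) (Suc N) = \<one>"
  using assms
proof (induction N)
  case 0
  have "a 1 0 = a 0 0" using 0(2)[of 0 1] by simp
  then show ?case using 0(1) by (simp add: alt_sum_0 alt_sum_Suc l_inv)
next
  case (Suc N)
  \<comment> \<open>The sign of column \<open>Suc N\<close>, namely
    \<open>(-1)^(N + 1)\<close>.\<close>
  let ?s = "\<lambda>x. if even N then inv x else x"
  let ?c = "alt_sum (\<lambda>i. a i (Suc N)) (Suc N)"
  have cl: "alt_sum (a i) N \<in> carrier G" "alt_sum (a i) (Suc N) \<in> carrier G" if "i \<le> Suc (Suc N)" for i
    using Suc.prems(1) that by (auto intro: alt_sum_closed)
  have c: "?c \<in> carrier G" using Suc.prems(1) by (auto intro: alt_sum_closed)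
  have ih: "alt_sum (\<lambda>i. alt_sum (a i) N) (Suc N) = \<one>"
    by (rule Suc.IH) (use Suc.prems in auto)
  have "alt_sum (\<lambda>i. alt_sum (a i) (Suc N)) (Suc N) = alt_sum (\<lambda>i. ?s (a i (Suc N)) \<otimes> alt_sum (a i) N) (Suc
      N)"
    by (rule alt_sum_cong) (use Suc.prems(1) cl in \<open>auto simp: alt_sum_Suc\<close>)
  also have "\<dots> = alt_sum (\<lambda>i. ?s (a i (Suc N))) (Suc N) \<otimes> alt_sum (\<lambda>i. alt_sum (a i) N) (Suc N)"
    by (rule alt_sum_mult) (use Suc.prems(1) cl in auto)
  also have "\<dots> = alt_sum (\<lambda>i. ?s (a i (Suc N))) (Suc N)"
    using ih Suc.prems(1) by (simp add: alt_sum_closed)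
  also have "\<dots> = ?s ?c"
    using alt_sum_inv[of "Suc N" "\<lambda>i. a i (Suc N)"] Suc.prems(1) by auto
  finally have 1: "alt_sum (\<lambda>i. alt_sum (a i) (Suc N)) (Suc N) = ?s ?c" .
  \<comment> \<open>By the symmetry the new row is the new column again; its sign
    \<open>(-1)^(N + 2)\<close> is the opposite one.\<close>
  have 2: "alt_sum (a (Suc (Suc N))) (Suc N) = ?c"
    by (rule alt_sum_cong) (use Suc.prems(2)[of _ "Suc (Suc N)"] Suc.prems(1) in auto)
  show ?case
    using alt_sum_Suc[of "Suc N" "\<lambda>i. alt_sum (a i) (Suc N)"] cl 1 2 c by (auto simp: l_inv r_inv)
qed

end

lemma coface_ord_maps: "coface n i \<in> ord_maps n (Suc n)"
  by (auto simp: coface_def ord_maps_def mono_on_def)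

text \<open>The cosimplicial identity, oriented as \<open>alt_sum_alt_sum_simplicial\<close>
  demands: a pair with \<open>j < i\<close> is exchanged for \<open>(j, i - 1)\<close>.\<close>

lemma coface_coface:
  assumes "j < i" "i \<le> Suc (Suc n)"
  shows "compose {..n} (coface (Suc n) i) (coface n j) = compose {..n} (coface (Suc n) j) (coface n (i -
      1))"
  using assms by (auto simp: compose_def coface_def fun_eq_iff)

lemma face_simplices: "f \<in> simplices C (Suc n) \<Longrightarrow> face n i f \<in> simplices C n"
  unfolding face_def by (rule pull_simplices[OF _ coface_ord_maps])

lemma coface_arr_eq: "coface_arr n i f = simplex_arrow n (coface n i) (Suc n) f"
  by (simp add: coface_arr_def face_def)

lemma natsys_face:
  assumes "is_functor (op_cat (simplex_cat C)) A T" "f \<in> simplices C (Suc n)"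
  shows "arr_map T (coface_arr n i f) \<in> Hom A (obj_map T (Suc n, f)) (obj_map T (n, face n i f))"
  unfolding coface_arr_eq face_def by (rule natsys_hom[OF assms coface_ord_maps])

context preadditive begin

abbreviation "asum x y \<equiv> comm_group.alt_sum (hom_group A x y)"

lemma asum_hom:
  assumes "x \<in> Ob A" "y \<in> Ob A" "\<And>i. i \<le> N \<Longrightarrow> b i \<in> Hom A x y" shows "asum x y b N \<in> Hom A x y"
proof -
  interpret G: comm_group "hom_group A x y" using hom_comm_group assms by blast
  show ?thesis using G.alt_sum_closed[of N b] assms by simp
qed

lemma asum_cong:
  assumes "x \<in> Ob A" "y \<in> Ob A" "\<And>i. i \<le> N \<Longrightarrow> b i = c i" "\<And>i. i \<le> N \<Longrightarrow> c i \<in> Hom A x y"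
  shows "asum x y b N = asum x y c N"
proof -
  interpret G: comm_group "hom_group A x y" using hom_comm_group assms by blast
  show ?thesis by (rule G.alt_sum_cong) (use assms in auto)
qed

lemma comp_asum_right:
  assumes "\<And>i. i \<le> N \<Longrightarrow> b i \<in> Hom A x y" "g \<in> Hom A y z"
  shows "g \<cdot>\<^bsub>A\<^esub> asum x y b N = asum x z (\<lambda>i. g \<cdot>\<^bsub>A\<^esub> b i) N"
proof -
  note x = Hom_Ob[OF assms(1)[of 0]] Hom_Ob[OF assms(2)]
  interpret G: comm_group "hom_group A x y" using hom_comm_group x by blast
  interpret H: comm_group "hom_group A x z" using hom_comm_group x by blast
  have h: "g \<cdot>\<^bsub>A\<^esub> b i \<in> Hom A x z" if "i \<le> N" for i using comp_hom[OF assms(1)[OF that] assms(2)] .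
  show ?thesis unfolding G.alt_sum_def H.alt_sum_def
    by (subst comp_finprod_right[OF _ _ assms(2)])
      (use assms x h neg_hom comp_neg_right[OF assms(1) assms(2)] in \<open>auto intro!: H.finprod_cong'\<close>)
qed

lemma comp_asum_left:
  assumes "\<And>i. i \<le> N \<Longrightarrow> b i \<in> Hom A y z" "g \<in> Hom A x y"
  shows "asum y z b N \<cdot>\<^bsub>A\<^esub> g = asum x z (\<lambda>i. b i \<cdot>\<^bsub>A\<^esub> g) N"
proof -
  note x = Hom_Ob[OF assms(1)[of 0]] Hom_Ob[OF assms(2)]
  interpret G: comm_group "hom_group A y z" using hom_comm_group x by blast
  interpret H: comm_group "hom_group A x z" using hom_comm_group x by blast
  have h: "b i \<cdot>\<^bsub>A\<^esub> g \<in> Hom A x z" if "i \<le> N" for i using comp_hom[OF assms(2) assms(1)[OF that]] .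
  show ?thesis unfolding G.alt_sum_def H.alt_sum_def
    by (subst comp_finprod_left[OF _ _ assms(2)])
      (use assms x h neg_hom comp_neg_left[OF assms(2) assms(1)] in \<open>auto intro!: H.finprod_cong'\<close>)
qed

end

lemma thom_homology_apply:
  "T \<in> Ob (natsys_cat C A) \<Longrightarrow> obj_map (thom_homology C A n) T = homology_obj A (thom_diff C A T n) (thom_out
      C A T n)"
  "t \<in> Hom (natsys_cat C A) T T' \<Longrightarrow> arr_map (thom_homology C A n) t =
       homology_map A (thom_diff C A T n) (thom_out C A T n) (thom_diff C A T' n) (thom_out C A T' n)
         (coprod_map A (simplices C n) (\<lambda>f. obj_map T (n, f)) (\<lambda>f. obj_map T' (n, f)) (\<lambda>f. component t (n,
             f)))"
proof -
  show "T \<in> Ob (natsys_cat C A) \<Longrightarrow> obj_map (thom_homology C A n) T = homology_obj A (thom_diff C A T n)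
      (thom_out C A T n)"
    by (simp add: thom_homology_def)
  assume t: "t \<in> Hom (natsys_cat C A) T T'"
  then obtain \<eta> where "t = (T, \<eta>, T')" by (auto simp: natsys_cat_def Hom_fun_cat)
  then show "arr_map (thom_homology C A n) t =
       homology_map A (thom_diff C A T n) (thom_out C A T n) (thom_diff C A T' n) (thom_out C A T' n)
         (coprod_map A (simplices C n) (\<lambda>f. obj_map T (n, f)) (\<lambda>f. obj_map T' (n, f)) (\<lambda>f. component t (n,
             f)))"
    using Hom_D(1)[OF t] by (simp add: thom_homology_def)
qed

section \<open>The Thomason complex, its chain maps and the homology functors\<close>

context cocomplete_abelian begin

abbreviation natsys :: "('u, 'u) cat \<Rightarrow> ('u, 'u, 'o, 'a) natsys \<Rightarrow> bool" where
  "natsys C T \<equiv> is_functor (op_cat (simplex_cat C)) A T"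

abbreviation "chain_in C T n \<equiv> coprod_in A (simplices C n) (\<lambda>f. obj_map T (n, f))"

lemma thom_chains_coproduct:
  "natsys C T \<Longrightarrow> is_coproduct A (simplices C n) (\<lambda>f. obj_map T (n, f)) (thom_chains C A T n) (chain_in C T
      n)"
  unfolding thom_chains_def by (rule coprod_simplices[OF subset_refl]) (use natsys_ob in blast)

lemma thom_chains_ob: "natsys C T \<Longrightarrow> thom_chains C A T n \<in> Ob A"
  using coproduct_ob[OF thom_chains_coproduct] .

lemmas chain_in_hom = coproduct_in[OF thom_chains_coproduct]

lemma bd_hom:
  assumes "natsys C T" "f \<in> simplices C (Suc n)"
  shows "chain_in C T n (face n i f) \<cdot>\<^bsub>A\<^esub> arr_map T (coface_arr n i f) \<in> Hom A (obj_map T (Suc n, f))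
      (thom_chains C A T n)"
  by (rule comp_hom[OF natsys_face[OF assms] chain_in_hom[OF assms(1) face_simplices[OF assms(2)]]])

lemma thom_diff:
  assumes T: "natsys C T"
  shows "thom_diff C A T n \<in> Hom A (thom_chains C A T (Suc n)) (thom_chains C A T n)"
    "\<And>f. f \<in> simplices C (Suc n) \<Longrightarrow> thom_diff C A T n \<cdot>\<^bsub>A\<^esub> chain_in C T (Suc n) f =
      asum (obj_map T (Suc n, f)) (thom_chains C A T n)
        (\<lambda>i. chain_in C T n (face n i f) \<cdot>\<^bsub>A\<^esub> arr_map T (coface_arr n i f)) (Suc n)"
proof -
  let ?k = "\<lambda>f. asum (obj_map T (Suc n, f)) (thom_chains C A T n)
        (\<lambda>i. chain_in C T n (face n i f) \<cdot>\<^bsub>A\<^esub> arr_map T (coface_arr n i f)) (Suc n)"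
  have k: "?k f \<in> Hom A (obj_map T (Suc n, f)) (thom_chains C A T n)" if "f \<in> simplices C (Suc n)" for f
    by (rule asum_hom[OF natsys_ob[OF T that] thom_chains_ob[OF T] bd_hom[OF T that]])
  \<comment> \<open>The copairing property is obtained first in the \<open>finprod\<close> form of
    the definition, conditional on the typing of the sums; the equation \<open>a\<close> below
    converts it to \<open>asum\<close> and discharges the condition.\<close>
  have e: "thom_diff C A T n \<in> Hom A (thom_chains C A T (Suc n)) (thom_chains C A T n) \<and>
    (\<forall>f\<in>simplices C (Suc n). thom_diff C A T n \<cdot>\<^bsub>A\<^esub> chain_in C T (Suc n) f =
      finprod (hom_group A (obj_map T (Suc n, f)) (thom_chains C A T n))
       (\<lambda>i. if even i then chain_in C T n (face n i f) \<cdot>\<^bsub>A\<^esub> arr_map T (coface_arr n i f)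
          else neg (obj_map T (Suc n, f)) (thom_chains C A T n) (chain_in C T n (face n i f) \<cdot>\<^bsub>A\<^esub> arr_map T
              (coface_arr n i f)))
       {..Suc n})"
    if k: "\<And>f. f \<in> simplices C (Suc n) \<Longrightarrow> finprod (hom_group A (obj_map T (Suc n, f)) (thom_chains C A T n))
       (\<lambda>i. if even i then chain_in C T n (face n i f) \<cdot>\<^bsub>A\<^esub> arr_map T (coface_arr n i f)
          else neg (obj_map T (Suc n, f)) (thom_chains C A T n) (chain_in C T n (face n i f) \<cdot>\<^bsub>A\<^esub> arr_map T
              (coface_arr n i f)))
       {..Suc n} \<in> Hom A (obj_map T (Suc n, f)) (thom_chains C A T n)"
    using copair[OF thom_chains_coproduct[OF T] thom_chains_ob[OF T] k]
    unfolding thom_diff_def Let_def thom_chains_def[of _ _ _ "Suc n"] by blast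
  have a: "?k f = finprod (hom_group A (obj_map T (Suc n, f)) (thom_chains C A T n))
       (\<lambda>i. if even i then chain_in C T n (face n i f) \<cdot>\<^bsub>A\<^esub> arr_map T (coface_arr n i f)
          else neg (obj_map T (Suc n, f)) (thom_chains C A T n) (chain_in C T n (face n i f) \<cdot>\<^bsub>A\<^esub> arr_map T
              (coface_arr n i f)))
       {..Suc n}" if "f \<in> simplices C (Suc n)" for f
    by (rule comm_group.alt_sum_def[OF hom_comm_group[OF natsys_ob[OF T that] thom_chains_ob[OF T]]])
  show "thom_diff C A T n \<in> Hom A (thom_chains C A T (Suc n)) (thom_chains C A T n)"
    "\<And>f. f \<in> simplices C (Suc n) \<Longrightarrow> thom_diff C A T n \<cdot>\<^bsub>A\<^esub> chain_in C T (Suc n) f = ?k f"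
    using e k a by auto
qed

text \<open>It suffices to test on each summand, where the composite becomes a double alternating
  sum to which the simplicial cancellation applies.\<close>

lemma thom_diff_diff:
  assumes T: "natsys C T"
  shows "thom_diff C A T n \<cdot>\<^bsub>A\<^esub> thom_diff C A T (Suc n) = Zero A (thom_chains C A T (Suc (Suc n)))
      (thom_chains C A T n)"
proof (rule coproduct_eq[OF thom_chains_coproduct[OF T] comp_hom[OF thom_diff(1)[OF T] thom_diff(1)[OF T]]
    zero_hom])
  show "thom_chains C A T (Suc (Suc n)) \<in> Ob A" "thom_chains C A T n \<in> Ob A" using thom_chains_ob[OF T] by
      auto
  fix f assume f: "f \<in> simplices C (Suc (Suc n))"
  let ?x = "obj_map T (Suc (Suc n), f)" and ?y = "thom_chains C A T n"
  note d = thom_diff(1)[OF T]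
  note x = natsys_ob[OF T f] and y = thom_chains_ob[OF T, of n]
  define a where "a = (\<lambda>i j. chain_in C T n (face n j (face (Suc n) i f)) \<cdot>\<^bsub>A\<^esub> arr_map T (coface_arr n j
      (face (Suc n) i f))
      \<cdot>\<^bsub>A\<^esub> arr_map T (coface_arr (Suc n) i f))"
  note ff = face_simplices[OF f]
  have a_hom: "a i j \<in> Hom A ?x ?y" for i j
    unfolding a_def by (rule comp_hom[OF natsys_face[OF T f] bd_hom[OF T ff]])
  \<comment> \<open>By functoriality of \<open>T\<close>, the entry depends on \<open>i\<close> and
    \<open>j\<close> only through the composite of the two cofaces, so \<open>coface_coface\<close>
    gives the required symmetry.\<close>
  have a_eq: "a i j = chain_in C T n (pull n f (compose {..n} (coface (Suc n) i) (coface n j))) \<cdot>\<^bsub>A\<^esub>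
      arr_map T (simplex_arrow n (compose {..n} (coface (Suc n) i) (coface n j)) (Suc (Suc n)) f)" for i j
    unfolding a_def natsys_comp[OF T f coface_ord_maps coface_ord_maps]
    using comp_assoc[OF natsys_face[OF T f] natsys_face[OF T ff] chain_in_hom[OF T face_simplices[OF ff]]]
    by (simp add: coface_arr_eq face_def pull_pull[OF coface_ord_maps coface_ord_maps])
  have "thom_diff C A T n \<cdot>\<^bsub>A\<^esub> thom_diff C A T (Suc n) \<cdot>\<^bsub>A\<^esub> chain_in C T (Suc (Suc n)) f =
      thom_diff C A T n \<cdot>\<^bsub>A\<^esub> asum ?x (thom_chains C A T (Suc n))
        (\<lambda>i. chain_in C T (Suc n) (face (Suc n) i f) \<cdot>\<^bsub>A\<^esub> arr_map T (coface_arr (Suc n) i f)) (Suc (Suc n))"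
    using comp_assoc[OF chain_in_hom[OF T f] d d] thom_diff(2)[OF T f] by simp
  also have "\<dots> = asum ?x ?y (\<lambda>i. thom_diff C A T n \<cdot>\<^bsub>A\<^esub>
      (chain_in C T (Suc n) (face (Suc n) i f) \<cdot>\<^bsub>A\<^esub> arr_map T (coface_arr (Suc n) i f))) (Suc (Suc n))"
    by (rule comp_asum_right[OF bd_hom[OF T f] d])
  also have "\<dots> = asum ?x ?y (\<lambda>i. asum ?x ?y (a i) (Suc n)) (Suc (Suc n))"
  proof (rule asum_cong[OF x y])
    fix i
    have "thom_diff C A T n \<cdot>\<^bsub>A\<^esub> (chain_in C T (Suc n) (face (Suc n) i f) \<cdot>\<^bsub>A\<^esub> arr_map T (coface_arr (Suc
        n) i f)) =
      asum (obj_map T (Suc n, face (Suc n) i f)) ?y (\<lambda>j. chain_in C T n (face n j (face (Suc n) i f)) \<cdot>\<^bsub>A\<^esub>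
          arr_map T (coface_arr n j (face (Suc n) i f))) (Suc n) \<cdot>\<^bsub>A\<^esub> arr_map T (coface_arr (Suc n) i f)"
      by (rule comp_eq_reduce[OF thom_diff(2)[OF T ff] chain_in_hom[OF T ff] d natsys_face[OF T f]])
    also have "\<dots> = asum ?x ?y (a i) (Suc n)"
      unfolding a_def by (rule comp_asum_left[OF bd_hom[OF T ff] natsys_face[OF T f]])
    finally show "thom_diff C A T n \<cdot>\<^bsub>A\<^esub> (chain_in C T (Suc n) (face (Suc n) i f) \<cdot>\<^bsub>A\<^esub> arr_map T
        (coface_arr (Suc n) i f))
        = asum ?x ?y (a i) (Suc n)" .
    show "asum ?x ?y (a i) (Suc n) \<in> Hom A ?x ?y" by (rule asum_hom[OF x y a_hom])
  qed
  also have "\<dots> = Zero A ?x ?y"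
    using comm_group.alt_sum_alt_sum_simplicial[OF hom_comm_group[OF x y], of "Suc n" a] a_hom
      a_eq coface_coface[of _ _ n] by simp
  also have "\<dots> = Zero A (thom_chains C A T (Suc (Suc n))) ?y \<cdot>\<^bsub>A\<^esub> chain_in C T (Suc (Suc n)) f"
    using comp_zero_left[OF chain_in_hom[OF T f] y] by simp
  finally show "thom_diff C A T n \<cdot>\<^bsub>A\<^esub> thom_diff C A T (Suc n) \<cdot>\<^bsub>A\<^esub> chain_in C T (Suc (Suc n)) f =
     Zero A (thom_chains C A T (Suc (Suc n))) (thom_chains C A T n) \<cdot>\<^bsub>A\<^esub> chain_in C T (Suc (Suc n)) f" .
qed

lemma zero_obj_A: "is_zero_obj A (zero_obj A)" "zero_obj A \<in> Ob A"
  using zero_obj[OF ex_zero_obj] by auto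

lemma thom_composable_zero:
  assumes T: "natsys C T" shows "composable_zero A (thom_diff C A T n) (thom_out C A T n)"
proof (cases n)
  case 0
  then show ?thesis
    using thom_diff(1)[OF T, of 0] comp_zero_left[OF thom_diff(1)[OF T, of 0] zero_obj_A(2)]
      thom_chains_ob[OF T, of 0] zero_obj_A(2)
    by (simp add: composable_zero_def thom_out_def Hom_iff)
next
  case (Suc m)
  then show ?thesis using thom_diff(1)[OF T, of n] thom_diff(1)[OF T, of m] thom_diff_diff[OF T, of m]
    by (simp add: composable_zero_def thom_out_def Hom_iff)
qed

lemma thom_Dom_Cod [simp]:
  "natsys C T \<Longrightarrow> Dom A (thom_diff C A T n) = thom_chains C A T (Suc n)"
  "natsys C T \<Longrightarrow> Cod A (thom_diff C A T n) = thom_chains C A T n"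
  using thom_diff(1) by (auto simp: Hom_iff)

text \<open>Natural transformations are the case where \<open>v\<close> is the identity, and the
  unit of the Kan extension is the case \<open>v = after u\<close>; one argument turns both into
  chain maps. Compatibility is asked for faces because the differential is built from these.\<close>

definition face_map :: "('u, 'u) cat \<Rightarrow> ('u, 'u) cat \<Rightarrow> ('u, 'u, 'o, 'a) natsys \<Rightarrow> ('u, 'u, 'o, 'a) natsys \<Rightarrow>
    (nat \<Rightarrow> (nat, nat \<times> nat, 'u, 'u) fctr \<Rightarrow> (nat, nat \<times> nat, 'u, 'u) fctr) \<Rightarrow> (nat \<Rightarrow> (nat, nat \<times> nat, 'u, 'u)
        fctr \<Rightarrow> 'a) \<Rightarrow> bool" where
  "face_map C D T T' v \<tau> \<longleftrightarrow> natsys C T \<and> natsys D T' \<and>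
     (\<forall>n. \<forall>f\<in>simplices C n. v n f \<in> simplices D n \<and> \<tau> n f \<in> Hom A (obj_map T (n, f)) (obj_map T' (n, v n
         f))) \<and>
     (\<forall>n i. \<forall>f\<in>simplices C (Suc n). v n (face n i f) = face n i (v (Suc n) f) \<and>
       \<tau> n (face n i f) \<cdot>\<^bsub>A\<^esub> arr_map T (coface_arr n i f) = arr_map T' (coface_arr n i (v (Suc n) f)) \<cdot>\<^bsub>A\<^esub>
           \<tau> (Suc n) f)"

definition chain_map :: "('u, 'u) cat \<Rightarrow> ('u, 'u) cat \<Rightarrow> ('u, 'u, 'o, 'a) natsys \<Rightarrow> ('u, 'u, 'o, 'a) natsys \<Rightarrow>
    (nat \<Rightarrow> (nat, nat \<times> nat, 'u, 'u) fctr \<Rightarrow> (nat, nat \<times> nat, 'u, 'u) fctr) \<Rightarrow> (nat \<Rightarrow> (nat, nat \<times> nat, 'u, 'u)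
        fctr \<Rightarrow> 'a) \<Rightarrow> nat \<Rightarrow> 'a" where
  "chain_map C D T T' v \<tau> n = copair A (simplices C n) (\<lambda>f. obj_map T (n, f)) (thom_chains D A T' n)
     (\<lambda>f. chain_in D T' n (v n f) \<cdot>\<^bsub>A\<^esub> \<tau> n f)"

lemma chain_map:
  assumes m: "face_map C D T T' v \<tau>"
  shows "chain_map C D T T' v \<tau> n \<in> Hom A (thom_chains C A T n) (thom_chains D A T' n)"
    "\<And>f. f \<in> simplices C n \<Longrightarrow> chain_map C D T T' v \<tau> n \<cdot>\<^bsub>A\<^esub> chain_in C T n f = chain_in D T' n (v n f) \<cdot>\<^bsub>A\<^esub>
        \<tau> n f"
proof -
  have T: "natsys C T" "natsys D T'" using m by (auto simp: face_map_def)
  have "chain_in D T' n (v n f) \<cdot>\<^bsub>A\<^esub> \<tau> n f \<in> Hom A (obj_map T (n, f)) (thom_chains D A T' n)" if "f \<in>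
      simplices C n" for f
    using comp_hom[OF _ chain_in_hom[OF T(2)]] m that unfolding face_map_def by blast
  from copair[OF thom_chains_coproduct[OF T(1)] thom_chains_ob[OF T(2)] this]
  show "chain_map C D T T' v \<tau> n \<in> Hom A (thom_chains C A T n) (thom_chains D A T' n)"
    "\<And>f. f \<in> simplices C n \<Longrightarrow> chain_map C D T T' v \<tau> n \<cdot>\<^bsub>A\<^esub> chain_in C T n f = chain_in D T' n (v n f) \<cdot>\<^bsub>A\<^esub>
        \<tau> n f"
    unfolding chain_map_def thom_chains_def[of C] by blast+
qed

text \<open>On a summand both sides expand into alternating sums, which agree term by term through
  the two face conditions.\<close>

lemma chain_map_diff:
  assumes m: "face_map C D T T' v \<tau>"
  shows "chain_map C D T T' v \<tau> n \<cdot>\<^bsub>A\<^esub> thom_diff C A T n = thom_diff D A T' n \<cdot>\<^bsub>A\<^esub> chain_map C D T T' v \<tau>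
      (Suc n)"
proof -
  have T: "natsys C T" and T': "natsys D T'" using m by (auto simp: face_map_def)
  note c = chain_map[OF m] and d = thom_diff[OF T] and d' = thom_diff[OF T']
  have v: "v n f \<in> simplices D n" "\<tau> n f \<in> Hom A (obj_map T (n, f)) (obj_map T' (n, v n f))"
    if "f \<in> simplices C n" for n f using m that by (auto simp: face_map_def)
  show ?thesis
  proof (rule coproduct_eq[OF thom_chains_coproduct[OF T] comp_hom[OF d(1) c(1)] comp_hom[OF c(1) d'(1)]])
    fix f assume f: "f \<in> simplices C (Suc n)"
    let ?x = "obj_map T (Suc n, f)" and ?y = "thom_chains D A T' n"
    note x = natsys_ob[OF T f] and y = thom_chains_ob[OF T', of n]
    note vf = v[OF f] and F = natsys_face[OF T f] and ff = face_simplices[OF f] and F' = natsys_face[OF T'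
        v(1)[OF f]]
    have "chain_map C D T T' v \<tau> n \<cdot>\<^bsub>A\<^esub> thom_diff C A T n \<cdot>\<^bsub>A\<^esub> chain_in C T (Suc n) f =
        asum ?x ?y (\<lambda>i. chain_map C D T T' v \<tau> n \<cdot>\<^bsub>A\<^esub> (chain_in C T n (face n i f) \<cdot>\<^bsub>A\<^esub> arr_map T
            (coface_arr n i f))) (Suc n)"
      using comp_assoc[OF chain_in_hom[OF T f] d(1) c(1)] d(2)[OF f] comp_asum_right[OF bd_hom[OF T f]
          c(1)] by simp
    also have "\<dots> = asum ?x ?y (\<lambda>i. (chain_in D T' n (face n i (v (Suc n) f)) \<cdot>\<^bsub>A\<^esub>
        arr_map T' (coface_arr n i (v (Suc n) f))) \<cdot>\<^bsub>A\<^esub> \<tau> (Suc n) f) (Suc n)"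
    proof (rule asum_cong[OF x y])
      fix i
      have e: "v n (face n i f) = face n i (v (Suc n) f)"
        "\<tau> n (face n i f) \<cdot>\<^bsub>A\<^esub> arr_map T (coface_arr n i f) = arr_map T' (coface_arr n i (v (Suc n) f))
            \<cdot>\<^bsub>A\<^esub> \<tau> (Suc n) f"
        using m f by (auto simp: face_map_def)
      show "chain_map C D T T' v \<tau> n \<cdot>\<^bsub>A\<^esub> (chain_in C T n (face n i f) \<cdot>\<^bsub>A\<^esub> arr_map T (coface_arr n i f)) =
         (chain_in D T' n (face n i (v (Suc n) f)) \<cdot>\<^bsub>A\<^esub> arr_map T' (coface_arr n i (v (Suc n) f))) \<cdot>\<^bsub>A\<^esub> \<tau>
             (Suc n) f"
        using comp_eq_reduce[OF c(2)[OF ff] chain_in_hom[OF T ff] c(1) F]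
          comp_assoc[OF F v(2)[OF ff] chain_in_hom[OF T' v(1)[OF ff]]] e
          comp_assoc[OF vf(2) F' chain_in_hom[OF T' face_simplices[OF vf(1)]]] by simp
      show "(chain_in D T' n (face n i (v (Suc n) f)) \<cdot>\<^bsub>A\<^esub> arr_map T' (coface_arr n i (v (Suc n) f))) \<cdot>\<^bsub>A\<^esub>
          \<tau> (Suc n) f
        \<in> Hom A ?x ?y" by (rule comp_hom[OF vf(2) bd_hom[OF T' vf(1)]])
    qed
    also have "\<dots> = asum (obj_map T' (Suc n, v (Suc n) f)) ?y (\<lambda>i. chain_in D T' n (face n i (v (Suc n) f))
        \<cdot>\<^bsub>A\<^esub>
        arr_map T' (coface_arr n i (v (Suc n) f))) (Suc n) \<cdot>\<^bsub>A\<^esub> \<tau> (Suc n) f"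
      by (rule comp_asum_left[OF bd_hom[OF T' vf(1)] vf(2), symmetric])
    also have "\<dots> = thom_diff D A T' n \<cdot>\<^bsub>A\<^esub> (chain_in D T' (Suc n) (v (Suc n) f) \<cdot>\<^bsub>A\<^esub> \<tau> (Suc n) f)"
      by (rule comp_eq_reduce[OF d'(2)[OF vf(1)] chain_in_hom[OF T' vf(1)] d'(1) vf(2), symmetric])
    also have "\<dots> = thom_diff D A T' n \<cdot>\<^bsub>A\<^esub> chain_map C D T T' v \<tau> (Suc n) \<cdot>\<^bsub>A\<^esub> chain_in C T (Suc n) f"
      using comp_assoc[OF chain_in_hom[OF T f] c(1) d'(1)] c(2)[OF f] by simp
    finally show "chain_map C D T T' v \<tau> n \<cdot>\<^bsub>A\<^esub> thom_diff C A T n \<cdot>\<^bsub>A\<^esub> chain_in C T (Suc n) f =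
         thom_diff D A T' n \<cdot>\<^bsub>A\<^esub> chain_map C D T T' v \<tau> (Suc n) \<cdot>\<^bsub>A\<^esub> chain_in C T (Suc n) f" .
  qed
qed

text \<open>Supplies the component one degree down. In degree 0 the outgoing differential ends in
  the chosen zero object, where the identity serves; in higher degrees the chain map of the
  preceding degree does.\<close>

lemma chain_map_out:
  assumes m: "face_map C D T T' v \<tau>"
  obtains \<psi> where "\<psi> \<in> Hom A (Cod A (thom_out C A T n)) (Cod A (thom_out D A T' n))"
    "thom_out D A T' n \<cdot>\<^bsub>A\<^esub> chain_map C D T T' v \<tau> n = \<psi> \<cdot>\<^bsub>A\<^esub> thom_out C A T n"
    "(\<And>n. is_iso A (chain_map C D T T' v \<tau> n)) \<Longrightarrow> is_iso A \<psi>"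
proof (cases n)
  case 0
  have T: "natsys C T" "natsys D T'" using m by (auto simp: face_map_def)
  note z = zero_obj_A(2)
  note o = thom_chains_ob[OF T(1)] thom_chains_ob[OF T(2)]
  show ?thesis
    by (rule that[of "Id A (zero_obj A)"])
      (use 0 z o comp_zero_left[OF chain_map(1)[OF m] z] comp_zero_right[OF id_hom[OF z]] id_hom[OF z]
          iso_id[OF z]
        in \<open>simp_all add: thom_out_def\<close>)
next
  case (Suc k)
  have T: "natsys C T" "natsys D T'" using m by (auto simp: face_map_def)
  show ?thesis
    by (rule that[of "chain_map C D T T' v \<tau> k"])
      (use Suc T chain_map(1)[OF m] chain_map_diff[OF m, of k] in \<open>simp_all add: thom_out_def\<close>)
qed

lemma chain_map_at:
  assumes m: "face_map C D T T' v \<tau>"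
  shows "chain_map_at A (thom_diff C A T n) (thom_out C A T n) (thom_diff D A T' n) (thom_out D A T' n)
    (chain_map C D T T' v \<tau> n)"
proof -
  have T: "natsys C T" "natsys D T'" using m by (auto simp: face_map_def)
  obtain \<psi> where "\<psi> \<in> Hom A (Cod A (thom_out C A T n)) (Cod A (thom_out D A T' n))"
    "thom_out D A T' n \<cdot>\<^bsub>A\<^esub> chain_map C D T T' v \<tau> n = \<psi> \<cdot>\<^bsub>A\<^esub> thom_out C A T n" using chain_map_out[OF m] .
  then show ?thesis unfolding chain_map_at_def
    using T chain_map(1)[OF m] chain_map_diff[OF m, of n] by auto
qed

text \<open>Homology at one spot involves three adjacent degrees; the lowest component is invertible
  by the last conclusion of \<open>chain_map_out\<close>.\<close>

lemma chain_map_homology_iso: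
  assumes m: "face_map C D T T' v \<tau>" and iso: "\<And>n. is_iso A (chain_map C D T T' v \<tau> n)"
  shows "is_iso A (homology_map A (thom_diff C A T n) (thom_out C A T n) (thom_diff D A T' n) (thom_out D A
      T' n)
    (chain_map C D T T' v \<tau> n))"
proof -
  have T: "natsys C T" "natsys D T'" using m by (auto simp: face_map_def)
  obtain \<psi> where p: "\<psi> \<in> Hom A (Cod A (thom_out C A T n)) (Cod A (thom_out D A T' n))"
    "thom_out D A T' n \<cdot>\<^bsub>A\<^esub> chain_map C D T T' v \<tau> n = \<psi> \<cdot>\<^bsub>A\<^esub> thom_out C A T n" "is_iso A \<psi>"
    using chain_map_out[OF m] iso by metis
  show ?thesis
    by (rule homology_map_iso[OF thom_composable_zero[OF T(1)] thom_composable_zero[OF T(2)] _ iso _ iso[of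
        "Suc n"] _ p(1,3,2)])
      (use T chain_map(1)[OF m] chain_map_diff[OF m, of n] in simp_all)
qed

lemma face_map_nat_trans:
  assumes t: "t \<in> Hom (natsys_cat C A) T T'"
  shows "face_map C C T T' (\<lambda>n f. f) (\<lambda>n f. component t (n, f))"
  unfolding face_map_def
  using natsys_HomD(1,2)[OF t] natsys_component[OF t] natsys_naturality[OF t _ coface_ord_maps]
  by (simp add: coface_arr_eq face_def)

text \<open>The action of \<open>thom_homology\<close> on arrows thus becomes an instance of
  \<open>chain_map\<close>, and the facts about face maps apply to it.\<close>

lemma coprod_map_eq_chain_map:
  "coprod_map A (simplices C n) (\<lambda>f. obj_map T (n, f)) (\<lambda>f. obj_map T' (n, f)) (\<lambda>f. component t (n, f)) =
    chain_map C C T T' (\<lambda>n f. f) (\<lambda>n f. component t (n, f)) n"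
  by (simp add: coprod_map_def chain_map_def thom_chains_def)

abbreviation "nat_chain_map C T T' t \<equiv> chain_map C C T T' (\<lambda>n f. f) (\<lambda>n f. component t (n, f))"

lemma thom_homology_arr:
  "t \<in> Hom (natsys_cat C A) T T' \<Longrightarrow> arr_map (thom_homology C A n) t =
       homology_map A (thom_diff C A T n) (thom_out C A T n) (thom_diff C A T' n) (thom_out C A T' n)
         (nat_chain_map C T T' t n)"
  unfolding coprod_map_eq_chain_map[symmetric] by (rule thom_homology_apply(2))

lemma thom_homology_functor:
  fixes C :: "('u, 'u) cat"
  shows "is_functor (natsys_cat C A) A (thom_homology C A n)"
proof -
  interpret N: category "natsys_cat C A" by (rule natsys_category[OF category_axioms])
  have nat: "natsys C T" if "T \<in> Ob (natsys_cat C A)" for T using that by (simp add: Ob_natsys)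
  have comp: "component (s \<cdot>\<^bsub>natsys_cat C A\<^esub> t) (n, f) = component s (n, f) \<cdot>\<^bsub>A\<^esub> component t (n, f)"
    if "f \<in> simplices C n" for s t n f
    unfolding natsys_cat_def by (rule component_comp) (use that in \<open>simp add: Ob_simplex_cat\<close>)
  have id: "component (Id (natsys_cat C A) T) (n, f) = Id A (obj_map T (n, f))" if "f \<in> simplices C n" for
      T n f
    unfolding natsys_cat_def by (rule component_id) (use that in \<open>simp add: Ob_simplex_cat\<close>)
  show ?thesis
  proof (rule functorI[OF natsys_category[OF category_axioms] category_axioms])
    fix T assume T: "T \<in> Ob (natsys_cat C A)"
    note z = thom_composable_zero[OF nat[OF T], of n]
    show "obj_map (thom_homology C A n) T \<in> Ob A" using thom_homology_apply(1)[OF T] homology_obj_ob[OF z]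
        by simp
    note m = face_map_nat_trans[OF N.id_hom[OF T]]
    have "nat_chain_map C T T (Id (natsys_cat C A) T) n = Id A (thom_chains C A T n)"
      by (rule coproduct_eq[OF thom_chains_coproduct[OF nat[OF T]] chain_map(1)[OF m] id_hom[OF
          thom_chains_ob[OF nat[OF T]]]])
        (use chain_map(2)[OF m] id id_left[OF chain_in_hom[OF nat[OF T]]] id_right[OF chain_in_hom[OF
            nat[OF T]]] in simp)
    then show "arr_map (thom_homology C A n) (Id (natsys_cat C A) T) = Id A (obj_map (thom_homology C A n)
        T)"
      using thom_homology_apply(1)[OF T] thom_homology_arr[OF N.id_hom[OF T]] homology_map_id[OF z] nat[OF
          T] by simp
  next
    fix t assume "t \<in> Ar (natsys_cat C A)"
    then have t: "t \<in> Hom (natsys_cat C A) (Dom (natsys_cat C A) t) (Cod (natsys_cat C A) t)" by (simp add: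
        Hom_iff)
    note T = N.Hom_Ob[OF t]
    show "arr_map (thom_homology C A n) t \<in> Hom A (obj_map (thom_homology C A n) (Dom (natsys_cat C A) t))
            (obj_map (thom_homology C A n) (Cod (natsys_cat C A) t))"
      unfolding thom_homology_apply(1)[OF T(1)] thom_homology_apply(1)[OF T(2)] thom_homology_arr[OF t]
      by (rule homology_map(1)[OF thom_composable_zero[OF nat[OF T(1)]] thom_composable_zero[OF nat[OF
          T(2)]]
        chain_map_at[OF face_map_nat_trans[OF t]]])
  next
    fix T T' T'' t s assume t: "t \<in> Hom (natsys_cat C A) T T'" and s: "s \<in> Hom (natsys_cat C A) T' T''"
    note st = N.comp_hom[OF t s]
    note n = nat[OF N.Hom_Ob(1)[OF t]] nat[OF N.Hom_Ob(2)[OF t]] nat[OF N.Hom_Ob(2)[OF s]]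
    note m = face_map_nat_trans[OF t] and m' = face_map_nat_trans[OF s] and m'' = face_map_nat_trans[OF st]
    have e: "nat_chain_map C T T'' (s \<cdot>\<^bsub>natsys_cat C A\<^esub> t) n = nat_chain_map C T' T'' s n \<cdot>\<^bsub>A\<^esub>
        nat_chain_map C T T' t n"
    proof (rule coproduct_eq[OF thom_chains_coproduct[OF n(1)] chain_map(1)[OF m''] comp_hom[OF
        chain_map(1)[OF m] chain_map(1)[OF m']]])
      fix f assume f: "f \<in> simplices C n"
      note c = natsys_component[OF t f] natsys_component[OF s f]
      show "nat_chain_map C T T'' (s \<cdot>\<^bsub>natsys_cat C A\<^esub> t) n \<cdot>\<^bsub>A\<^esub> chain_in C T n f =
        nat_chain_map C T' T'' s n \<cdot>\<^bsub>A\<^esub> nat_chain_map C T T' t n \<cdot>\<^bsub>A\<^esub> chain_in C T n f"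
        using chain_map(2)[OF m f] chain_map(2)[OF m'' f] comp[OF f]
          comp_assoc[OF chain_in_hom[OF n(1) f] chain_map(1)[OF m] chain_map(1)[OF m']]
          comp_eq_reduce[OF chain_map(2)[OF m' f] chain_in_hom[OF n(2) f] chain_map(1)[OF m'] c(1)]
          comp_assoc[OF c chain_in_hom[OF n(3) f]] by simp
    qed
    note z = n[THEN thom_composable_zero]
    show "arr_map (thom_homology C A n) (s \<cdot>\<^bsub>natsys_cat C A\<^esub> t) =
        arr_map (thom_homology C A n) s \<cdot>\<^bsub>A\<^esub> arr_map (thom_homology C A n) t"
      unfolding thom_homology_arr[OF t] thom_homology_arr[OF s] thom_homology_arr[OF st] e
      by (rule homology_map_comp[OF z chain_map_at[OF m] chain_map_at[OF m']])
  qed (auto simp: thom_homology_def)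
qed

text \<open>Every injection has a zero source and so vanishes, hence the identity of the chain
  object is zero. This empties the rows of the second page with \<open>q > 0\<close>.\<close>

lemma thom_homology_zero:
  fixes C :: "('u, 'u) cat"
  assumes "is_zero_obj (natsys_cat C A) T" shows "is_zero_obj A (obj_map (thom_homology C A n) T)"
proof -
  interpret N: preadditive "natsys_cat C A"
    unfolding natsys_cat_def by (rule fun_cat_preadditive'[OF op_category[OF simplex_category]])
  have T: "T \<in> Ob (natsys_cat C A)" using assms by (simp add: is_zero_obj_def)
  then have nat: "natsys C T" by (simp add: Ob_natsys)
  note ob = thom_chains_ob[OF nat, of n]
  have "Id A (thom_chains C A T n) = Zero A (thom_chains C A T n) (thom_chains C A T n)"
  proof (rule coproduct_eq[OF thom_chains_coproduct[OF nat] id_hom[OF ob] zero_hom[OF ob ob]])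
    fix f assume f: "f \<in> simplices C n"
    have "is_zero_obj A (obj_map T (n, f))"
      by (rule fun_cat_zero_objD[OF op_category[OF simplex_category] preadditive_axioms assms[unfolded
          natsys_cat_def]])
        (use f in \<open>simp add: Ob_simplex_cat\<close>)
    from zero_obj_hom(2)[OF this chain_in_hom[OF nat f]]
    show "Id A (thom_chains C A T n) \<cdot>\<^bsub>A\<^esub> chain_in C T n f = Zero A (thom_chains C A T n) (thom_chains C A
        T n) \<cdot>\<^bsub>A\<^esub> chain_in C T n f"
      using id_left[OF chain_in_hom[OF nat f]] comp_zero_left[OF chain_in_hom[OF nat f] ob] by simp
  qed
  then have "is_zero_obj A (thom_chains C A T n)" using zero_obj_iff[OF ob] by simp
  then show ?thesis unfolding thom_homology_apply(1)[OF T]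
    by (intro homology_zero[OF thom_composable_zero[OF nat]]) (simp add: nat)
qed

end

section \<open>Satellites of exact functors\<close>

context preadditive begin

text \<open>The map \<open>a\<close> factors through its image, the kernel of its cokernel, which by
  exactness is a kernel of \<open>b\<close>.\<close>

lemma exact_at_comp_zero:
  assumes "exact_at A a b" "a \<in> Hom A x y" "b \<in> Hom A y z" shows "b \<cdot>\<^bsub>A\<^esub> a = Zero A x z"
proof -
  obtain c k where c: "is_cokernel A c a" and k: "is_kernel A k c" "is_kernel A k b"
    using assms(1) unfolding exact_at_def by blast
  note ch = cokernel_hom[OF c assms(2)] and kh = kernel_hom[OF k(2) assms(3)]
  obtain h where h: "h \<in> Hom A x (Dom A k)" "k \<cdot>\<^bsub>A\<^esub> h = a" using kernel_lift[OF k(1) ch(1) assms(2) ch(2)]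
      by blast
  show ?thesis
    using comp_eq_reduce[OF kh(2,1) assms(3) h(1)] h(2) comp_zero_left[OF h(1)] Hom_Ob(2)[OF assms(3)] by
        simp
qed

lemma kernel_of_mono_zero:
  assumes z: "is_zero_obj A z" and b: "b \<in> Hom A x y" "is_mono A b"
  shows "is_kernel A (Zero A z x) b"
proof -
  note x = Hom_Ob[OF b(1)]
  have zo: "z \<in> Ob A" using z by (simp add: is_zero_obj_def)
  show ?thesis
  proof (rule kernelI[OF b(1) zero_hom[OF zo x(1)] comp_zero_right[OF b(1) zo]])
    show "is_mono A (Zero A z x)" unfolding is_mono_def using zo x zero_obj_unique(1)[OF z] by auto
    fix v g assume g: "g \<in> Hom A v x" "b \<cdot>\<^bsub>A\<^esub> g = Zero A v y"
    note v = Hom_Ob(1)[OF g(1)]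
    have "g = Zero A v x"
      by (rule mono_cancel[OF b(2,1) g(1) zero_hom[OF v x(1)]]) (use g comp_zero_right[OF b(1) v] in simp)
    then show "\<exists>h\<in>Hom A v z. Zero A z x \<cdot>\<^bsub>A\<^esub> h = g"
      using zero_hom[OF v zo] comp_zero_left[OF zero_hom[OF v zo] x(1)] by auto
  qed
qed

lemma cokernel_of_zero_id:
  assumes "z \<in> Ob A" "x \<in> Ob A" shows "is_cokernel A (Id A x) (Zero A z x)"
  by (rule cokernelI[OF zero_hom[OF assms] id_hom[OF assms(2)] id_left[OF zero_hom[OF assms]] iso_epi[OF
      iso_id[OF assms(2)]]])
    (use id_right in auto)

lemma kernel_of_zero_id:
  assumes "z \<in> Ob A" "x \<in> Ob A" shows "is_kernel A (Id A x) (Zero A x z)"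
  by (rule kernelI[OF zero_hom[OF assms(2,1)] id_hom[OF assms(2)] id_right[OF zero_hom[OF assms(2,1)]]
      iso_mono[OF iso_id[OF assms(2)]]])
    (use id_left in auto)

lemma short_exact_zero_id:
  assumes "is_zero_obj A z" "x \<in> Ob A" shows "short_exact A (Zero A z x) (Id A x)"
proof -
  have z: "z \<in> Ob A" using assms by (simp add: is_zero_obj_def)
  show ?thesis unfolding short_exact_def
    using kernel_of_mono_zero[OF assms(1) id_hom[OF assms(2)] iso_mono[OF iso_id[OF assms(2)]]]
      cokernel_of_zero_id[OF z assms(2)] by blast
qed

text \<open>At a zero object the identity is at once a cokernel of the incoming map, a kernel of
  that cokernel and a kernel of the outgoing map.\<close>

lemma exact_at_zero_obj:
  assumes z: "is_zero_obj A z" and a: "a \<in> Hom A x z" and b: "b \<in> Hom A z y"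
  shows "exact_at A a b"
proof -
  have zo: "z \<in> Ob A" using z by (simp add: is_zero_obj_def)
  have e: "a = Zero A x z" "b = Zero A z y" "Id A z = Zero A z z"
    using zero_obj_hom(1)[OF z a] zero_obj_hom(2)[OF z b] zero_obj_iff[OF zo] z by auto
  show ?thesis unfolding exact_at_def
  proof (intro exI[of _ "Id A z"] conjI)
    show "is_cokernel A (Id A z) a" unfolding e(1) by (rule cokernel_of_zero_id[OF Hom_Ob(1)[OF a] zo])
    show "is_kernel A (Id A z) b" unfolding e(2) by (rule kernel_of_zero_id[OF Hom_Ob(2)[OF b] zo])
    show "is_kernel A (Id A z) (Id A z)" using kernel_of_zero_id[OF zo zo] e(3) by simp
  qed
qed

text \<open>The identity is a cokernel of the incoming zero map, and its kernel is zero like that of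
  any monomorphism. This is the spot where the connecting map into degree 0 meets the image of a
  mono under an exact functor.\<close>

lemma exact_at_zero_mono:
  assumes z: "is_zero_obj A z" and b: "b \<in> Hom A x y" "is_mono A b"
  shows "exact_at A (Zero A z x) b"
proof -
  have zo: "z \<in> Ob A" using z by (simp add: is_zero_obj_def)
  note x = Hom_Ob(1)[OF b(1)]
  show ?thesis unfolding exact_at_def
    using cokernel_of_zero_id[OF zo x] kernel_of_mono_zero[OF z b]
      kernel_of_mono_zero[OF z id_hom[OF x] iso_mono[OF iso_id[OF x]]] by blast
qed

end

lemma nat_trans_id:
  assumes "is_functor C D F" shows "nat_trans C D F F (\<lambda>x\<in>Ob C. Id D (obj_map F x))"
proof -
  interpret C: category C by (rule functorD(1)[OF assms])
  interpret D: category D by (rule functorD(2)[OF assms])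
  show ?thesis
    by (rule nat_transI[OF assms assms])
      (use functorD(3)[OF assms] D.id_hom D.id_left[OF functorD(4)[OF assms]] D.id_right[OF functorD(4)[OF
          assms]]
        C.Hom_Ob in auto)
qed

lemma nat_trans_zero:
  assumes "is_functor C D F" "is_functor C D G" "preadditive D"
  shows "nat_trans C D F G (\<lambda>x\<in>Ob C. Zero D (obj_map F x) (obj_map G x))"
proof -
  interpret C: category C by (rule functorD(1)[OF assms(1)])
  interpret D: preadditive D by fact
  show ?thesis
    by (rule nat_transI[OF assms(1,2)])
      (use functorD(3)[OF assms(1)] functorD(3)[OF assms(2)] D.zero_hom D.comp_zero_right[OF functorD(4)[OF
          assms(2)]]
        D.comp_zero_left[OF functorD(4)[OF assms(1)]] C.Hom_Ob in auto)
qed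

locale exact_functor = C: preadditive C + D: preadditive D
  for C :: "('o1, 'a1, 'z1) acat_scheme" and D :: "('o2, 'a2, 'z2) acat_scheme" +
  fixes F :: "('o1, 'a1, 'o2, 'a2) fctr"
  assumes additive: "additive_functor C D F"
    and exact: "short_exact C f g \<Longrightarrow> short_exact D (arr_map F f) (arr_map F g)"
    and ex_zero: "\<exists>z. is_zero_obj D z"
begin

lemma F: "is_functor C D F" using additive by (simp add: additive_functor_def)

abbreviation "z \<equiv> zero_obj D"

lemma z: "is_zero_obj D z" "z \<in> Ob D" using D.zero_obj[OF ex_zero] by auto

lemma short_exact_hom:
  assumes "short_exact C f g"
  shows "f \<in> Hom C (Dom C f) (Cod C f)" "g \<in> Hom C (Cod C f) (Cod C g)"
  using assms by (auto simp: short_exact_def is_kernel_def Hom_iff)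

lemma F_short_exact:
  assumes "short_exact C f g"
  shows "arr_map F f \<in> Hom D (obj_map F (Dom C f)) (obj_map F (Cod C f))"
    "arr_map F g \<in> Hom D (obj_map F (Cod C f)) (obj_map F (Cod C g))"
    "is_mono D (arr_map F f)" "is_epi D (arr_map F g)"
  using functorD(4)[OF F] short_exact_hom[OF assms] exact[OF assms] D.kernel_mono D.cokernel_epi
  unfolding short_exact_def by blast+

text \<open>Every connecting map starts at the chosen zero object, the value of
  \<open>zero_functor\<close>, and so has to be the zero map.\<close>

definition "satellites =
  \<lparr>degree = (\<lambda>n. if n = 0 then F else zero_functor C D),
   conn = (\<lambda>n f g. Zero D z (obj_map (if n = 0 then F else zero_functor C D) (Dom C f)))\<rparr>"

lemma zero_functor_CD: "is_functor C D (zero_functor C D)"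
  by (rule zero_functor[OF C.category_axioms D.category_axioms ex_zero])

lemma zero_functor_obj: "x \<in> Ob C \<Longrightarrow> obj_map (zero_functor C D) x = z"
  by (simp add: zero_functor_def)

lemma satellites_degree: "is_functor C D (degree satellites n)"
  "x \<in> Ob C \<Longrightarrow> obj_map (degree satellites (Suc n)) x = z"
  using F zero_functor_CD by (auto simp: satellites_def zero_functor_obj)

text \<open>By exactness the connecting map is killed by degree 0 of \<open>f\<close>; by naturality
  its composite with \<open>t\<close> is killed by the image of \<open>f\<close> under
  \<open>F\<close>, which is monic as \<open>F\<close> preserves short exact sequences.\<close>

lemma comp_conn_zero:
  assumes S: "delta_functor C D S" and t: "nat_trans C D (degree S 0) F t" and s: "short_exact C f g"
  shows "t (Dom C f) \<cdot>\<^bsub>D\<^esub> conn S 0 f g = Zero D (obj_map (degree S (Suc 0)) (Cod C g)) (obj_map F (Dom C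
      f))"
proof -
  note f = short_exact_hom[OF s]
  note x = C.Hom_Ob[OF f(1)] C.Hom_Ob[OF f(2)]
  note t' = nat_transD[OF t]
  have c: "conn S 0 f g \<in> Hom D (obj_map (degree S (Suc 0)) (Cod C g)) (obj_map (degree S 0) (Dom C f))"
    and e: "exact_at D (conn S 0 f g) (arr_map (degree S 0) f)" using S s unfolding delta_functor_def by
        blast+
  note a = functorD(4)[OF t'(1) f(1)]
  note co = D.Hom_Ob(1)[OF c]
  have "arr_map F f \<cdot>\<^bsub>D\<^esub> (t (Dom C f) \<cdot>\<^bsub>D\<^esub> conn S 0 f g) = t (Cod C f) \<cdot>\<^bsub>D\<^esub> (arr_map (degree S 0) f \<cdot>\<^bsub>D\<^esub>
      conn S 0 f g)"
    using D.comp_eq_reduce[OF t'(5)[OF f(1)] a t'(4)[OF x(2)] c]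
      D.comp_assoc[OF c t'(4)[OF x(1)] functorD(4)[OF F f(1)]] by simp
  also have "\<dots> = Zero D (obj_map (degree S (Suc 0)) (Cod C g)) (obj_map F (Cod C f))"
    using D.exact_at_comp_zero[OF e c a] D.comp_zero_right[OF t'(4)[OF x(2)] co] by simp
  also have "\<dots> = arr_map F f \<cdot>\<^bsub>D\<^esub> Zero D (obj_map (degree S (Suc 0)) (Cod C g)) (obj_map F (Dom C f))"
    using D.comp_zero_right[OF functorD(4)[OF F f(1)] co] by simp
  finally show ?thesis
    by (rule D.mono_cancel[OF F_short_exact(3,1)[OF s] D.comp_hom[OF c t'(4)[OF x(1)]] D.zero_hom[OF co
        functorD(3)[OF F x(1)]]])
qed

lemma satellites_delta_functor: "delta_functor C D satellites"
  unfolding delta_functor_def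
proof (intro conjI allI impI)
  note deg = satellites_degree
  \<comment> \<open>Addition of endomorphisms of \<open>z\<close> is trivial, which is what
    additivity of the zero functor amounts to.\<close>
  have "Plus D (Id D z) (Id D z) = Id D z"
    using D.zero_obj_unique(1)[OF z(1) D.plus_hom D.id_hom] D.id_hom[OF z(2)] z(2) by blast
  then have add_Z: "arr_map (zero_functor C D) (Plus C f g) = Plus D (arr_map (zero_functor C D) f)
      (arr_map (zero_functor C D) g)"
    if "f \<in> Hom C x y" "g \<in> Hom C x y" for f g x y
    using C.plus_hom[OF that] that by (simp add: zero_functor_def Hom_iff)
  show "additive_functor C D (degree satellites n)" for n
  proof (cases n)
    case 0 then show ?thesis using additive by (simp add: satellites_def)
  next
    case (Suc m)
    then show ?thesis unfolding additive_functor_def using deg(1)[of n] add_Z by (auto simp: satellites_def)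
  qed
  fix f g assume s: "short_exact C f g"
  note f = short_exact_hom[OF s]
  note x = C.Hom_Ob[OF f(1)] C.Hom_Ob[OF f(2)]
  show "is_epi D (arr_map (degree satellites 0) g)" using F_short_exact(4)[OF s] by (simp add:
      satellites_def)
  fix n
  have conn: "conn satellites n f g \<in> Hom D z (obj_map (degree satellites n) (Dom C f))"
    using D.zero_hom[OF z(2) functorD(3)[OF deg(1) x(1)], of n] by (simp add: satellites_def)
  then show conn': "conn satellites n f g \<in> Hom D (obj_map (degree satellites (Suc n)) (Cod C g))
      (obj_map (degree satellites n) (Dom C f))" using deg(2)[OF x(4)] by simp
  show "exact_at D (arr_map (degree satellites n) f) (arr_map (degree satellites n) g)"
  proof (cases n)
    case 0
    then show ?thesis using exact[OF s] by (auto simp: satellites_def short_exact_def exact_at_def)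
  next
    case (Suc m)
    then show ?thesis
      using D.exact_at_zero_obj[OF z(1)] functorD(4)[OF deg(1) f(1), of n] functorD(4)[OF deg(1) f(2), of n]
        deg(2)[OF x(2), of m] by simp
  qed
  show "exact_at D (arr_map (degree satellites (Suc n)) g) (conn satellites n f g)"
    by (rule D.exact_at_zero_obj[OF z(1) _ conn])
      (use functorD(4)[OF deg(1) f(2), of "Suc n"] deg(2)[OF x(4)] in simp)
  show "exact_at D (conn satellites n f g) (arr_map (degree satellites n) f)"
  proof (cases n)
    case 0
    then show ?thesis using D.exact_at_zero_mono[OF z(1) F_short_exact(1,3)[OF s]] by (simp add:
        satellites_def)
  next
    case (Suc m)
    show ?thesis
      by (rule D.exact_at_zero_obj[OF z(1)])
        (use Suc conn functorD(4)[OF deg(1) f(1), of n] deg(2)[OF x(1), of m] in simp_all)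
  qed
next
  fix f g f' g' a b c n
  assume A: "short_exact C f g \<and> short_exact C f' g' \<and>
        a \<in> Hom C (Dom C f) (Dom C f') \<and> b \<in> Hom C (Cod C f) (Cod C f') \<and>
        c \<in> Hom C (Cod C g) (Cod C g') \<and>
        b \<cdot>\<^bsub>C\<^esub> f = f' \<cdot>\<^bsub>C\<^esub> a \<and> c \<cdot>\<^bsub>C\<^esub> g = g' \<cdot>\<^bsub>C\<^esub> b"
  note deg = satellites_degree
  have ca: "c \<in> Hom C (Cod C g) (Cod C g')" "a \<in> Hom C (Dom C f) (Dom C f')" using A by auto
  note x = C.Hom_Ob[OF ca(1)] C.Hom_Ob[OF ca(2)]
  have conn: "conn satellites n f g \<in> Hom D z (obj_map (degree satellites n) (Dom C f))" if "Dom C f \<in> Ob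
      C" for f g
    using D.zero_hom[OF z(2) functorD(3)[OF deg(1) that], of n] by (simp add: satellites_def)
  have "arr_map (degree satellites (Suc n)) c \<in> Hom D z z"
    using functorD(4)[OF deg(1) ca(1), of "Suc n"] deg(2)[OF x(1)] deg(2)[OF x(2)] by simp
  from D.comp_hom[OF this conn[OF x(4)]] D.comp_hom[OF conn[OF x(3)] functorD(4)[OF deg(1) ca(2)]]
  show "conn satellites n f' g' \<cdot>\<^bsub>D\<^esub> arr_map (degree satellites (Suc n)) c =
      arr_map (degree satellites n) a \<cdot>\<^bsub>D\<^esub> conn satellites n f g"
    by (rule D.zero_obj_unique(2)[OF z(1)])
qed

text \<open>In positive degrees the targets are zero objects, so the extension of \<open>t0\<close>
  is unique. Its existence reduces to the square in degree 0, both sides of which vanish: one by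
  \<open>comp_conn_zero\<close>, the other because it passes through a zero object.\<close>

lemma left_satellites: "left_satellites C D F satellites"
  unfolding left_satellites_def
proof (intro conjI allI impI satellites_delta_functor)
  note deg = satellites_degree
  show F0: "degree satellites 0 = F" by (simp add: satellites_def)
  fix S t0 assume A: "delta_functor C D S \<and> nat_trans C D (degree S 0) (degree satellites 0) t0"
  then have S: "delta_functor C D S" and t0: "nat_trans C D (degree S 0) F t0" using F0 by auto
  have Sf: "is_functor C D (degree S n)" for n using S by (simp add: delta_functor_def additive_functor_def)
  define t where "t = (\<lambda>n. if n = 0 then t0 else (\<lambda>x\<in>Ob C. Zero D (obj_map (degree S n) x) z))"
  have t_Suc: "nat_trans C D (degree S (Suc n)) (degree satellites (Suc n)) (t (Suc n))" for n
    using nat_trans_zero[OF Sf deg(1) D.preadditive_axioms, of "Suc n" "Suc n"]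
    by (simp add: t_def deg(2) cong: restrict_cong)
  have t: "nat_trans C D (degree S n) (degree satellites n) (t n)" for n
    using t_Suc t0 F0 by (cases n) (auto simp: t_def)
  have "delta_morphism C D S satellites t"
    unfolding delta_morphism_def
  proof (intro conjI allI impI)
    fix n f g assume s: "short_exact C f g"
    note f = short_exact_hom[OF s]
    note x = C.Hom_Ob[OF f(1)] C.Hom_Ob[OF f(2)]
    have c: "conn S n f g \<in> Hom D (obj_map (degree S (Suc n)) (Cod C g)) (obj_map (degree S n) (Dom C f))"
      "conn satellites n f g \<in> Hom D (obj_map (degree satellites (Suc n)) (Cod C g)) (obj_map (degree
          satellites n) (Dom C f))"
      using S satellites_delta_functor s unfolding delta_functor_def by blast+
    note h = D.comp_hom[OF c(1) nat_transD(4)[OF t x(1)]] D.comp_hom[OF nat_transD(4)[OF t x(4)] c(2)]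
    show "t n (Dom C f) \<cdot>\<^bsub>D\<^esub> conn S n f g = conn satellites n f g \<cdot>\<^bsub>D\<^esub> t (Suc n) (Cod C g)"
    proof (cases n)
      case 0
      have "conn satellites 0 f g \<cdot>\<^bsub>D\<^esub> t (Suc 0) (Cod C g) =
          Zero D (obj_map (degree S (Suc 0)) (Cod C g)) (obj_map F (Dom C f))"
        using nat_transD(4)[OF t x(4), of "Suc 0"] deg(2)[OF x(4), of 0] functorD(3)[OF F x(1)]
        by (simp add: satellites_def D.comp_zero_left)
      then show ?thesis using comp_conn_zero[OF S t0 s] by (simp add: t_def 0)
    next
      case (Suc m)
      then have zz: "obj_map (degree satellites n) (Dom C f) = z" using deg(2)[OF x(1)] by simp
      show ?thesis by (rule D.zero_obj_unique(1)[OF z(1) h[unfolded zz]])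
    qed
  qed (rule t)
  moreover have "t' = t" if t': "delta_morphism C D S satellites t'" "t' 0 = t0" for t'
  proof
    fix n
    have n: "nat_trans C D (degree S n) (degree satellites n) (t' n)" using t'(1) by (simp add:
        delta_morphism_def)
    show "t' n = t n"
    proof (cases n)
      case 0 then show ?thesis using t'(2) by (simp add: t_def)
    next
      case (Suc m)
      show ?thesis
      proof (rule extensionalityI[OF nat_transD(3)[OF n] nat_transD(3)[OF t]])
        fix x assume x: "x \<in> Ob C"
        show "t' n x = t n x"
          by (rule D.zero_obj_unique(1)[OF z(1)])
            (use nat_transD(4)[OF n x] nat_transD(4)[OF t x, of n] Suc deg(2)[OF x] in simp_all)
      qed
    qed
  qed
  moreover have "t 0 = t0" by (simp add: t_def)
  ultimately show "\<exists>!t. delta_morphism C D S satellites t \<and> t 0 = t0"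
    by (intro ex1I[of _ t]) blast+
qed

text \<open>By universality, the identity and the endomorphism that vanishes in positive degrees agree.
  The latter is a morphism because \<open>F\<close> preserves monomorphisms, so that the connecting maps
  into degree \<open>0\<close> are zero.\<close>

lemma left_satellites_zero:
  assumes S: "left_satellites C D F S" and x: "x \<in> Ob C"
  shows "is_zero_obj D (obj_map (degree S (Suc n)) x)"
proof -
  have dS: "delta_functor C D S" and S0: "degree S 0 = F" using S by (auto simp: left_satellites_def)
  have Sf: "is_functor C D (degree S n)" for n using dS by (simp add: delta_functor_def
      additive_functor_def)
  define i where "i = (\<lambda>n. \<lambda>x\<in>Ob C. Id D (obj_map (degree S n) x))"
  define k where "k = (\<lambda>n. if n = 0 then i 0 else (\<lambda>x\<in>Ob C. Zero D (obj_map (degree S n) x) (obj_map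
      (degree S n) x)))"
  have i: "nat_trans C D (degree S n) (degree S n) (i n)" for n unfolding i_def by (rule nat_trans_id[OF
      Sf])
  have k: "nat_trans C D (degree S n) (degree S n) (k n)" for n
    using i nat_trans_zero[OF Sf Sf D.preadditive_axioms, of n n] by (cases n) (auto simp: k_def)
  have c: "conn S n f g \<in> Hom D (obj_map (degree S (Suc n)) (Cod C g)) (obj_map (degree S n) (Dom C f))"
    "Dom C f \<in> Ob C" "Cod C g \<in> Ob C" if s: "short_exact C f g" for n f g
    using dS s C.Hom_Ob[OF short_exact_hom(1)[OF s]] C.Hom_Ob[OF short_exact_hom(2)[OF s]]
    unfolding delta_functor_def by blast+
  have "delta_morphism C D S S i"
    unfolding delta_morphism_def
    using i D.id_left[OF c(1)] D.id_right[OF c(1)] c(2,3) by (simp add: i_def)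
  moreover have "delta_morphism C D S S k"
    unfolding delta_morphism_def
  proof (intro conjI allI impI)
    fix n f g assume s: "short_exact C f g"
    note c = c[OF s]
    note o = D.Hom_Ob[OF c(1)]
    show "k n (Dom C f) \<cdot>\<^bsub>D\<^esub> conn S n f g = conn S n f g \<cdot>\<^bsub>D\<^esub> k (Suc n) (Cod C g)"
    proof (cases n)
      case 0
      have "i 0 (Dom C f) \<cdot>\<^bsub>D\<^esub> conn S 0 f g = Zero D (obj_map (degree S (Suc 0)) (Cod C g)) (obj_map F (Dom
          C f))"
        by (rule comp_conn_zero[OF dS _ s]) (use i[of 0] S0 in simp)
      then show ?thesis
        using 0 S0 D.comp_zero_right[OF c(1), of "obj_map (degree S (Suc 0)) (Cod C g)" 0] o c(3) by (simp
            add: k_def)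
    next
      case (Suc m)
      then show ?thesis using D.comp_zero_right[OF c(1) o(1)] D.comp_zero_left[OF c(1) o(2)] c(2,3) by
          (simp add: k_def)
    qed
  qed (rule k)
  moreover have "\<exists>!t. delta_morphism C D S S t \<and> t 0 = i 0" using S dS i unfolding left_satellites_def by
      blast
  moreover have "k 0 = i 0" by (simp add: k_def)
  ultimately have "i = k" by (elim ex1E) metis
  then have "i (Suc n) x = k (Suc n) x" by simp
  then show ?thesis using x D.zero_obj_iff[OF functorD(3)[OF Sf x]] by (simp add: i_def k_def)
qed

end

section \<open>Spectral sequences concentrated in one row\<close>

text \<open>All differentials can be taken to be zero, and the filtration of \<open>H n\<close> has
  a single jump at \<open>p = n\<close>. The pages are built from \<open>H\<close> rather than from
  \<open>E2\<close>, so that the limit terms match the abutment literally and \<open>h\<close>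
  enters only through the identification of the second page.\<close>

lemma (in abelian_category) row_spectral_sequence:
  assumes N: "category N" and H: "\<And>n. is_functor N A (H n)" and E2: "\<And>p q. is_functor N A (E2 p q)"
    and zero: "\<And>p q T. T \<in> Ob N \<Longrightarrow> is_zero_obj A (obj_map (E2 p (Suc q)) T)"
    and h: "\<And>p T. T \<in> Ob N \<Longrightarrow> h p T \<in> Hom A (obj_map (H p) T) (obj_map (E2 p 0) T) \<and> is_iso A (h p T)"
    and nat: "\<And>p t T T'. t \<in> Hom N T T' \<Longrightarrow> arr_map (E2 p 0) t \<cdot>\<^bsub>A\<^esub> h p T = h p T' \<cdot>\<^bsub>A\<^esub> arr_map (H p) t"
  shows "\<exists>S \<Phi> X \<theta>. functorial_specseq N A E2 H S \<Phi> X \<theta>"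
proof -
  interpret N: category N by (rule N)
  define z where "z = zero_obj A"
  have z: "is_zero_obj A z" "z \<in> Ob A" using zero_obj[OF ex_zero_obj] by (auto simp: z_def)
  have Hob: "obj_map (H n) T \<in> Ob A" if "T \<in> Ob N" for n T using functorD(3)[OF H that] .
  have Har: "arr_map (H n) t \<in> Hom A (obj_map (H n) T) (obj_map (H n) T')" if "t \<in> Hom N T T'" for n T T' t
    using functorD(4)[OF H that] .
  \<comment> \<open>There is no dependence on the page number: a differential on page
    \<open>r \<ge> 2\<close> changes \<open>q\<close> by \<open>r - 1 \<ge> 1\<close>, so it cannot
    connect two terms of the only possibly nonzero row.\<close>
  define P where "P = (\<lambda>T (p :: int) (q :: int). if p \<ge> 0 \<and> q = 0 then obj_map (H (nat p)) T else z)"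
  define \<Phi> where "\<Phi> = (\<lambda>t (r :: nat) (p :: int) (q :: int). if p \<ge> 0 \<and> q = 0 then arr_map (H (nat p)) t
      else Id A z)"
  define S where "S = (\<lambda>T. \<lparr>page = (\<lambda>r. P T),
     diffl = (\<lambda>r p q. Zero A (P T p q) (P T (p - int r) (q + int r - 1))),
     turn = (\<lambda>r p q. homology_of_zero (P T (p + int r) (q - int r + 1)) (P T p q) (P T (p - int r) (q + int
         r - 1)))\<rparr>)"
  \<comment> \<open>Total degree \<open>n\<close> meets the row only at \<open>(n, 0)\<close>, so
    the filtration steps below \<open>n\<close> are zero and step \<open>n\<close> is all of
    \<open>H n\<close>, which is also the whole quotient there.\<close>
  define X where "X = (\<lambda>T. \<lparr>incl = (\<lambda>n p. if p = int n then Id A (obj_map (H n) T) else Zero A z (obj_map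
      (H n) T)),
     quot = (\<lambda>n p. if p = n then Id A (obj_map (H n) T) else Zero A z z)\<rparr>)"
  \<comment> \<open>Off the row both sides are zero objects, and the zero map between them is an
    isomorphism.\<close>
  define \<theta> where "\<theta> = (\<lambda>p q T. if q = 0 then h p T else Zero A z (obj_map (E2 p q) T))"
  have Pob: "P T p q \<in> Ob A" if "T \<in> Ob N" for T p q using Hob[OF that] z by (simp add: P_def)
  have \<Phi>hom: "\<Phi> t r p q \<in> Hom A (P T p q) (P T' p q)" if "t \<in> Hom N T T'" for t r p q T T'
    using Har[OF that] id_hom[OF z(2)] by (simp add: P_def \<Phi>_def)
  have diff_in: "diff_in (S T) r p q = Zero A (P T (p + int r) (q - int r + 1)) (P T p q)" for T r p q
    by (simp add: diff_in_def S_def)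
  have zz: "Zero A z z = Id A z" using zero_obj_iff[OF z(2)] z(1) by simp
  have ss: "spectral_sequence A (S T)" if T: "T \<in> Ob N" for T
    unfolding spectral_sequence_def diff_in
  proof (intro allI impI conjI)
    fix r p q
    note o = Pob[OF T]
    note zh = homology_of_zero[OF o o o]
    show "page (S T) r p q \<in> Ob A" using o by (simp add: S_def)
    show "is_zero_obj A (page (S T) r p q)" if "p < 0 \<or> q < 0" using that z by (auto simp: S_def P_def)
    show "diffl (S T) r p q \<in> Hom A (page (S T) r p q) (page (S T) r (p - int r) (q + int r - 1))"
      using zero_hom[OF o o] by (simp add: S_def)
    show "diffl (S T) r p q \<cdot>\<^bsub>A\<^esub> Zero A (P T (p + int r) (q - int r + 1)) (P T p q) =
      Zero A (page (S T) r (p + int r) (q - int r + 1)) (page (S T) r (p - int r) (q + int r - 1))"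
      using comp_zero_right[OF zero_hom[OF o o] o] by (simp add: S_def)
    show "turn (S T) r p q \<in> Hom A (homology_obj A (Zero A (P T (p + int r) (q - int r + 1)) (P T p q))
        (diffl (S T) r p q))
        (page (S T) (Suc r) p q)" "is_iso A (turn (S T) r p q)"
      using zh by (simp_all add: S_def)
  qed
  have cv: "converges A (S T) (\<lambda>n. obj_map (H n) T) (X T)" if T: "T \<in> Ob N" for T
    unfolding converges_def
  proof (intro allI conjI impI)
    fix n :: nat
    note o = Hob[OF T, of n]
    show "is_mono A (incl (X T) n p)" "Cod A (incl (X T) n p) = obj_map (H n) T" for p
      using iso_mono[OF iso_id[OF o]] o z zero_obj_unique(1)[OF z(1)] by (auto simp: X_def is_mono_def)
    show "is_zero_obj A (Dom A (incl (X T) n (- 1)))" using o z by (simp add: X_def)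
    show "is_iso A (incl (X T) n (int n))" using iso_id[OF o] by (simp add: X_def)
    fix p assume p: "p \<le> n"
    show "Cod A (quot (X T) n p) = page (S T) (limit_page p (n - p)) (int p) (int (n - p))"
      using o z p by (auto simp: X_def S_def P_def)
    show "\<exists>j. j \<in> Hom A (Dom A (incl (X T) n (int p - 1))) (Dom A (incl (X T) n (int p))) \<and>
             incl (X T) n (int p) \<cdot>\<^bsub>A\<^esub> j = incl (X T) n (int p - 1) \<and> short_exact A j (quot (X T) n p)"
    proof (cases "p = n")
      case True
      show ?thesis
        by (rule exI[of _ "Zero A z (obj_map (H n) T)"])
          (use True o z short_exact_zero_id[OF z(1) o] zero_hom[OF z(2) o] id_left[OF zero_hom[OF z(2) o]]
              in \<open>simp add: X_def\<close>)
    next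
      case False
      have "int p - 1 \<noteq> int n" "int p \<noteq> int n" using False p by auto
      moreover have "short_exact A (Zero A z z) (Zero A z z)" using short_exact_zero_id[OF z(1,2)] zz by
          simp
      ultimately show ?thesis
        by (intro exI[of _ "Zero A z z"])
          (use False o z zero_hom[OF z(2,2)] comp_zero_left[OF zero_hom[OF z(2,2)] o] in \<open>simp add: X_def\<close>)
    qed
  qed
  have \<theta>: "is_iso A (\<theta> p q T) \<and> \<theta> p q T \<in> Hom A (page (S T) 2 (int p) (int q)) (obj_map (E2 p q) T)" if T:
      "T \<in> Ob N" for p q T
  proof (cases q)
    case 0 then show ?thesis using h[OF T] by (simp add: \<theta>_def S_def P_def)
  next
    case (Suc m)
    have "Zero A z (obj_map (E2 p q) T) \<in> Hom A z (obj_map (E2 p q) T)"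
      by (rule zero_hom[OF z(2) functorD(3)[OF E2 T]])
    then show ?thesis using Suc zero_obj_iso[OF z(1) zero[OF T]] by (simp add: \<theta>_def S_def P_def)
  qed
  have mor: "specseq_morphism A (S T) (S T') (\<Phi> t)" if t: "t \<in> Hom N T T'" for T T' t
    unfolding specseq_morphism_def diff_in
  proof (intro allI impI conjI)
    fix r p q
    note o = Pob[OF N.Hom_Ob(1)[OF t]] and o' = Pob[OF N.Hom_Ob(2)[OF t]]
    show "\<Phi> t r p q \<in> Hom A (page (S T) r p q) (page (S T') r p q)" using \<Phi>hom[OF t] by (simp add: S_def)
    show "\<Phi> t r (p - int r) (q + int r - 1) \<cdot>\<^bsub>A\<^esub> diffl (S T) r p q = diffl (S T') r p q \<cdot>\<^bsub>A\<^esub> \<Phi> t r p q"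
      using comp_zero_right[OF \<Phi>hom[OF t] o] comp_zero_left[OF \<Phi>hom[OF t] o'] by (simp add: S_def)
    \<comment> \<open>The morphism is the same on all pages, so compatibility with turning the page
      is naturality of \<open>homology_of_zero\<close>.\<close>
    have "\<Phi> t (Suc r) p q = \<Phi> t r p q" by (simp add: \<Phi>_def)
    then show "\<Phi> t (Suc r) p q \<cdot>\<^bsub>A\<^esub> turn (S T) r p q = turn (S T') r p q \<cdot>\<^bsub>A\<^esub>
       homology_map A (Zero A (P T (p + int r) (q - int r + 1)) (P T p q)) (diffl (S T) r p q)
        (Zero A (P T' (p + int r) (q - int r + 1)) (P T' p q)) (diffl (S T') r p q) (\<Phi> t r p q)"
      using homology_of_zero_natural[OF o o o o' o' o' \<Phi>hom[OF t]] by (simp add: S_def)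
  qed
  have cmor: "converges_morphism A (X T) (X T') (\<Phi> t) (\<lambda>n. arr_map (H n) t)" if t: "t \<in> Hom N T T'" for T
      T' t
    unfolding converges_morphism_def
  proof (intro allI impI)
    fix n p :: nat assume p: "p \<le> n"
    note o = Hob[OF N.Hom_Ob(1)[OF t], of n] and o' = Hob[OF N.Hom_Ob(2)[OF t], of n] and a = Har[OF t, of
        n]
    show "\<exists>s\<in>Hom A (Dom A (incl (X T) n (int p))) (Dom A (incl (X T') n (int p))).
              incl (X T') n (int p) \<cdot>\<^bsub>A\<^esub> s = arr_map (H n) t \<cdot>\<^bsub>A\<^esub> incl (X T) n (int p) \<and>
              quot (X T') n p \<cdot>\<^bsub>A\<^esub> s = \<Phi> t (limit_page p (n - p)) (int p) (int (n - p)) \<cdot>\<^bsub>A\<^esub> quot (X T) n p"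
    proof (cases "p = n")
      case True
      then show ?thesis using a o o' id_left[OF a] id_right[OF a] by (intro bexI[of _ "arr_map (H n) t"])
          (simp_all add: X_def \<Phi>_def)
    next
      case False
      then show ?thesis using p z o o' id_hom[OF z(2)] comp_zero_right[OF a z(2)] id_right[OF zero_hom[OF
          z(2) o']]
          id_right[OF zero_hom[OF z(2,2)]] id_left[OF zero_hom[OF z(2,2)]]
        by (intro bexI[of _ "Id A z"]) (simp_all add: X_def \<Phi>_def)
    qed
  qed
  have nat\<theta>: "arr_map (E2 p q) t \<cdot>\<^bsub>A\<^esub> \<theta> p q T = \<theta> p q T' \<cdot>\<^bsub>A\<^esub> \<Phi> t 2 (int p) (int q)" if t: "t \<in> Hom N T T'"
      for T T' t p q
  proof (cases q)
    case 0 then show ?thesis using nat[OF t] by (simp add: \<theta>_def \<Phi>_def)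
  next
    case (Suc m)
    have "\<theta> p q T \<in> Hom A z (obj_map (E2 p q) T)" "\<theta> p q T' \<in> Hom A z (obj_map (E2 p q) T')" "\<Phi> t 2 (int p)
        (int q) \<in> Hom A z z"
      using \<theta>[OF N.Hom_Ob(1)[OF t], of p q] \<theta>[OF N.Hom_Ob(2)[OF t], of p q] Suc id_hom[OF z(2)]
      by (simp_all add: S_def P_def \<Phi>_def)
    then show ?thesis using zero_obj_unique(2)[OF z(1) comp_hom comp_hom] functorD(4)[OF E2 t, of p q] by
        blast
  qed
  have "functorial_specseq N A E2 H S \<Phi> X \<theta>"
    unfolding functorial_specseq_def
  proof (intro conjI ballI allI impI)
    show "\<Phi> (Id N T) r p q = Id A (page (S T) r p q)" if "T \<in> Ob N" for T r p q
      using functorD(5)[OF H that] by (simp add: \<Phi>_def S_def P_def)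
    show "\<Phi> (t' \<cdot>\<^bsub>N\<^esub> t) r p q = \<Phi> t' r p q \<cdot>\<^bsub>A\<^esub> \<Phi> t r p q" if "t \<in> Hom N T T'" "t' \<in> Hom N T' T''" for T T'
        T'' t t' r p q
      using functorD(6)[OF H that] id_left[OF id_hom[OF z(2)]] by (simp add: \<Phi>_def)
  qed (use ss cv \<theta> mor cmor nat\<theta> in blast)+
  then show ?thesis by blast
qed

section \<open>The spectral sequence of a functor of small categories\<close>

context natsys_functor begin

text \<open>Naturality of the unit read at one simplex; restriction replaces a simplex of
  \<open>E\<close> by its image under \<open>u\<close>.\<close>

lemma unit_natural:
  assumes L: "is_functor NE NB L" and \<eta>: "is_unit NE NB L K \<eta>" and t: "t \<in> Hom NE T T'" and f: "f \<in>
      simplices E n"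
  shows "component (arr_map L t) (n, after u n f) \<cdot>\<^bsub>A\<^esub> component (\<eta> T) (n, f) =
    component (\<eta> T') (n, f) \<cdot>\<^bsub>A\<^esub> component t (n, f)"
proof -
  have c: "component (s \<cdot>\<^bsub>NE\<^esub> r) (n, f) = component s (n, f) \<cdot>\<^bsub>A\<^esub> component r (n, f)" for s r
    unfolding natsys_cat_def by (rule component_comp) (use f in \<open>simp add: Ob_simplex_cat\<close>)
  have "arr_map K (arr_map L t) \<cdot>\<^bsub>NE\<^esub> \<eta> T = \<eta> T' \<cdot>\<^bsub>NE\<^esub> t" using \<eta> t by (simp add: is_unit_def)
  from arg_cong[OF this, of "\<lambda>s. component s (n, f)"] show ?thesis
    using K_component[OF functorD(4)[OF L t] f] by (simp add: c)
qed

lemma unit_component: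
  assumes L: "is_functor NE NB L" and \<eta>: "is_unit NE NB L K \<eta>" and T: "T \<in> Ob NE" and f: "f \<in> simplices E n"
  shows "component (\<eta> T) (n, f) \<in> Hom A (obj_map T (n, f)) (obj_map (obj_map L T) (n, after u n f))"
  by (rule coproduct_in[OF unit_coproduct[OF L \<eta> T after_simplices[OF u f]]]) (use f in \<open>simp add:
      fibre_def\<close>)

text \<open>Exactness in a functor category can be passed to components and back. At a simplex of
  \<open>B\<close> the sequence in question is the coproduct, over the fibre, of the short exact
  sequences at simplices of \<open>E\<close>, with the unit components as injections.\<close>

lemma Lan_exact:
  assumes ex: "exact_coproducts TYPE('u) A" and L: "is_functor NE NB L" and \<eta>: "is_unit NE NB L K \<eta>"
    and s: "short_exact NE f g"
  shows "short_exact NB (arr_map L f) (arr_map L g)"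
proof -
  have CE: "category (op_cat (simplex_cat E))" and CB: "category (op_cat (simplex_cat B))"
    by (rule op_category[OF simplex_category])+
  interpret NE: preadditive NE by (rule NE_preadditive)
  interpret NB: preadditive NB by (rule NB_preadditive)
  have k: "is_kernel NE f g" "is_cokernel NE g f" using s by (auto simp: short_exact_def)
  obtain T1 T2 T3 where f: "f \<in> Hom NE T1 T2" and g: "g \<in> Hom NE T2 T3"
    using k(1) by (auto simp: is_kernel_def Hom_iff)
  note T = NE.Hom_Ob[OF f] NE.Hom_Ob(2)[OF g]
  note Lf = functorD(4)[OF L f] and Lg = functorD(4)[OF L g]
  have ptE: "short_exact A (component f (n, x)) (component g (n, x))" if x: "x \<in> simplices E n" for n x
    unfolding short_exact_def
    using kernel_component[OF CE k(1)[unfolded natsys_cat_def]] cokernel_component[OF CE k(2)[unfolded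
        natsys_cat_def]] x
    by (simp add: Ob_simplex_cat)
  have ptB: "short_exact A (component (arr_map L f) (n, y)) (component (arr_map L g) (n, y))" if y: "y \<in>
      simplices B n" for n y
  proof -
    have fib: "fibre n y \<subseteq> simplices E n" by (auto simp: fibre_def)
    obtain e :: "_ \<Rightarrow> 'u" where e: "inj_on e (fibre n y)" using small_index[OF fib] by blast
    have x: "x \<in> simplices E n" "after u n x = y" if "x \<in> fibre n y" for x using that by (auto simp:
        fibre_def)
    note c = unit_coproduct[OF L \<eta> T(1) y] unit_coproduct[OF L \<eta> T(2) y] unit_coproduct[OF L \<eta> T(3) y]
    have nf: "component (arr_map L f) (n, y) \<cdot>\<^bsub>A\<^esub> component (\<eta> T1) (n, x) = component (\<eta> T2) (n, x) \<cdot>\<^bsub>A\<^esub>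
        component f (n, x)"
      if "x \<in> fibre n y" for x
      using unit_natural[OF L \<eta> f x(1)[OF that]] x(2)[OF that] by simp
    have ng: "component (arr_map L g) (n, y) \<cdot>\<^bsub>A\<^esub> component (\<eta> T2) (n, x) = component (\<eta> T3) (n, x) \<cdot>\<^bsub>A\<^esub>
        component g (n, x)"
      if "x \<in> fibre n y" for x
      using unit_natural[OF L \<eta> g x(1)[OF that]] x(2)[OF that] by simp
    show ?thesis
      by (rule coproduct_short_exact[OF cocomplete ex e c natsys_component[OF Lf y] nf natsys_component[OF
          Lg y] ng
          natsys_component[OF f x(1)] natsys_component[OF g x(1)] ptE[OF x(1)]])
  qed
  have pt: "is_kernel A (component (arr_map L f) x) (component (arr_map L g) x)"
    "is_cokernel A (component (arr_map L g) x) (component (arr_map L f) x)"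
    if "x \<in> Ob (op_cat (simplex_cat B))" for x
    using ptB that by (cases x; simp add: Ob_simplex_cat short_exact_def)+
  show ?thesis
    unfolding short_exact_def natsys_cat_def
    using kernel_if_pointwise[OF CB Lf[unfolded natsys_cat_def] Lg[unfolded natsys_cat_def]]
      cokernel_if_pointwise[OF CB Lf[unfolded natsys_cat_def] Lg[unfolded natsys_cat_def]]
      pt unfolding natsys_cat_def by blast
qed

abbreviation "unit_chain_map L \<eta> T \<equiv> chain_map E B T (obj_map L T) (after u) (\<lambda>n f. component (\<eta> T) (n, f))"

text \<open>This is the naturality square of the unit at a coface arrow; \<open>after_pull\<close>
  identifies the face of the image with the image of the face.\<close>

lemma face_map_unit:
  assumes L: "is_functor NE NB L" and \<eta>: "is_unit NE NB L K \<eta>" and T: "T \<in> Ob NE"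
  shows "face_map E B T (obj_map L T) (after u) (\<lambda>n f. component (\<eta> T) (n, f))"
proof -
  have LT: "natsys B (obj_map L T)" using functorD(3)[OF L T] by (simp add: Ob_natsys)
  have e: "\<eta> T \<in> Hom NE T (obj_map K (obj_map L T))" using \<eta> T by (simp add: is_unit_def)
  show ?thesis unfolding face_map_def
    using T LT after_simplices[OF u] unit_component[OF L \<eta> T] natsys_naturality[OF e _ coface_ord_maps]
      K_apply(3)[OF LT _ coface_ord_maps]
    by (simp add: Ob_natsys coface_arr_eq face_def after_pull[OF coface_ord_maps])
qed

text \<open>By \<open>coproduct_fibrewise\<close> along \<open>after u\<close>, the chains over
  \<open>B\<close> form a coproduct of the same family as the chains over \<open>E\<close>, and the
  chain map is the comparison between the two.\<close>

lemma unit_chain_map_iso: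
  assumes L: "is_functor NE NB L" and \<eta>: "is_unit NE NB L K \<eta>" and T: "T \<in> Ob NE"
  shows "is_iso A (unit_chain_map L \<eta> T n)"
proof -
  have LT: "natsys B (obj_map L T)" using functorD(3)[OF L T] by (simp add: Ob_natsys)
  have nT: "natsys E T" using T by (simp add: Ob_natsys)
  note m = face_map_unit[OF L \<eta> T]
  have "is_coproduct A (simplices E n) (\<lambda>f. obj_map T (n, f)) (thom_chains B A (obj_map L T) n)
      (\<lambda>f. chain_in B (obj_map L T) n (after u n f) \<cdot>\<^bsub>A\<^esub> component (\<eta> T) (n, f))"
    by (rule coproduct_fibrewise[OF thom_chains_coproduct[OF LT]])
      (use after_simplices[OF u] unit_coproduct[OF L \<eta> T] in \<open>auto simp: fibre_def\<close>)
  from coproduct_comparison_iso[OF thom_chains_coproduct[OF nT] this chain_map[OF m]] show ?thesis .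
qed

text \<open>On the summand of each \<open>f\<close> this is \<open>unit_natural\<close> followed by
  an injection.\<close>

lemma unit_chain_map_natural:
  assumes L: "is_functor NE NB L" and \<eta>: "is_unit NE NB L K \<eta>" and t: "t \<in> Hom NE T T'"
  shows "nat_chain_map B (obj_map L T) (obj_map L T') (arr_map L t) n \<cdot>\<^bsub>A\<^esub> unit_chain_map L \<eta> T n =
    unit_chain_map L \<eta> T' n \<cdot>\<^bsub>A\<^esub> nat_chain_map E T T' t n"
proof -
  interpret NE: preadditive NE by (rule NE_preadditive)
  note T = NE.Hom_Ob[OF t]
  have nT: "natsys E T" "natsys E T'" using T by (auto simp: Ob_natsys)
  have LT: "natsys B (obj_map L T)" "natsys B (obj_map L T')" using functorD(3)[OF L] T by (auto simp:
      Ob_natsys)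
  note m = face_map_unit[OF L \<eta> T(1)] and m' = face_map_unit[OF L \<eta> T(2)]
  note Lt = functorD(4)[OF L t]
  note mt = face_map_nat_trans[OF t] and mLt = face_map_nat_trans[OF Lt]
  note c = chain_map[OF m] and c' = chain_map[OF m'] and ct = chain_map[OF mt] and cLt = chain_map[OF mLt]
  show ?thesis
  proof (rule coproduct_eq[OF thom_chains_coproduct[OF nT(1)] comp_hom[OF c(1) cLt(1)] comp_hom[OF ct(1)
      c'(1)]])
    fix f assume f: "f \<in> simplices E n"
    note uf = after_simplices[OF u f]
    note h = unit_component[OF L \<eta> T(1) f] unit_component[OF L \<eta> T(2) f] natsys_component[OF t f]
        natsys_component[OF Lt uf]
    note i = chain_in_hom[OF nT(1) f] chain_in_hom[OF nT(2) f] chain_in_hom[OF LT(1) uf] chain_in_hom[OF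
        LT(2) uf]
    show "nat_chain_map B (obj_map L T) (obj_map L T') (arr_map L t) n \<cdot>\<^bsub>A\<^esub> unit_chain_map L \<eta> T n \<cdot>\<^bsub>A\<^esub>
        chain_in E T n f =
         unit_chain_map L \<eta> T' n \<cdot>\<^bsub>A\<^esub> nat_chain_map E T T' t n \<cdot>\<^bsub>A\<^esub> chain_in E T n f"
      using comp_assoc[OF i(1) c(1) cLt(1)] c(2)[OF f] comp_eq_reduce[OF cLt(2)[OF uf] i(3) cLt(1) h(1)]
        comp_assoc[OF h(1,4) i(4)] unit_natural[OF L \<eta> t f] comp_assoc[OF i(1) ct(1) c'(1)] ct(2)[OF f]
        comp_eq_reduce[OF c'(2)[OF f] i(2) c'(1) h(3)] comp_assoc[OF h(3,2) i(4)] by simp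
  qed
qed

definition "unit_homology_map L \<eta> n T =
  homology_map A (thom_diff E A T n) (thom_out E A T n) (thom_diff B A (obj_map L T) n) (thom_out B A
      (obj_map L T) n)
    (unit_chain_map L \<eta> T n)"

lemma unit_homology_map:
  assumes L: "is_functor NE NB L" and \<eta>: "is_unit NE NB L K \<eta>" and T: "T \<in> Ob NE"
  shows "unit_homology_map L \<eta> n T \<in> Hom A (obj_map (thom_homology E A n) T) (obj_map (thom_homology B A n)
      (obj_map L T))"
    "is_iso A (unit_homology_map L \<eta> n T)"
proof -
  have LT: "obj_map L T \<in> Ob NB" using functorD(3)[OF L T] .
  then have n: "natsys E T" "natsys B (obj_map L T)" using T by (auto simp: Ob_natsys)
  note m = face_map_unit[OF L \<eta> T]
  show "unit_homology_map L \<eta> n T \<in> Hom A (obj_map (thom_homology E A n) T) (obj_map (thom_homology B A n)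
      (obj_map L T))"
    unfolding unit_homology_map_def thom_homology_apply(1)[OF T] thom_homology_apply(1)[OF LT]
    by (rule homology_map(1)[OF thom_composable_zero[OF n(1)] thom_composable_zero[OF n(2)] chain_map_at[OF
        m]])
  show "is_iso A (unit_homology_map L \<eta> n T)"
    unfolding unit_homology_map_def by (rule chain_map_homology_iso[OF m unit_chain_map_iso[OF L \<eta> T]])
qed

text \<open>Functoriality of homology turns the commuting square of chain maps into one of homology
  maps.\<close>

lemma unit_homology_map_natural:
  assumes L: "is_functor NE NB L" and \<eta>: "is_unit NE NB L K \<eta>" and t: "t \<in> Hom NE T T'"
  shows "arr_map (thom_homology B A n) (arr_map L t) \<cdot>\<^bsub>A\<^esub> unit_homology_map L \<eta> n T =
    unit_homology_map L \<eta> n T' \<cdot>\<^bsub>A\<^esub> arr_map (thom_homology E A n) t"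
proof -
  interpret NE: preadditive NE by (rule NE_preadditive)
  note T = NE.Hom_Ob[OF t]
  have nT: "natsys E T" "natsys E T'" using T by (auto simp: Ob_natsys)
  have LT: "natsys B (obj_map L T)" "natsys B (obj_map L T')" using functorD(3)[OF L] T by (auto simp:
      Ob_natsys)
  note z = nT[THEN thom_composable_zero, of n] LT[THEN thom_composable_zero, of n]
  note Lt = functorD(4)[OF L t]
  note m = face_map_unit[OF L \<eta> T(1), THEN chain_map_at] face_map_unit[OF L \<eta> T(2), THEN chain_map_at]
    face_map_nat_trans[OF t, THEN chain_map_at] face_map_nat_trans[OF Lt, THEN chain_map_at]
  show ?thesis
    unfolding unit_homology_map_def thom_homology_arr[OF t] thom_homology_arr[OF Lt]
      homology_map_comp[OF z(1,3,4) m(1,4), symmetric] homology_map_comp[OF z(1,2,4) m(3,2), symmetric]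
      unit_chain_map_natural[OF L \<eta> t] ..
qed

end

text \<open>Kan extension and satellites are determined by their universal properties only up to
  isomorphism. Hence existence of each is asserted separately, and the spectral sequence is produced
  for every choice of both.\<close>

theorem theorem2p10:
  fixes E B :: "('u, 'u) cat" and u :: "('u, 'u, 'u, 'u) fctr" and A :: "('o, 'a) acat"
  assumes "infinite (UNIV :: 'u set)"
    and "category E" and "category B" and "is_functor E B u"
    and "abelian_category A" and "cocomplete TYPE('u) A" and "exact_coproducts TYPE('u) A"
  shows "(\<exists>L. is_Lan E B A u L) \<and>
    (\<forall>L. is_Lan E B A u L \<longrightarrow>
       (\<exists>Lq. left_satellites (natsys_cat E A) (natsys_cat B A) L Lq) \<and>
       (\<forall>Lq. left_satellites (natsys_cat E A) (natsys_cat B A) L Lq \<longrightarrow>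
          (\<exists>S \<Phi> X \<theta>.
             functorial_specseq (natsys_cat E A) A
               (\<lambda>p q. functor_comp (natsys_cat E A) (thom_homology B A p) (degree Lq q))
               (thom_homology E A)
               S \<Phi> X \<theta>)))"
proof -
  interpret natsys_functor A E B u
    using assms by (intro natsys_functor.intro cocomplete_abelian.intro cocomplete_abelian_axioms.intro
        natsys_functor_axioms.intro)
  show ?thesis
  proof (intro conjI allI impI)
    show "\<exists>L. is_Lan E B A u L" by (rule ex_Lan)
    fix L assume "is_Lan E B A u L"
    then have adj: "is_left_adjoint NE NB L K" by (simp add: is_Lan_def)
    then have L: "is_functor NE NB L" by (simp add: is_left_adjoint_def)
    obtain \<eta> where \<eta>: "is_unit NE NB L K \<eta>" using left_adjoint_unit[OF adj] ..
    \<comment> \<open>Additivity comes from the adjunction and exactness from the coproduct formula.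
      The locale then yields both the existence of satellites of \<open>L\<close> and the vanishing
      of any such system in positive degrees.\<close>
    interpret ex: exact_functor NE NB L
    proof (intro exact_functor.intro exact_functor_axioms.intro NE_preadditive NB_preadditive)
      show "additive_functor NE NB L" by (rule left_adjoint_additive[OF adj NE_preadditive NB_preadditive
          K_additive])
      show "\<exists>z. is_zero_obj NB z" unfolding natsys_cat_def
        using fun_cat_zero_obj[OF op_category[OF simplex_category] preadditive_axioms ex_zero_obj] by blast
    qed (rule Lan_exact[OF assms(7) L \<eta>])
    show "\<exists>Lq. left_satellites NE NB L Lq" using ex.left_satellites by blast
    fix Lq assume Lq: "left_satellites NE NB L Lq"
    then have L0: "degree Lq 0 = L" and dL: "is_functor NE NB (degree Lq q)" for q
      by (auto simp: left_satellites_def delta_functor_def additive_functor_def)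
    show "\<exists>S \<Phi> X \<theta>. functorial_specseq NE A (\<lambda>p q. functor_comp NE (thom_homology B A p) (degree Lq q))
        (thom_homology E A) S \<Phi> X \<theta>"
    \<comment> \<open>Row 0 of the second page is the homology of \<open>L T\<close>, as
      \<open>degree Lq 0 = L\<close>, and the unit compares it with the homology of
      \<open>T\<close>; the higher rows are homology of zero systems.\<close>
    proof (rule row_spectral_sequence[where h = "unit_homology_map L \<eta>"])
      show "is_functor NE A (functor_comp NE (thom_homology B A p) (degree Lq q))" for p q
        by (rule functor_comp[OF dL thom_homology_functor])
      show "is_zero_obj A (obj_map (functor_comp NE (thom_homology B A p) (degree Lq (Suc q))) T)" if "T \<in>
          Ob NE" for p q T
        using thom_homology_zero[OF ex.left_satellites_zero[OF Lq that]] that by (simp add: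
            functor_comp_apply)
      show "unit_homology_map L \<eta> p T \<in> Hom A (obj_map (thom_homology E A p) T)
          (obj_map (functor_comp NE (thom_homology B A p) (degree Lq 0)) T) \<and> is_iso A (unit_homology_map L
              \<eta> p T)"
        if "T \<in> Ob NE" for p T
        using unit_homology_map[OF L \<eta> that] that by (simp add: functor_comp_apply L0)
      show "arr_map (functor_comp NE (thom_homology B A p) (degree Lq 0)) t \<cdot>\<^bsub>A\<^esub> unit_homology_map L \<eta> p T =
          unit_homology_map L \<eta> p T' \<cdot>\<^bsub>A\<^esub> arr_map (thom_homology E A p) t" if "t \<in> Hom NE T T'" for p t T T'
        using unit_homology_map_natural[OF L \<eta> that] that by (simp add: functor_comp_apply L0 Hom_iff)
    qed (rule thom_homology_functor natsys_category[OF category_axioms])+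
  qed
qed

end
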